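(* For any $\Gamma$, the global simplex-displacement spectrum $$\operatorname{spec}(\Gamma)=\bigl\{\lambda_\phi(\Delta): [\phi]\in\operatorname{Out}(\Gamma),\ \Delta\text{ a simplex of }\overline{\mathcal O(\Gamma)}^\infty\text{ such that }\lambda_\phi(\Delta)<+\infty\bigr\}$$ is well-ordered as a subset of $\mathbb R$. In particular, for any $[\phi]\in\operatorname{Out}(\Gamma)$ the set $$\operatorname{spec}(\phi)=\bigl\{\lambda_\phi(\Delta):\Delta\text{ a simplex of }\overline{\mathcal O(\Gamma)}^\infty\text{ such that }\lambda_\phi(\Delta)<+\infty\bigr\}$$ is well-ordered as a subset of $\mathbb R$.
   Context: **Setting.** $\Gamma=\bigsqcup_{i=1}^k\Gamma_i$ is a finite disjoint union of connected finite graphs of groups with trivial edge groups and non-trivial fundamental groups $H_i=\pi_1(\Gamma_i)$ (as graphs of groups), each $H_i$ being equipped with the free splitting given by the vertex groups of $\Gamma_i$. $\mathcal O(\Gamma_i)$ is the set of equivariant isometry classes of minimal metric simplicial $H_i$-trees (simplicial isometric actions) with trivial edge stabilisers such that: for each non-trivial vertex group $V$ of $\Gamma_i$ there is exactly one orbit of vertices with stabiliser conjugate to $V$ (non-free vertices); every other vertex has trivial stabiliser (free vertices); no free vertex has valence two. (If $H_i$ is itself a vertex group, this is a single point.) $\mathcal O(\Gamma)=\prod_i\mathcal O(\Gamma_i)$; a point $X=(X_1,\dots,X_k)$ is regarded as the forest $\bigsqcup_i X_i$ and identified with the quotient metric graph of groups $\underline X=\bigsqcup_iH_i\backslash X_i$.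 **Bordification.** $\overline{\mathcal O(\Gamma)}^\infty$ (the free splitting complex relative to $\Gamma$) is the set of tuples of minimal metric simplicial $H_i$-trees with trivial edge stabilisers in which all vertex groups of $\Gamma_i$ are elliptic (possibly with more elliptic elements), up to equivariant isometry. An (open) simplex is the set of all points equivariantly homeomorphic to a given one, parametrised by positive edge lengths. Points of $\partial_\infty\mathcal O(\Gamma)=\overline{\mathcal O(\Gamma)}^\infty\setminus\mathcal O(\Gamma)$ are exactly those of the form $X/A$: for $X\in\mathcal O(\Gamma)$ and a proper subgraph $A\subset\underline X$ with some component carrying a hyperbolic element, collapse each component of $A$ to a vertex whose group is the fundamental group of the component. $\mathcal O(X/A)$ denotes the outer space defined by the splitting given by the vertex groups of $X/A$. **Automorphisms and displacement.** $\operatorname{Aut}(\Gamma)$ is the group of tuples $\phi=(\sigma,\phi_1,\dots,\phi_k)$ with $\sigma$ a permutation of $\{1,\dots,k\}$ and $\phi_i:H_i\to H_{\sigma(i)}$ an isomorphism mapping each vertex group to a conjugate of a vertex group; $\operatorname{Inn}(\Gamma)$ consists of those with $\sigma=\mathrm{id}$ and all $\phi_i$ inner; $\operatorname{Out}(\Gamma)=\operatorname{Aut}(\Gamma)/\operatorname{Inn}(\Gamma)$. $\phi X=(\phi_1X_{\sigma(1)},\dots,\phi_kX_{\sigma(k)})$, where $\phi_iX_{\sigma(i)}$ is $X_{\sigma(i)}$ with $H_i$ acting through $\phi_i$. $\Lambda(X,Y)$ is the minimum of $\operatorname{Lip}(f)$ over tuples $f$ of Lipschitz $H_i$-equivariant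 maps $f_i:X_i\to Y_i$. For $X\in\mathcal O(\Gamma)$, $\lambda_\phi(X)=\Lambda(X,\phi X)$. A straight map $f:X\to X$ (constant speed on each edge) represents $\phi$ if it maps $X_i$ to $X_{\sigma(i)}$ with $f(hx)=\phi_i(h)f(x)$. A subgraph $A\subset\underline X$ is $\phi$-invariant if some straight map representing $\phi$ maps (the full preimage in $X$ of) $A$ into itself. For $X_\infty=X/A\in\partial_\infty\mathcal O(\Gamma)$: if $A$ is $\phi$-invariant then $\phi$ induces an element of $\operatorname{Aut}(X/A)$, still denoted $\phi$, and $\lambda_\phi(X_\infty)=\Lambda(X_\infty,\phi X_\infty)$ computed in $\mathcal O(X/A)$; otherwise $\lambda_\phi(X_\infty)=\infty$. For a simplex $\Delta$, $\lambda_\phi(\Delta)=\inf_{X\in\Delta}\lambda_\phi(X)$. *)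

theory Defs
  imports
    "HOL-Analysis.Abstract_Metric_Spaces"
    "HOL-Library.Extended_Nonnegative_Real"
    "HOL-Combinatorics.Permutations"
    "HOL-Algebra.Group_Action"
    "Graph_Theory.Digraph_Component"
begin

section \<open>Graphs of groups with trivial edge groups\<close>

text \<open>
  Every geometric edge of the underlying graph is one arc, with an arbitrarily chosen orientation;
  loops and multiple arcs are allowed. As edge groups are trivial, no attaching maps are needed.
\<close>

record ('v, 'e, 'g) gog =
  ugraph :: "('v, 'e) pre_digraph"
  vgrp :: "'v \<Rightarrow> 'g monoid"
  base :: 'v

definition graph_of_groups :: "('v, 'e, 'g) gog \<Rightarrow> bool" where
  "graph_of_groups G \<longleftrightarrow>
     fin_digraph (ugraph G) \<and> Digraph_Component.connected (ugraph G) \<and>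
     base G \<in> verts (ugraph G) \<and> (\<forall>v \<in> verts (ugraph G). group (vgrp G v))"

text \<open>
  The fundamental group consists of words in vertex group elements and oriented edges that describe
  loops at the base vertex, modulo multiplication in the vertex groups and cancellation of an edge
  against its reverse. \<open>Ed e False\<close> is the reverse of \<open>Ed e True\<close>.
\<close>

datatype ('v, 'e, 'g) letter = Vg 'v 'g | Ed 'e bool

type_synonym ('v, 'e, 'g) loop_class = "('v, 'e, 'g) letter list set"

fun gpath :: "('v, 'e, 'g) gog \<Rightarrow> 'v \<Rightarrow> ('v, 'e, 'g) letter list \<Rightarrow> 'v \<Rightarrow> bool" where
  "gpath G u [] v \<longleftrightarrow> u \<in> verts (ugraph G) \<and> u = v"
| "gpath G u (Vg x g # w) v \<longleftrightarrow> x = u \<and> g \<in> carrier (vgrp G u) \<and> gpath G u w v"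
| "gpath G u (Ed e b # w) v \<longleftrightarrow> e \<in> arcs (ugraph G) \<and>
     (if b then tail (ugraph G) e = u \<and> gpath G (head (ugraph G) e) w v
      else head (ugraph G) e = u \<and> gpath G (tail (ugraph G) e) w v)"

definition gloops :: "('v, 'e, 'g) gog \<Rightarrow> ('v, 'e, 'g) letter list set" where
  "gloops G = {w. gpath G (base G) w (base G)}"

inductive elem_step :: "('v, 'e, 'g) gog \<Rightarrow> ('v, 'e, 'g) letter list \<Rightarrow> ('v, 'e, 'g) letter list \<Rightarrow> bool"
  for G where
  elem_mult: "elem_step G (p @ [Vg v g, Vg v h] @ q) (p @ [Vg v (g \<otimes>\<^bsub>vgrp G v\<^esub> h)] @ q)"
| elem_one: "elem_step G (p @ [Vg v \<one>\<^bsub>vgrp G v\<^esub>] @ q) (p @ q)"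
| elem_cancel: "elem_step G (p @ [Ed e b, Ed e (\<not> b)] @ q) (p @ q)"

definition loop_equiv :: "('v, 'e, 'g) gog \<Rightarrow> ('v, 'e, 'g) letter list rel" where
  "loop_equiv G =
     {(w, w'). w \<in> gloops G \<and> w' \<in> gloops G \<and>
        equivclp (\<lambda>a b. a \<in> gloops G \<and> b \<in> gloops G \<and> elem_step G a b) w w'}"

definition pi1 :: "('v, 'e, 'g) gog \<Rightarrow> ('v, 'e, 'g) loop_class monoid" where
  "pi1 G = \<lparr>carrier = gloops G // loop_equiv G,
            monoid.mult = (\<lambda>a b. loop_equiv G `` {p @ q | p q. p \<in> a \<and> q \<in> b}),
            monoid.one = loop_equiv G `` {[]}\<rparr>"

fun inv_letter :: "('v, 'e, 'g) gog \<Rightarrow> ('v, 'e, 'g) letter \<Rightarrow> ('v, 'e, 'g) letter" where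
  "inv_letter G (Vg v g) = Vg v (inv\<^bsub>vgrp G v\<^esub> g)"
| "inv_letter G (Ed e b) = Ed e (\<not> b)"

text \<open>
  The vertex group at \<open>v\<close> is a subgroup of the fundamental group only after the choice of a path
  from the base vertex to \<open>v\<close>; letting this path vary gives its full conjugacy class.
\<close>

definition vertex_groups :: "('v, 'e, 'g) gog \<Rightarrow> 'v \<Rightarrow> ('v, 'e, 'g) loop_class set set" where
  "vertex_groups G v =
     {(\<lambda>g. loop_equiv G `` {p @ [Vg v g] @ rev (map (inv_letter G) p)}) ` carrier (vgrp G v) | p.
        gpath G (base G) p v}"

definition nontrivial_vertices :: "('v, 'e, 'g) gog \<Rightarrow> 'v set" where
  "nontrivial_vertices G = {v \<in> verts (ugraph G). carrier (vgrp G v) \<noteq> {\<one>\<^bsub>vgrp G v\<^esub>}}"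


section \<open>Metric simplicial trees with a group action\<close>

text \<open>
  A tree is given combinatorially, each geometric edge being a pair of opposite arcs. Lipschitz
  maps, isometries and homeomorphisms below are maps of the geometric realisation, so they need not
  be simplicial.
\<close>

record ('h, 'x) gtree =
  tgraph :: "'x pair_pre_digraph"
  len :: "'x \<times> 'x \<Rightarrow> real"
  act :: "'h \<Rightarrow> 'x \<Rightarrow> 'x"

abbreviation tverts :: "('h, 'x) gtree \<Rightarrow> 'x set" where "tverts T \<equiv> pverts (tgraph T)"
abbreviation tarcs :: "('h, 'x) gtree \<Rightarrow> 'x rel" where "tarcs T \<equiv> parcs (tgraph T)"

definition simplicial_tree :: "'x pair_pre_digraph \<Rightarrow> bool" where
  "simplicial_tree g \<longleftrightarrow> pair_bidirected_digraph g \<and> pverts g \<noteq> {} \<and>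
     (\<forall>u \<in> pverts g. \<forall>v \<in> pverts g. \<exists>!p. pre_digraph.apath (with_proj g) u p v)"

definition metric_tree :: "('h, 'b) monoid_scheme \<Rightarrow> ('h, 'x) gtree \<Rightarrow> bool" where
  "metric_tree H T \<longleftrightarrow> simplicial_tree (tgraph T) \<and>
     (\<forall>(u, v) \<in> tarcs T. 0 < len T (u, v) \<and> len T (v, u) = len T (u, v)) \<and>
     group_action H (tverts T) (act T) \<and>
     (\<forall>g \<in> carrier H. \<forall>(u, v) \<in> tarcs T.
        (act T g u, act T g v) \<in> tarcs T \<and> len T (act T g u, act T g v) = len T (u, v))"

text \<open>
  Stabilisers of edges are setwise, so that this condition also excludes inversions. In particular
  a subgroup fixing a point of the realisation fixes a vertex.
\<close>

definition trivial_edge_stabilisers :: "('h, 'b) monoid_scheme \<Rightarrow> ('h, 'x) gtree \<Rightarrow> bool" where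
  "trivial_edge_stabilisers H T \<longleftrightarrow>
     (\<forall>(u, v) \<in> tarcs T. \<forall>g \<in> carrier H. {act T g u, act T g v} = {u, v} \<longrightarrow> g = \<one>\<^bsub>H\<^esub>)"

text \<open>
  Subgraphs of the quotient graph of groups are represented by their full preimages in the tree.
\<close>

definition invariant_subgraph ::
    "('h, 'b) monoid_scheme \<Rightarrow> ('h, 'x) gtree \<Rightarrow> 'x pair_pre_digraph \<Rightarrow> bool" where
  "invariant_subgraph H T A \<longleftrightarrow>
     subgraph (with_proj A) (with_proj (tgraph T)) \<and> symmetric (with_proj A) \<and>
     (\<forall>g \<in> carrier H. (\<forall>v \<in> pverts A. act T g v \<in> pverts A) \<and>
                      (\<forall>(u, v) \<in> parcs A. (act T g u, act T g v) \<in> parcs A))"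

definition minimal_tree :: "('h, 'b) monoid_scheme \<Rightarrow> ('h, 'x) gtree \<Rightarrow> bool" where
  "minimal_tree H T \<longleftrightarrow>
     (\<forall>A. invariant_subgraph H T A \<and> simplicial_tree A \<longrightarrow> A = tgraph T)"

definition elliptic :: "('h, 'x) gtree \<Rightarrow> 'h set \<Rightarrow> bool" where
  "elliptic T S \<longleftrightarrow> (\<exists>x \<in> tverts T. \<forall>g \<in> S. act T g x = x)"

definition free_vertex :: "('h, 'b) monoid_scheme \<Rightarrow> ('h, 'x) gtree \<Rightarrow> 'x \<Rightarrow> bool" where
  "free_vertex H T x \<longleftrightarrow> stabilizer H (act T) x = {\<one>\<^bsub>H\<^esub>}"

definition redundant_vertex :: "('h, 'b) monoid_scheme \<Rightarrow> ('h, 'x) gtree \<Rightarrow> 'x \<Rightarrow> bool" where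
  "redundant_vertex H T x \<longleftrightarrow> free_vertex H T x \<and> out_degree (with_proj (tgraph T)) x = 2"

text \<open>
  The second alternative occurs only for an infinite cyclic group acting freely on a line: the
  quotient circle needs one vertex of valence two to carry a simplicial structure at all.
\<close>

definition no_redundant_vertices :: "('h, 'b) monoid_scheme \<Rightarrow> ('h, 'x) gtree \<Rightarrow> bool" where
  "no_redundant_vertices H T \<longleftrightarrow>
     (\<forall>x \<in> tverts T. \<not> redundant_vertex H T x) \<or>
     (orbits H (tverts T) (act T) = {tverts T} \<and> (\<forall>x \<in> tverts T. redundant_vertex H T x))"


subsection \<open>Geometric realisation\<close>

text \<open>Points are given by their barycentric coordinates.\<close>

definition vpt :: "'x \<Rightarrow> 'x \<Rightarrow> real" where
  "vpt u = (\<lambda>x. if x = u then 1 else 0)"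

definition seg :: "'x \<times> 'x \<Rightarrow> ('x \<Rightarrow> real) set" where
  "seg e = (\<lambda>t x. (1 - t) * vpt (fst e) x + t * vpt (snd e) x) ` {0..1}"

definition realisation :: "'x pair_pre_digraph \<Rightarrow> ('x \<Rightarrow> real) set" where
  "realisation g = vpt ` pverts g \<union> (\<Union>e \<in> parcs g. seg e)"

abbreviation points :: "('h, 'x) gtree \<Rightarrow> ('x \<Rightarrow> real) set" where
  "points T \<equiv> realisation (tgraph T)"

definition vdist :: "('h, 'x) gtree \<Rightarrow> 'x \<Rightarrow> 'x \<Rightarrow> real" where
  "vdist T u v = sum_list (map (len T) (THE p. pre_digraph.apath (with_proj (tgraph T)) u p v))"

text \<open>
  The distance from \<open>p\<close> to \<open>u\<close> inside an edge through \<open>p\<close> with endpoint \<open>u\<close>; there is at most one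
  summand, and none if \<open>p\<close> is the vertex \<open>u\<close>.
\<close>

definition pdist_end :: "('h, 'x) gtree \<Rightarrow> ('x \<Rightarrow> real) \<Rightarrow> 'x \<Rightarrow> real" where
  "pdist_end T p u = (\<Sum>w \<in> {w. p w \<noteq> 0} - {u}. p w * len T (u, w))"

text \<open>
  The path metric: a path between two points either stays inside an edge containing both, or leaves
  \<open>p\<close> through a vertex \<open>u\<close> and reaches \<open>q\<close> through a vertex \<open>w\<close>.
\<close>

definition tdist :: "('h, 'x) gtree \<Rightarrow> ('x \<Rightarrow> real) \<Rightarrow> ('x \<Rightarrow> real) \<Rightarrow> real" where
  "tdist T p q =
     (if p \<in> points T \<and> q \<in> points T then
        Inf ({\<bar>p v - q v\<bar> * len T (u, v) | u v. (u, v) \<in> tarcs T \<and> p \<in> seg (u, v) \<and> q \<in> seg (u, v)}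
           \<union> {pdist_end T p u + vdist T u w + pdist_end T q w | u w. p u \<noteq> 0 \<and> q w \<noteq> 0})
      else 0)"

definition pact :: "('h, 'x) gtree \<Rightarrow> 'h \<Rightarrow> ('x \<Rightarrow> real) \<Rightarrow> ('x \<Rightarrow> real)" where
  "pact T g p = (\<lambda>x. if x \<in> tverts T then p (inv_into (tverts T) (act T g) x) else 0)"

definition equivariant_map :: "('h, 'b) monoid_scheme \<Rightarrow> ('h, 'x) gtree \<Rightarrow> ('h, 'y) gtree \<Rightarrow>
    (('x \<Rightarrow> real) \<Rightarrow> ('y \<Rightarrow> real)) \<Rightarrow> bool" where
  "equivariant_map H T T' f \<longleftrightarrow> f ` points T \<subseteq> points T' \<and>
     (\<forall>g \<in> carrier H. \<forall>p \<in> points T. f (pact T g p) = pact T' g (f p))"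

definition equiv_isometric ::
    "('h, 'b) monoid_scheme \<Rightarrow> ('h, 'x) gtree \<Rightarrow> ('h, 'y) gtree \<Rightarrow> bool" where
  "equiv_isometric H T T' \<longleftrightarrow>
     (\<exists>f. equivariant_map H T T' f \<and> bij_betw f (points T) (points T') \<and>
          (\<forall>p \<in> points T. \<forall>q \<in> points T. tdist T' (f p) (f q) = tdist T p q))"

definition equiv_homeomorphic ::
    "('h, 'b) monoid_scheme \<Rightarrow> ('h, 'x) gtree \<Rightarrow> ('h, 'y) gtree \<Rightarrow> bool" where
  "equiv_homeomorphic H T T' \<longleftrightarrow>
     (\<exists>f. equivariant_map H T T' f \<and>
          homeomorphic_map (Metric_space.mtopology (points T) (tdist T))
                           (Metric_space.mtopology (points T') (tdist T')) f)"

definition Lip :: "('h, 'x) gtree \<Rightarrow> ('h, 'y) gtree \<Rightarrow> (('x \<Rightarrow> real) \<Rightarrow> ('y \<Rightarrow> real)) \<Rightarrow> ennreal" where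
  "Lip T T' f =
     Inf {ennreal C | C. 0 \<le> C \<and>
            (\<forall>p \<in> points T. \<forall>q \<in> points T. tdist T' (f p) (f q) \<le> C * tdist T p q)}"

definition straight_map ::
    "('h, 'x) gtree \<Rightarrow> ('h, 'y) gtree \<Rightarrow> (('x \<Rightarrow> real) \<Rightarrow> ('y \<Rightarrow> real)) \<Rightarrow> bool" where
  "straight_map T T' f \<longleftrightarrow> f ` points T \<subseteq> points T' \<and>
     (\<forall>e \<in> tarcs T. \<exists>c \<ge> 0. \<forall>p \<in> seg e. \<forall>q \<in> seg e. tdist T' (f p) (f q) = c * tdist T p q)"


subsection \<open>Collapsing an invariant subgraph\<close>

definition comp_of :: "'x pair_pre_digraph \<Rightarrow> 'x \<Rightarrow> 'x set" where
  "comp_of A v = {w. (v, w) \<in> (parcs A)\<^sup>*}"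

definition collapse :: "('h, 'x) gtree \<Rightarrow> 'x pair_pre_digraph \<Rightarrow> ('h, 'x set) gtree" where
  "collapse T A =
     \<lparr>tgraph = \<lparr>pverts = comp_of A ` tverts T,
                parcs = {(comp_of A u, comp_of A v) | u v. (u, v) \<in> tarcs T - parcs A}\<rparr>,
      len = (\<lambda>e. THE l. \<exists>(u, v) \<in> tarcs T - parcs A. e = (comp_of A u, comp_of A v) \<and> l = len T (u, v)),
      act = (\<lambda>g. \<lambda>C \<in> comp_of A ` tverts T. act T g ` C)\<rparr>"


section \<open>Outer space and its simplicial bordification\<close>

text \<open>
  The disjoint union of the components is a list, with indices \<open>0, \<dots>, k - 1\<close>. A finite family
  of vertex groups can always be given with one common element type.
\<close>

type_synonym ('v, 'e, 'g) union_gog = "('v, 'e, 'g) gog list"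

definition valid_union :: "('v, 'e, 'g) union_gog \<Rightarrow> bool" where
  "valid_union \<Gamma> \<longleftrightarrow>
     (\<forall>G \<in> set \<Gamma>. graph_of_groups G \<and> carrier (pi1 G) \<noteq> {\<one>\<^bsub>pi1 G\<^esub>})"

abbreviation HH :: "('v, 'e, 'g) union_gog \<Rightarrow> nat \<Rightarrow> ('v, 'e, 'g) loop_class monoid" where
  "HH \<Gamma> i \<equiv> pi1 (\<Gamma> ! i)"

text \<open>
  Points of the spaces below are isometry classes of trees; we work with representatives whose
  vertices have the type below, and all notions are invariant under equivariant isometry. This type
  is large enough: a minimal tree as below has finitely many orbits of vertices, and each orbit
  injects into the group.
\<close>

type_synonym ('v, 'e, 'g) htree =
  "(('v, 'e, 'g) loop_class, ('v, 'e, 'g) loop_class \<times> nat) gtree"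

type_synonym ('v, 'e, 'g) hforest = "nat \<Rightarrow> ('v, 'e, 'g) htree"

definition bord_trees :: "('v, 'e, 'g) gog \<Rightarrow> ('v, 'e, 'g) htree set" where
  "bord_trees G =
     {T. metric_tree (pi1 G) T \<and> trivial_edge_stabilisers (pi1 G) T \<and> minimal_tree (pi1 G) T \<and>
         (\<forall>v \<in> verts (ugraph G). \<forall>S \<in> vertex_groups G v. elliptic T S)}"

definition outer_trees :: "('v, 'e, 'g) gog \<Rightarrow> ('v, 'e, 'g) htree set" where
  "outer_trees G =
     {T. metric_tree (pi1 G) T \<and> trivial_edge_stabilisers (pi1 G) T \<and> minimal_tree (pi1 G) T \<and>
         (\<forall>v \<in> nontrivial_vertices G.
            \<exists>!O'. O' \<in> orbits (pi1 G) (tverts T) (act T) \<and>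
                  (\<forall>x \<in> O'. stabilizer (pi1 G) (act T) x \<in> vertex_groups G v)) \<and>
         (\<forall>x \<in> tverts T. free_vertex (pi1 G) T x \<or>
            (\<exists>v \<in> nontrivial_vertices G. stabilizer (pi1 G) (act T) x \<in> vertex_groups G v)) \<and>
         no_redundant_vertices (pi1 G) T}"

definition outer_space :: "('v, 'e, 'g) union_gog \<Rightarrow> ('v, 'e, 'g) hforest set" where
  "outer_space \<Gamma> = (\<Pi>\<^sub>E i \<in> {..<length \<Gamma>}. outer_trees (\<Gamma> ! i))"

definition bordification :: "('v, 'e, 'g) union_gog \<Rightarrow> ('v, 'e, 'g) hforest set" where
  "bordification \<Gamma> = (\<Pi>\<^sub>E i \<in> {..<length \<Gamma>}. bord_trees (\<Gamma> ! i))"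

text \<open>
  A simplex is a full equivalence class of representatives, hence saturated under isometry. As
  homeomorphisms of the realisations ignore vertices of valence two with trivial stabiliser, these
  are harmless in the representatives.
\<close>

definition simplices :: "('v, 'e, 'g) union_gog \<Rightarrow> ('v, 'e, 'g) hforest set set" where
  "simplices \<Gamma> = bordification \<Gamma> //
     {(X, Y). X \<in> bordification \<Gamma> \<and> Y \<in> bordification \<Gamma> \<and>
              (\<forall>i < length \<Gamma>. equiv_homeomorphic (HH \<Gamma> i) (X i) (Y i))}"


section \<open>Automorphisms\<close>

type_synonym ('v, 'e, 'g) uaut =
  "(nat \<Rightarrow> nat) \<times> (nat \<Rightarrow> ('v, 'e, 'g) loop_class \<Rightarrow> ('v, 'e, 'g) loop_class)"

text \<open>
  Only the nontrivial vertex groups are part of the splitting, hence only these have to be respected.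
\<close>

definition aut_carrier :: "('v, 'e, 'g) union_gog \<Rightarrow> ('v, 'e, 'g) uaut set" where
  "aut_carrier \<Gamma> =
     {(\<sigma>, \<phi>). \<sigma> permutes {..<length \<Gamma>} \<and> \<phi> \<in> extensional {..<length \<Gamma>} \<and>
        (\<forall>i < length \<Gamma>. \<phi> i \<in> iso (HH \<Gamma> i) (HH \<Gamma> (\<sigma> i)) \<and> \<phi> i \<in> extensional (carrier (HH \<Gamma> i)) \<and>
           (\<forall>v \<in> nontrivial_vertices (\<Gamma> ! i). \<forall>S \<in> vertex_groups (\<Gamma> ! i) v.
              \<exists>w \<in> nontrivial_vertices (\<Gamma> ! \<sigma> i). \<phi> i ` S \<in> vertex_groups (\<Gamma> ! \<sigma> i) w))}"

definition AutG :: "('v, 'e, 'g) union_gog \<Rightarrow> ('v, 'e, 'g) uaut monoid" where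
  "AutG \<Gamma> =
     \<lparr>carrier = aut_carrier \<Gamma>,
      monoid.mult = (\<lambda>(\<sigma>, \<phi>) (\<tau>, \<psi>).
        (\<sigma> \<circ> \<tau>, \<lambda>i \<in> {..<length \<Gamma>}. compose (carrier (HH \<Gamma> i)) (\<phi> (\<tau> i)) (\<psi> i))),
      monoid.one = (id, \<lambda>i \<in> {..<length \<Gamma>}. \<lambda>x \<in> carrier (HH \<Gamma> i). x)\<rparr>"

definition InnG :: "('v, 'e, 'g) union_gog \<Rightarrow> ('v, 'e, 'g) uaut set" where
  "InnG \<Gamma> =
     {(id, \<lambda>i \<in> {..<length \<Gamma>}. \<lambda>x \<in> carrier (HH \<Gamma> i). h i \<otimes>\<^bsub>HH \<Gamma> i\<^esub> x \<otimes>\<^bsub>HH \<Gamma> i\<^esub> inv\<^bsub>HH \<Gamma> i\<^esub> (h i)) | h.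
        \<forall>i < length \<Gamma>. h i \<in> carrier (HH \<Gamma> i)}"

definition OutG :: "('v, 'e, 'g) union_gog \<Rightarrow> ('v, 'e, 'g) uaut set monoid" where
  "OutG \<Gamma> = AutG \<Gamma> Mod InnG \<Gamma>"

definition twist :: "('h \<Rightarrow> 'h) \<Rightarrow> ('h, 'x) gtree \<Rightarrow> ('h, 'x) gtree" where
  "twist \<alpha> T = T\<lparr>act := (\<lambda>g. act T (\<alpha> g))\<rparr>"

definition aut_act ::
    "('v, 'e, 'g) union_gog \<Rightarrow> ('v, 'e, 'g) uaut \<Rightarrow> ('v, 'e, 'g) hforest \<Rightarrow> ('v, 'e, 'g) hforest" where
  "aut_act \<Gamma> \<phi> X = (\<lambda>i \<in> {..<length \<Gamma>}. twist (snd \<phi> i) (X (fst \<phi> i)))"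


section \<open>Displacement\<close>

text \<open>
  The minimal Lipschitz constant, written as an infimum; it is infinite if there are no Lipschitz
  equivariant maps. The Lipschitz constant of a tuple is the maximum over its components.
\<close>

definition stretch ::
    "('v, 'e, 'g) union_gog \<Rightarrow> ('v, 'e, 'g) hforest \<Rightarrow> ('v, 'e, 'g) hforest \<Rightarrow> ennreal" where
  "stretch \<Gamma> X Y =
     Inf {(SUP i \<in> {..<length \<Gamma>}. Lip (X i) (Y i) (f i)) | f.
            \<forall>i < length \<Gamma>. equivariant_map (HH \<Gamma> i) (X i) (Y i) (f i) \<and> Lip (X i) (Y i) (f i) < \<infinity>}"

definition straight_rep :: "('v, 'e, 'g) union_gog \<Rightarrow> ('v, 'e, 'g) uaut \<Rightarrow> ('v, 'e, 'g) hforest \<Rightarrow>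
    (nat \<Rightarrow> (('v, 'e, 'g) loop_class \<times> nat \<Rightarrow> real) \<Rightarrow> (('v, 'e, 'g) loop_class \<times> nat \<Rightarrow> real)) \<Rightarrow> bool" where
  "straight_rep \<Gamma> \<phi> X f \<longleftrightarrow>
     (\<forall>i < length \<Gamma>. straight_map (X i) (X (fst \<phi> i)) (f i) \<and>
        (\<forall>h \<in> carrier (HH \<Gamma> i). \<forall>p \<in> points (X i).
           f i (pact (X i) h p) = pact (X (fst \<phi> i)) (snd \<phi> i h) (f i p)))"

type_synonym ('v, 'e, 'g) hsubgraph = "nat \<Rightarrow> (('v, 'e, 'g) loop_class \<times> nat) pair_pre_digraph"

definition aut_invariant ::
    "('v, 'e, 'g) union_gog \<Rightarrow> ('v, 'e, 'g) uaut \<Rightarrow> ('v, 'e, 'g) hforest \<Rightarrow> ('v, 'e, 'g) hsubgraph \<Rightarrow> bool" where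
  "aut_invariant \<Gamma> \<phi> X A \<longleftrightarrow>
     (\<exists>f. straight_rep \<Gamma> \<phi> X f \<and>
          (\<forall>i < length \<Gamma>. f i ` realisation (A i) \<subseteq> realisation (A (fst \<phi> i))))"

definition proper_subgraph ::
    "('v, 'e, 'g) union_gog \<Rightarrow> ('v, 'e, 'g) hforest \<Rightarrow> ('v, 'e, 'g) hsubgraph \<Rightarrow> bool" where
  "proper_subgraph \<Gamma> X A \<longleftrightarrow>
     (\<forall>i < length \<Gamma>. invariant_subgraph (HH \<Gamma> i) (X i) (A i)) \<and>
     (\<exists>i < length \<Gamma>. A i \<noteq> tgraph (X i))"

definition carries_hyperbolic ::
    "('v, 'e, 'g) union_gog \<Rightarrow> ('v, 'e, 'g) hforest \<Rightarrow> ('v, 'e, 'g) hsubgraph \<Rightarrow> bool" where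
  "carries_hyperbolic \<Gamma> X A \<longleftrightarrow>
     (\<exists>i < length \<Gamma>. \<exists>v \<in> pverts (A i). \<exists>g \<in> carrier (HH \<Gamma> i).
        act (X i) g ` comp_of (A i) v = comp_of (A i) v \<and> \<not> elliptic (X i) {g})"

text \<open>
  A point at infinity can be written as \<open>X\<^sub>0 / A\<close> in several ways (e.g. \<open>A\<close> may have additional
  components that are trees); its displacement is finite as soon as \<open>A\<close> is invariant in one of them.
\<close>

definition displacement ::
    "('v, 'e, 'g) union_gog \<Rightarrow> ('v, 'e, 'g) uaut \<Rightarrow> ('v, 'e, 'g) hforest \<Rightarrow> ennreal" where
  "displacement \<Gamma> \<phi> X =
     (if (\<exists>X\<^sub>0 \<in> outer_space \<Gamma>. \<forall>i < length \<Gamma>. equiv_isometric (HH \<Gamma> i) (X i) (X\<^sub>0 i)) \<or>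
         (\<exists>X\<^sub>0 \<in> outer_space \<Gamma>. \<exists>A.
            proper_subgraph \<Gamma> X\<^sub>0 A \<and> carries_hyperbolic \<Gamma> X\<^sub>0 A \<and> aut_invariant \<Gamma> \<phi> X\<^sub>0 A \<and>
            (\<forall>i < length \<Gamma>. equiv_isometric (HH \<Gamma> i) (X i) (collapse (X\<^sub>0 i) (A i))))
      then stretch \<Gamma> X (aut_act \<Gamma> \<phi> X)
      else \<infinity>)"

definition simplex_displacement ::
    "('v, 'e, 'g) union_gog \<Rightarrow> ('v, 'e, 'g) uaut \<Rightarrow> ('v, 'e, 'g) hforest set \<Rightarrow> ennreal" where
  "simplex_displacement \<Gamma> \<phi> \<Delta> = (INF X \<in> \<Delta>. displacement \<Gamma> \<phi> X)"

definition spec :: "('v, 'e, 'g) union_gog \<Rightarrow> ('v, 'e, 'g) uaut \<Rightarrow> real set" where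
  "spec \<Gamma> \<phi> =
     {enn2real (simplex_displacement \<Gamma> \<phi> \<Delta>) | \<Delta>.
        \<Delta> \<in> simplices \<Gamma> \<and> simplex_displacement \<Gamma> \<phi> \<Delta> < \<infinity>}"

definition global_spec :: "('v, 'e, 'g) union_gog \<Rightarrow> real set" where
  "global_spec \<Gamma> =
     {enn2real (simplex_displacement \<Gamma> \<phi> \<Delta>) | c \<phi> \<Delta>.
        c \<in> carrier (OutG \<Gamma>) \<and> \<phi> \<in> c \<and> \<Delta> \<in> simplices \<Gamma> \<and> simplex_displacement \<Gamma> \<phi> \<Delta> < \<infinity>}"

definition well_ordered :: "real set \<Rightarrow> bool" where
  "well_ordered S \<longleftrightarrow> well_order_on S {(x, y). x \<in> S \<and> y \<in> S \<and> x \<le> y}"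

end

theory Submission
  imports Defs
begin

text \<open>
  The displacement of a simplex is an infimum, over the combinatorial types of equivariant maps
  sending edges to geodesics, of quantities that depend monotonically on crossing numbers: after the
  edge lengths and the positions of the images of vertices inside edges are fixed, the length of the
  image of an edge is a sum of nonnegative terms whose coefficients count how often each orbit of
  edges is crossed in each way. The number of orbits of edges of a tree in outer space, hence of its
  collapses, is bounded in terms of \<open>\<Gamma>\<close>: mod 2 cochains on the quotient bound its first Betti
  number, and free vertices have valence at least three.

  Suppose the spectrum contained a strictly decreasing sequence, and choose for each term a point and a
  map that nearly realise it. Dickson's lemma yields indices \<open>n < m\<close> with the same finite incidence
  data such that every crossing number of the \<open>n\<close>-th map is at most the corresponding one of the
  \<open>m\<close>-th. Giving the \<open>n\<close>-th tree the lengths and positions of the \<open>m\<close>-th shows that the \<open>n\<close>-th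
  displacement is at most the stretching factor of the \<open>m\<close>-th map, a contradiction.
\<close>

section \<open>Trees and the sides of an edge\<close>

text \<open>Each arc gives a coordinate on the tree: the side of the arc on which a point lies. The
  path distance is half the sum, over all arcs, of length times coordinate difference. It is thus
  linear in the lengths with nonnegative coefficients, which is what allows crossing numbers to be
  compared term by term, and betweenness is a condition on coordinates alone, independent of the
  lengths.

  The obstacle is that a boundary point has infinite displacement unless it is a collapse
  \<open>X0 / A\<close> with \<open>A\<close> invariant. A change of lengths must therefore be
  lifted from the collapse to \<open>X0\<close>, and the straight map preserving \<open>A\<close>
  must be reparametrised.

  No infimum has to be attained: "nearly" means below the preceding term of the decreasing
  sequence.\<close>

locale stree =
  fixes V :: "'x set" and E :: "'x rel"
  assumes wf: "(a, b) \<in> E \<Longrightarrow> a \<in> V \<and> b \<in> V"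
    and sym: "(a, b) \<in> E \<Longrightarrow> (b, a) \<in> E"
    and irrefl: "(a, b) \<in> E \<Longrightarrow> a \<noteq> b"
    and nonempty: "V \<noteq> {}"
    and conn: "u \<in> V \<Longrightarrow> v \<in> V \<Longrightarrow> (u, v) \<in> E\<^sup>*"
    and bridge: "(a, b) \<in> E \<Longrightarrow> (b, a) \<notin> (E - {(a, b), (b, a)})\<^sup>*"

text \<open>Removing an edge in both directions separates the tree; the value is 1 on the part
  containing the head of \<open>e\<close>. It is a real number so that it can be extended affinely
  to the realisation.\<close>

definition side :: "'x rel \<Rightarrow> 'x \<times> 'x \<Rightarrow> 'x \<Rightarrow> real" where
  "side E e x = (if (snd e, x) \<in> (E - {e, prod.swap e})\<^sup>* then 1 else 0)"

text \<open>The edges of the geodesic from \<open>u\<close> to \<open>v\<close>, described without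
  choosing a path.\<close>

definition path_arcs :: "'x rel \<Rightarrow> 'x \<Rightarrow> 'x \<Rightarrow> ('x \<times> 'x) set" where
  "path_arcs E u v = {e \<in> E. side E e u = 0 \<and> side E e v = 1}"

lemma side_cases: "side E e x = 0 \<or> side E e x = 1"
  by (auto simp: side_def)

context stree
begin

lemma side_snd: "(a, b) \<in> E \<Longrightarrow> side E (a, b) b = 1"
  by (simp add: side_def)

lemma side_fst: "(a, b) \<in> E \<Longrightarrow> side E (a, b) a = 0"
  using bridge by (simp add: side_def)

text \<open>The edge from \<open>u\<close> to \<open>v\<close> survives the deletion of
  \<open>e\<close> in both directions, so its ends stay in one component.\<close>

lemma side_eq:
  assumes "(u, v) \<in> E" "e \<noteq> (u, v)" "e \<noteq> (v, u)"
  shows "side E e u = side E e v"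
proof -
  let ?R = "E - {e, prod.swap e}"
  have "(u, v) \<in> ?R" "(v, u) \<in> ?R" using assms sym by (cases e, auto)+
  then have "(snd e, u) \<in> ?R\<^sup>* \<longleftrightarrow> (snd e, v) \<in> ?R\<^sup>*" by (meson rtrancl.rtrancl_into_rtrancl)
  then show ?thesis by (simp add: side_def)
qed

lemma tree_induct:
  assumes "x \<in> V" "P x" and "\<And>u v. (u, v) \<in> E \<Longrightarrow> P u \<Longrightarrow> P v" and "y \<in> V"
  shows "P y"
proof -
  have "(x, y) \<in> E\<^sup>*" using conn assms by blast
  then show ?thesis by induction (use assms in auto)
qed

lemma side_swap:
  assumes "(a, b) \<in> E" "x \<in> V"
  shows "side E (b, a) x = 1 - side E (a, b) x"
proof -
  have "side E (b, a) x + side E (a, b) x = 1"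
  proof (rule tree_induct[of a])
    show "a \<in> V" "side E (b, a) a + side E (a, b) a = 1"
      using assms wf sym side_fst side_snd by force+
    fix u v assume uv: "(u, v) \<in> E" and IH: "side E (b, a) u + side E (a, b) u = 1"
    show "side E (b, a) v + side E (a, b) v = 1"
    proof (cases "(u, v) = (a, b) \<or> (u, v) = (b, a)")
      case True
      then show ?thesis using assms sym side_fst side_snd by force
    next
      case False
      then show ?thesis using side_eq[OF uv, of "(a, b)"] side_eq[OF uv, of "(b, a)"] IH by auto
    qed
  qed (use assms in auto)
  then show ?thesis by simp
qed

text \<open>The side of \<open>e\<close> away from \<open>f\<close> and the side of \<open>f\<close>
  away from \<open>e\<close> are disjoint: no end of either edge lies in both, so a common vertex
  would propagate along paths to the whole tree.\<close>

lemma side_cross: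
  assumes "e \<in> E" "f \<in> E" "e \<noteq> f" "e \<noteq> prod.swap f" "x \<in> V"
  shows "side E e x = side E e (fst f) \<or> side E f x = side E f (fst e)"
proof (rule ccontr)
  assume "\<not> ?thesis"
  then have 1: "side E e x \<noteq> side E e (fst f) \<and> side E f x \<noteq> side E f (fst e)" by blast
  have ends: "side E e (snd f) = side E e (fst f)" "side E f (snd e) = side E f (fst e)"
    using side_eq[of "fst f" "snd f" e] side_eq[of "fst e" "snd e" f] assms
    by (metis prod.collapse prod.swap_def swap_swap)+
  have "side E e (fst e) \<noteq> side E e (fst f) \<and> side E f (fst e) \<noteq> side E f (fst e)"
  proof (rule tree_induct[of x "\<lambda>y. side E e y \<noteq> side E e (fst f) \<and> side E f y \<noteq> side E f (fst e)"])
    fix u v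
    assume uv: "(u, v) \<in> E"
      and IH: "side E e u \<noteq> side E e (fst f) \<and> side E f u \<noteq> side E f (fst e)"
    have "u \<noteq> fst e" "u \<noteq> snd e" "u \<noteq> fst f" "u \<noteq> snd f" using IH ends by auto
    then have "side E e u = side E e v" "side E f u = side E f v"
      using side_eq[OF uv, of e] side_eq[OF uv, of f] by (metis fst_conv snd_conv)+
    then show "side E e v \<noteq> side E e (fst f) \<and> side E f v \<noteq> side E f (fst e)" using IH by simp
  qed (use assms 1 wf in \<open>auto, (metis prod.collapse)\<close>)
  then show False by simp
qed

lemma fst_V: "e \<in> E \<Longrightarrow> fst e \<in> V" and snd_V: "e \<in> E \<Longrightarrow> snd e \<in> V"
  using wf by (metis prod.collapse)+

end

section \<open>Trees by bridges and trees by unique simple paths\<close>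

lemma simplicial_treeD_pair: "simplicial_tree g \<Longrightarrow> pair_bidirected_digraph g"
  by (simp add: simplicial_tree_def)

context
  fixes g :: "'x pair_pre_digraph"
  assumes st: "stree (pverts g) (parcs g)"
begin

interpretation stree "pverts g" "parcs g" by (rule st)

lemma stree_bidirected: "pair_bidirected_digraph g"
  by unfold_locales
    (use wf sym irrefl fst_V snd_V in \<open>auto simp: symmetric_def intro!: symI\<close>)

interpretation P: pair_bidirected_digraph g by (rule stree_bidirected)

text \<open>The rest of a simple path never returns to its first vertex, so it does not cross the
  first edge again, and this edge separates the ends. All other edges are blind to the first step,
  which gives the induction.\<close>

lemma apath_arcs_raw:
  assumes "P.apath u p v"
  shows "set p = path_arcs (parcs g) u v \<and> distinct p"
  using assms
proof (induction p arbitrary: u)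
  case Nil
  then show ?case by (auto simp: P.apath_simps path_arcs_def)
next
  case (Cons e p)
  obtain a where e: "e = (u, a)" "e \<in> parcs g" and p: "P.apath a p v"
    and u: "u \<notin> set (pawalk_verts a p)"
    using Cons.prems by (cases e) (auto simp: P.apath_simps)
  have IH: "set p = path_arcs (parcs g) a v" "distinct p" using Cons.IH[OF p] by auto
  have wp: "P.awalk a p v" using p by (simp add: P.apath_def)
  have nu: "fst f \<noteq> u \<and> snd f \<noteq> u" if "f \<in> set p" for f
    using P.set_awalk_verts[OF wp] u that by auto
  have "side (parcs g) e v = side (parcs g) e a"
  proof -
    have "P.awalk a q v \<Longrightarrow> (\<forall>f \<in> set q. fst f \<noteq> u \<and> snd f \<noteq> u) \<Longrightarrow>
      side (parcs g) e v = side (parcs g) e a" for q a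
    proof (induction q arbitrary: a)
      case Nil
      then show ?case by (auto simp: P.awalk_simps)
    next
      case (Cons f q)
      obtain b where f: "f = (a, b)" "(a, b) \<in> parcs g" "P.awalk b q v"
        using Cons.prems by (cases f) (auto simp: P.awalk_simps)
      have "side (parcs g) e a = side (parcs g) e b"
        by (rule side_eq[OF f(2)]) (use Cons.prems f e in auto)
      then show ?case using Cons.IH[OF f(3)] Cons.prems by auto
    qed
    then show ?thesis using wp nu by blast
  qed
  then have ev: "side (parcs g) e v = 1" "side (parcs g) e u = 0"
    using e side_fst side_snd by auto
  have eq: "side (parcs g) f u = side (parcs g) f a" if "f \<noteq> e" "f \<noteq> (a, u)" for f
    using side_eq[of u a f] e that by auto
  have au: "(a, u) \<in> parcs g" using sym e by blast
  have "path_arcs (parcs g) u v = insert e (path_arcs (parcs g) a v)"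
  proof (rule Set.set_eqI)
    fix f
    consider "f = e" | "f = (a, u)" | "f \<noteq> e" "f \<noteq> (a, u)" by blast
    then show "f \<in> path_arcs (parcs g) u v \<longleftrightarrow> f \<in> insert e (path_arcs (parcs g) a v)"
    proof cases
      case 1
      then show ?thesis using ev e by (auto simp: path_arcs_def)
    next
      case 2
      have "f \<notin> path_arcs (parcs g) a v" using 2 nu[of "(a, u)"] IH(1) by auto
      moreover have "side (parcs g) f u = 1" using 2 au side_snd by simp
      moreover have "f \<noteq> e" using 2 e irrefl by auto
      ultimately show ?thesis by (auto simp: path_arcs_def)
    next
      case 3
      then show ?thesis using eq[OF 3] by (auto simp: path_arcs_def)
    qed
  qed
  moreover have "e \<notin> set p" using nu[of e] e by auto
  ultimately show ?case using IH by auto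
qed

text \<open>Both paths consist of the same arcs, and only one of these leaves \<open>u\<close>; so
  the first arcs agree, and the remainders are treated by induction.\<close>

lemma apath_unique_raw:
  assumes "P.apath u p v" "P.apath u q v"
  shows "p = q"
  using assms
proof (induction p arbitrary: u q)
  case Nil
  then have "u = v" by (auto simp: P.apath_simps)
  then show ?case using Nil P.apath_nonempty_ends by blast
next
  case (Cons e p)
  have "q \<noteq> []" using Cons.prems P.apath_ends by blast
  then obtain f q' where q: "q = f # q'" by (cases q) auto
  have s: "set (e # p) = set q"
    using apath_arcs_raw[OF Cons.prems(1)] apath_arcs_raw[OF Cons.prems(2)] by simp
  obtain a where e: "e = (u, a)" and p: "P.apath a p v" "u \<notin> set (pawalk_verts a p)"
    using Cons.prems by (cases e) (auto simp: P.apath_simps)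
  have "fst f = u" using Cons.prems q by (auto simp: P.apath_simps)
  moreover have "f \<in> set (e # p)" using s q by simp
  moreover have "fst h \<noteq> u" if "h \<in> set p" for h
    using P.awalk_verts_arc1[OF that, of a] p by auto
  ultimately have "f = e" by (metis set_ConsD)
  moreover have "P.apath a q' v" using Cons.prems(2) q \<open>f = e\<close> e by (auto simp: P.apath_simps)
  ultimately show ?case using Cons.IH[OF p(1)] q by blast
qed

lemma apath_exists_raw:
  assumes "u \<in> pverts g" "v \<in> pverts g"
  shows "\<exists>p. P.apath u p v"
proof -
  have "(u, v) \<in> (parcs g)\<^sup>*" using conn assms by blast
  then have "\<exists>p. P.awalk u p v"
  proof (induction rule: rtrancl_induct)
    case base
    then show ?case using assms by (auto intro!: exI[of _ "[]"] simp: P.awalk_simps)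
  next
    case (step y z)
    then obtain p where "P.awalk u p y" by blast
    moreover have "P.awalk y [(y, z)] z" using step wf[of y z] by (auto simp: P.awalk_simps)
    ultimately show ?case by (meson P.awalk_appendI)
  qed
  then show ?thesis using P.apath_awalk_to_apath by blast
qed

lemma stree_simplicial_tree: "simplicial_tree g"
  unfolding simplicial_tree_def
  using stree_bidirected nonempty apath_exists_raw apath_unique_raw by blast

end

text \<open>If an edge were not a bridge, a detour around it would contain a second simple path
  between its ends.\<close>

lemma simplicial_tree_stree:
  assumes "simplicial_tree g"
  shows "stree (pverts g) (parcs g)"
proof -
  interpret P: pair_bidirected_digraph g using assms by (rule simplicial_treeD_pair)
  have ap: "\<exists>!p. P.apath u p v" if "u \<in> pverts g" "v \<in> pverts g" for u v
    using assms that by (auto simp: simplicial_tree_def)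
  show ?thesis
  proof
    fix a b assume ab: "(a, b) \<in> parcs g"
    show V: "a \<in> pverts g \<and> b \<in> pverts g" using ab P.wellformed' by blast
    show ba: "(b, a) \<in> parcs g" using ab P.arcs_symmetric by blast
    show "a \<noteq> b" using P.pair_no_loops[OF ab] by simp
    show "(b, a) \<notin> (parcs g - {(a, b), (b, a)})\<^sup>*"
    proof
      let ?h = "\<lparr>pverts = pverts g, parcs = parcs g - {(a, b), (b, a)}\<rparr>"
      interpret h: pair_wf_digraph ?h by unfold_locales (use P.wellformed' in auto)
      have walk: "\<exists>p. h.awalk b p x" if "(b, x) \<in> (parcs g - {(a, b), (b, a)})\<^sup>*" for x
        using that
      proof (induction rule: rtrancl_induct)
        case base
        have "h.awalk b [] b" using V h.awalk_Nil_iff by auto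
        then show ?case by blast
      next
        case (step y z)
        then obtain p where "h.awalk b p y" by blast
        moreover have "h.awalk y [(y, z)] z"
          using step P.wellformed' by (auto simp: h.awalk_simps)
        ultimately show ?case by (meson h.awalk_appendI)
      qed
      assume "(b, a) \<in> (parcs g - {(a, b), (b, a)})\<^sup>*"
      then obtain p where p: "h.apath b p a" using walk h.apath_awalk_to_apath by blast
      then have "P.apath b p a"
        by (auto simp: h.apath_def P.apath_def h.awalk_def P.awalk_def)
      moreover have "P.apath b [(b, a)] a"
        using ba V \<open>a \<noteq> b\<close> by (auto simp: P.apath_simps)
      ultimately have "p = [(b, a)]" using ap V by blast
      then show False using p by (auto simp: h.apath_simps)
    qed
  next
    show "pverts g \<noteq> {}" using assms by (simp add: simplicial_tree_def)
  next
    fix u v assume "u \<in> pverts g" "v \<in> pverts g"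
    then obtain p where "P.awalk u p v" using ap P.awalkI_apath by blast
    then show "(u, v) \<in> (parcs g)\<^sup>*"
    proof (induction p arbitrary: u)
      case Nil
      then show ?case by (auto simp: P.awalk_simps)
    next
      case (Cons e p)
      then have "e \<in> parcs g" "fst e = u" "(snd e, v) \<in> (parcs g)\<^sup>*" by (auto simp: P.awalk_simps)
      then show ?case by (metis converse_rtrancl_into_rtrancl prod.collapse)
    qed
  qed
qed

lemma finite_path_arcs:
  fixes g :: "'x pair_pre_digraph"
  assumes "stree (pverts g) (parcs g)" "u \<in> pverts g" "v \<in> pverts g"
  shows "finite (path_arcs (parcs g) u v)"
  using apath_exists_raw[OF assms(1) assms(2,3)] apath_arcs_raw[OF assms(1)] by (metis List.finite_set)

lemma path_arcs_empty:
  fixes g :: "'x pair_pre_digraph"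
  assumes "stree (pverts g) (parcs g)" "u \<in> pverts g" "v \<in> pverts g"
    and "path_arcs (parcs g) u v = {}"
  shows "u = v"
proof -
  interpret P: pair_bidirected_digraph g using assms(1) by (rule stree_bidirected)
  obtain p where p: "P.apath u p v" using apath_exists_raw[OF assms(1) assms(2,3)] by blast
  then have "p = []" using apath_arcs_raw[OF assms(1)] assms(4) by fastforce
  then show ?thesis using p by (auto simp: P.apath_simps)
qed

lemma vdist_path_arcs:
  assumes "simplicial_tree (tgraph T)" "u \<in> tverts T" "v \<in> tverts T"
  shows "vdist T u v = (\<Sum>e \<in> path_arcs (tarcs T) u v. len T e)"
proof -
  have st: "stree (tverts T) (tarcs T)" using assms simplicial_tree_stree by blast
  let ?ap = "pre_digraph.apath (with_proj (tgraph T))"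
  have ex: "\<exists>!p. ?ap u p v" using assms by (simp add: simplicial_tree_def)
  then have "?ap u (THE p. ?ap u p v) v" by (rule theI')
  from apath_arcs_raw[OF st this] show ?thesis
    unfolding vdist_def by (metis sum_list_distinct_conv_sum_set)
qed

lemma vdist_list:
  assumes "simplicial_tree (tgraph T)" "u \<in> tverts T" "v \<in> tverts T"
  obtains p where "set p \<subseteq> tarcs T" "pcas u p v" "vdist T u v = sum_list (map (len T) p)"
proof -
  interpret P: pair_bidirected_digraph "tgraph T" using assms(1) by (rule simplicial_treeD_pair)
  have "\<exists>!p. P.apath u p v" using assms by (simp add: simplicial_tree_def)
  then have "P.apath u (THE p. P.apath u p v) v" by (rule theI')
  then show thesis
    by (intro that[of "THE p. P.apath u p v"]) (auto simp: vdist_def P.apath_def P.awalk_def)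
qed

text \<open>
  The hypotheses on \<open>\<theta>\<close> cover group elements, isomorphisms of trees, and collapse maps (which may
  identify the ends of an edge).
\<close>

lemma side_map:
  assumes "stree V E" "stree V' E'"
    and simp: "\<And>u v. (u, v) \<in> E \<Longrightarrow> \<theta> u = \<theta> v \<or> (\<theta> u, \<theta> v) \<in> E'"
    and inj: "\<And>u v. (u, v) \<in> E \<Longrightarrow> \<theta> u = \<theta> a \<Longrightarrow> \<theta> v = \<theta> b \<Longrightarrow> u = a \<and> v = b"
    and ab: "(a, b) \<in> E" "(\<theta> a, \<theta> b) \<in> E'" and x: "x \<in> V"
  shows "side E' (\<theta> a, \<theta> b) (\<theta> x) = side E (a, b) x"
proof -
  interpret A: stree V E by fact
  interpret B: stree V' E' by fact
  have a: "a \<in> V" using A.wf ab by blast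
  show ?thesis
  proof (rule A.tree_induct[OF a _ _ x, of "\<lambda>x. side E' (\<theta> a, \<theta> b) (\<theta> x) = side E (a, b) x"])
    show "side E' (\<theta> a, \<theta> b) (\<theta> a) = side E (a, b) a"
      using A.side_fst[OF ab(1)] B.side_fst[OF ab(2)] by simp
    fix u v assume uv: "(u, v) \<in> E" and IH: "side E' (\<theta> a, \<theta> b) (\<theta> u) = side E (a, b) u"
    consider "(u, v) = (a, b)" | "(v, u) = (a, b)" | "(u, v) \<noteq> (a, b)" "(v, u) \<noteq> (a, b)" by blast
    then show "side E' (\<theta> a, \<theta> b) (\<theta> v) = side E (a, b) v"
    proof cases
      case 1
      then show ?thesis using A.side_snd[OF ab(1)] B.side_snd[OF ab(2)] by simp
    next
      case 2
      then show ?thesis using A.side_fst[OF ab(1)] B.side_fst[OF ab(2)] by simp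
    next
      case 3
      have "side E (a, b) u = side E (a, b) v" using A.side_eq[OF uv, of "(a, b)"] 3 by auto
      moreover have "side E' (\<theta> a, \<theta> b) (\<theta> u) = side E' (\<theta> a, \<theta> b) (\<theta> v)"
      proof (cases "\<theta> u = \<theta> v")
        case False
        then have "(\<theta> u, \<theta> v) \<in> E'" using simp uv by blast
        moreover have "(\<theta> a, \<theta> b) \<noteq> (\<theta> u, \<theta> v)" "(\<theta> a, \<theta> b) \<noteq> (\<theta> v, \<theta> u)"
          using inj[OF uv] inj[OF A.sym[OF uv]] 3 by auto
        ultimately show ?thesis by (rule B.side_eq)
      qed simp
      ultimately show ?thesis using IH by simp
    qed
  qed
qed

section \<open>The path metric in coordinates\<close>

definition pt :: "'x \<Rightarrow> 'x \<Rightarrow> real \<Rightarrow> 'x \<Rightarrow> real" where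
  "pt a b t = (\<lambda>x. (1 - t) * vpt a x + t * vpt b x)"

text \<open>Summation over the support, since points are finitely supported functions on a possibly
  infinite type.\<close>

definition aff :: "('x \<Rightarrow> real) \<Rightarrow> ('x \<Rightarrow> real) \<Rightarrow> real" where
  "aff s p = (\<Sum>x | p x \<noteq> 0. p x * s x)"

definition coord :: "'x rel \<Rightarrow> 'x \<times> 'x \<Rightarrow> ('x \<Rightarrow> real) \<Rightarrow> real" where
  "coord E e p = aff (side E e) p"

definition mid :: "real \<Rightarrow> real \<Rightarrow> real \<Rightarrow> bool" where
  "mid x y z \<longleftrightarrow> x \<le> y \<and> y \<le> z \<or> z \<le> y \<and> y \<le> x"

lemma mid_end [simp]: "mid x y y" "mid x x y"
  by (auto simp: mid_def)

lemma mid_abs: "mid x y z \<longleftrightarrow> \<bar>z - x\<bar> = \<bar>y - x\<bar> + \<bar>z - y\<bar>"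
  unfolding mid_def by linarith

lemma pt_same [simp]: "pt a a t = vpt a"
  by (simp add: pt_def fun_eq_iff algebra_simps)

lemma pt_0 [simp]: "pt a b 0 = vpt a" and pt_1 [simp]: "pt a b 1 = vpt b"
  by (simp_all add: pt_def fun_eq_iff)

lemma pt_swap: "pt b a (1 - t) = pt a b t"
  by (simp add: pt_def fun_eq_iff algebra_simps)

lemma vpt_inj [simp]: "vpt u = vpt v \<longleftrightarrow> u = v"
  by (metis one_neq_zero vpt_def)

lemma vpt_self [simp]: "vpt u u = 1"
  by (simp add: vpt_def)

lemma pt_fst: "a \<noteq> b \<Longrightarrow> pt a b t a = 1 - t" and pt_snd: "a \<noteq> b \<Longrightarrow> pt a b t b = t"
  by (simp_all add: pt_def vpt_def)

lemma pt_nz: "pt a b t x \<noteq> 0 \<Longrightarrow> x = a \<or> x = b"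
  by (auto simp: pt_def vpt_def split: if_splits)

lemma aff_pt: "aff s (pt a b t) = (1 - t) * s a + t * s b"
proof -
  have "aff s (pt a b t) = (\<Sum>x \<in> {a, b}. pt a b t x * s x)"
    unfolding aff_def by (rule sum.mono_neutral_left) (use pt_nz in \<open>auto, fast\<close>)
  also have "\<dots> = (1 - t) * s a + t * s b"
    by (cases "a = b") (auto simp: pt_fst pt_snd vpt_def pt_def algebra_simps)
  finally show ?thesis .
qed

lemma coord_pt: "coord E e (pt a b t) = (1 - t) * side E e a + t * side E e b"
  by (simp add: coord_def aff_pt)

lemma coord_vpt [simp]: "coord E e (vpt u) = side E e u"
  using coord_pt[of E e u u 0] by simp

definition rep :: "'x pair_pre_digraph \<Rightarrow> 'x \<Rightarrow> 'x \<Rightarrow> real \<Rightarrow> bool" where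
  "rep g a b t \<longleftrightarrow> 0 \<le> t \<and> t \<le> 1 \<and> ((a, b) \<in> parcs g \<or> a = b \<and> a \<in> pverts g)"

lemma seg_pt: "seg (a, b) = pt a b ` {0..1}"
  by (simp add: seg_def pt_def)

lemma realisation_rep: "p \<in> realisation g \<longleftrightarrow> (\<exists>a b t. rep g a b t \<and> p = pt a b t)"
proof
  assume "p \<in> realisation g"
  then consider u where "u \<in> pverts g" "p = vpt u"
    | a b t where "(a, b) \<in> parcs g" "0 \<le> t" "t \<le> 1" "p = pt a b t"
    unfolding realisation_def by (auto simp: seg_pt)
  then show "\<exists>a b t. rep g a b t \<and> p = pt a b t"
  proof cases
    case 1
    then have "rep g u u 0 \<and> p = pt u u 0" by (simp add: rep_def)
    then show ?thesis by blast
  qed (auto simp: rep_def)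
next
  assume "\<exists>a b t. rep g a b t \<and> p = pt a b t"
  then obtain a b t where r: "0 \<le> t" "t \<le> 1" "(a, b) \<in> parcs g \<or> a = b \<and> a \<in> pverts g"
    and p: "p = pt a b t" by (auto simp: rep_def)
  from r(3) show "p \<in> realisation g"
  proof
    assume "(a, b) \<in> parcs g"
    moreover have "p \<in> seg (a, b)" using r p by (simp add: seg_pt)
    ultimately show ?thesis unfolding realisation_def by blast
  next
    assume "a = b \<and> a \<in> pverts g"
    then have "p = vpt a" "a \<in> pverts g" using p by auto
    then have "p \<in> vpt ` pverts g" by blast
    then show ?thesis unfolding realisation_def by blast
  qed
qed

lemma realisationE:
  assumes "p \<in> realisation g"
  obtains a b t where "rep g a b t" "p = pt a b t"
  using assms unfolding realisation_rep by blast

lemma rep_in: "rep g a b t \<Longrightarrow> pt a b t \<in> realisation g"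
  using realisation_rep by blast

lemma vpt_in: "u \<in> pverts g \<Longrightarrow> vpt u \<in> realisation g"
  by (simp add: realisation_def)

section \<open>The path metric as a weighted sum of coordinate differences\<close>

locale metric_gtree =
  fixes T :: "('h, 'x) gtree"
  assumes simplicial: "simplicial_tree (tgraph T)"
    and len_pos: "e \<in> tarcs T \<Longrightarrow> 0 < len T e"
    and len_sym: "(u, v) \<in> tarcs T \<Longrightarrow> len T (v, u) = len T (u, v)"

sublocale metric_gtree \<subseteq> stree "tverts T" "tarcs T"
  using simplicial by (rule simplicial_tree_stree)

context metric_gtree
begin

abbreviation "E \<equiv> tarcs T"
abbreviation "V \<equiv> tverts T"

abbreviation crd :: "'x \<times> 'x \<Rightarrow> ('x \<Rightarrow> real) \<Rightarrow> real" where "crd \<equiv> coord E"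

definition crossing :: "('x \<Rightarrow> real) \<Rightarrow> ('x \<Rightarrow> real) \<Rightarrow> ('x \<times> 'x) set" where
  "crossing p q = {e \<in> E. crd e p \<noteq> crd e q}"

text \<open>The path metric in coordinates. It is halved because each edge occurs as two opposite
  arcs with the same length and the same coordinate difference.\<close>

definition dd :: "('x \<Rightarrow> real) \<Rightarrow> ('x \<Rightarrow> real) \<Rightarrow> real" where
  "dd p q = (\<Sum>e \<in> crossing p q. len T e * \<bar>crd e q - crd e p\<bar>) / 2"

lemma len_nonneg: "e \<in> E \<Longrightarrow> 0 \<le> len T e"
  using len_pos less_imp_le by blast

lemma finite_paths: "u \<in> V \<Longrightarrow> v \<in> V \<Longrightarrow> finite (path_arcs E u v)"
  by (rule finite_path_arcs[OF stree_axioms])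

lemma rep_V: "rep (tgraph T) a b t \<Longrightarrow> a \<in> V \<and> b \<in> V"
  using wf by (auto simp: rep_def)

text \<open>Only the two directions of the edge that carries a point can see where in this edge the
  point is.\<close>

lemma coord_off:
  assumes "rep (tgraph T) a b t" "e \<noteq> (a, b)" "e \<noteq> (b, a)"
  shows "crd e (pt a b t) = side E e a"
proof (cases "a = b")
  case False
  then have "side E e a = side E e b" using assms side_eq by (auto simp: rep_def)
  then show ?thesis by (simp add: coord_pt algebra_simps)
qed simp

lemma coord_on: "(a, b) \<in> E \<Longrightarrow> crd (a, b) (pt a b t) = t"
  and coord_on_swap: "(a, b) \<in> E \<Longrightarrow> crd (b, a) (pt a b t) = 1 - t"
  using sym by (auto simp: coord_pt side_fst side_snd)

lemma coord_range: "p \<in> points T \<Longrightarrow> 0 \<le> crd e p \<and> crd e p \<le> 1"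
proof (elim realisationE)
  fix a b t assume "rep (tgraph T) a b t" "p = pt a b t"
  then show ?thesis
    using side_cases[of E e a] side_cases[of E e b] by (auto simp: coord_pt rep_def)
qed

lemma coord_swap: "(a, b) \<in> E \<Longrightarrow> p \<in> points T \<Longrightarrow> crd (b, a) p = 1 - crd (a, b) p"
  by (elim realisationE) (use rep_V in \<open>auto simp: coord_pt side_swap algebra_simps\<close>)

text \<open>Apart from the edges carrying the two points, a crossed arc separates the ends
  \<open>a\<close> and \<open>c\<close>, hence lies on the finite geodesic between them.\<close>

lemma finite_crossing:
  assumes "p \<in> points T" "q \<in> points T"
  shows "finite (crossing p q)"
proof -
  obtain a b t where p: "rep (tgraph T) a b t" "p = pt a b t" using assms by (elim realisationE)
  obtain c d s where q: "rep (tgraph T) c d s" "q = pt c d s" using assms by (elim realisationE)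
  have "crossing p q \<subseteq> {(a, b), (b, a), (c, d), (d, c)} \<union> path_arcs E a c \<union> path_arcs E c a"
  proof
    fix e assume e: "e \<in> crossing p q"
    show "e \<in> {(a, b), (b, a), (c, d), (d, c)} \<union> path_arcs E a c \<union> path_arcs E c a"
    proof (cases "e \<in> {(a, b), (b, a), (c, d), (d, c)}")
      case False
      then have "side E e a \<noteq> side E e c"
        using e p q coord_off by (auto simp: crossing_def)
      then have "e \<in> path_arcs E a c \<union> path_arcs E c a"
        using e side_cases[of E e a] side_cases[of E e c]
        by (auto simp: crossing_def path_arcs_def)
      then show ?thesis by blast
    qed blast
  qed
  moreover have "finite (path_arcs E a c)" "finite (path_arcs E c a)"
    using finite_paths rep_V p q by blast+
  ultimately show ?thesis by (auto intro: finite_subset)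
qed

lemma dd_superset:
  assumes "finite F" "crossing p q \<subseteq> F" "F \<subseteq> E"
  shows "dd p q = (\<Sum>e \<in> F. len T e * \<bar>crd e q - crd e p\<bar>) / 2"
proof -
  have "(\<Sum>e \<in> crossing p q. len T e * \<bar>crd e q - crd e p\<bar>)
      = (\<Sum>e \<in> F. len T e * \<bar>crd e q - crd e p\<bar>)"
    by (rule sum.mono_neutral_left) (use assms in \<open>auto simp: crossing_def\<close>)
  then show ?thesis by (simp add: dd_def)
qed

lemma crossing_E: "crossing p q \<subseteq> E"
  by (auto simp: crossing_def)

lemma dd_nonneg: "0 \<le> dd p q"
proof -
  have "0 \<le> len T e" if "e \<in> crossing p q" for e
    using that len_nonneg by (simp add: crossing_def)
  then show ?thesis unfolding dd_def by (simp add: sum_nonneg)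
qed

lemma dd_sym: "dd p q = dd q p"
  unfolding dd_def crossing_def by (simp add: abs_minus_commute eq_commute)

text \<open>With one finite set of arcs for all three distances, statements about them can be
  checked arc by arc.\<close>

lemma dd_common:
  assumes "p \<in> points T" "q \<in> points T" "m \<in> points T"
  obtains F where "finite F" "F \<subseteq> E" "dd p q = (\<Sum>e \<in> F. len T e * \<bar>crd e q - crd e p\<bar>) / 2"
    "dd p m = (\<Sum>e \<in> F. len T e * \<bar>crd e m - crd e p\<bar>) / 2"
    "dd m q = (\<Sum>e \<in> F. len T e * \<bar>crd e q - crd e m\<bar>) / 2"
    "\<And>e. e \<in> E - F \<Longrightarrow> crd e p = crd e m \<and> crd e m = crd e q"
proof (rule that)
  let ?F = "crossing p q \<union> crossing p m \<union> crossing m q"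
  show "finite ?F" using assms finite_crossing by blast
  show "?F \<subseteq> E" using crossing_E by blast
  then show "dd p q = (\<Sum>e \<in> ?F. len T e * \<bar>crd e q - crd e p\<bar>) / 2"
    "dd p m = (\<Sum>e \<in> ?F. len T e * \<bar>crd e m - crd e p\<bar>) / 2"
    "dd m q = (\<Sum>e \<in> ?F. len T e * \<bar>crd e q - crd e m\<bar>) / 2"
    using \<open>finite ?F\<close> by (blast intro: dd_superset)+
qed (auto simp: crossing_def)

lemma dd_triangle:
  assumes "p \<in> points T" "q \<in> points T" "m \<in> points T"
  shows "dd p q \<le> dd p m + dd m q"
proof -
  obtain F where F: "finite F" "F \<subseteq> E" "dd p q = (\<Sum>e \<in> F. len T e * \<bar>crd e q - crd e p\<bar>) / 2"
    "dd p m = (\<Sum>e \<in> F. len T e * \<bar>crd e m - crd e p\<bar>) / 2"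
    "dd m q = (\<Sum>e \<in> F. len T e * \<bar>crd e q - crd e m\<bar>) / 2"
    "\<And>e. e \<in> E - F \<Longrightarrow> crd e p = crd e m \<and> crd e m = crd e q"
    by (rule dd_common[OF assms]) (rule that)
  have "(\<Sum>e \<in> F. len T e * \<bar>crd e q - crd e p\<bar>)
      \<le> (\<Sum>e \<in> F. len T e * \<bar>crd e m - crd e p\<bar> + len T e * \<bar>crd e q - crd e m\<bar>)"
  proof (rule sum_mono)
    fix e assume "e \<in> F"
    then have "len T e * \<bar>crd e q - crd e p\<bar> \<le> len T e * (\<bar>crd e m - crd e p\<bar> + \<bar>crd e q - crd e m\<bar>)"
      using F(2) len_nonneg[of e] by (intro mult_left_mono) auto
    then show "len T e * \<bar>crd e q - crd e p\<bar> \<le> len T e * \<bar>crd e m - crd e p\<bar> + len T e * \<bar>crd e q - crd e m\<bar>"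
      by (simp add: algebra_simps)
  qed
  then show ?thesis using F by (simp add: sum.distrib)
qed

text \<open>Lengths are positive, so the triangle inequality is an equality exactly if it is one in
  each coordinate. The right-hand side does not mention lengths, hence betweenness survives a change
  of metric.\<close>

lemma dd_additive_iff:
  assumes "p \<in> points T" "q \<in> points T" "m \<in> points T"
  shows "dd p q = dd p m + dd m q \<longleftrightarrow> (\<forall>e \<in> E. mid (crd e p) (crd e m) (crd e q))"
proof -
  obtain F where F: "finite F" "F \<subseteq> E" "dd p q = (\<Sum>e \<in> F. len T e * \<bar>crd e q - crd e p\<bar>) / 2"
    "dd p m = (\<Sum>e \<in> F. len T e * \<bar>crd e m - crd e p\<bar>) / 2"
    "dd m q = (\<Sum>e \<in> F. len T e * \<bar>crd e q - crd e m\<bar>) / 2"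
    "\<And>e. e \<in> E - F \<Longrightarrow> crd e p = crd e m \<and> crd e m = crd e q"
    by (rule dd_common[OF assms]) (rule that)
  let ?x = "\<lambda>e. len T e * (\<bar>crd e m - crd e p\<bar> + \<bar>crd e q - crd e m\<bar> - \<bar>crd e q - crd e p\<bar>)"
  have "dd p q = dd p m + dd m q \<longleftrightarrow> sum ?x F = 0"
    unfolding F(3-5) by (auto simp: sum.distrib sum_subtractf algebra_simps)
  also have "\<dots> \<longleftrightarrow> (\<forall>e \<in> F. ?x e = 0)"
  proof (rule sum_nonneg_eq_0_iff[OF F(1)])
    fix e assume "e \<in> F"
    then have "0 \<le> len T e" using F(2) len_nonneg[of e] by blast
    then show "0 \<le> ?x e" by (simp add: abs_triangle_ineq4)
  qed
  also have "\<dots> \<longleftrightarrow> (\<forall>e \<in> F. mid (crd e p) (crd e m) (crd e q))"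
  proof (rule ball_cong[OF refl])
    fix e assume "e \<in> F"
    then have "len T e \<noteq> 0" using F(2) len_pos[of e] by auto
    then show "?x e = 0 \<longleftrightarrow> mid (crd e p) (crd e m) (crd e q)" unfolding mid_abs by auto
  qed
  also have "\<dots> \<longleftrightarrow> (\<forall>e \<in> E. mid (crd e p) (crd e m) (crd e q))"
  proof -
    have "mid (crd e p) (crd e m) (crd e q)" if "e \<in> E - F" for e
      using F(6)[OF that] by (simp add: mid_def)
    then show ?thesis using F(2) by blast
  qed
  finally show ?thesis .
qed

lemma path_arcs_swap:
  assumes "u \<in> V" "v \<in> V"
  shows "path_arcs E v u = prod.swap ` path_arcs E u v"
proof -
  have "prod.swap e \<in> path_arcs E v u" if "e \<in> path_arcs E u v" "u \<in> V" "v \<in> V" for e u v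
    using that sym by (cases e) (auto simp: path_arcs_def side_swap)
  then show ?thesis using assms by (force simp: image_iff)
qed

lemma sum_path_arcs_swap:
  assumes "u \<in> V" "v \<in> V"
  shows "(\<Sum>e \<in> path_arcs E v u. len T e) = (\<Sum>e \<in> path_arcs E u v. len T e)"
  unfolding path_arcs_swap[OF assms]
  by (subst sum.reindex) (auto simp: path_arcs_def len_sym intro!: sum.cong)

lemma dd_vpt:
  assumes "u \<in> V" "v \<in> V"
  shows "dd (vpt u) (vpt v) = vdist T u v"
proof -
  have c: "crossing (vpt u) (vpt v) = path_arcs E u v \<union> path_arcs E v u"
  proof (rule Set.set_eqI)
    fix e
    show "e \<in> crossing (vpt u) (vpt v) \<longleftrightarrow> e \<in> path_arcs E u v \<union> path_arcs E v u"
      using side_cases[of E e u] side_cases[of E e v] by (auto simp: crossing_def path_arcs_def)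
  qed
  have "(\<Sum>e \<in> path_arcs E u v \<union> path_arcs E v u. len T e * \<bar>side E e v - side E e u\<bar>)
      = (\<Sum>e \<in> path_arcs E u v. len T e * \<bar>side E e v - side E e u\<bar>)
      + (\<Sum>e \<in> path_arcs E v u. len T e * \<bar>side E e v - side E e u\<bar>)"
    by (rule sum.union_disjoint) (use finite_paths assms in \<open>auto simp: path_arcs_def\<close>)
  also have "\<dots> = (\<Sum>e \<in> path_arcs E u v. len T e) + (\<Sum>e \<in> path_arcs E v u. len T e)"
    by (intro arg_cong2[of _ _ _ _ "(+)"] sum.cong) (auto simp: path_arcs_def)
  finally show ?thesis
    unfolding dd_def c using sum_path_arcs_swap[OF assms] vdist_path_arcs[OF simplicial assms] by simp
qed

lemma dd_edge:
  assumes "(a, b) \<in> E" "0 \<le> t" "t \<le> 1" "0 \<le> s" "s \<le> 1"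
  shows "dd (pt a b t) (pt a b s) = len T (a, b) * \<bar>s - t\<bar>"
proof -
  have r: "rep (tgraph T) a b t" "rep (tgraph T) a b s" using assms by (auto simp: rep_def)
  have c: "crossing (pt a b t) (pt a b s) \<subseteq> {(a, b), (b, a)}"
  proof
    fix e assume "e \<in> crossing (pt a b t) (pt a b s)"
    then show "e \<in> {(a, b), (b, a)}"
      using coord_off[OF r(1), of e] coord_off[OF r(2), of e] by (force simp: crossing_def)
  qed
  have "(a, b) \<noteq> (b, a)" using irrefl assms by auto
  then show ?thesis
    using dd_superset[OF _ c] assms sym coord_on coord_on_swap len_sym irrefl
    by (simp add: abs_minus_commute)
qed

lemma pdist_end_vpt: "pdist_end T (vpt u) u = 0"
  by (auto simp: pdist_end_def vpt_def intro!: sum.neutral)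

lemma pdist_end_fst:
  assumes "(a, b) \<in> E"
  shows "pdist_end T (pt a b t) a = t * len T (a, b)"
proof -
  have "a \<noteq> b" using irrefl assms by blast
  have "pdist_end T (pt a b t) a = (\<Sum>w \<in> {b}. pt a b t w * len T (a, w))"
    unfolding pdist_end_def
    by (rule sum.mono_neutral_left) (use \<open>a \<noteq> b\<close> pt_nz[of a b t] in auto)
  then show ?thesis using \<open>a \<noteq> b\<close> by (simp add: pt_snd)
qed

lemma dd_pdist_end:
  assumes p: "p \<in> points T" and u: "p u \<noteq> 0"
  shows "u \<in> V" "dd p (vpt u) = pdist_end T p u"
proof -
  have gen: "dd (pt a b t) (vpt a) = pdist_end T (pt a b t) a" if "rep (tgraph T) a b t" for a b t
  proof (cases "a = b")
    case True
    then show ?thesis by (simp add: pdist_end_vpt dd_def crossing_def)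
  next
    case False
    then show ?thesis
      using that dd_edge[of a b t 0] pdist_end_fst by (auto simp: rep_def)
  qed
  obtain a b t where r: "rep (tgraph T) a b t" "p = pt a b t" using p by (elim realisationE)
  have r': "rep (tgraph T) b a (1 - t)" using r sym by (auto simp: rep_def)
  show "u \<in> V" using pt_nz[of a b t u] u r(2) rep_V[OF r(1)] by auto
  show "dd p (vpt u) = pdist_end T p u"
    using pt_nz[of a b t u] u r(2) gen[OF r(1)] gen[OF r'] pt_swap[of b a t] by auto
qed

text \<open>Matches the two kinds of candidates in the definition of \<open>tdist\<close>. If
  \<open>p\<close> is inside an edge, the coordinate of \<open>q\<close> for that edge decides: 0 or
  1 tells through which end to leave, and a value strictly between them forces \<open>q\<close> into
  the same edge.\<close>

lemma exit_vertex:
  assumes p: "p \<in> points T" and q: "q \<in> points T"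
  obtains (exit) u where "u \<in> V" "p u \<noteq> 0" "dd p q = dd p (vpt u) + dd (vpt u) q"
  | (inside) a b t s where "(a, b) \<in> E" "0 < t" "t < 1" "0 < s" "s < 1" "p = pt a b t" "q = pt a b s"
proof -
  obtain a b t where r: "rep (tgraph T) a b t" "p = pt a b t" using p by (elim realisationE)
  consider u where "u \<in> V" "p = vpt u" | "(a, b) \<in> E" "0 < t" "t < 1"
  proof -
    have "a \<in> V" "b \<in> V" using rep_V[OF r(1)] by auto
    then show thesis
      using that(1)[of a] that(1)[of b] that(2) r
      by (cases "t = 0"; cases "t = 1"; cases "a = b") (simp_all add: rep_def)
  qed
  then show thesis
  proof cases
    case 1
    moreover have "dd (vpt u) (vpt u) = 0" for u by (simp add: dd_def crossing_def)
    ultimately show ?thesis using exit[of u] by simp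
  next
    case 2
    have ab: "a \<noteq> b" using 2 irrefl by blast
    have leave: thesis if u: "u = a \<or> u = b" and c: "crd (a, b) (vpt u) = crd (a, b) q" for u
    proof (rule exit)
      show uV: "u \<in> V" using u r rep_V by blast
      show "p u \<noteq> 0" using u r 2 ab by (auto simp: pt_fst pt_snd)
      have "mid (crd e p) (crd e (vpt u)) (crd e q)" if "e \<in> E" for e
      proof -
        consider "e = (a, b)" | "e = (b, a)" | "e \<noteq> (a, b)" "e \<noteq> (b, a)" by blast
        then show ?thesis
        proof cases
          case 1
          then show ?thesis using c by (auto simp: mid_def)
        next
          case 3
          then have "crd e p = side E e a" "side E e a = side E e b"
            using coord_off r 2 side_eq by auto
          then show ?thesis using u by (auto simp: mid_def)
        next
          case 2
          then show ?thesis
            using c coord_swap[OF \<open>(a, b) \<in> E\<close> q] coord_swap[OF \<open>(a, b) \<in> E\<close> vpt_in[OF uV]]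
            unfolding mid_def by (auto simp: linear)
        qed
      qed
      then show "dd p q = dd p (vpt u) + dd (vpt u) q"
        using dd_additive_iff[OF p q vpt_in[OF uV]] by simp
    qed
    obtain c d s where rq: "rep (tgraph T) c d s" "q = pt c d s" using q by (elim realisationE)
    consider "crd (a, b) q = 0" | "crd (a, b) q = 1" | "0 < crd (a, b) q" "crd (a, b) q < 1"
      using coord_range[OF q, of "(a, b)"] by fastforce
    then show ?thesis
    proof cases
      case 1
      then show ?thesis using leave[of a] side_fst \<open>(a, b) \<in> E\<close> by simp
    next
      case c1: 2
      then show ?thesis using leave[of b] side_snd \<open>(a, b) \<in> E\<close> by simp
    next
      case 3
      then have "crd (a, b) (pt c d s) \<noteq> side E (a, b) c"
        using rq(2) side_cases[of E "(a, b)" c] by auto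
      then have "(c, d) = (a, b) \<or> (c, d) = (b, a)"
        using coord_off[OF rq(1), of "(a, b)"] by blast
      moreover have "q = pt d c (1 - s)" using rq pt_swap[of d c s] by simp
      ultimately have "q = pt a b s \<or> q = pt a b (1 - s)" using rq(2) by (elim disjE) auto
      then obtain s' where q': "q = pt a b s'" by blast
      then have "s' = crd (a, b) q" using coord_on \<open>(a, b) \<in> E\<close> by simp
      then show ?thesis using inside[of a b t s'] 3 2 r q' by simp
    qed
  qed
qed

lemma exit_vertex_vpt:
  assumes "p \<in> points T" "w \<in> V"
  obtains u where "u \<in> V" "p u \<noteq> 0" "dd p (vpt w) = dd p (vpt u) + dd (vpt u) (vpt w)"
proof -
  have "vpt w \<noteq> pt a b s" if "(a, b) \<in> E" "0 < s" "s < 1" for a b s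
  proof
    assume eq: "vpt w = pt a b s"
    have "a \<noteq> b" using that irrefl by blast
    then have "vpt w a \<noteq> 0" "vpt w b \<noteq> 0" using that unfolding eq by (auto simp: pt_fst pt_snd)
    then show False using \<open>a \<noteq> b\<close> by (auto simp: vpt_def split: if_splits)
  qed
  with exit_vertex[OF assms(1) vpt_in[OF assms(2)]] that show thesis by (smt (verit))
qed

text \<open>Every candidate in the infimum is the length of a path, hence at least
  \<open>dd\<close>. The path that leaves the points through the vertices of
  \<open>exit_vertex\<close>, or stays inside a common edge, attains it.\<close>

lemma tdist_dd:
  assumes p: "p \<in> points T" and q: "q \<in> points T"
  shows "tdist T p q = dd p q"
proof -
  let ?S1 = "{\<bar>p v - q v\<bar> * len T (u, v) | u v. (u, v) \<in> E \<and> p \<in> seg (u, v) \<and> q \<in> seg (u, v)}"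
  let ?S2 = "{pdist_end T p u + vdist T u w + pdist_end T q w | u w. p u \<noteq> 0 \<and> q w \<noteq> 0}"
  have S1: "x = dd p q" if "x \<in> ?S1" for x
  proof -
    obtain u v t s where "x = \<bar>p v - q v\<bar> * len T (u, v)" "(u, v) \<in> E" "p = pt u v t" "q = pt u v s"
      "0 \<le> t" "t \<le> 1" "0 \<le> s" "s \<le> 1"
      using \<open>x \<in> ?S1\<close> by (auto simp: seg_pt)
    then show ?thesis using dd_edge[of u v t s] irrefl by (auto simp: pt_snd abs_minus_commute)
  qed
  have S2: "dd p q \<le> x" if "x \<in> ?S2" for x
  proof -
    obtain u w where x: "x = pdist_end T p u + vdist T u w + pdist_end T q w"
      and uw: "p u \<noteq> 0" "q w \<noteq> 0" using \<open>x \<in> ?S2\<close> by blast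
    have V: "u \<in> V" "w \<in> V"
      using dd_pdist_end(1)[OF p uw(1)] dd_pdist_end(1)[OF q uw(2)] by simp_all
    have "x = dd p (vpt u) + dd (vpt u) (vpt w) + dd (vpt w) q"
      using x dd_pdist_end(2)[OF p uw(1)] dd_pdist_end(2)[OF q uw(2)] dd_vpt[OF V] dd_sym by simp
    moreover have "dd p q \<le> dd p (vpt u) + dd (vpt u) q"
      "dd (vpt u) q \<le> dd (vpt u) (vpt w) + dd (vpt w) q"
      by (rule dd_triangle; intro p q vpt_in V)+
    ultimately show ?thesis by linarith
  qed
  have mem: "dd p q \<in> ?S1 \<union> ?S2"
    using p q
  proof (cases rule: exit_vertex)
    case (exit u)
    obtain w where w: "w \<in> V" "q w \<noteq> 0" "dd q (vpt u) = dd q (vpt w) + dd (vpt w) (vpt u)"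
      by (rule exit_vertex_vpt[OF q exit(1)]) (rule that)
    have "dd p q = pdist_end T p u + vdist T u w + pdist_end T q w"
      using exit(3) w(3) dd_pdist_end(2)[OF p exit(2)] dd_pdist_end(2)[OF q w(2)]
        dd_vpt[OF exit(1) w(1)] dd_sym[of "vpt u" q] dd_sym[of "vpt u" "vpt w"] by simp
    then show ?thesis using exit w by blast
  next
    case (inside a b t s)
    then have "dd p q = \<bar>p b - q b\<bar> * len T (a, b)"
      using dd_edge[of a b t s] irrefl by (auto simp: pt_snd abs_minus_commute)
    moreover have "p \<in> seg (a, b)" "q \<in> seg (a, b)" using inside by (auto simp: seg_pt)
    ultimately show ?thesis using inside by blast
  qed
  have "Inf (?S1 \<union> ?S2) = dd p q"
  proof (rule cInf_eq_minimum[OF mem])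
    fix x assume "x \<in> ?S1 \<union> ?S2"
    then show "dd p q \<le> x"
    proof
      assume "x \<in> ?S1"
      from S1[OF this] show ?thesis by simp
    qed (rule S2)
  qed
  then show ?thesis using p q by (simp add: tdist_def)
qed

lemma dd_0: "dd p p = 0"
  by (simp add: dd_def crossing_def)

lemma dd_vertex_0:
  assumes "p \<in> points T" "p u \<noteq> 0" "dd p (vpt u) = 0"
  shows "p = vpt u"
proof -
  obtain a b t where r: "rep (tgraph T) a b t" "p = pt a b t" using assms by (elim realisationE)
  have gen: "pt a b t = vpt a" if "rep (tgraph T) a b t" "dd (pt a b t) (vpt a) = 0" for a b t
  proof (cases "a = b")
    case False
    then have "(a, b) \<in> E" using that by (auto simp: rep_def)
    then have "t = 0" using that dd_edge[of a b t 0] len_pos by (force simp: rep_def)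
    then show ?thesis by simp
  qed simp
  have r': "rep (tgraph T) b a (1 - t)" using r sym by (auto simp: rep_def)
  show ?thesis
    using pt_nz[of a b t u] assms r(2) gen[OF r(1)] gen[OF r'] pt_swap[of b a t] by auto
qed

lemma dd_eq_0:
  assumes p: "p \<in> points T" and q: "q \<in> points T" and 0: "dd p q = 0"
  shows "p = q"
  using p q
proof (cases rule: exit_vertex)
  case (exit u)
  have z: "dd p (vpt u) = 0" "dd (vpt u) q = 0"
    using exit(3) 0 dd_nonneg[of p "vpt u"] dd_nonneg[of "vpt u" q] by linarith+
  obtain w where w: "w \<in> V" "q w \<noteq> 0" "dd q (vpt u) = dd q (vpt w) + dd (vpt w) (vpt u)"
    by (rule exit_vertex_vpt[OF q exit(1)]) (rule that)
  have z': "dd q (vpt w) = 0" "dd (vpt w) (vpt u) = 0"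
    using w(3) z dd_sym[of q "vpt u"] dd_nonneg[of q "vpt w"] dd_nonneg[of "vpt w" "vpt u"] by linarith+
  have "p = vpt u" "q = vpt w"
    using dd_vertex_0[OF p exit(2) z(1)] dd_vertex_0[OF q w(2) z'(1)] by simp_all
  moreover have "w = u"
  proof (rule path_arcs_empty)
    show "stree V E" by (rule stree_axioms)
    have "(\<Sum>e \<in> path_arcs E w u. len T e) = 0"
      using z' dd_vpt w exit vdist_path_arcs[OF simplicial] by simp
    moreover have "finite (path_arcs E w u)" using finite_paths w exit by blast
    moreover have "0 < len T e" if "e \<in> path_arcs E w u" for e
      using that len_pos by (auto simp: path_arcs_def)
    ultimately show "path_arcs E w u = {}" by (metis equals0I less_irrefl sum_pos)
  qed (use w exit in auto)
  ultimately show ?thesis by simp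
next
  case (inside a b t s)
  then have "t = s" using 0 dd_edge[of a b t s] len_pos by force
  then show ?thesis using inside by simp
qed

text \<open>Extends \<open>side_cross\<close> from vertices to points: a point inside one of the two
  edges has, for the other edge, the same coordinate as the ends of the first.\<close>

lemma coord_cross:
  assumes "e \<in> E" "f \<in> E" "e \<noteq> f" "e \<noteq> prod.swap f" "x \<in> points T"
  shows "crd e x = side E e (fst f) \<or> crd f x = side E f (fst e)"
proof -
  have on: "crd f (pt a b t) = side E f (fst e)"
    if "rep (tgraph T) a b t" "e = (a, b) \<or> e = (b, a)" "e \<in> E" "f \<in> E" "e \<noteq> f" "e \<noteq> prod.swap f"
    for a b t e f
  proof -
    have "crd f (pt a b t) = side E f a" by (rule coord_off) (use that in auto)
    moreover have "side E f a = side E f b"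
    proof -
      have "f \<noteq> (fst e, snd e)" "f \<noteq> (snd e, fst e)" using that by auto
      then show ?thesis using that side_eq[of "fst e" "snd e" f] by auto
    qed
    ultimately show ?thesis using that by auto
  qed
  obtain a b t where r: "rep (tgraph T) a b t" "x = pt a b t" using assms by (elim realisationE)
  consider "e = (a, b) \<or> e = (b, a)" | "f = (a, b) \<or> f = (b, a)"
    | "e \<noteq> (a, b)" "e \<noteq> (b, a)" "f \<noteq> (a, b)" "f \<noteq> (b, a)" by blast
  then show ?thesis
  proof cases
    case 1
    then show ?thesis using on[OF r(1) 1] assms r(2) by simp
  next
    case 2
    have "f \<noteq> e" "f \<noteq> prod.swap e" using assms by auto
    then show ?thesis using on[OF r(1) 2] assms r(2) by simp
  next
    case 3
    then show ?thesis using coord_off[OF r(1)] side_cross[OF assms(1-4), of a] rep_V r by auto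
  qed
qed

text \<open>Suppose \<open>e\<close> places \<open>m'\<close> strictly before \<open>m\<close> on
  the way from \<open>p\<close> to \<open>q\<close>, and \<open>f\<close> places \<open>m\<close>
  strictly before \<open>m'\<close>. By \<open>coord_cross\<close> each of the four points has a
  certain extreme value for \<open>e\<close> or a certain value for \<open>f\<close>. One of the
  pairs \<open>m\<close>, \<open>q\<close> and \<open>p\<close>, \<open>m'\<close> misses the
  extreme value, so its two points agree for \<open>f\<close>; but \<open>f\<close> separates both
  pairs strictly.\<close>

lemma mid_chain:
  assumes pts: "p \<in> points T" "q \<in> points T" "m \<in> points T" "m' \<in> points T"
    and m: "\<And>e. e \<in> E \<Longrightarrow> mid (crd e p) (crd e m) (crd e q)"
    and m': "\<And>e. e \<in> E \<Longrightarrow> mid (crd e p) (crd e m') (crd e q)"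
  shows "(\<forall>e \<in> E. mid (crd e p) (crd e m) (crd e m')) \<or> (\<forall>e \<in> E. mid (crd e p) (crd e m') (crd e m))"
proof (rule ccontr)
  assume "\<not> ?thesis"
  then obtain e f where e: "e \<in> E" "\<not> mid (crd e p) (crd e m) (crd e m')"
    and f: "f \<in> E" "\<not> mid (crd f p) (crd f m') (crd f m)" by blast
  have "e \<noteq> f" using e f m[OF e(1)] m'[OF e(1)] unfolding mid_def by auto
  moreover have "e \<noteq> prod.swap f"
  proof
    assume "e = prod.swap f"
    then have "crd e x = 1 - crd f x" if "x \<in> points T" for x
      using coord_swap[of "fst f" "snd f" x] f that by (cases f) auto
    then show False
      using e f m[OF e(1)] m'[OF e(1)] pts unfolding mid_def by auto
  qed
  ultimately have c: "crd e x = side E e (fst f) \<or> crd f x = side E f (fst e)"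
    if "x \<in> points T" for x
    using coord_cross[OF e(1) f(1) _ _ that] by simp
  have rg: "0 \<le> crd h x" "crd h x \<le> 1" if "x \<in> points T" for h x
    using coord_range that by blast+
  have "crd e p \<le> crd e m' \<and> crd e m' < crd e m \<and> crd e m \<le> crd e q \<or>
      crd e q \<le> crd e m \<and> crd e m < crd e m' \<and> crd e m' \<le> crd e p"
    using e(2) m[OF e(1)] m'[OF e(1)] unfolding mid_def by linarith
  moreover have "crd f p \<le> crd f m \<and> crd f m < crd f m' \<and> crd f m' \<le> crd f q \<or>
      crd f q \<le> crd f m' \<and> crd f m' < crd f m \<and> crd f m \<le> crd f p"
    using f(2) m[OF f(1)] m'[OF f(1)] unfolding mid_def by linarith
  ultimately show False
    using c[OF pts(1)] c[OF pts(2)] c[OF pts(3)] c[OF pts(4)]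
      rg[OF pts(1), of e] rg[OF pts(2), of e] rg[OF pts(3), of e] rg[OF pts(4), of e]
      side_cases[of E e "fst f"]
    by (elim disjE conjE) linarith+
qed

text \<open>By \<open>mid_chain\<close> the points between \<open>p\<close> and \<open>q\<close> are
  linearly ordered, so they are placed as on an interval. In particular such a point is determined
  by its distance from \<open>p\<close>.\<close>

lemma dd_between:
  assumes pts: "p \<in> points T" "q \<in> points T" "m \<in> points T" "m' \<in> points T"
    and "dd p q = dd p m + dd m q" "dd p q = dd p m' + dd m' q"
  shows "dd m m' = \<bar>dd p m - dd p m'\<bar>"
proof -
  have "(\<forall>e \<in> E. mid (crd e p) (crd e m) (crd e m')) \<or> (\<forall>e \<in> E. mid (crd e p) (crd e m') (crd e m))"
    by (rule mid_chain[OF pts])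
      (use assms dd_additive_iff[OF pts(1,2,3)] dd_additive_iff[OF pts(1,2,4)] in simp_all)
  then have "dd p m' = dd p m + dd m m' \<or> dd p m = dd p m' + dd m' m"
    using dd_additive_iff[OF pts(1) pts(4) pts(3)] dd_additive_iff[OF pts(1) pts(3) pts(4)] by simp
  then show ?thesis using dd_nonneg[of m m'] dd_sym[of m m'] by auto
qed

section \<open>Existence of geodesics\<close>

definition geodesic :: "('x \<Rightarrow> real) \<Rightarrow> ('x \<Rightarrow> real) \<Rightarrow> bool" where
  "geodesic p q \<longleftrightarrow> (\<forall>r. 0 \<le> r \<and> r \<le> dd p q \<longrightarrow> (\<exists>m \<in> points T. dd p m = r \<and> dd m q = dd p q - r))"

lemma geodesic_sym:
  assumes "geodesic p q"
  shows "geodesic q p"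
  unfolding geodesic_def
proof (intro allI impI)
  fix r assume r: "0 \<le> r \<and> r \<le> dd q p"
  then have "0 \<le> dd p q - r \<and> dd p q - r \<le> dd p q" using dd_sym[of p q] by auto
  then obtain m where "m \<in> points T" "dd p m = dd p q - r" "dd m q = dd p q - (dd p q - r)"
    using assms unfolding geodesic_def by blast
  then show "\<exists>m \<in> points T. dd q m = r \<and> dd m p = dd q p - r"
    using dd_sym[of p q] dd_sym[of p m] dd_sym[of m q] by (intro bexI[of _ m]) auto
qed

lemma geodesic_concat:
  assumes pts: "p \<in> points T" "q \<in> points T" "m0 \<in> points T"
    and add: "dd p q = dd p m0 + dd m0 q" and g: "geodesic p m0" "geodesic m0 q"
  shows "geodesic p q"
  unfolding geodesic_def
proof (intro allI impI)
  fix r assume r: "0 \<le> r \<and> r \<le> dd p q"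
  show "\<exists>m \<in> points T. dd p m = r \<and> dd m q = dd p q - r"
  proof (cases "r \<le> dd p m0")
    case True
    then obtain m where m: "m \<in> points T" "dd p m = r" "dd m m0 = dd p m0 - r"
      using g(1) r unfolding geodesic_def by blast
    have "dd m q \<le> dd m m0 + dd m0 q" "dd p q \<le> dd p m + dd m q" by (rule dd_triangle; intro pts m)+
    then show ?thesis using m add by (intro bexI[of _ m]) auto
  next
    case False
    then obtain m where m: "m \<in> points T" "dd m0 m = r - dd p m0" "dd m q = dd m0 q - (r - dd p m0)"
      using g(2) r add unfolding geodesic_def by (metis add_diff_cancel_left' diff_ge_0_iff_ge diff_right_mono le_cases)
    have "dd p m \<le> dd p m0 + dd m0 m" "dd p q \<le> dd p m + dd m q" by (rule dd_triangle; intro pts m)+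
    then show ?thesis using m add by (intro bexI[of _ m]) auto
  qed
qed

lemma geodesic_edge:
  assumes "(a, b) \<in> E" "0 \<le> t" "t \<le> 1" "0 \<le> s" "s \<le> 1"
  shows "geodesic (pt a b t) (pt a b s)"
  unfolding geodesic_def
proof (intro allI impI)
  fix r assume r: "0 \<le> r \<and> r \<le> dd (pt a b t) (pt a b s)"
  let ?l = "len T (a, b)"
  have l: "0 < ?l" using assms len_pos by blast
  have D: "dd (pt a b t) (pt a b s) = ?l * \<bar>s - t\<bar>" using dd_edge assms by blast
  define x where "x = t + (if t \<le> s then 1 else - 1) * (r / ?l)"
  have rl: "0 \<le> r / ?l" "r / ?l \<le> \<bar>s - t\<bar>" using r l D by (auto simp: field_simps)
  define y where "y = r / ?l"
  have x: "0 \<le> x" "x \<le> 1" "\<bar>x - t\<bar> = r / ?l" "\<bar>s - x\<bar> = \<bar>s - t\<bar> - r / ?l"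
    using assms rl unfolding x_def y_def[symmetric] by (auto split: if_splits)
  have "pt a b x \<in> points T" by (rule rep_in) (use assms x in \<open>auto simp: rep_def\<close>)
  moreover have "dd (pt a b t) (pt a b x) = r" "dd (pt a b x) (pt a b s) = dd (pt a b t) (pt a b s) - r"
    using dd_edge assms x D l by (auto simp: field_simps)
  ultimately show "\<exists>m \<in> points T. dd (pt a b t) m = r \<and> dd m (pt a b s) = dd (pt a b t) (pt a b s) - r"
    by blast
qed

lemma geodesic_refl: "p \<in> points T \<Longrightarrow> geodesic p p"
  unfolding geodesic_def using dd_0 by force

text \<open>Induction along a path: the next edge either prolongs the geodesic or retraces its last
  edge, and the side of that edge on which \<open>u\<close> lies tells which. In the second case the
  new geodesic is an initial part of the old one.\<close>

lemma geodesic_vpt: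
  assumes u: "u \<in> V" and w: "w \<in> V"
  shows "geodesic (vpt u) (vpt w)"
proof (rule tree_induct[OF u _ _ w, of "\<lambda>w. geodesic (vpt u) (vpt w)"])
  show "geodesic (vpt u) (vpt u)" by (intro geodesic_refl vpt_in u)
  fix v w assume vw: "(v, w) \<in> E" and IH: "geodesic (vpt u) (vpt v)"
  have V: "vpt v \<in> points T" "vpt w \<in> points T" "vpt u \<in> points T"
    using wf[OF vw] u by (auto intro: vpt_in)
  have off: "side E e v = side E e w" if "e \<noteq> (v, w)" "e \<noteq> (w, v)" for e using side_eq vw that by blast
  have sw: "side E (w, v) x = 1 - side E (v, w) x" if "x \<in> V" for x using side_swap vw that by blast
  have ends: "side E (v, w) v = 0" "side E (v, w) w = 1" "side E (w, v) v = 1" "side E (w, v) w = 0"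
    using side_fst[OF vw] side_snd[OF vw] side_fst[OF sym[OF vw]] side_snd[OF sym[OF vw]] by auto
  consider "side E (v, w) u = 0" | "side E (v, w) u = 1" using side_cases[of E "(v, w)" u] by blast
  then show "geodesic (vpt u) (vpt w)"
  proof cases
    case 1
    have "mid (side E e u) (side E e v) (side E e w)" for e
    proof -
      consider "e = (v, w)" | "e = (w, v)" | "side E e v = side E e w" using off by blast
      then show ?thesis using 1 by cases (simp_all add: sw[OF u] ends)
    qed
    then have "dd (vpt u) (vpt w) = dd (vpt u) (vpt v) + dd (vpt v) (vpt w)"
      using dd_additive_iff[OF V(3,2,1)] by simp
    moreover have "geodesic (vpt v) (vpt w)" using geodesic_edge[OF vw, of 0 1] by simp
    ultimately show ?thesis by (intro geodesic_concat[OF V(3,2,1)] IH)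
  next
    case 2
    have "mid (side E e u) (side E e w) (side E e v)" for e
    proof -
      consider "e = (v, w)" | "e = (w, v)" | "side E e v = side E e w" using off by blast
      then show ?thesis using 2 by cases (simp_all add: sw[OF u] ends)
    qed
    then have add: "dd (vpt u) (vpt v) = dd (vpt u) (vpt w) + dd (vpt w) (vpt v)"
      using dd_additive_iff[OF V(3,1,2)] by simp
    show ?thesis
      unfolding geodesic_def
    proof (intro allI impI)
      fix r assume r: "0 \<le> r \<and> r \<le> dd (vpt u) (vpt w)"
      then have "r \<le> dd (vpt u) (vpt v)" using add dd_nonneg[of "vpt w" "vpt v"] by linarith
      then obtain m where m: "m \<in> points T" "dd (vpt u) m = r" "dd m (vpt v) = dd (vpt u) (vpt v) - r"
        using IH r unfolding geodesic_def by blast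
      have "dd m (vpt w) = \<bar>dd (vpt u) m - dd (vpt u) (vpt w)\<bar>"
        by (rule dd_between[OF V(3,1) m(1) V(2)]) (use m add in auto)
      then show "\<exists>m \<in> points T. dd (vpt u) m = r \<and> dd m (vpt w) = dd (vpt u) (vpt w) - r"
        using m r by (intro bexI[of _ m]) auto
    qed
  qed
qed

lemma geodesic_to_end:
  assumes "p \<in> points T" "p u \<noteq> 0"
  shows "geodesic p (vpt u)"
proof -
  obtain a b t where r: "rep (tgraph T) a b t" "p = pt a b t" using assms by (elim realisationE)
  have u: "u = a \<or> u = b" using pt_nz[of a b t u] assms r(2) by simp
  show ?thesis
  proof (cases "a = b")
    case True
    then show ?thesis using u r geodesic_refl[OF assms(1)] by simp
  next
    case False
    then show ?thesis
      using u r geodesic_edge[of a b t 0] geodesic_edge[of a b t 1] by (auto simp: rep_def)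
  qed
qed

lemma geodesic:
  assumes p: "p \<in> points T" and q: "q \<in> points T"
  shows "geodesic p q"
  using p q
proof (cases rule: exit_vertex)
  case (exit u)
  obtain w where w: "w \<in> V" "q w \<noteq> 0" "dd q (vpt u) = dd q (vpt w) + dd (vpt w) (vpt u)"
    by (rule exit_vertex_vpt[OF q exit(1)]) (rule that)
  have "geodesic q (vpt u)"
    by (rule geodesic_concat[OF q vpt_in[OF exit(1)] vpt_in[OF w(1)] w(3)
          geodesic_to_end[OF q w(2)] geodesic_vpt[OF w(1) exit(1)]])
  then show ?thesis
    by (rule geodesic_concat[OF p q vpt_in[OF exit(1)] exit(3) geodesic_to_end[OF p exit(2)]
          geodesic_sym])
next
  case (inside a b t s)
  then show ?thesis using geodesic_edge by simp
qed

theorem Metric_space_points: "Metric_space (points T) (tdist T)"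
proof
  show "0 \<le> tdist T p q" for p q
    using tdist_dd dd_nonneg by (cases "p \<in> points T \<and> q \<in> points T") (auto simp: tdist_def)
  show "tdist T p q = tdist T q p" for p q
    using tdist_dd dd_sym by (cases "p \<in> points T \<and> q \<in> points T") (auto simp: tdist_def)
  show "tdist T p q = 0 \<longleftrightarrow> p = q" if "p \<in> points T" "q \<in> points T" for p q
    using tdist_dd that dd_eq_0 dd_0 by metis
  show "tdist T p r \<le> tdist T p q + tdist T q r"
    if "p \<in> points T" "q \<in> points T" "r \<in> points T" for p q r
    using tdist_dd that dd_triangle by simp
qed

end

section \<open>Maps between trees\<close>

definition push :: "('x \<Rightarrow> 'y) \<Rightarrow> ('x \<Rightarrow> real) \<Rightarrow> 'y \<Rightarrow> real" where
  "push \<theta> p = (\<lambda>y. \<Sum>x | p x \<noteq> 0 \<and> \<theta> x = y. p x)"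

lemma push_pt: "push \<theta> (pt a b t) = pt (\<theta> a) (\<theta> b) t"
proof
  fix y
  have "push \<theta> (pt a b t) y = aff (\<lambda>x. if \<theta> x = y then 1 else 0) (pt a b t)"
  proof -
    have fin: "finite {x. pt a b t x \<noteq> 0}"
      by (rule finite_subset[of _ "{a, b}"]) (use pt_nz[of a b t] in auto)
    have "(\<Sum>x | pt a b t x \<noteq> 0 \<and> \<theta> x = y. pt a b t x)
        = (\<Sum>x \<in> {x. pt a b t x \<noteq> 0}. if \<theta> x = y then pt a b t x else 0)"
      using fin by (subst sum.inter_filter[symmetric]) (auto intro: sum.cong)
    then show ?thesis unfolding push_def aff_def by (simp add: if_distrib cong: if_cong)
  qed
  then show "push \<theta> (pt a b t) y = pt (\<theta> a) (\<theta> b) t y"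
    unfolding aff_pt by (simp add: pt_def vpt_def eq_commute)
qed

text \<open>Reduces the well-definedness of a map given edge by edge to three cases: identical data,
  a reversed edge, and a common vertex \<open>u\<close>, where the two edges may be
  unrelated.\<close>

lemma pt_eqD:
  assumes "pt a b t = pt c d s" "0 \<le> t" "t \<le> 1" "0 \<le> s" "s \<le> 1"
  shows "a = c \<and> b = d \<and> t = s \<or> a = d \<and> b = c \<and> s = 1 - t \<or>
    (\<exists>u. (u = a \<and> t = 0 \<or> u = b \<and> t = 1 \<or> u = a \<and> u = b) \<and> (u = c \<and> s = 0 \<or> u = d \<and> s = 1 \<or> u = c \<and> u = d))"
proof (cases "a = b \<or> t = 0 \<or> t = 1")
  case True
  then obtain u where u: "u = a \<and> t = 0 \<or> u = b \<and> t = 1 \<or> u = a \<and> u = b" by blast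
  then have "pt c d s = vpt u" using assms(1) by auto
  then have v: "\<And>x. (1 - s) * vpt c x + s * vpt d x = vpt u x" by (metis pt_def)
  have "u = c \<and> s = 0 \<or> u = d \<and> s = 1 \<or> u = c \<and> u = d"
    using v[of c] v[of d] v[of u] by (auto simp: vpt_def split: if_splits)
  then show ?thesis using u by blast
next
  case False
  then have ab: "a \<noteq> b" "0 < t" "t < 1" using assms by auto
  have eq: "pt a b t x = pt c d s x" for x using assms(1) by simp
  have nz: "pt c d s a \<noteq> 0" "pt c d s b \<noteq> 0" using eq[of a] eq[of b] ab by (auto simp: pt_fst pt_snd)
  then have "a = c \<and> b = d \<or> a = d \<and> b = c" using pt_nz[of c d s] ab by metis
  then show ?thesis using eq[of b] ab by (auto simp: pt_fst pt_snd)
qed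

text \<open>By \<open>side_map\<close>, corresponding arcs give equal coordinates, so the two sums
  for the distance agree term by term. Injectivity on points follows from preservation of
  distances.\<close>

lemma tree_iso_tdist:
  assumes "metric_gtree T" "metric_gtree T'"
    and bij: "bij_betw \<theta> (tverts T) (tverts T')"
    and arcs: "\<And>u v. u \<in> tverts T \<Longrightarrow> v \<in> tverts T \<Longrightarrow> (\<theta> u, \<theta> v) \<in> tarcs T' \<longleftrightarrow> (u, v) \<in> tarcs T"
    and lens: "\<And>u v. (u, v) \<in> tarcs T \<Longrightarrow> len T' (\<theta> u, \<theta> v) = len T (u, v)"
  shows "bij_betw (push \<theta>) (points T) (points T')"
    and "p \<in> points T \<Longrightarrow> q \<in> points T \<Longrightarrow> tdist T' (push \<theta> p) (push \<theta> q) = tdist T p q"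
proof -
  interpret A: metric_gtree T by fact
  interpret B: metric_gtree T' by fact
  have inj: "\<theta> u = \<theta> v \<longleftrightarrow> u = v" if "u \<in> tverts T" "v \<in> tverts T" for u v
    using bij that by (meson bij_betw_def inj_onD)
  have into: "\<theta> u \<in> tverts T'" if "u \<in> tverts T" for u using bij that by (meson bij_betwE)
  have rep: "rep (tgraph T') (\<theta> a) (\<theta> b) t" if "rep (tgraph T) a b t" for a b t
    using that arcs[of a b] into A.rep_V[OF that] by (auto simp: rep_def)
  have push_in: "push \<theta> p \<in> points T'" if "p \<in> points T" for p
    using that by (elim realisationE) (simp add: push_pt rep rep_in)
  have sd: "side (tarcs T') (\<theta> a, \<theta> b) (\<theta> x) = side (tarcs T) (a, b) x"
    if "(a, b) \<in> tarcs T" "x \<in> tverts T" for a b x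
  proof (rule side_map[OF A.stree_axioms B.stree_axioms])
    have V: "a \<in> tverts T" "b \<in> tverts T" using A.wf that by auto
    then show "(\<theta> a, \<theta> b) \<in> tarcs T'" using arcs that by simp
    fix u v assume uv: "(u, v) \<in> tarcs T"
    then have "u \<in> tverts T" "v \<in> tverts T" using A.wf by auto
    then show "\<theta> u = \<theta> v \<or> (\<theta> u, \<theta> v) \<in> tarcs T'" "\<theta> u = \<theta> a \<Longrightarrow> \<theta> v = \<theta> b \<Longrightarrow> u = a \<and> v = b"
      using arcs uv inj V by simp_all
  qed (use that in auto)
  have crd: "coord (tarcs T') (\<theta> a, \<theta> b) (push \<theta> p) = coord (tarcs T) (a, b) p"
    if "(a, b) \<in> tarcs T" "p \<in> points T" for a b p
    using that(2)
  proof (rule realisationE)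
    fix c d t assume r: "rep (tgraph T) c d t" "p = pt c d t"
    then show ?thesis using sd[OF that(1), of c] sd[OF that(1), of d] A.rep_V[OF r(1)]
      by (simp add: push_pt coord_pt)
  qed
  have E': "tarcs T' = map_prod \<theta> \<theta> ` tarcs T"
  proof (intro equalityI subsetI)
    fix e assume e: "e \<in> tarcs T'"
    then have "fst e \<in> tverts T'" "snd e \<in> tverts T'" using B.fst_V B.snd_V by auto
    then have "fst e \<in> \<theta> ` tverts T" "snd e \<in> \<theta> ` tverts T" using bij_betw_imp_surj_on[OF bij] by auto
    then obtain u v where "u \<in> tverts T" "v \<in> tverts T" "fst e = \<theta> u" "snd e = \<theta> v" by auto
    then show "e \<in> map_prod \<theta> \<theta> ` tarcs T" using arcs[of u v] e by (cases e) force
  next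
    fix e assume "e \<in> map_prod \<theta> \<theta> ` tarcs T"
    then obtain u v where "(u, v) \<in> tarcs T" "e = (\<theta> u, \<theta> v)" by auto
    then show "e \<in> tarcs T'" using arcs[of u v] A.wf by blast
  qed
  have injE: "inj_on (map_prod \<theta> \<theta>) (tarcs T)"
  proof (rule inj_onI)
    fix x y assume xy: "x \<in> tarcs T" "y \<in> tarcs T" "map_prod \<theta> \<theta> x = map_prod \<theta> \<theta> y"
    then have "\<theta> (fst x) = \<theta> (fst y)" "\<theta> (snd x) = \<theta> (snd y)"
      by (simp_all add: map_prod_def split: prod.splits)
    then have "fst x = fst y" "snd x = snd y"
      using inj[OF A.fst_V A.fst_V] inj[OF A.snd_V A.snd_V] xy(1,2) by simp_all
    then show "x = y" by (rule prod_eqI)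
  qed
  show td: "tdist T' (push \<theta> p) (push \<theta> q) = tdist T p q"
    if pq: "p \<in> points T" "q \<in> points T" for p q
  proof -
    have cr: "B.crossing (push \<theta> p) (push \<theta> q) = map_prod \<theta> \<theta> ` A.crossing p q"
    proof -
      have c: "coord (tarcs T') (map_prod \<theta> \<theta> e) (push \<theta> p) = coord (tarcs T) e p \<and>
          coord (tarcs T') (map_prod \<theta> \<theta> e) (push \<theta> q) = coord (tarcs T) e q" if "e \<in> tarcs T" for e
        using crd[OF _ pq(1), of "fst e" "snd e"] crd[OF _ pq(2), of "fst e" "snd e"] that
        by (cases e) auto
      have "e \<in> B.crossing (push \<theta> p) (push \<theta> q)" if e: "e \<in> map_prod \<theta> \<theta> ` A.crossing p q" for e
      proof -
        obtain f where f: "e = map_prod \<theta> \<theta> f" "f \<in> A.crossing p q" using e by (rule imageE)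
        then have "f \<in> tarcs T" by (simp add: A.crossing_def)
        then have "e \<in> tarcs T'" using f(1) unfolding E' by simp
        then show ?thesis using f c[OF \<open>f \<in> tarcs T\<close>] unfolding A.crossing_def B.crossing_def by simp
      qed
      moreover have "e \<in> map_prod \<theta> \<theta> ` A.crossing p q" if e: "e \<in> B.crossing (push \<theta> p) (push \<theta> q)" for e
      proof -
        have "e \<in> map_prod \<theta> \<theta> ` tarcs T" using e unfolding E'[symmetric] by (simp add: B.crossing_def)
        then obtain f where f: "e = map_prod \<theta> \<theta> f" "f \<in> tarcs T" by (rule imageE)
        then have "f \<in> A.crossing p q" using e c[OF f(2)] by (simp add: A.crossing_def B.crossing_def)
        then show ?thesis using f by blast
      qed
      ultimately show ?thesis by blast
    qed
    have "(\<Sum>e \<in> B.crossing (push \<theta> p) (push \<theta> q).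
          len T' e * \<bar>coord (tarcs T') e (push \<theta> q) - coord (tarcs T') e (push \<theta> p)\<bar>)
        = (\<Sum>e \<in> A.crossing p q. len T e * \<bar>coord (tarcs T) e q - coord (tarcs T) e p\<bar>)"
      unfolding cr
    proof (subst sum.reindex)
      show "inj_on (map_prod \<theta> \<theta>) (A.crossing p q)"
        using injE A.crossing_E inj_on_subset by blast
    next
      show "sum ((\<lambda>e. len T' e * \<bar>coord (tarcs T') e (push \<theta> q) - coord (tarcs T') e (push \<theta> p)\<bar>) \<circ>
          map_prod \<theta> \<theta>) (A.crossing p q) = (\<Sum>e \<in> A.crossing p q. len T e * \<bar>coord (tarcs T) e q - coord (tarcs T) e p\<bar>)"
      proof (rule sum.cong[OF refl])
        fix e assume "e \<in> A.crossing p q"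
        then obtain a b where "e = (a, b)" "(a, b) \<in> tarcs T" by (cases e) (auto simp: A.crossing_def)
        then show "((\<lambda>e. len T' e * \<bar>coord (tarcs T') e (push \<theta> q) - coord (tarcs T') e (push \<theta> p)\<bar>) \<circ>
          map_prod \<theta> \<theta>) e = len T e * \<bar>coord (tarcs T) e q - coord (tarcs T) e p\<bar>"
          using crd[OF _ pq(1)] crd[OF _ pq(2)] lens by simp
      qed
    qed
    then show ?thesis
      using A.tdist_dd[OF pq] B.tdist_dd[OF push_in[OF pq(1)] push_in[OF pq(2)]]
      by (simp add: A.dd_def B.dd_def)
  qed
  show "bij_betw (push \<theta>) (points T) (points T')"
  proof (rule bij_betw_imageI)
    show "inj_on (push \<theta>) (points T)"
    proof (rule inj_onI)
      fix p q assume pq: "p \<in> points T" "q \<in> points T" and eq: "push \<theta> p = push \<theta> q"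
      have "A.dd p q = B.dd (push \<theta> p) (push \<theta> q)"
        using td[OF pq] A.tdist_dd[OF pq] B.tdist_dd[OF push_in[OF pq(1)] push_in[OF pq(2)]] by simp
      then show "p = q" using A.dd_eq_0[OF pq] B.dd_0 eq by simp
    qed
    show "push \<theta> ` points T = points T'"
    proof
      show "push \<theta> ` points T \<subseteq> points T'" using push_in by blast
      show "points T' \<subseteq> push \<theta> ` points T"
      proof
        fix p assume "p \<in> points T'"
        then show "p \<in> push \<theta> ` points T"
        proof (rule realisationE)
          fix a b t assume r: "rep (tgraph T') a b t" "p = pt a b t"
          obtain u v where uv: "u \<in> tverts T" "v \<in> tverts T" "a = \<theta> u" "b = \<theta> v"
            using B.rep_V[OF r(1)] bij by (metis bij_betw_imp_surj_on imageE)
          then have "rep (tgraph T) u v t" using r arcs[of u v] inj by (auto simp: rep_def)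
          then have "pt u v t \<in> points T" by (rule rep_in)
          moreover have "p = push \<theta> (pt u v t)" using uv r by (simp add: push_pt)
          ultimately show ?thesis by blast
        qed
      qed
    qed
  qed
qed

section \<open>Group actions on metric trees\<close>

locale htree =
  fixes H :: "('h, 'b) monoid_scheme" and T :: "('h, 'x) gtree"
  assumes mt: "metric_tree H T"

lemma metric_tree_gtree: "metric_tree H T \<Longrightarrow> metric_gtree T"
  by unfold_locales (auto simp: metric_tree_def split: prod.splits)

sublocale htree \<subseteq> metric_gtree T
  using mt by (rule metric_tree_gtree)

context htree
begin

lemma group_action_T: "group_action H (tverts T) (act T)"
  using mt by (simp add: metric_tree_def)

sublocale ga: group_action H "tverts T" "act T"
  by (rule group_action_T)

lemma group_H: "group H"
  using group_action_T by (simp add: group_action_def group_hom_def)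

sublocale group H
  by (rule group_H)

lemma act_V: "g \<in> carrier H \<Longrightarrow> x \<in> V \<Longrightarrow> act T g x \<in> V"
  using ga.element_image by blast

lemma act_mult: "g \<in> carrier H \<Longrightarrow> h \<in> carrier H \<Longrightarrow> x \<in> V \<Longrightarrow>
    act T (g \<otimes>\<^bsub>H\<^esub> h) x = act T g (act T h x)"
  using ga.composition_rule by blast

lemma act_one: "x \<in> V \<Longrightarrow> act T \<one>\<^bsub>H\<^esub> x = x"
  using ga.id_eq_one by (metis restrict_apply')

lemma act_inj: "g \<in> carrier H \<Longrightarrow> x \<in> V \<Longrightarrow> y \<in> V \<Longrightarrow> act T g x = act T g y \<longleftrightarrow> x = y"
  using ga.inj_prop by (meson inj_onD)

lemma act_bij: "g \<in> carrier H \<Longrightarrow> bij_betw (act T g) V V"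
  using ga.bij_prop0 by (auto simp: Bij_def)

lemma act_inv: "g \<in> carrier H \<Longrightarrow> x \<in> V \<Longrightarrow> act T (inv\<^bsub>H\<^esub> g) (act T g x) = x"
  "g \<in> carrier H \<Longrightarrow> x \<in> V \<Longrightarrow> act T g (act T (inv\<^bsub>H\<^esub> g) x) = x"
  using act_mult[of "inv\<^bsub>H\<^esub> g" g x] act_mult[of g "inv\<^bsub>H\<^esub> g" x] act_one by auto

lemma act_E: "g \<in> carrier H \<Longrightarrow> (u, v) \<in> E \<Longrightarrow> (act T g u, act T g v) \<in> E"
  and act_len: "g \<in> carrier H \<Longrightarrow> (u, v) \<in> E \<Longrightarrow> len T (act T g u, act T g v) = len T (u, v)"
  using mt by (auto simp: metric_tree_def)

lemma act_E_iff:
  "g \<in> carrier H \<Longrightarrow> u \<in> V \<Longrightarrow> v \<in> V \<Longrightarrow> (act T g u, act T g v) \<in> E \<longleftrightarrow> (u, v) \<in> E"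
  using act_E[of g u v] act_E[of "inv\<^bsub>H\<^esub> g" "act T g u" "act T g v"] act_inv by auto

text \<open>\<open>pact\<close> is defined by pulling back along the inverse map; in the form of a
  pushforward it can be computed on presentations and falls under
  \<open>tree_iso_tdist\<close>.\<close>

lemma pact_push:
  assumes g: "g \<in> carrier H" and p: "p \<in> points T"
  shows "pact T g p = push (act T g) p"
  using p
proof (rule realisationE)
  fix a b t assume r: "rep (tgraph T) a b t" "p = pt a b t"
  have V: "a \<in> V" "b \<in> V" using rep_V[OF r(1)] by auto
  have "pact T g (pt a b t) = pt (act T g a) (act T g b) t"
  proof
    fix x
    show "pact T g (pt a b t) x = pt (act T g a) (act T g b) t x"
    proof (cases "x \<in> V")
      case True
      define y where "y = inv_into V (act T g) x"
      have "x \<in> act T g ` V" using True ga.surj_prop[OF g] by simp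
      then have "y \<in> V" "act T g y = x" unfolding y_def by (auto intro: inv_into_into f_inv_into_f)
      then have "y = a \<longleftrightarrow> x = act T g a" "y = b \<longleftrightarrow> x = act T g b" using act_inj[OF g] V by auto
      then show ?thesis using True by (simp add: pact_def pt_def vpt_def y_def[symmetric])
    next
      case False
      then have "x \<noteq> act T g a" "x \<noteq> act T g b" using act_V[OF g] V by auto
      then show ?thesis using False by (simp add: pact_def pt_def vpt_def)
    qed
  qed
  then show ?thesis using r by (simp add: push_pt)
qed

lemma pact_pt:
  assumes "g \<in> carrier H" "rep (tgraph T) a b t"
  shows "pact T g (pt a b t) = pt (act T g a) (act T g b) t"
  using pact_push[OF assms(1) rep_in[OF assms(2)]] by (simp add: push_pt)

lemma rep_act: "g \<in> carrier H \<Longrightarrow> rep (tgraph T) a b t \<Longrightarrow> rep (tgraph T) (act T g a) (act T g b) t"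
  using act_E act_V by (auto simp: rep_def)

lemma pact_vpt: "g \<in> carrier H \<Longrightarrow> a \<in> V \<Longrightarrow> pact T g (vpt a) = vpt (act T g a)"
  using pact_pt[of g a a 0] by (simp add: rep_def)

lemma act_iso:
  assumes "g \<in> carrier H"
  shows "bij_betw (push (act T g)) (points T) (points T)"
    "p \<in> points T \<Longrightarrow> q \<in> points T \<Longrightarrow> tdist T (push (act T g) p) (push (act T g) q) = tdist T p q"
  by (rule tree_iso_tdist[OF metric_gtree_axioms metric_gtree_axioms act_bij[OF assms]];
      use act_E_iff act_len assms in blast)+

lemma pact_in: "g \<in> carrier H \<Longrightarrow> p \<in> points T \<Longrightarrow> pact T g p \<in> points T"
  using act_iso(1) pact_push by (metis bij_betwE)

lemma tdist_pact:
  "g \<in> carrier H \<Longrightarrow> p \<in> points T \<Longrightarrow> q \<in> points T \<Longrightarrow> tdist T (pact T g p) (pact T g q) = tdist T p q"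
  using act_iso(2) pact_push by simp

lemma side_act:
  assumes "g \<in> carrier H" "(a, b) \<in> E" "x \<in> V"
  shows "side E (act T g a, act T g b) (act T g x) = side E (a, b) x"
proof (rule side_map[OF stree_axioms stree_axioms _ _ assms(2) act_E[OF assms(1,2)] assms(3)])
  fix u v assume uv: "(u, v) \<in> E"
  then show "act T g u = act T g v \<or> (act T g u, act T g v) \<in> E" using act_E assms by simp
  show "act T g u = act T g a \<Longrightarrow> act T g v = act T g b \<Longrightarrow> u = a \<and> v = b"
    using act_inj[OF assms(1)] wf[OF uv] wf[OF assms(2)] by simp
qed

end

section \<open>Extending vertex maps at constant speed\<close>

context metric_gtree
begin

text \<open>The point at proportion \<open>t\<close> of the geodesic; by \<open>geo_unique\<close>
  the choice is forced for points \<open>p\<close>, \<open>q\<close> and \<open>t\<close> in the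
  unit interval.\<close>

definition geo :: "('x \<Rightarrow> real) \<Rightarrow> ('x \<Rightarrow> real) \<Rightarrow> real \<Rightarrow> 'x \<Rightarrow> real" where
  "geo p q t = (SOME m. m \<in> points T \<and> dd p m = t * dd p q \<and> dd m q = (1 - t) * dd p q)"

lemma geo:
  assumes "p \<in> points T" "q \<in> points T" "0 \<le> t" "t \<le> 1"
  shows "geo p q t \<in> points T" "dd p (geo p q t) = t * dd p q" "dd (geo p q t) q = (1 - t) * dd p q"
proof -
  have "0 \<le> t * dd p q" "t * dd p q \<le> dd p q"
    using assms dd_nonneg[of p q] by (auto simp: mult_left_le_one_le)
  then obtain m where "m \<in> points T" "dd p m = t * dd p q" "dd m q = dd p q - t * dd p q"
    using geodesic[OF assms(1,2)] unfolding geodesic_def by blast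
  then have "\<exists>m. m \<in> points T \<and> dd p m = t * dd p q \<and> dd m q = (1 - t) * dd p q"
    by (auto simp: algebra_simps)
  from someI_ex[OF this] show "geo p q t \<in> points T" "dd p (geo p q t) = t * dd p q"
    "dd (geo p q t) q = (1 - t) * dd p q" unfolding geo_def by blast+
qed

lemma geo_add:
  assumes "dd p m = t * dd p q" "dd m q = (1 - t) * dd p q"
  shows "dd p q = dd p m + dd m q"
  unfolding assms by (simp add: left_diff_distrib)

lemma geo_unique:
  assumes pq: "p \<in> points T" "q \<in> points T" "0 \<le> t" "t \<le> 1"
    and m: "m \<in> points T" "dd p m = t * dd p q" "dd m q = (1 - t) * dd p q"
  shows "m = geo p q t"
proof (rule dd_eq_0[OF m(1) geo(1)[OF pq]])
  have "dd m (geo p q t) = \<bar>dd p m - dd p (geo p q t)\<bar>"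
    by (rule dd_between[OF pq(1,2) m(1) geo(1)[OF pq] geo_add[OF m(2,3)] geo_add[OF geo(2,3)[OF pq]]])
  then show "dd m (geo p q t) = 0" unfolding m(2) geo(2)[OF pq] by simp
qed

lemma geo_dist:
  assumes pq: "p \<in> points T" "q \<in> points T" and t: "0 \<le> t" "t \<le> 1" and s: "0 \<le> s" "s \<le> 1"
  shows "dd (geo p q t) (geo p q s) = \<bar>t - s\<bar> * dd p q"
proof -
  have "dd (geo p q t) (geo p q s) = \<bar>dd p (geo p q t) - dd p (geo p q s)\<bar>"
    by (rule dd_between[OF pq geo(1)[OF pq t] geo(1)[OF pq s] geo_add[OF geo(2,3)[OF pq t]]
          geo_add[OF geo(2,3)[OF pq s]]])
  also have "\<dots> = \<bar>(t - s) * dd p q\<bar>"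
    unfolding geo(2)[OF pq t] geo(2)[OF pq s] by (simp only: left_diff_distrib)
  finally show ?thesis using dd_nonneg[of p q] by (simp only: abs_mult abs_of_nonneg)
qed

lemma geo_rev:
  assumes pq: "p \<in> points T" "q \<in> points T" and t: "0 \<le> t" "t \<le> 1"
  shows "geo q p (1 - t) = geo p q t"
proof -
  have "dd q (geo p q t) = (1 - t) * dd q p" "dd (geo p q t) p = (1 - (1 - t)) * dd q p"
    unfolding dd_sym[of q "geo p q t"] dd_sym[of "geo p q t" p] dd_sym[of q p] geo(2,3)[OF pq t]
    by simp_all
  then show ?thesis by (intro geo_unique[symmetric] pq geo(1)[OF pq t]) (use t in simp_all)
qed

lemma geo_ends:
  assumes "p \<in> points T" "q \<in> points T"
  shows "geo p q 0 = p" "geo p q 1 = q" "0 \<le> t \<Longrightarrow> t \<le> 1 \<Longrightarrow> geo p p t = p"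
  by (rule geo_unique[symmetric]; use assms dd_0 in simp)+

text \<open>The path from \<open>p\<close> to \<open>q\<close> consists of whole edges and a piece
  of an edge at either end. Distances add up along it, hence so do the estimates.\<close>

lemma lipschitz_of_edges:
  assumes M: "Metric_space M d" and F: "\<And>p. p \<in> points T \<Longrightarrow> F p \<in> M" and C: "0 \<le> C"
    and edge: "\<And>a b t s. (a, b) \<in> E \<Longrightarrow> 0 \<le> t \<Longrightarrow> t \<le> 1 \<Longrightarrow> 0 \<le> s \<Longrightarrow> s \<le> 1 \<Longrightarrow>
      d (F (pt a b t)) (F (pt a b s)) \<le> C * (len T (a, b) * \<bar>s - t\<bar>)"
    and p: "p \<in> points T" and q: "q \<in> points T"
  shows "d (F p) (F q) \<le> C * tdist T p q"
proof -
  interpret M: Metric_space M d by fact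
  have walk: "d (F (vpt u)) (F (vpt w)) \<le> C * sum_list (map (len T) l)"
    if "u \<in> V" "w \<in> V" "set l \<subseteq> E" "pcas u l w" for u l w
    using that
  proof (induction l arbitrary: u)
    case Nil
    then have "d (F (vpt u)) (F (vpt w)) = 0" using F[OF vpt_in[of u]] M.mdist_zero by simp
    then show ?case using Nil by simp
  next
    case (Cons e l)
    obtain a where e: "e = (u, a)" "(u, a) \<in> E" using Cons.prems by (cases e) auto
    have a: "a \<in> V" using wf e by blast
    note w = Cons.prems(2)
    have "d (F (vpt u)) (F (vpt w)) \<le> d (F (vpt u)) (F (vpt a)) + d (F (vpt a)) (F (vpt w))"
      by (rule M.triangle) (intro F vpt_in Cons.prems(1) a w)+
    moreover have "d (F (vpt u)) (F (vpt a)) \<le> C * len T (u, a)" using edge[OF e(2), of 0 1] by simp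
    moreover have "d (F (vpt a)) (F (vpt w)) \<le> C * sum_list (map (len T) l)"
      using Cons.IH[OF a w] Cons.prems e by simp
    ultimately show ?case using e by (simp add: algebra_simps)
  qed
  have vert: "d (F (vpt u)) (F (vpt w)) \<le> C * dd (vpt u) (vpt w)" if u: "u \<in> V" and w: "w \<in> V" for u w
  proof -
    obtain l where "set l \<subseteq> E" "pcas u l w" "vdist T u w = sum_list (map (len T) l)"
      using vdist_list[OF simplicial u w] .
    then show ?thesis using walk[OF u w] dd_vpt[OF u w] by simp
  qed
  have half: "d (F x) (F (vpt u)) \<le> C * dd x (vpt u)" if x: "x \<in> points T" "x u \<noteq> 0" for x u
  proof -
    obtain a b t where r: "rep (tgraph T) a b t" "x = pt a b t" using x(1) by (rule realisationE)
    have u: "u = a \<or> u = b" using pt_nz[of a b t u] x r by simp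
    show ?thesis
    proof (cases "a = b")
      case True
      then have "x = vpt u" using r u by simp
      then show ?thesis using M.mdist_zero F[OF x(1)] dd_0 by simp
    next
      case False
      then have ab: "(a, b) \<in> E" "0 \<le> t" "t \<le> 1" using r by (auto simp: rep_def)
      have "d (F (pt a b t)) (F (pt a b s)) \<le> C * dd (pt a b t) (pt a b s)" if "0 \<le> s" "s \<le> 1" for s
        using edge[OF ab that] dd_edge[OF ab that] by simp
      from this[of 0] this[of 1] show ?thesis using u r by auto
    qed
  qed
  show ?thesis
    unfolding tdist_dd[OF p q] using p q
  proof (cases rule: exit_vertex)
    case (exit u)
    obtain w where w: "w \<in> V" "q w \<noteq> 0" "dd q (vpt u) = dd q (vpt w) + dd (vpt w) (vpt u)"
      by (rule exit_vertex_vpt[OF q exit(1)]) (rule that)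
    have "d (F p) (F q) \<le> d (F p) (F (vpt u)) + d (F (vpt u)) (F q)"
      by (rule M.triangle) (intro F vpt_in p q exit(1))+
    moreover have "d (F (vpt u)) (F q) \<le> d (F (vpt u)) (F (vpt w)) + d (F (vpt w)) (F q)"
      by (rule M.triangle) (intro F vpt_in p q exit(1) w(1))+
    moreover have "d (F (vpt w)) (F q) = d (F q) (F (vpt w))" by (rule M.commute)
    ultimately have "d (F p) (F q) \<le> C * (dd p (vpt u) + dd (vpt u) (vpt w) + dd q (vpt w))"
      using half[OF p exit(2)] half[OF q w(2)] vert[OF exit(1) w(1)] by (simp add: algebra_simps)
    also have "dd p (vpt u) + dd (vpt u) (vpt w) + dd q (vpt w) = dd p q"
      using exit(3) w(3) dd_sym[of q "vpt u"] dd_sym[of "vpt w" "vpt u"] by simp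
    finally show "d (F p) (F q) \<le> C * dd p q" .
  next
    case (inside a b t s)
    then show "d (F p) (F q) \<le> C * dd p q" using edge[of a b t s] dd_edge[of a b t s] by simp
  qed
qed

end

text \<open>Equivariance passes from the vertices to the edges because the group acts by isometries
  and a point of a geodesic is determined by its distances from the ends.\<close>

lemma straight_extension:
  fixes T :: "('h, 'x) gtree" and T' :: "('h, 'y) gtree"
  assumes "metric_tree H T" "metric_tree H T'"
    and f0: "\<And>v. v \<in> tverts T \<Longrightarrow> f0 v \<in> points T'"
    and eq: "\<And>g v. g \<in> carrier H \<Longrightarrow> v \<in> tverts T \<Longrightarrow> f0 (act T g v) = pact T' g (f0 v)"
  obtains F where "equivariant_map H T T' F" "\<And>v. v \<in> tverts T \<Longrightarrow> F (vpt v) = f0 v"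
    "\<And>a b t. (a, b) \<in> tarcs T \<Longrightarrow> 0 \<le> t \<Longrightarrow> t \<le> 1 \<Longrightarrow> F (pt a b t) = metric_gtree.geo T' (f0 a) (f0 b) t"
proof -
  interpret A: htree H T by unfold_locales fact
  interpret B: htree H T' by unfold_locales fact
  \<comment> \<open>A point has several presentations; \<open>F\<close> picks the value from one of
    them, and \<open>indep\<close> shows that all give the same.\<close>
  define F where "F p = (SOME m. \<exists>a b t. rep (tgraph T) a b t \<and> p = pt a b t \<and> m = B.geo (f0 a) (f0 b) t)" for p
  have at_vertex: "B.geo (f0 a) (f0 b) t = f0 u"
    if "rep (tgraph T) a b t" "u = a \<and> t = 0 \<or> u = b \<and> t = 1 \<or> u = a \<and> u = b" for a b t u
    using that(2) B.geo_ends[OF f0 f0, of a b] A.rep_V[OF that(1)] that(1) by (auto simp: rep_def)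
  have indep: "B.geo (f0 a) (f0 b) t = B.geo (f0 c) (f0 d) s"
    if r: "rep (tgraph T) a b t" "rep (tgraph T) c d s" "pt a b t = pt c d s" for a b t c d s
  proof -
    have lims: "0 \<le> t" "t \<le> 1" "0 \<le> s" "s \<le> 1" using r by (auto simp: rep_def)
    have V: "a \<in> tverts T" "b \<in> tverts T" using A.rep_V r by auto
    note rev = B.geo_rev[OF f0[OF V(1)] f0[OF V(2)] lims(1,2)]
    from pt_eqD[OF r(3) lims] consider "a = c \<and> b = d \<and> t = s" | "a = d \<and> b = c \<and> s = 1 - t"
      | u where "u = a \<and> t = 0 \<or> u = b \<and> t = 1 \<or> u = a \<and> u = b"
        "u = c \<and> s = 0 \<or> u = d \<and> s = 1 \<or> u = c \<and> u = d" by blast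
    then show ?thesis
    proof cases
      case 2
      then show ?thesis using rev by metis
    next
      case 3
      then show ?thesis using at_vertex[OF r(1) 3(1)] at_vertex[OF r(2) 3(2)] by simp
    qed simp
  qed
  have F: "F (pt a b t) = B.geo (f0 a) (f0 b) t" if r: "rep (tgraph T) a b t" for a b t
    unfolding F_def
  proof (rule some_equality)
    show "\<exists>a' b' t'. rep (tgraph T) a' b' t' \<and> pt a b t = pt a' b' t' \<and>
        B.geo (f0 a) (f0 b) t = B.geo (f0 a') (f0 b') t'" using r by blast
    fix m assume "\<exists>a' b' t'. rep (tgraph T) a' b' t' \<and> pt a b t = pt a' b' t' \<and>
        m = B.geo (f0 a') (f0 b') t'"
    then show "m = B.geo (f0 a) (f0 b) t" using indep[OF r] by metis
  qed
  show thesis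
  proof (rule that)
    show "F (vpt v) = f0 v" if "v \<in> tverts T" for v
      using F[of v v 0] at_vertex[of v v 0 v] that by (simp add: rep_def)
    show "F (pt a b t) = B.geo (f0 a) (f0 b) t" if "(a, b) \<in> tarcs T" "0 \<le> t" "t \<le> 1" for a b t
      using F that by (simp add: rep_def)
    show "equivariant_map H T T' F"
      unfolding equivariant_map_def
    proof (intro conjI ballI subsetI)
      fix m assume "m \<in> F ` points T"
      then obtain p where p: "p \<in> points T" "m = F p" by blast
      show "m \<in> points T'"
      proof (rule realisationE[OF p(1)])
        fix a b t assume r: "rep (tgraph T) a b t" "p = pt a b t"
        then show ?thesis using F[OF r(1)] p A.rep_V[OF r(1)] B.geo(1)[OF f0 f0] by (simp add: rep_def)
      qed
    next
      fix g p assume g: "g \<in> carrier H" and p: "p \<in> points T"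
      show "F (pact T g p) = pact T' g (F p)"
      proof (rule realisationE[OF p])
        fix a b t assume r: "rep (tgraph T) a b t" "p = pt a b t"
        have V: "f0 a \<in> points T'" "f0 b \<in> points T'" using A.rep_V r f0 by auto
        have t: "0 \<le> t" "t \<le> 1" using r by (auto simp: rep_def)
        have "pact T' g (B.geo (f0 a) (f0 b) t) = B.geo (pact T' g (f0 a)) (pact T' g (f0 b)) t"
        proof (rule B.geo_unique)
          note q = B.geo[OF V t] 
          have iso: "B.dd (pact T' g x) (pact T' g y) = B.dd x y" if "x \<in> points T'" "y \<in> points T'" for x y
            using B.tdist_pact[OF g that] B.tdist_dd that B.pact_in[OF g] by simp
          show "B.dd (pact T' g (f0 a)) (pact T' g (B.geo (f0 a) (f0 b) t)) =
              t * B.dd (pact T' g (f0 a)) (pact T' g (f0 b))"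
            "B.dd (pact T' g (B.geo (f0 a) (f0 b) t)) (pact T' g (f0 b)) =
              (1 - t) * B.dd (pact T' g (f0 a)) (pact T' g (f0 b))"
            using iso V q by simp_all
        qed (use B.pact_in[OF g] V t B.geo[OF V t] in auto)
        moreover have "f0 (act T g a) = pact T' g (f0 a)" "f0 (act T g b) = pact T' g (f0 b)"
          using eq g A.rep_V[OF r(1)] by auto
        ultimately show ?thesis
          using F[OF r(1)] F[OF A.rep_act[OF g r(1)]] A.pact_pt[OF g r(1)] r by simp
      qed
    qed
  qed
qed

section \<open>Changing the edge lengths\<close>

definition relen :: "('x \<times> 'x \<Rightarrow> real) \<Rightarrow> ('h, 'x) gtree \<Rightarrow> ('h, 'x) gtree" where
  "relen l T = T\<lparr>len := l\<rparr>"

lemma relen_simps [simp]: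
  "tgraph (relen l T) = tgraph T" "len (relen l T) = l" "act (relen l T) = act T"
  by (simp_all add: relen_def)

lemma twist_simps [simp]:
  "tgraph (twist \<alpha> T) = tgraph T" "len (twist \<alpha> T) = len T" "act (twist \<alpha> T) h = act T (\<alpha> h)"
  by (simp_all add: twist_def)

lemma tdist_twist [simp]: "tdist (twist \<alpha> T) = tdist T"
  by (simp add: fun_eq_iff tdist_def pdist_end_def vdist_def)

lemma pact_twist [simp]: "pact (twist \<alpha> T) h = pact T (\<alpha> h)"
  by (simp add: fun_eq_iff pact_def)

lemma pact_relen [simp]: "pact (relen l T) = pact T"
  by (simp add: fun_eq_iff pact_def)

lemma metric_tree_twist:
  assumes T: "metric_tree H' T" and \<alpha>: "\<alpha> \<in> hom H H'" and H: "group H"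
  shows "metric_tree H (twist \<alpha> T)"
proof -
  interpret htree H' T by unfold_locales fact
  have c: "\<alpha> g \<in> carrier H'" if "g \<in> carrier H" for g using \<alpha> that by (auto simp: hom_def)
  have gh: "group_hom H' (BijGroup V) (act T)"
    using group_action_T by (simp add: group_action_def)
  have "group_hom H H' \<alpha>" using \<alpha> H group_H by (simp add: group_hom_def group_hom_axioms_def)
  moreover have "(\<lambda>g. act T (\<alpha> g)) \<in> hom H (BijGroup V)"
    using \<alpha> group_hom.homh[OF gh] by (auto simp: hom_def Pi_iff)
  ultimately have "group_action H V (\<lambda>g. act T (\<alpha> g))"
    using H by (simp add: group_action_def group_hom_def group_hom_axioms_def group_BijGroup)
  then show ?thesis
    using T c unfolding metric_tree_def twist_def by auto
qed

definition inv_len :: "('h, 'b) monoid_scheme \<Rightarrow> ('h, 'x) gtree \<Rightarrow> ('x \<times> 'x \<Rightarrow> real) \<Rightarrow> bool" where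
  "inv_len H T l \<longleftrightarrow> (\<forall>(u, v) \<in> tarcs T. 0 < l (u, v) \<and> l (v, u) = l (u, v) \<and>
     (\<forall>g \<in> carrier H. l (act T g u, act T g v) = l (u, v)))"

lemma inv_lenD:
  assumes "inv_len H T l" "(u, v) \<in> tarcs T"
  shows "0 < l (u, v)" "l (v, u) = l (u, v)" "g \<in> carrier H \<Longrightarrow> l (act T g u, act T g v) = l (u, v)"
  using assms by (auto simp: inv_len_def)

lemma metric_tree_relen:
  assumes "metric_tree H T" "inv_len H T l"
  shows "metric_tree H (relen l T)"
  using assms unfolding metric_tree_def inv_len_def by auto

lemma inv_len_self: "metric_tree H T \<Longrightarrow> inv_len H T (len T)"
  unfolding metric_tree_def inv_len_def by auto

definition finite_quotient :: "('h, 'b) monoid_scheme \<Rightarrow> ('h, 'x) gtree \<Rightarrow> bool" where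
  "finite_quotient H T \<longleftrightarrow> (\<exists>F. finite F \<and> F \<subseteq> tarcs T \<and>
     (\<forall>e \<in> tarcs T. \<exists>g \<in> carrier H. \<exists>(u, v) \<in> F. e = (act T g u, act T g v)))"

lemma inv_len_ratio:
  assumes fin: "finite_quotient H T" and l: "inv_len H T l" "inv_len H T l'"
  obtains K where "0 < K" "\<And>e. e \<in> tarcs T \<Longrightarrow> l' e \<le> K * l e"
proof -
  obtain F where F: "finite F" "F \<subseteq> tarcs T"
    and cov: "\<And>e. e \<in> tarcs T \<Longrightarrow> \<exists>g \<in> carrier H. \<exists>(u, v) \<in> F. e = (act T g u, act T g v)"
    using fin unfolding finite_quotient_def by blast
  \<comment> \<open>The ratio of two invariant length functions is constant on orbits, so the sum
    over representatives bounds it everywhere; the summand 1 keeps \<open>K\<close> positive when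
    there are no edges.\<close>
  define K where "K = 1 + (\<Sum>e \<in> F. l' e / l e)"
  have pos: "0 \<le> l' e / l e" if "e \<in> F" for e
    using inv_lenD(1)[OF l(1), of "fst e" "snd e"] inv_lenD(1)[OF l(2), of "fst e" "snd e"] that F(2) by auto
  have K: "l' e / l e \<le> K" if "e \<in> F" for e
    using member_le_sum[OF that _ F(1), of "\<lambda>e. l' e / l e"] pos unfolding K_def by fastforce
  show thesis
  proof (rule that)
    show "0 < K" unfolding K_def using sum_nonneg[of F "\<lambda>e. l' e / l e"] pos by fastforce
    fix e assume "e \<in> tarcs T"
    then obtain g u v where g: "g \<in> carrier H" "(u, v) \<in> F" "e = (act T g u, act T g v)" using cov by blast
    then have uv: "(u, v) \<in> tarcs T" using F by blast
    have "l' (u, v) \<le> K * l (u, v)" using K[OF g(2)] inv_lenD(1)[OF l(1) uv] by (simp add: field_simps)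
    then show "l' e \<le> K * l e" using g inv_lenD(3)[OF l(1) uv g(1)] inv_lenD(3)[OF l(2) uv g(1)] by simp
  qed
qed

lemma tdist_relen_le:
  assumes "metric_gtree T" "metric_gtree (relen l T)"
    and K: "\<And>e. e \<in> tarcs T \<Longrightarrow> l e \<le> K * len T e"
    and pq: "p \<in> points T" "q \<in> points T"
  shows "tdist (relen l T) p q \<le> K * tdist T p q"
proof -
  interpret A: metric_gtree T by fact
  interpret B: metric_gtree "relen l T" by fact
  have "B.dd p q = (\<Sum>e \<in> A.crossing p q. l e * \<bar>coord (tarcs T) e q - coord (tarcs T) e p\<bar>) / 2"
    by (simp add: B.dd_def A.crossing_def B.crossing_def)
  also have "\<dots> \<le> (\<Sum>e \<in> A.crossing p q. K * (len T e * \<bar>coord (tarcs T) e q - coord (tarcs T) e p\<bar>)) / 2"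
  proof (intro divide_right_mono sum_mono)
    fix e assume "e \<in> A.crossing p q"
    then have "l e \<le> K * len T e" using K A.crossing_E by blast
    then have "l e * \<bar>coord (tarcs T) e q - coord (tarcs T) e p\<bar>
        \<le> (K * len T e) * \<bar>coord (tarcs T) e q - coord (tarcs T) e p\<bar>" by (rule mult_right_mono) simp
    then show "l e * \<bar>coord (tarcs T) e q - coord (tarcs T) e p\<bar>
        \<le> K * (len T e * \<bar>coord (tarcs T) e q - coord (tarcs T) e p\<bar>)" by (simp only: mult.assoc)
  qed simp
  also have "\<dots> = K * A.dd p q" by (simp add: A.dd_def sum_distrib_left)
  finally show ?thesis using A.tdist_dd[OF pq] B.tdist_dd pq by simp
qed

lemma tdist_relen_additive:
  assumes "metric_gtree T" "metric_gtree (relen l T)"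
    and pts: "p \<in> points T" "q \<in> points T" "m \<in> points T"
  shows "tdist (relen l T) p q = tdist (relen l T) p m + tdist (relen l T) m q \<longleftrightarrow>
    tdist T p q = tdist T p m + tdist T m q"
proof -
  interpret A: metric_gtree T by fact
  interpret B: metric_gtree "relen l T" by fact
  show ?thesis
    using A.dd_additive_iff[OF pts] B.dd_additive_iff[of p q m] pts A.tdist_dd B.tdist_dd by simp
qed

lemma bilipschitz_openin:
  assumes "Metric_space M d" "Metric_space M' d'"
    and f: "bij_betw f M M'"
    and L: "\<And>p q. p \<in> M \<Longrightarrow> q \<in> M \<Longrightarrow> d' (f p) (f q) \<le> K * d p q" and K: "0 < K"
  shows "continuous_map (Metric_space.mtopology M d) (Metric_space.mtopology M' d') f"
proof -
  interpret A: Metric_space M d by fact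
  interpret B: Metric_space M' d' by fact
  have into: "f p \<in> M'" if "p \<in> M" for p using f that bij_betwE by blast
  show ?thesis
    unfolding continuous_map_def
  proof (intro conjI allI impI)
    show "f \<in> topspace A.mtopology \<rightarrow> topspace B.mtopology" using into by simp
    fix U assume U: "openin B.mtopology U"
    show "openin A.mtopology {x \<in> topspace A.mtopology. f x \<in> U}"
      unfolding A.openin_mtopology
    proof (intro conjI allI impI)
      fix x assume x: "x \<in> {x \<in> topspace A.mtopology. f x \<in> U}"
      then obtain r where r: "r > 0" "B.mball (f x) r \<subseteq> U" using U unfolding B.openin_mtopology by blast
      have "A.mball x (r / K) \<subseteq> {x \<in> topspace A.mtopology. f x \<in> U}"
      proof
        fix y assume y: "y \<in> A.mball x (r / K)"
        then have "d' (f x) (f y) \<le> K * d x y" "K * d x y < r"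
          using L K by (auto simp: field_simps)
        then have "f y \<in> B.mball (f x) r" using y into by auto
        then show "y \<in> {x \<in> topspace A.mtopology. f x \<in> U}" using r y by auto
      qed
      then show "\<exists>r>0. A.mball x r \<subseteq> {x \<in> topspace A.mtopology. f x \<in> U}"
        using r K by (intro exI[of _ "r / K"]) auto
    qed auto
  qed
qed

lemma bilipschitz_homeomorphic_map:
  assumes M: "Metric_space M d" "Metric_space M' d'"
    and f: "bij_betw f M M'" and K: "0 < K"
    and L: "\<And>p q. p \<in> M \<Longrightarrow> q \<in> M \<Longrightarrow> d' (f p) (f q) \<le> K * d p q"
      "\<And>p q. p \<in> M \<Longrightarrow> q \<in> M \<Longrightarrow> d p q \<le> K * d' (f p) (f q)"
  shows "homeomorphic_map (Metric_space.mtopology M d) (Metric_space.mtopology M' d') f"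
proof -
  interpret A: Metric_space M d by fact
  interpret B: Metric_space M' d' by fact
  let ?g = "inv_into M f"
  have g: "bij_betw ?g M' M" using f by (rule bij_betw_inv_into)
  have fg: "f (?g y) = y" if "y \<in> M'" for y using f that by (rule bij_betw_inv_into_right)
  have gf: "?g (f x) = x" if "x \<in> M" for x using f that by (rule bij_betw_inv_into_left)
  have gM: "?g y \<in> M" if "y \<in> M'" for y using g that bij_betwE by blast
  have "homeomorphic_maps A.mtopology B.mtopology f ?g"
    unfolding homeomorphic_maps_def
  proof (intro conjI ballI)
    show "continuous_map A.mtopology B.mtopology f" by (rule bilipschitz_openin[OF M f L(1) K])
    show "continuous_map B.mtopology A.mtopology ?g"
    proof (rule bilipschitz_openin[OF M(2,1) g _ K])
      fix p q assume "p \<in> M'" "q \<in> M'"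
      then show "d (?g p) (?g q) \<le> K * d' p q" using L(2)[OF gM gM, of p q] fg by simp
    qed
  qed (use fg gf in auto)
  then show ?thesis using homeomorphic_maps_map by blast
qed

lemma equiv_isometric_homeomorphic:
  assumes "metric_tree H T" "metric_tree H T'" "equiv_isometric H T T'"
  shows "equiv_homeomorphic H T T'"
proof -
  obtain f where f: "equivariant_map H T T' f" "bij_betw f (points T) (points T')"
    "\<And>p q. p \<in> points T \<Longrightarrow> q \<in> points T \<Longrightarrow> tdist T' (f p) (f q) = tdist T p q"
    using assms(3) by (auto simp: equiv_isometric_def)
  have "homeomorphic_map (Metric_space.mtopology (points T) (tdist T))
      (Metric_space.mtopology (points T') (tdist T')) f"
    by (rule bilipschitz_homeomorphic_map[where K = 1, OF _ _ f(2)])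
      (simp_all add: f(3) metric_gtree.Metric_space_points[OF metric_tree_gtree[OF assms(1)]]
        metric_gtree.Metric_space_points[OF metric_tree_gtree[OF assms(2)]])
  then show ?thesis using f unfolding equiv_homeomorphic_def by blast
qed

text \<open>The identity of the realisation is biLipschitz as there are finitely many orbits of
  edges. This is why a change of lengths does not leave a simplex.\<close>

lemma equiv_homeomorphic_relen:
  assumes T: "metric_tree H T" and l: "inv_len H T l" and fin: "finite_quotient H T"
  shows "equiv_homeomorphic H T (relen l T)"
proof -
  have mt: "metric_tree H (relen l T)" by (rule metric_tree_relen[OF T l])
  note g = metric_tree_gtree[OF T] metric_tree_gtree[OF mt]
  obtain K where K: "0 < K" "\<And>e. e \<in> tarcs T \<Longrightarrow> l e \<le> K * len T e"
    by (rule inv_len_ratio[OF fin inv_len_self[OF T] l]) (rule that)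
  obtain K' where K': "0 < K'" "\<And>e. e \<in> tarcs T \<Longrightarrow> len T e \<le> K' * l e"
    by (rule inv_len_ratio[OF fin l inv_len_self[OF T]]) (rule that)
  have orig: "relen (len T) (relen l T) = T" by (simp add: relen_def)
  have nn: "0 \<le> tdist T p q" "0 \<le> tdist (relen l T) p q" for p q
    using metric_gtree.Metric_space_points[OF g(1)] metric_gtree.Metric_space_points[OF g(2)]
    by (auto dest: Metric_space.nonneg)
  have "homeomorphic_map (Metric_space.mtopology (points T) (tdist T))
      (Metric_space.mtopology (points (relen l T)) (tdist (relen l T))) id"
  proof (rule bilipschitz_homeomorphic_map)
    fix p q assume pq: "p \<in> points T" "q \<in> points T"
    have "tdist (relen l T) p q \<le> K * tdist T p q" by (rule tdist_relen_le[OF g K(2) pq])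
    also have "\<dots> \<le> (K + K') * tdist T p q" using nn K' by (intro mult_right_mono) auto
    finally show "tdist (relen l T) (id p) (id q) \<le> (K + K') * tdist T p q" by simp
    have "tdist T p q \<le> K' * tdist (relen l T) p q"
      using tdist_relen_le[of "relen l T" "len T" K' p q] g K'(2) pq by (simp add: orig)
    also have "\<dots> \<le> (K + K') * tdist (relen l T) p q" using nn K by (intro mult_right_mono) auto
    finally show "tdist T p q \<le> (K + K') * tdist (relen l T) (id p) (id q)" by simp
  qed (use K K' metric_gtree.Metric_space_points[OF g(1)] metric_gtree.Metric_space_points[OF g(2)] in auto)
  then show ?thesis
    unfolding equiv_homeomorphic_def by (intro exI[of _ id]) (simp add: equivariant_map_def)
qed

text \<open>
  A straight map stays a map with the same images of edges after a change of lengths, but has to be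
  reparametrised along each edge; betweenness in a tree does not depend on the lengths.
\<close>

lemma straight_map_relen:
  fixes T :: "('h, 'x) gtree" and T' :: "('h, 'y) gtree"
  assumes T: "metric_tree H T" "metric_tree H T'"
    and l: "inv_len H T l" "inv_len H T' l'" and fin: "finite_quotient H T'"
    and f: "equivariant_map H T T' f" "straight_map T T' f"
  obtains F where "equivariant_map H T T' F" "straight_map (relen l T) (relen l' T') F"
    "\<And>v. v \<in> tverts T \<Longrightarrow> F (vpt v) = f (vpt v)"
    "\<And>e. e \<in> tarcs T \<Longrightarrow> F ` seg e \<subseteq> f ` seg e"
proof -
  interpret A: htree H T by unfold_locales fact
  interpret B: htree H T' by unfold_locales fact
  interpret A': htree H "relen l T" by unfold_locales (rule metric_tree_relen[OF T(1) l(1)])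
  interpret B': htree H "relen l' T'" by unfold_locales (rule metric_tree_relen[OF T(2) l(2)])
  have f_in: "f p \<in> points T'" if "p \<in> points T" for p
    using f(1) that by (auto simp: equivariant_map_def)
  obtain F where F: "equivariant_map H T (relen l' T') F" "\<And>v. v \<in> tverts T \<Longrightarrow> F (vpt v) = f (vpt v)"
    "\<And>a b t. (a, b) \<in> tarcs T \<Longrightarrow> 0 \<le> t \<Longrightarrow> t \<le> 1 \<Longrightarrow> F (pt a b t) = B'.geo (f (vpt a)) (f (vpt b)) t"
  proof (rule straight_extension[OF T(1) B'.mt, of "\<lambda>v. f (vpt v)"])
    show "f (vpt v) \<in> points (relen l' T')" if "v \<in> tverts T" for v
      using f_in[OF vpt_in[OF that]] by simp
    show "f (vpt (act T g v)) = pact (relen l' T') g (f (vpt v))"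
      if "g \<in> carrier H" "v \<in> tverts T" for g v
    proof -
      have "f (pact T g (vpt v)) = pact T' g (f (vpt v))"
        using f(1) that vpt_in[OF that(2)] unfolding equivariant_map_def by blast
      then show ?thesis using A.pact_vpt[OF that] by simp
    qed
  qed (rule that)
  obtain K where K: "0 < K" "\<And>e. e \<in> tarcs T' \<Longrightarrow> l' e \<le> K * len T' e"
    by (rule inv_len_ratio[OF fin inv_len_self[OF T(2)] l(2)]) (rule that)
  show thesis
  proof (rule that)
    show "equivariant_map H T T' F" using F(1) by (simp add: equivariant_map_def)
    show "F (vpt v) = f (vpt v)" if "v \<in> tverts T" for v by (rule F(2)[OF that])
    show "straight_map (relen l T) (relen l' T') F"
      unfolding straight_map_def
    proof (intro conjI ballI)
      show "F ` points (relen l T) \<subseteq> points (relen l' T')" using F(1) by (simp add: equivariant_map_def)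
      fix e assume "e \<in> tarcs (relen l T)"
      then obtain a b where e: "e = (a, b)" "(a, b) \<in> tarcs T" by (cases e) auto
      have V: "a \<in> tverts T" "b \<in> tverts T" using A.wf e by auto
      have P: "f (vpt a) \<in> points (relen l' T')" "f (vpt b) \<in> points (relen l' T')"
        using f_in[OF vpt_in] V by simp_all
      let ?D = "B'.dd (f (vpt a)) (f (vpt b))"
      have lp: "0 < l (a, b)" using inv_lenD(1)[OF l(1) e(2)] .
      show "\<exists>c\<ge>0. \<forall>p\<in>seg e. \<forall>q\<in>seg e. tdist (relen l' T') (F p) (F q) = c * tdist (relen l T) p q"
      proof (intro exI[of _ "?D / l (a, b)"] conjI ballI)
        show "0 \<le> ?D / l (a, b)" using B'.dd_nonneg lp by simp
        fix p q assume "p \<in> seg e" "q \<in> seg e"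
        then obtain t s where ts: "p = pt a b t" "0 \<le> t" "t \<le> 1" "q = pt a b s" "0 \<le> s" "s \<le> 1"
          using e by (auto simp: seg_pt)
        have "tdist (relen l' T') (F p) (F q) = \<bar>t - s\<bar> * ?D"
          using B'.geo_dist[OF P ts(2,3,5,6)] B'.tdist_dd[OF B'.geo(1)[OF P ts(2,3)] B'.geo(1)[OF P ts(5,6)]]
            F(3)[OF e(2)] ts by simp
        moreover have "tdist (relen l T) p q = l (a, b) * \<bar>s - t\<bar>"
          using A'.dd_edge[of a b t s] A'.tdist_dd[of p q] e ts rep_in[of "tgraph T" a b t]
            rep_in[of "tgraph T" a b s] by (simp add: rep_def)
        ultimately show "tdist (relen l' T') (F p) (F q) = ?D / l (a, b) * tdist (relen l T) p q"
          using lp by (simp add: abs_minus_commute)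
      qed
    qed
    fix e assume "e \<in> tarcs T"
    then obtain a b where e: "e = (a, b)" "(a, b) \<in> tarcs T" by (cases e) auto
    have V: "a \<in> tverts T" "b \<in> tverts T" using A.wf e by auto
    have P: "f (vpt a) \<in> points T'" "f (vpt b) \<in> points T'" using f_in[OF vpt_in] V by simp_all
    then have P': "f (vpt a) \<in> points (relen l' T')" "f (vpt b) \<in> points (relen l' T')" by simp_all
    have "\<exists>c\<ge>0. \<forall>p\<in>seg e. \<forall>q\<in>seg e. tdist T' (f p) (f q) = c * tdist T p q"
      using f(2) \<open>e \<in> tarcs T\<close> unfolding straight_map_def by (elim conjE bspec)
    then obtain c where c0: "0 \<le> c" and c1: "\<forall>p\<in>seg e. \<forall>q\<in>seg e. tdist T' (f p) (f q) = c * tdist T p q"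
      by (elim exE conjE) (rule that)
    have c: "0 \<le> c" "\<And>p q. p \<in> seg e \<Longrightarrow> q \<in> seg e \<Longrightarrow> tdist T' (f p) (f q) = c * tdist T p q"
      using c0 c1 by simp_all
    have pin: "pt a b s \<in> points T" if "0 \<le> s" "s \<le> 1" for s
      using rep_in[of "tgraph T" a b s] that e by (simp add: rep_def)
    have dT: "tdist T' (f (pt a b s)) (f (pt a b r)) = c * (len T (a, b) * \<bar>r - s\<bar>)"
      if "0 \<le> s" "s \<le> 1" "0 \<le> r" "r \<le> 1" for s r
    proof -
      have "pt a b s \<in> seg e" "pt a b r \<in> seg e" using that e by (auto simp: seg_pt)
      then have "tdist T' (f (pt a b s)) (f (pt a b r)) = c * tdist T (pt a b s) (pt a b r)" by (rule c(2))
      also have "tdist T (pt a b s) (pt a b r) = len T (a, b) * \<bar>r - s\<bar>"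
        using A.tdist_dd[OF pin pin] A.dd_edge[OF e(2) that] that by simp
      finally show ?thesis .
    qed
    \<comment> \<open>The new distance from the image of \<open>a\<close>, along the old image of
      the edge. It is continuous because the metrics are comparable, so by the intermediate value
      theorem it takes the value belonging to proportion \<open>t\<close> at some old parameter
      \<open>s\<close>. Betweenness being unchanged, the image at \<open>s\<close> is the point at
      proportion \<open>t\<close> of the new geodesic.\<close>
    define \<psi> where "\<psi> s = tdist (relen l' T') (f (vpt a)) (f (pt a b s))" for s
    have lip: "\<bar>\<psi> s - \<psi> r\<bar> \<le> (K * c * len T (a, b)) * \<bar>s - r\<bar>"
      if "0 \<le> s" "s \<le> 1" "0 \<le> r" "r \<le> 1" for s r
    proof -
      have Q: "f (pt a b s) \<in> points T'" "f (pt a b r) \<in> points T'" by (intro f_in pin that)+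
      then have Q': "f (pt a b s) \<in> points (relen l' T')" "f (pt a b r) \<in> points (relen l' T')" by simp_all
      have "\<bar>\<psi> s - \<psi> r\<bar> \<le> tdist (relen l' T') (f (pt a b s)) (f (pt a b r))"
        unfolding \<psi>_def B'.tdist_dd[OF P'(1) Q'(1)] B'.tdist_dd[OF P'(1) Q'(2)] B'.tdist_dd[OF Q']
        using B'.dd_triangle[OF P'(1) Q'(1,2)] B'.dd_triangle[OF P'(1) Q'(2,1)]
          B'.dd_sym[of "f (pt a b s)" "f (pt a b r)"] by linarith
      also have "\<dots> \<le> K * tdist T' (f (pt a b s)) (f (pt a b r))"
        by (rule tdist_relen_le[OF B.metric_gtree_axioms B'.metric_gtree_axioms K(2) Q])
      finally show ?thesis using dT[OF that] by (simp add: abs_minus_commute mult.assoc)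
    qed
    have cont: "continuous_on {0..1} \<psi>"
    proof (rule continuous_onI)
      fix x \<epsilon> :: real assume x: "x \<in> {0..1}" and \<epsilon>: "0 < \<epsilon>"
      let ?L = "K * c * len T (a, b)"
      have L: "0 \<le> ?L" using K(1) c(1) A.len_pos[OF e(2)] by simp
      show "\<exists>d>0. \<forall>y\<in>{0..1}. dist y x < d \<longrightarrow> dist (\<psi> y) (\<psi> x) \<le> \<epsilon>"
      proof (intro exI[of _ "\<epsilon> / (?L + 1)"] conjI ballI impI)
        show "0 < \<epsilon> / (?L + 1)" using L \<epsilon> by simp
        fix y assume y: "y \<in> {0..1}" "dist y x < \<epsilon> / (?L + 1)"
        have "\<bar>\<psi> y - \<psi> x\<bar> \<le> ?L * \<bar>y - x\<bar>" using lip[of y x] x y by simp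
        also have "\<dots> \<le> (?L + 1) * \<bar>y - x\<bar>" by (intro mult_right_mono) auto
        also have "\<dots> \<le> \<epsilon>" using y(2) L by (simp add: dist_real_def field_simps)
        finally show "dist (\<psi> y) (\<psi> x) \<le> \<epsilon>" by (simp add: dist_real_def)
      qed
    qed
    show "F ` seg e \<subseteq> f ` seg e"
    proof
      fix m assume "m \<in> F ` seg e"
      then obtain t where t: "0 \<le> t" "t \<le> 1" "m = F (pt a b t)" using e by (auto simp: seg_pt)
      let ?D = "B'.dd (f (vpt a)) (f (vpt b))"
      have "\<psi> 0 = 0" "\<psi> 1 = ?D"
        using B'.tdist_dd[OF P'(1) P'(1)] B'.tdist_dd[OF P'] B'.dd_0 by (simp_all add: \<psi>_def)
      then have "\<psi> 0 \<le> t * ?D" "t * ?D \<le> \<psi> 1"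
        using t B'.dd_nonneg[of "f (vpt a)" "f (vpt b)"] by (auto simp: mult_left_le_one_le)
      then obtain s where s: "0 \<le> s" "s \<le> 1" "\<psi> s = t * ?D"
        using IVT'[of \<psi> 0 "t * ?D" 1] cont by auto
      have Q: "f (pt a b s) \<in> points T'" by (intro f_in pin s)
      have "tdist T' (f (vpt a)) (f (vpt b)) = tdist T' (f (vpt a)) (f (pt a b s)) + tdist T' (f (pt a b s)) (f (vpt b))"
        using dT[of 0 1] dT[of 0 s] dT[of s 1] s by (simp add: algebra_simps)
      then have add: "tdist (relen l' T') (f (vpt a)) (f (vpt b)) =
          tdist (relen l' T') (f (vpt a)) (f (pt a b s)) + tdist (relen l' T') (f (pt a b s)) (f (vpt b))"
        using tdist_relen_additive[OF B.metric_gtree_axioms B'.metric_gtree_axioms P Q] by blast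
      have Q': "f (pt a b s) \<in> points (relen l' T')" using Q by simp
      have "f (pt a b s) = B'.geo (f (vpt a)) (f (vpt b)) t"
      proof (rule B'.geo_unique[OF P' t(1,2) Q'])
        show 1: "B'.dd (f (vpt a)) (f (pt a b s)) = t * ?D"
          using s(3) B'.tdist_dd[OF P'(1) Q'] by (simp add: \<psi>_def)
        show "B'.dd (f (pt a b s)) (f (vpt b)) = (1 - t) * ?D"
          using add 1 B'.tdist_dd[OF P'] B'.tdist_dd[OF P'(1) Q'] B'.tdist_dd[OF Q' P'(2)]
          by (simp add: left_diff_distrib)
      qed
      then have "m = f (pt a b s)" using t F(3)[OF e(2) t(1,2)] by simp
      then show "m \<in> f ` seg e" using s e by (auto simp: seg_pt)
    qed
  qed
qed

section \<open>Collapsing subforests\<close>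

lemma group_actionI:
  assumes "group H" and ext: "\<And>g. g \<in> carrier H \<Longrightarrow> f g \<in> extensional S"
    and clo: "\<And>g x. g \<in> carrier H \<Longrightarrow> x \<in> S \<Longrightarrow> f g x \<in> S"
    and one: "\<And>x. x \<in> S \<Longrightarrow> f \<one>\<^bsub>H\<^esub> x = x"
    and mult: "\<And>g h x. g \<in> carrier H \<Longrightarrow> h \<in> carrier H \<Longrightarrow> x \<in> S \<Longrightarrow> f (g \<otimes>\<^bsub>H\<^esub> h) x = f g (f h x)"
  shows "group_action H S f"
proof -
  interpret group H by fact
  have B: "f g \<in> Bij S" if g: "g \<in> carrier H" for g
  proof -
    have "f (inv\<^bsub>H\<^esub> g) (f g x) = x" "f g (f (inv\<^bsub>H\<^esub> g) x) = x" if "x \<in> S" for x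
      using mult[of "inv\<^bsub>H\<^esub> g" g x] mult[of g "inv\<^bsub>H\<^esub> g" x] one g that by auto
    then have "bij_betw (f g) S S"
      by (intro bij_betw_byWitness[of S "f (inv\<^bsub>H\<^esub> g)"]) (use clo g in auto)
    then show ?thesis using ext g by (simp add: Bij_def)
  qed
  have "f (g \<otimes>\<^bsub>H\<^esub> h) = compose S (f g) (f h)" if "g \<in> carrier H" "h \<in> carrier H" for g h
    by (rule extensionalityI[of _ S]) (use ext mult that in \<open>auto simp: compose_def\<close>)
  then have "f \<in> hom H (BijGroup S)" using B by (auto simp: hom_def BijGroup_def)
  then show ?thesis
    using group_BijGroup is_group by (simp add: group_action_def group_hom_def group_hom_axioms_def)
qed

text \<open>Deleting arcs cannot create a detour, so the bridge condition is inherited and the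
  essential thing to check is connectivity.\<close>

lemma stree_sub:
  assumes "stree V E" "W \<subseteq> V" "F \<subseteq> E" "W \<noteq> {}"
    and "\<And>a b. (a, b) \<in> F \<Longrightarrow> a \<in> W \<and> b \<in> W" "\<And>a b. (a, b) \<in> F \<Longrightarrow> (b, a) \<in> F"
    and "\<And>u v. u \<in> W \<Longrightarrow> v \<in> W \<Longrightarrow> (u, v) \<in> F\<^sup>*"
  shows "stree W F"
proof -
  interpret stree V E by fact
  show ?thesis
  proof
    fix a b assume "(a, b) \<in> F"
    moreover have "(F - {(a, b), (b, a)})\<^sup>* \<subseteq> (E - {(a, b), (b, a)})\<^sup>*"
      using assms(3) by (intro rtrancl_mono) auto
    ultimately show "(b, a) \<notin> (F - {(a, b), (b, a)})\<^sup>*" "a \<noteq> b" using bridge irrefl assms(3) by blast+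
  qed (use assms in auto)
qed

lemma equiv_isometricI:
  assumes T: "metric_tree H T" "metric_tree H T'"
    and bij: "bij_betw \<theta> (tverts T) (tverts T')"
    and arcs: "\<And>u v. u \<in> tverts T \<Longrightarrow> v \<in> tverts T \<Longrightarrow> (\<theta> u, \<theta> v) \<in> tarcs T' \<longleftrightarrow> (u, v) \<in> tarcs T"
    and lens: "\<And>u v. (u, v) \<in> tarcs T \<Longrightarrow> len T' (\<theta> u, \<theta> v) = len T (u, v)"
    and eq: "\<And>g v. g \<in> carrier H \<Longrightarrow> v \<in> tverts T \<Longrightarrow> \<theta> (act T g v) = act T' g (\<theta> v)"
  shows "equiv_isometric H T T'"
proof -
  interpret A: htree H T by unfold_locales fact
  interpret B: htree H T' by unfold_locales fact
  note iso = tree_iso_tdist[OF A.metric_gtree_axioms B.metric_gtree_axioms bij arcs lens]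
  have "push \<theta> (pact T g p) = pact T' g (push \<theta> p)" if g: "g \<in> carrier H" and p: "p \<in> points T" for g p
    using p
  proof (rule realisationE)
    fix a b t assume r: "rep (tgraph T) a b t" "p = pt a b t"
    have "pt (\<theta> a) (\<theta> b) t \<in> points T'" using iso(1) p unfolding r(2) push_pt[symmetric] by (rule bij_betwE[rule_format])
    then have "pact T' g (pt (\<theta> a) (\<theta> b) t) = pt (act T' g (\<theta> a)) (act T' g (\<theta> b)) t"
      using B.pact_push[OF g] by (simp add: push_pt)
    then show ?thesis using A.pact_pt[OF g r(1)] eq[OF g] A.rep_V[OF r(1)] r(2) by (simp add: push_pt)
  qed
  moreover have "push \<theta> ` points T \<subseteq> points T'" using bij_betw_imp_surj_on[OF iso(1)] by simp
  ultimately have "equivariant_map H T T' (push \<theta>)" by (simp add: equivariant_map_def)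
  moreover have "\<forall>p\<in>points T. \<forall>q\<in>points T. tdist T' (push \<theta> p) (push \<theta> q) = tdist T p q"
    using iso(2) by simp
  ultimately show ?thesis unfolding equiv_isometric_def using iso(1) by (intro exI[of _ "push \<theta>"]) simp
qed

lemma equivariant_map_comp:
  assumes "equivariant_map H T T' f" "equivariant_map H T' T'' f'"
  shows "equivariant_map H T T'' (f' \<circ> f)"
  using assms unfolding equivariant_map_def by (auto simp: image_subset_iff)

lemma equiv_isometric_trans:
  assumes "equiv_isometric H T T'" "equiv_isometric H T' T''"
  shows "equiv_isometric H T T''"
proof -
  obtain f where f: "equivariant_map H T T' f" "bij_betw f (points T) (points T')"
    "\<forall>p \<in> points T. \<forall>q \<in> points T. tdist T' (f p) (f q) = tdist T p q"
    using assms(1) unfolding equiv_isometric_def by (elim exE conjE) (rule that)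
  obtain g where g: "equivariant_map H T' T'' g" "bij_betw g (points T') (points T'')"
    "\<forall>p \<in> points T'. \<forall>q \<in> points T'. tdist T'' (g p) (g q) = tdist T' p q"
    using assms(2) unfolding equiv_isometric_def by (elim exE conjE) (rule that)
  have "f p \<in> points T'" if "p \<in> points T" for p using bij_betwE[OF f(2)] that by simp
  then have "\<forall>p \<in> points T. \<forall>q \<in> points T. tdist T'' ((g \<circ> f) p) ((g \<circ> f) q) = tdist T p q"
    using f(3) g(3) by simp
  then show ?thesis unfolding equiv_isometric_def
    using equivariant_map_comp[OF f(1) g(1)] bij_betw_trans[OF f(2) g(2)]
    by (intro exI[of _ "g \<circ> f"] conjI)
qed

lemma equivariant_map_inv:
  assumes f: "equivariant_map H T T' f" "bij_betw f (points T) (points T')" and T: "metric_tree H T"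
  shows "equivariant_map H T' T (inv_into (points T) f)"
  unfolding equivariant_map_def
proof (intro conjI ballI)
  interpret htree H T by unfold_locales fact
  let ?g = "inv_into (points T) f"
  show "?g ` points T' \<subseteq> points T" using bij_betw_inv_into[OF f(2)] by (simp add: bij_betw_def)
  fix g p assume g: "g \<in> carrier H" and p: "p \<in> points T'"
  have 1: "?g p \<in> points T" using bij_betwE[OF bij_betw_inv_into[OF f(2)]] p by simp
  have "f (pact T g (?g p)) = pact T' g (f (?g p))"
    using f(1) g 1 unfolding equivariant_map_def by simp
  also have "f (?g p) = p" by (rule bij_betw_inv_into_right[OF f(2) p])
  finally show "?g (pact T' g p) = pact T g (?g p)"
    using bij_betw_inv_into_left[OF f(2) pact_in[OF g 1]] by simp
qed

lemma equiv_isometric_sym: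
  assumes iso: "equiv_isometric H T T'" and T: "metric_tree H T"
  shows "equiv_isometric H T' T"
proof -
  obtain f where f: "equivariant_map H T T' f" "bij_betw f (points T) (points T')"
    "\<forall>p \<in> points T. \<forall>q \<in> points T. tdist T' (f p) (f q) = tdist T p q"
    using iso unfolding equiv_isometric_def by (elim exE conjE) (rule that)
  let ?g = "inv_into (points T) f"
  have "tdist T (?g p) (?g q) = tdist T' p q" if "p \<in> points T'" "q \<in> points T'" for p q
    using f(3) bij_betwE[OF bij_betw_inv_into[OF f(2)]] that bij_betw_inv_into_right[OF f(2)] by metis
  then show ?thesis
    unfolding equiv_isometric_def using equivariant_map_inv[OF f(1,2) T] bij_betw_inv_into[OF f(2)]
    by (intro exI[of _ ?g]) simp
qed

text \<open>An isometry of realisations need not map vertices to vertices. But if a fixed vertex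
  goes to a point inside an edge, trivial edge stabilisers make every element of \<open>S\<close>
  trivial, and any vertex is fixed.\<close>

lemma elliptic_isometric:
  assumes T: "metric_tree H T" "metric_tree H T'" and iso: "equiv_isometric H T T'"
    and tes: "trivial_edge_stabilisers H T'" and S: "S \<subseteq> carrier H" "elliptic T S"
  shows "elliptic T' S"
proof -
  interpret A: htree H T by unfold_locales fact
  interpret B: htree H T' by unfold_locales fact
  obtain f where f: "equivariant_map H T T' f"
    using iso unfolding equiv_isometric_def by (elim exE conjE) (rule that)
  obtain x where x: "x \<in> tverts T" "\<And>g. g \<in> S \<Longrightarrow> act T g x = x" using S(2) by (auto simp: elliptic_def)
  have p: "f (vpt x) \<in> points T'" using f vpt_in[OF x(1)] by (auto simp: equivariant_map_def)
  have fix_p: "pact T' g (f (vpt x)) = f (vpt x)" if "g \<in> S" for g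
  proof -
    have g: "g \<in> carrier H" using that S by blast
    have "f (pact T g (vpt x)) = pact T' g (f (vpt x))"
      using f g vpt_in[OF x(1)] unfolding equivariant_map_def by simp
    then show ?thesis using A.pact_vpt[OF g x(1)] x(2)[OF that] by simp
  qed
  obtain a b t where r: "rep (tgraph T') a b t" "f (vpt x) = pt a b t" using p by (rule realisationE)
  have V: "a \<in> tverts T'" "b \<in> tverts T'" using B.rep_V[OF r(1)] by auto
  consider u where "u \<in> tverts T'" "f (vpt x) = vpt u" | "(a, b) \<in> tarcs T'" "0 < t" "t < 1"
  proof -
    show thesis
      using that(1)[of a] that(1)[of b] that(2) r V
      by (cases "t = 0"; cases "t = 1"; cases "a = b") (simp_all add: rep_def)
  qed
  then show ?thesis
  proof cases
    case 1
    have "act T' g u = u" if "g \<in> S" for g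
      using fix_p[OF that] 1 B.pact_vpt[of g u] that S by auto
    then show ?thesis using 1 by (auto simp: elliptic_def)
  next
    case 2
    have "act T' g a = a" if "g \<in> S" for g
    proof -
      have g: "g \<in> carrier H" using that S by blast
      have "pt (act T' g a) (act T' g b) t = pt a b t"
        using fix_p[OF that] r B.pact_pt[OF g r(1)] by simp
      from pt_eqD[OF this] 2 have "{act T' g a, act T' g b} = {a, b}"
        using B.irrefl[OF 2(1)] by auto
      then have "g = \<one>\<^bsub>H\<^esub>" using tes 2(1) g unfolding trivial_edge_stabilisers_def by blast
      then show ?thesis using B.act_one V by simp
    qed
    then show ?thesis using V by (auto simp: elliptic_def)
  qed
qed

text \<open>The target type and the map \<open>q\<close> are left open and only the fibres are
  prescribed. The same theory then serves for components as sets of vertices, for chosen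
  representatives, and for the identity.\<close>

locale collapsing = htree H T for H :: "('h, 'b) monoid_scheme" and T :: "('h, 'x) gtree" +
  fixes A :: "'x rel" and q :: "'x \<Rightarrow> 'y"
  assumes A_E: "A \<subseteq> tarcs T"
    and A_sym: "(u, v) \<in> A \<Longrightarrow> (v, u) \<in> A"
    and A_act: "g \<in> carrier H \<Longrightarrow> (u, v) \<in> A \<Longrightarrow> (act T g u, act T g v) \<in> A"
    and q_eq: "u \<in> tverts T \<Longrightarrow> v \<in> tverts T \<Longrightarrow> q u = q v \<longleftrightarrow> (u, v) \<in> A\<^sup>*"
begin

lemma side_A:
  assumes "(u, v) \<in> A\<^sup>*" "e \<in> E - A"
  shows "side E e u = side E e v"
  using assms(1)
proof induction
  case (step v w)
  have "e \<noteq> (v, w)" "e \<noteq> (w, v)" using assms step A_sym by auto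
  then show ?case using side_eq[of v w e] step A_E by auto
qed simp

lemma EA_sym: "(u, v) \<in> E - A \<Longrightarrow> (v, u) \<in> E - A"
  using sym A_sym by blast

lemma A_V: "(u, v) \<in> A\<^sup>* \<Longrightarrow> u \<in> V \<Longrightarrow> v \<in> V"
  by (induction rule: rtrancl_induct) (use A_E wf in auto)

lemma side_q: "u \<in> V \<Longrightarrow> v \<in> V \<Longrightarrow> q u = q v \<Longrightarrow> e \<in> E - A \<Longrightarrow> side E e u = side E e v"
  using q_eq side_A by blast

lemma q_neq: "(u, v) \<in> E - A \<Longrightarrow> q u \<noteq> q v"
  using side_q[of u v "(u, v)"] wf side_fst side_snd by fastforce

text \<open>An arc outside \<open>A\<close> is the only one leading from its side 0 to its side 1,
  and both sides are unions of fibres of \<open>q\<close>. So collapsing creates no multiple edges,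
  and every edge of the collapse has a unique lift.\<close>

lemma q_arc_inj:
  assumes ab: "(a, b) \<in> E - A" and uv: "(u, v) \<in> E" and "q u = q a" "q v = q b"
  shows "u = a \<and> v = b"
proof -
  have "side E (a, b) u = 0" "side E (a, b) v = 1"
    using side_q[of u a "(a, b)"] side_q[of v b "(a, b)"] assms wf side_fst side_snd by auto
  then have "\<not> ((a, b) \<noteq> (u, v) \<and> (a, b) \<noteq> (v, u))" using side_eq[OF uv, of "(a, b)"] by auto
  moreover have "(a, b) \<noteq> (v, u)" using \<open>side E (a, b) u = 0\<close> side_snd ab by auto
  ultimately show ?thesis by blast
qed

lemma A_act_star: "g \<in> carrier H \<Longrightarrow> (u, v) \<in> A\<^sup>* \<Longrightarrow> (act T g u, act T g v) \<in> A\<^sup>*"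
  by (erule rtrancl_induct) (auto intro: rtrancl_into_rtrancl A_act)

lemma A_act_iff:
  assumes "g \<in> carrier H" "(u, v) \<in> E"
  shows "(act T g u, act T g v) \<in> A \<longleftrightarrow> (u, v) \<in> A"
  using A_act[of g u v] A_act[of "inv\<^bsub>H\<^esub> g" "act T g u" "act T g v"] assms
    act_inv(1)[OF assms(1)] wf[OF assms(2)] by auto

lemma q_act:
  assumes "g \<in> carrier H" "u \<in> V" "v \<in> V" "q u = q v"
  shows "q (act T g u) = q (act T g v)"
proof -
  have "(act T g u, act T g v) \<in> A\<^sup>*" using q_eq[OF assms(2,3)] A_act_star[OF assms(1)] assms(4) by simp
  then show ?thesis using q_eq[OF act_V[OF assms(1,2)] act_V[OF assms(1,3)]] by simp
qed

end

text \<open>The collapsed tree is specified by properties and not by a formula;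
  \<open>quotient_trees_isometric\<close> shows that this determines it up to equivariant
  isometry.\<close>

locale quotient_tree = collapsing H T A q
  for H :: "('h, 'b) monoid_scheme" and T :: "('h, 'x) gtree" and A and q :: "'x \<Rightarrow> 'y" +
  fixes Y :: "('h, 'y) gtree"
  assumes Y_V: "tverts Y = q ` tverts T"
    and Y_E: "tarcs Y = {(q u, q v) | u v. (u, v) \<in> tarcs T - A}"
    and Y_len: "(u, v) \<in> tarcs T - A \<Longrightarrow> len Y (q u, q v) = len T (u, v)"
    and Y_act: "g \<in> carrier H \<Longrightarrow> v \<in> tverts T \<Longrightarrow> act Y g (q v) = q (act T g v)"
    and Y_ext: "g \<in> carrier H \<Longrightarrow> act Y g \<in> extensional (tverts Y)"
begin

lemma Y_arcE:
  assumes "(x, y) \<in> tarcs Y"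
  obtains u v where "(u, v) \<in> E - A" "x = q u" "y = q v" "u \<in> V" "v \<in> V"
  using assms wf unfolding Y_E by blast

lemma Y_arcI: "(u, v) \<in> E - A \<Longrightarrow> (q u, q v) \<in> tarcs Y"
  unfolding Y_E by blast

text \<open>The sides of an arc outside \<open>A\<close> are unions of fibres. A detour around its
  image would consist of images of other arcs, and none of these changes the side.\<close>

lemma stree_Y: "stree (tverts Y) (tarcs Y)"
proof
  fix x y assume xy: "(x, y) \<in> tarcs Y"
  then obtain a b where ab: "(a, b) \<in> E - A" "x = q a" "y = q b" "a \<in> V" "b \<in> V" by (rule Y_arcE)
  show "x \<in> tverts Y \<and> y \<in> tverts Y" using ab by (simp add: Y_V)
  show "(y, x) \<in> tarcs Y" using Y_arcI[OF EA_sym[OF ab(1)]] ab by simp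
  show "x \<noteq> y" using ab q_neq by simp
  have "\<forall>w \<in> V. q w = z \<longrightarrow> side E (a, b) w = 1" if "(y, z) \<in> (tarcs Y - {(x, y), (y, x)})\<^sup>*" for z
    using that
  proof (induction rule: rtrancl_induct)
    case base
    then show ?case using ab side_q[of _ b "(a, b)"] side_snd by auto
  next
    case (step z z')
    obtain u v where uv: "(u, v) \<in> E - A" "z = q u" "z' = q v" "u \<in> V" "v \<in> V"
      using step(2) by (auto elim: Y_arcE)
    have "(a, b) \<noteq> (u, v)" "(a, b) \<noteq> (v, u)" using step(2) uv ab by auto
    then have "side E (a, b) v = 1" using side_eq[of u v "(a, b)"] uv step(3) by auto
    then show ?case using uv side_q[of _ v "(a, b)"] ab by auto
  qed
  then have "\<not> (y, x) \<in> (tarcs Y - {(x, y), (y, x)})\<^sup>*" using ab side_fst by force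
  then show "(y, x) \<notin> (tarcs Y - {(x, y), (y, x)})\<^sup>*" .
next
  show "tverts Y \<noteq> {}" using nonempty by (simp add: Y_V)
next
  have step: "(q u, q v) \<in> (tarcs Y)\<^sup>*" if "(u, v) \<in> E" for u v
  proof (cases "(u, v) \<in> A")
    case True
    then have "q u = q v" using q_eq wf that by blast
    then show ?thesis by simp
  next
    case False
    then show ?thesis using that Y_arcI by blast
  qed
  have "(q u, q v) \<in> (tarcs Y)\<^sup>*" if "(u, v) \<in> E\<^sup>*" for u v
    using that by induction (use step in \<open>auto intro: rtrancl_trans\<close>)
  then show "(x, y) \<in> (tarcs Y)\<^sup>*" if "x \<in> tverts Y" "y \<in> tverts Y" for x y
    using that conn by (auto simp: Y_V)
qed

lemma metric_tree_Y: "metric_tree H Y"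
  unfolding metric_tree_def
proof (intro conjI ballI)
  show "simplicial_tree (tgraph Y)" using stree_Y by (rule stree_simplicial_tree)
  fix e assume "e \<in> tarcs Y"
  then obtain u v where uv: "(u, v) \<in> E - A" "e = (q u, q v)" "u \<in> V" "v \<in> V"
    by (cases e) (auto elim: Y_arcE)
  show "case e of (x, y) \<Rightarrow> 0 < len Y (x, y) \<and> len Y (y, x) = len Y (x, y)"
    using uv Y_len[OF uv(1)] Y_len[OF EA_sym[OF uv(1)]] len_pos len_sym by auto
next
  show "group_action H (tverts Y) (act Y)"
    by (rule group_actionI[OF group_H Y_ext]) (auto simp: Y_V Y_act act_V act_one act_mult)
next
  fix g e assume g: "g \<in> carrier H" and "e \<in> tarcs Y"
  then obtain u v where uv: "(u, v) \<in> E - A" "e = (q u, q v)" "u \<in> V" "v \<in> V"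
    by (cases e) (auto elim: Y_arcE)
  have "(act T g u, act T g v) \<in> E - A" using uv A_act_iff g act_E by auto
  then show "case e of (x, y) \<Rightarrow> (act Y g x, act Y g y) \<in> tarcs Y \<and> len Y (act Y g x, act Y g y) = len Y (x, y)"
    using uv Y_act[OF g] Y_arcI Y_len[of u v] Y_len act_len[OF g] by auto
qed

sublocale Y: htree H Y
  by unfold_locales (rule metric_tree_Y)

text \<open>An element preserving an edge of the collapse preserves its unique lift.\<close>

lemma trivial_edge_stabilisers_Y:
  assumes "trivial_edge_stabilisers H T"
  shows "trivial_edge_stabilisers H Y"
  unfolding trivial_edge_stabilisers_def
proof (clarify)
  fix x y g assume "(x, y) \<in> tarcs Y" and g: "g \<in> carrier H" and eq: "{act Y g x, act Y g y} = {x, y}"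
  then obtain u v where uv: "(u, v) \<in> E - A" "x = q u" "y = q v" "u \<in> V" "v \<in> V" by (auto elim: Y_arcE)
  have guv: "(act T g u, act T g v) \<in> E" "(act T g v, act T g u) \<in> E" using uv g act_E sym by auto
  have "q (act T g u) = q u \<and> q (act T g v) = q v \<or> q (act T g v) = q u \<and> q (act T g u) = q v"
    using eq uv Y_act[OF g] by (auto simp: doubleton_eq_iff)
  then have "{act T g u, act T g v} = {u, v}"
    using q_arc_inj[OF uv(1) guv(1)] q_arc_inj[OF uv(1) guv(2)] by auto
  then show "g = \<one>\<^bsub>H\<^esub>" using assms uv g unfolding trivial_edge_stabilisers_def by blast
qed

text \<open>The preimage of an invariant subtree is an invariant subtree of \<open>T\<close>, hence
  all of \<open>T\<close>.\<close>

lemma minimal_tree_Y: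
  assumes "minimal_tree H T"
  shows "minimal_tree H Y"
  unfolding minimal_tree_def
proof (intro allI impI)
  fix A' :: "'y pair_pre_digraph"
  assume A': "invariant_subgraph H Y A' \<and> simplicial_tree A'"
  interpret A': stree "pverts A'" "parcs A'" using A' simplicial_tree_stree by blast
  have sub: "pverts A' \<subseteq> tverts Y" "parcs A' \<subseteq> tarcs Y"
    and inv: "\<And>g v. g \<in> carrier H \<Longrightarrow> v \<in> pverts A' \<Longrightarrow> act Y g v \<in> pverts A'"
      "\<And>g u v. g \<in> carrier H \<Longrightarrow> (u, v) \<in> parcs A' \<Longrightarrow> (act Y g u, act Y g v) \<in> parcs A'"
    using A' unfolding invariant_subgraph_def subgraph_def by auto
  \<comment> \<open>Arcs in \<open>A\<close> have no image arc; they belong to the preimage if the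
    vertex to which they collapse does.\<close>
  define B where "B = \<lparr>pverts = {v \<in> V. q v \<in> pverts A'},
    parcs = {(u, v) \<in> A. q u \<in> pverts A'} \<union> {(u, v) \<in> E - A. (q u, q v) \<in> parcs A'}\<rparr>"
  have BV: "v \<in> pverts B \<longleftrightarrow> v \<in> V \<and> q v \<in> pverts A'" for v by (simp add: B_def)
  have BE: "(u, v) \<in> parcs B \<longleftrightarrow> (u, v) \<in> E \<and>
      (if (u, v) \<in> A then q u \<in> pverts A' else (q u, q v) \<in> parcs A')" for u v
    using A_E by (auto simp: B_def)
  have qA: "q u = q v" if "(u, v) \<in> A" for u v using q_eq wf that A_E by blast
  have wfB: "a \<in> pverts B \<and> b \<in> pverts B" if "(a, b) \<in> parcs B" for a b
  proof (cases "(a, b) \<in> A")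
    case True
    then show ?thesis using that qA[OF True] wf[of a b] by (simp add: BV BE)
  next
    case False
    then show ?thesis using that A'.wf[of "q a" "q b"] wf[of a b] by (simp add: BV BE)
  qed
  have symB: "(b, a) \<in> parcs B" if "(a, b) \<in> parcs B" for a b
  proof (cases "(a, b) \<in> A")
    case True
    then show ?thesis using that qA[OF True] sym[of a b] A_sym[of a b] by (simp add: BE)
  next
    case False
    then have "(b, a) \<notin> A" using A_sym by blast
    then show ?thesis using that False A'.sym[of "q a" "q b"] sym[of a b] by (simp add: BE)
  qed
  have A_B: "(u, v) \<in> (parcs B)\<^sup>*" if "(u, v) \<in> A\<^sup>*" "u \<in> V" "q u \<in> pverts A'" for u v
    using that(1)
  proof induction
    case (step v w)
    have "q v = q u" using step(1) that q_eq A_V by metis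
    then have "(v, w) \<in> parcs B" using step(2) that A_E BE by auto
    then show ?case using step(3) by simp
  qed simp
  have connB: "(u, w) \<in> (parcs B)\<^sup>*" if u: "u \<in> pverts B" and w: "w \<in> pverts B" for u w
  proof -
    have "\<forall>w \<in> V. q w = z \<longrightarrow> (u, w) \<in> (parcs B)\<^sup>*" if "(q u, z) \<in> (parcs A')\<^sup>*" for z
      using that
    proof (induction rule: rtrancl_induct)
      case base
      then show ?case using A_B u q_eq BV by metis
    next
      case (step y z)
      have "(y, z) \<in> tarcs Y" using step(2) sub by blast
      then obtain a b where ab: "(a, b) \<in> E - A" "y = q a" "z = q b" "a \<in> V" "b \<in> V" by (rule Y_arcE)
      have "(u, a) \<in> (parcs B)\<^sup>*" using step(3) ab by blast
      moreover have "(a, b) \<in> parcs B" using ab step(2) by (simp add: BE)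
      moreover have "(b, w) \<in> (parcs B)\<^sup>*" if "w \<in> V" "q w = z" for w
        using A_B[of b w] q_eq[of b w] that ab A'.wf[OF step(2)] by simp
      ultimately show ?case by (meson rtrancl.rtrancl_into_rtrancl rtrancl_trans)
    qed
    moreover have "(q u, q w) \<in> (parcs A')\<^sup>*" using A'.conn u w BV by blast
    ultimately show ?thesis using w BV by blast
  qed
  have "stree (pverts B) (parcs B)"
  proof (rule stree_sub[OF stree_axioms])
    obtain y where "y \<in> pverts A'" using A'.nonempty by blast
    then show "pverts B \<noteq> {}" using sub BV unfolding Y_V by blast
    show "pverts B \<subseteq> V" using BV by blast
    show "parcs B \<subseteq> E" using A_E by (auto simp: B_def)
  qed (rule wfB symB connB; assumption)+
  then have "simplicial_tree B" by (rule stree_simplicial_tree)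
  moreover have "invariant_subgraph H T B"
    unfolding invariant_subgraph_def
  proof (intro conjI ballI)
    have "wf_digraph (with_proj B)"
      by (simp add: wf_digraph_wp_iff pair_wf_digraph_def) (use wfB in auto)
    moreover have "wf_digraph (with_proj (tgraph T))"
      by (simp add: wf_digraph_wp_iff pair_wf_digraph_def) (use wf in auto)
    ultimately show "subgraph (with_proj B) (with_proj (tgraph T))"
      unfolding subgraph_def using BV BE by auto
    show "symmetric (with_proj B)" using symB by (auto simp: symmetric_def intro: symI)
    show "act T g v \<in> pverts B" if "g \<in> carrier H" "v \<in> pverts B" for g v
      using that inv(1)[of g "q v"] Y_act[of g v] act_V by (simp add: BV)
    fix g e assume g: "g \<in> carrier H" and e: "e \<in> parcs B"
    obtain u v where uv: "e = (u, v)" by (cases e)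
    have V: "u \<in> V" "v \<in> V" "(u, v) \<in> E" using e uv BE wf by auto
    show "case e of (u, v) \<Rightarrow> (act T g u, act T g v) \<in> parcs B"
      using e inv[OF g] Y_act[OF g] V g act_E[OF g V(3)] A_act_iff[OF g V(3)] unfolding uv
      by (force simp: BE)
  qed
  ultimately have BT: "B = tgraph T" using assms by (simp add: minimal_tree_def)
  show "A' = tgraph Y"
  proof (rule pair_pre_digraph.equality)
    have "q v \<in> pverts A'" if "v \<in> V" for v using BV[of v] BT that by simp
    then show "pverts A' = tverts Y" using sub by (auto simp: Y_V)
    have "(q u, q v) \<in> parcs A'" if "(u, v) \<in> E - A" for u v using BE[of u v] BT that by simp
    then show "parcs A' = tarcs Y" using sub by (auto simp: Y_E)
  qed simp
qed

end

lemma quotient_trees_isometric: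
  fixes T :: "('h, 'x) gtree" and q1 :: "'x \<Rightarrow> 'y" and q2 :: "'x \<Rightarrow> 'z"
  assumes "quotient_tree H T A q1 Y1" "quotient_tree H T A q2 Y2"
  shows "equiv_isometric H Y1 Y2"
proof -
  interpret Q1: quotient_tree H T A q1 Y1 by fact
  interpret Q2: quotient_tree H T A q2 Y2 by fact
  \<comment> \<open>Independent of the chosen preimage, since both maps have the components of
    \<open>A\<close> as their fibres.\<close>
  define \<theta> where "\<theta> y = q2 (inv_into (tverts T) q1 y)" for y
  have \<theta>: "\<theta> (q1 v) = q2 v" if v: "v \<in> tverts T" for v
  proof -
    let ?w = "inv_into (tverts T) q1 (q1 v)"
    have "?w \<in> tverts T" "q1 ?w = q1 v" using v by (auto intro: inv_into_into f_inv_into_f)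
    then show ?thesis unfolding \<theta>_def using Q1.q_eq Q2.q_eq v by metis
  qed
  have q12: "q1 u = q1 v \<longleftrightarrow> q2 u = q2 v" if "u \<in> tverts T" "v \<in> tverts T" for u v
    using Q1.q_eq Q2.q_eq that by simp
  show ?thesis
  proof (rule equiv_isometricI[OF Q1.metric_tree_Y Q2.metric_tree_Y, of \<theta>])
    have "inj_on \<theta> (tverts Y1)" by (rule inj_onI) (use \<theta> q12 in \<open>auto simp: Q1.Y_V\<close>)
    moreover have "\<theta> ` tverts Y1 = tverts Y2"
      unfolding Q1.Y_V Q2.Y_V image_image using \<theta> by (intro image_cong) auto
    ultimately show "bij_betw \<theta> (tverts Y1) (tverts Y2)" by (simp add: bij_betw_def)
    show "(\<theta> x, \<theta> y) \<in> tarcs Y2 \<longleftrightarrow> (x, y) \<in> tarcs Y1" if xy: "x \<in> tverts Y1" "y \<in> tverts Y1" for x y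
    proof -
      obtain u v where uv: "u \<in> tverts T" "v \<in> tverts T" "x = q1 u" "y = q1 v" using xy by (auto simp: Q1.Y_V)
      have "(q2 u, q2 v) \<in> tarcs Y2 \<longleftrightarrow> (\<exists>a b. (a, b) \<in> tarcs T - A \<and> q2 u = q2 a \<and> q2 v = q2 b)"
        unfolding Q2.Y_E by auto
      also have "\<dots> \<longleftrightarrow> (\<exists>a b. (a, b) \<in> tarcs T - A \<and> q1 u = q1 a \<and> q1 v = q1 b)"
        using q12 uv Q1.wf by (metis DiffD1)
      also have "\<dots> \<longleftrightarrow> (q1 u, q1 v) \<in> tarcs Y1" unfolding Q1.Y_E by auto
      finally show ?thesis using uv \<theta> by simp
    qed
    show "len Y2 (\<theta> x, \<theta> y) = len Y1 (x, y)" if "(x, y) \<in> tarcs Y1" for x y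
      using that by (rule Q1.Y_arcE) (simp add: \<theta> Q1.Y_len Q2.Y_len)
    show "\<theta> (act Y1 g x) = act Y2 g (\<theta> x)" if "g \<in> carrier H" "x \<in> tverts Y1" for g x
      using that by (auto simp: Q1.Y_V Q1.Y_act Q2.Y_act \<theta> Q1.act_V)
  qed
qed

text \<open>A tree is its own collapse with \<open>A\<close> empty; this lets points of outer space
  and points at infinity be treated alike.\<close>

lemma quotient_tree_id:
  assumes "metric_tree H T"
  shows "quotient_tree H T {} id T"
proof -
  interpret htree H T by unfold_locales fact
  have "act T g \<in> extensional V" if "g \<in> carrier H" for g
    using ga.bij_prop0[OF that] by (simp add: Bij_def)
  then show ?thesis by unfold_locales auto
qed

section \<open>Concrete models of the collapse\<close>

definition quot :: "('x \<Rightarrow> 'y) \<Rightarrow> ('h, 'x) gtree \<Rightarrow> 'x rel \<Rightarrow> ('h, 'y) gtree" where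
  "quot q T A = \<lparr>tgraph = \<lparr>pverts = q ` tverts T, parcs = {(q u, q v) | u v. (u, v) \<in> tarcs T - A}\<rparr>,
     len = (\<lambda>e. THE l. \<exists>(u, v) \<in> tarcs T - A. e = (q u, q v) \<and> l = len T (u, v)),
     act = (\<lambda>g. \<lambda>y \<in> q ` tverts T. q (act T g (inv_into (tverts T) q y)))\<rparr>"

context collapsing
begin

lemma the_len:
  assumes "(a, b) \<in> E - A"
  shows "(THE l. \<exists>(u, v) \<in> E - A. (q a, q b) = (q u, q v) \<and> l = len T (u, v)) = len T (a, b)"
proof (rule the_equality)
  show "\<exists>(u, v) \<in> E - A. (q a, q b) = (q u, q v) \<and> len T (a, b) = len T (u, v)" using assms by blast
  fix l assume "\<exists>(u, v) \<in> E - A. (q a, q b) = (q u, q v) \<and> l = len T (u, v)"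
  then obtain u v where "(u, v) \<in> E" "q u = q a" "q v = q b" "l = len T (u, v)" by auto
  then show "l = len T (a, b)" using q_arc_inj[OF assms] by blast
qed

lemma quotient_tree_quot: "quotient_tree H T A q (quot q T A)"
proof
  show "tverts (quot q T A) = q ` tverts T"
    "tarcs (quot q T A) = {(q u, q v) | u v. (u, v) \<in> tarcs T - A}" by (simp_all add: quot_def)
  show "act (quot q T A) g \<in> extensional (tverts (quot q T A))" for g by (simp add: quot_def)
  show "len (quot q T A) (q u, q v) = len T (u, v)" if "(u, v) \<in> tarcs T - A" for u v
    using the_len[OF that] by (simp add: quot_def)
  show "act (quot q T A) g (q v) = q (act T g v)" if g: "g \<in> carrier H" and v: "v \<in> tverts T" for g v
  proof -
    have w: "inv_into V q (q v) \<in> V" "q (inv_into V q (q v)) = q v"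
      using v by (auto intro: inv_into_into f_inv_into_f)
    show ?thesis using q_act[OF g w(1) v w(2)] v by (simp add: quot_def)
  qed
qed

end

lemma comp_of_eq:
  assumes "\<And>u v. (u, v) \<in> parcs A \<Longrightarrow> (v, u) \<in> parcs A"
  shows "comp_of A u = comp_of A v \<longleftrightarrow> (u, v) \<in> (parcs A)\<^sup>*"
proof -
  have "sym ((parcs A)\<^sup>*)" using assms by (intro sym_rtrancl) (auto intro: symI)
  then show ?thesis
    unfolding comp_of_def by (auto dest: symD intro: rtrancl_trans)
qed

lemma quotient_tree_collapse:
  assumes "collapsing H T (parcs A) (comp_of A)"
  shows "quotient_tree H T (parcs A) (comp_of A) (collapse T A)"
proof -
  interpret collapsing H T "parcs A" "comp_of A" by fact
  show ?thesis
  proof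
    show "tverts (collapse T A) = comp_of A ` tverts T"
      "tarcs (collapse T A) = {(comp_of A u, comp_of A v) | u v. (u, v) \<in> tarcs T - parcs A}"
      by (simp_all add: collapse_def)
    show "act (collapse T A) g \<in> extensional (tverts (collapse T A))" for g by (simp add: collapse_def)
    show "len (collapse T A) (comp_of A u, comp_of A v) = len T (u, v)"
      if "(u, v) \<in> tarcs T - parcs A" for u v
      using the_len[OF that] by (simp add: collapse_def)
    show "act (collapse T A) g (comp_of A v) = comp_of A (act T g v)"
      if g: "g \<in> carrier H" and v: "v \<in> tverts T" for g v
    proof -
      have "act T g ` comp_of A v = comp_of A (act T g v)"
      proof (intro equalityI subsetI)
        fix x assume "x \<in> act T g ` comp_of A v"
        then show "x \<in> comp_of A (act T g v)" using A_act_star[OF g] by (auto simp: comp_of_def)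
      next
        fix x assume "x \<in> comp_of A (act T g v)"
        then have x: "(act T g v, x) \<in> (parcs A)\<^sup>*" by (simp add: comp_of_def)
        have xV: "x \<in> V" using A_V[OF x] act_V g v by simp
        have "(v, act T (inv\<^bsub>H\<^esub> g) x) \<in> (parcs A)\<^sup>*"
          using A_act_star[OF inv_closed[OF g] x] act_inv(1)[OF g v] by simp
        then have "act T (inv\<^bsub>H\<^esub> g) x \<in> comp_of A v" by (simp add: comp_of_def)
        moreover have "x = act T g (act T (inv\<^bsub>H\<^esub> g) x)" using act_inv(2)[OF g xV] by simp
        ultimately show "x \<in> act T g ` comp_of A v" by blast
      qed
      then show ?thesis using v by (simp add: collapse_def)
    qed
  qed
qed

text \<open>
  Collapsing turns vertices into sets of vertices; naming each component by one of its elements keeps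
  the vertex type, so that the result is again comparable with trees of the original type.
\<close>

definition choose_rep :: "'x pair_pre_digraph \<Rightarrow> 'x \<Rightarrow> 'x" where
  "choose_rep A v = (SOME w. w \<in> comp_of A v)"

lemma choose_rep_eq:
  assumes "\<And>u v. (u, v) \<in> parcs A \<Longrightarrow> (v, u) \<in> parcs A"
  shows "choose_rep A u = choose_rep A v \<longleftrightarrow> (u, v) \<in> (parcs A)\<^sup>*"
proof
  have mem: "choose_rep A x \<in> comp_of A x" for x
    unfolding choose_rep_def by (rule someI[of _ x]) (simp add: comp_of_def)
  have sy: "(y, x) \<in> (parcs A)\<^sup>*" if "(x, y) \<in> (parcs A)\<^sup>*" for x y
    using that assms by (meson sym_rtrancl symD symI)
  assume "choose_rep A u = choose_rep A v"
  then have "(u, choose_rep A u) \<in> (parcs A)\<^sup>*" "(choose_rep A u, v) \<in> (parcs A)\<^sup>*"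
    using mem[of u] mem[of v] sy by (auto simp: comp_of_def)
  then show "(u, v) \<in> (parcs A)\<^sup>*" by (rule rtrancl_trans)
next
  assume "(u, v) \<in> (parcs A)\<^sup>*"
  then show "choose_rep A u = choose_rep A v" using comp_of_eq[OF assms] by (metis choose_rep_def)
qed

lemma invariant_subgraphD:
  assumes "invariant_subgraph H T A"
  shows "parcs A \<subseteq> tarcs T" "(u, v) \<in> parcs A \<Longrightarrow> (v, u) \<in> parcs A"
    "g \<in> carrier H \<Longrightarrow> (u, v) \<in> parcs A \<Longrightarrow> (act T g u, act T g v) \<in> parcs A"
  using assms unfolding invariant_subgraph_def subgraph_def symmetric_def by (auto dest: symD)

lemma collapsing_comp_of:
  assumes "metric_tree H T" "invariant_subgraph H T A"
  shows "collapsing H T (parcs A) (comp_of A)" "collapsing H T (parcs A) (choose_rep A)"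
  using assms(1) invariant_subgraphD[OF assms(2)] comp_of_eq[of A] choose_rep_eq[of A]
  by (auto simp: collapsing_def htree_def collapsing_axioms_def)

text \<open>New lengths on the collapse are pulled back to the edges outside \<open>A\<close>, while
  those in \<open>A\<close> keep their old lengths. In this way a change of lengths at infinity
  comes from a change of the tree being collapsed.\<close>

lemma quotient_tree_relen:
  assumes "quotient_tree H T A q Y" "inv_len H Y l"
  defines "l0 \<equiv> (\<lambda>(u, v). if (u, v) \<in> A then len T (u, v) else l (q u, q v))"
  shows "inv_len H T l0" "quotient_tree H (relen l0 T) A q (relen l Y)"
proof -
  interpret quotient_tree H T A q Y by fact
  have l0: "l0 (u, v) = (if (u, v) \<in> A then len T (u, v) else l (q u, q v))" for u v by (simp add: l0_def)
  show inv: "inv_len H T l0"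
    unfolding inv_len_def
  proof (clarify, intro conjI ballI)
    fix u v assume uv: "(u, v) \<in> E"
    have V: "u \<in> V" "v \<in> V" using wf uv by auto
    have s: "(v, u) \<in> A \<longleftrightarrow> (u, v) \<in> A" using A_sym by blast
    show "0 < l0 (u, v)" "l0 (v, u) = l0 (u, v)"
      using len_pos[OF uv] len_sym[OF uv] inv_lenD(1,2)[OF assms(2) Y_arcI, of u v] s uv by (auto simp: l0)
    fix g assume g: "g \<in> carrier H"
    show "l0 (act T g u, act T g v) = l0 (u, v)"
      using act_len[OF g uv] inv_lenD(3)[OF assms(2) Y_arcI g, of u v] A_act_iff[OF g uv] uv V Y_act[OF g]
      by (auto simp: l0)
  qed
  have "metric_tree H (relen l0 T)" by (rule metric_tree_relen[OF mt inv])
  then show "quotient_tree H (relen l0 T) A q (relen l Y)"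
    by unfold_locales (auto simp: A_E A_sym A_act q_eq Y_V Y_E Y_act Y_ext[unfolded Y_V] l0)
qed

section \<open>The fundamental group of a graph of groups\<close>

lemma elem_step_ctx: "elem_step G a b \<Longrightarrow> elem_step G (p @ a @ q) (p @ b @ q)"
proof (induction rule: elem_step.induct)
  case (elem_mult p' v g h q')
  show ?case using elem_step.elem_mult[of G "p @ p'" v g h "q' @ q"] by simp
next
  case (elem_one p' v q')
  show ?case using elem_step.elem_one[of G "p @ p'" v "q' @ q"] by simp
next
  case (elem_cancel p' e b q')
  show ?case using elem_step.elem_cancel[of G "p @ p'" e b "q' @ q"] by simp
qed

text \<open>All intermediate words have to be paths from \<open>u\<close> to \<open>v\<close>; for
  loops at the base vertex this is the relation \<open>loop_equiv\<close>. General ends are needed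
  to cut loops into pieces.\<close>

definition peq :: "('v, 'e, 'g) gog \<Rightarrow> 'v \<Rightarrow> 'v \<Rightarrow> ('v, 'e, 'g) letter list \<Rightarrow> ('v, 'e, 'g) letter list \<Rightarrow> bool" where
  "peq G u v = equivclp (\<lambda>a b. gpath G u a v \<and> gpath G u b v \<and> elem_step G a b)"

definition inv_path :: "('v, 'e, 'g) gog \<Rightarrow> ('v, 'e, 'g) letter list \<Rightarrow> ('v, 'e, 'g) letter list" where
  "inv_path G p = rev (map (inv_letter G) p)"

definition cls :: "('v, 'e, 'g) gog \<Rightarrow> ('v, 'e, 'g) letter list \<Rightarrow> ('v, 'e, 'g) loop_class" where
  "cls G w = loop_equiv G `` {w}"

lemma inv_path_append: "inv_path G (p @ q) = inv_path G q @ inv_path G p"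
  by (simp add: inv_path_def)

lemma peq_refl: "peq G u v a a"
  by (simp add: peq_def)

lemma peq_sym: "peq G u v a b \<Longrightarrow> peq G u v b a"
  unfolding peq_def by (rule equivclp_sym)

lemma peq_trans: "peq G u v a b \<Longrightarrow> peq G u v b c \<Longrightarrow> peq G u v a c"
  unfolding peq_def by (rule equivclp_trans)

lemma peq_step: "gpath G u a v \<Longrightarrow> gpath G u b v \<Longrightarrow> elem_step G a b \<Longrightarrow> peq G u v a b"
  unfolding peq_def by (intro r_into_equivclp) simp

locale gog =
  fixes G :: "('v, 'e, 'g) gog"
  assumes gog: "graph_of_groups G"
begin

sublocale U: fin_digraph "ugraph G"
  using gog by (simp add: graph_of_groups_def)

lemma group_vgrp: "v \<in> verts (ugraph G) \<Longrightarrow> group (vgrp G v)"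
  using gog by (simp add: graph_of_groups_def)

lemma base_vert: "base G \<in> verts (ugraph G)"
  using gog by (simp add: graph_of_groups_def)

lemma gpath_verts: "gpath G u w v \<Longrightarrow> u \<in> verts (ugraph G) \<and> v \<in> verts (ugraph G)"
proof (induction w arbitrary: u)
  case (Cons l w)
  then show ?case by (cases l) (auto split: if_splits)
qed simp

lemma gpath_append: "gpath G u (a @ b) w \<longleftrightarrow> (\<exists>v. gpath G u a v \<and> gpath G v b w)"
proof (induction a arbitrary: u)
  case Nil
  then show ?case using gpath_verts by auto
next
  case (Cons l a)
  then show ?case by (cases l) auto
qed

lemma gpath_appendI: "gpath G u a v \<Longrightarrow> gpath G v b w \<Longrightarrow> gpath G u (a @ b) w"
  using gpath_append by blast

lemma peq_ctx:
  assumes "peq G u v a b" "gpath G t p u" "gpath G v q w"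
  shows "peq G t w (p @ a @ q) (p @ b @ q)"
  using assms(1) unfolding peq_def
proof (induction rule: equivclp_induct)
  case (step y z)
  have 1: "peq G t w (p @ y @ q) (p @ z @ q)"
    if "gpath G u y v" "gpath G u z v" "elem_step G y z" for y z
    by (rule peq_step) (use that assms(2,3) elem_step_ctx gpath_appendI in blast)+
  have "peq G t w (p @ y @ q) (p @ z @ q)"
    using step(2) 1[of y z] peq_sym[OF 1[of z y]] by blast
  with step(3) show ?case unfolding peq_def by (rule equivclp_trans)
qed simp

lemma letter_inverse:
  assumes "gpath G u [l] v"
  shows "gpath G v [inv_letter G l] u" "peq G u u [l, inv_letter G l] []"
    "peq G v v [inv_letter G l, l] []" "inv_letter G (inv_letter G l) = l"
proof -
  have uv: "u \<in> verts (ugraph G)" "v \<in> verts (ugraph G)" using assms gpath_verts by blast+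
  consider x g where "l = Vg x g" | e b where "l = Ed e b" by (cases l)
  then have "gpath G v [inv_letter G l] u \<and> peq G u u [l, inv_letter G l] [] \<and>
    peq G v v [inv_letter G l, l] [] \<and> inv_letter G (inv_letter G l) = l"
  proof cases
    case 1
    then have x: "l = Vg u g" "v = u" "g \<in> carrier (vgrp G u)" using assms by auto
    interpret gv: group "vgrp G u" using group_vgrp uv by blast
    have one: "peq G u u [Vg u \<one>\<^bsub>vgrp G u\<^esub>] []"
      using peq_step[OF _ _ elem_one[of G "[]" u "[]"]] uv by simp
    have prod: "peq G u u [Vg u g, Vg u h] [Vg u (g \<otimes>\<^bsub>vgrp G u\<^esub> h)]"
      if "g \<in> carrier (vgrp G u)" "h \<in> carrier (vgrp G u)" for g h
      using peq_step[OF _ _ elem_mult[of G "[]" u g h "[]"]] uv that by simp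
    have "peq G u u [Vg u g, Vg u (inv\<^bsub>vgrp G u\<^esub> g)] []"
      "peq G u u [Vg u (inv\<^bsub>vgrp G u\<^esub> g), Vg u g] []"
      using peq_trans[OF prod[of g "inv\<^bsub>vgrp G u\<^esub> g"]] peq_trans[OF prod[of "inv\<^bsub>vgrp G u\<^esub> g" g]] one x(3)
      by simp_all
    then show ?thesis using x uv by simp
  next
    case 2
    have inv: "gpath G v [inv_letter G l] u" using 2 assms uv by (cases b) auto
    have c: "gpath G u [l, inv_letter G l] u" "gpath G v [inv_letter G l, l] v"
      using gpath_appendI[OF assms inv] gpath_appendI[OF inv assms] by simp_all
    have p1: "peq G u u [l, inv_letter G l] []"
      by (rule peq_step[OF c(1)]) (use uv elem_cancel[of G "[]" e b "[]"] 2 in auto)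
    have p2: "peq G v v [inv_letter G l, l] []"
      by (rule peq_step[OF c(2)]) (use uv elem_cancel[of G "[]" e "\<not> b" "[]"] 2 in auto)
    show ?thesis by (intro conjI inv p1 p2) (simp add: 2)
  qed
  then show "gpath G v [inv_letter G l] u" "peq G u u [l, inv_letter G l] []"
    "peq G v v [inv_letter G l, l] []" "inv_letter G (inv_letter G l) = l" by auto
qed

lemma path_inverse:
  assumes "gpath G u p v"
  shows "gpath G v (inv_path G p) u \<and> peq G u u (p @ inv_path G p) [] \<and>
    peq G v v (inv_path G p @ p) [] \<and> inv_path G (inv_path G p) = p"
  using assms
proof (induction p arbitrary: u)
  case Nil
  then show ?case using peq_refl by (auto simp: inv_path_def)
next
  case (Cons l p)
  then obtain x where l: "gpath G u [l] x" and p: "gpath G x p v"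
    using gpath_append[of u "[l]" p v] by auto
  note IH = Cons.IH[OF p] and L = letter_inverse[OF l]
  have ip: "inv_path G (l # p) = inv_path G p @ [inv_letter G l]" by (simp add: inv_path_def)
  have 1: "peq G u u ([l] @ (p @ inv_path G p) @ [inv_letter G l]) ([l] @ [] @ [inv_letter G l])"
    by (rule peq_ctx[OF _ l L(1)]) (use IH in simp)
  have 2: "peq G v v (inv_path G p @ [inv_letter G l, l] @ p) (inv_path G p @ [] @ p)"
    by (rule peq_ctx[OF L(3)]) (use IH p in auto)
  have ii: "inv_path G (inv_path G (l # p)) = l # p"
    using IH L(4) unfolding ip by (simp add: inv_path_append) (simp add: inv_path_def)
  show ?case
    using peq_trans[OF 1] peq_trans[OF 2] IH L ip gpath_appendI[of v "inv_path G p" x "[inv_letter G l]" u] ii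
    by simp
qed

lemmas path_inverseD = path_inverse[THEN conjunct1] path_inverse[THEN conjunct2, THEN conjunct1]
  path_inverse[THEN conjunct2, THEN conjunct2, THEN conjunct1]
  path_inverse[THEN conjunct2, THEN conjunct2, THEN conjunct2]

abbreviation "loop w \<equiv> gpath G (base G) w (base G)"

lemma loop_equiv_iff: "(a, b) \<in> loop_equiv G \<longleftrightarrow> loop a \<and> loop b \<and> peq G (base G) (base G) a b"
  by (simp add: loop_equiv_def gloops_def peq_def)

lemma equiv_loop: "equiv (gloops G) (loop_equiv G)"
proof (rule equivI)
  show "loop_equiv G \<subseteq> gloops G \<times> gloops G" by (auto simp: loop_equiv_def)
  show "refl_on (gloops G) (loop_equiv G)"
    by (rule refl_onI) (auto simp: loop_equiv_iff gloops_def peq_refl)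
  show "sym (loop_equiv G)" by (rule symI) (auto simp: loop_equiv_iff peq_sym)
  show "trans (loop_equiv G)" by (rule transI) (auto simp: loop_equiv_iff intro: peq_trans)
qed

lemma cls_eq: "loop a \<Longrightarrow> peq G (base G) (base G) a b \<Longrightarrow> loop b \<Longrightarrow> cls G a = cls G b"
  unfolding cls_def using equiv_class_eq[OF equiv_loop] loop_equiv_iff by blast

lemma cls_carrier: "loop w \<Longrightarrow> cls G w \<in> carrier (pi1 G)"
  by (auto simp: cls_def pi1_def gloops_def intro: quotientI)

lemma carrier_cls: "c \<in> carrier (pi1 G) \<Longrightarrow> \<exists>w. loop w \<and> c = cls G w"
  by (auto simp: cls_def pi1_def gloops_def elim!: quotientE)

lemma cls_one: "\<one>\<^bsub>pi1 G\<^esub> = cls G []"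
  by (simp add: pi1_def cls_def)

lemma cls_mult:
  assumes a: "loop a" and b: "loop b"
  shows "cls G a \<otimes>\<^bsub>pi1 G\<^esub> cls G b = cls G (a @ b)"
proof -
  have ab: "loop (a @ b)" using a b gpath_appendI by blast
  have eq: "cls G (p @ q) = cls G (a @ b)" if "p \<in> cls G a" "q \<in> cls G b" for p q
  proof -
    have p: "loop p" "peq G (base G) (base G) a p" and q: "loop q" "peq G (base G) (base G) b q"
      using that by (auto simp: cls_def loop_equiv_iff)
    have nil: "loop []" using base_vert by simp
    have "peq G (base G) (base G) (a @ b) (p @ b)" using peq_ctx[OF p(2) nil b] by simp
    moreover have "peq G (base G) (base G) (p @ b) (p @ q)" using peq_ctx[OF q(2) p(1) nil] by simp
    ultimately have "cls G (a @ b) = cls G (p @ q)"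
      using cls_eq ab p q gpath_appendI peq_trans by metis
    then show ?thesis by simp
  qed
  have self: "a \<in> cls G a" "b \<in> cls G b" using a b by (auto simp: cls_def loop_equiv_iff peq_refl)
  have "cls G a \<otimes>\<^bsub>pi1 G\<^esub> cls G b = (\<Union>w \<in> {p @ q | p q. p \<in> cls G a \<and> q \<in> cls G b}. cls G w)"
    by (auto simp: pi1_def cls_def)
  also have "\<dots> = cls G (a @ b)" using eq self by blast
  finally show ?thesis .
qed

lemma loop_inv: "loop w \<Longrightarrow> loop (inv_path G w)"
  using path_inverseD(1) by blast

text \<open>That \<open>pi1 G\<close> is a group enters as a hypothesis; in the applications it
  comes from an action of \<open>pi1 G\<close> on a tree.\<close>

lemma cls_inv:
  assumes "group (pi1 G)" "loop w"
  shows "inv\<^bsub>pi1 G\<^esub> (cls G w) = cls G (inv_path G w)"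
proof -
  have "cls G (inv_path G w) \<otimes>\<^bsub>pi1 G\<^esub> cls G w = \<one>\<^bsub>pi1 G\<^esub>"
    unfolding cls_one cls_mult[OF loop_inv[OF assms(2)] assms(2)]
    by (rule cls_eq[OF gpath_appendI[OF loop_inv[OF assms(2)] assms(2)] path_inverseD(3)[OF assms(2)]])
      (simp add: base_vert)
  then show ?thesis using group.inv_equality[OF assms(1)] cls_carrier assms(2) loop_inv by blast
qed

definition vconj :: "('v, 'e, 'g) letter list \<Rightarrow> 'v \<Rightarrow> 'g \<Rightarrow> ('v, 'e, 'g) loop_class" where
  "vconj p v g = cls G (p @ [Vg v g] @ inv_path G p)"

lemma vertex_groups_vconj: "vertex_groups G v = {vconj p v ` carrier (vgrp G v) | p. gpath G (base G) p v}"
  unfolding vertex_groups_def vconj_def cls_def inv_path_def by (simp add: image_def)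

lemma vconj_loop:
  "gpath G (base G) p v \<Longrightarrow> g \<in> carrier (vgrp G v) \<Longrightarrow> loop (p @ [Vg v g] @ inv_path G p)"
  by (intro gpath_appendI[of "base G" p v] gpath_appendI[of v "[Vg v g]" v])
    (use path_inverseD(1) gpath_verts in auto)

lemma vconj_carrier: "gpath G (base G) p v \<Longrightarrow> g \<in> carrier (vgrp G v) \<Longrightarrow> vconj p v g \<in> carrier (pi1 G)"
  unfolding vconj_def using vconj_loop cls_carrier by blast

lemma vertex_groups_carrier: "S \<in> vertex_groups G v \<Longrightarrow> S \<subseteq> carrier (pi1 G)"
  unfolding vertex_groups_vconj using vconj_carrier by blast

lemma vconj_one:
  assumes "gpath G (base G) p v"
  shows "vconj p v \<one>\<^bsub>vgrp G v\<^esub> = \<one>\<^bsub>pi1 G\<^esub>"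
proof -
  have v: "v \<in> verts (ugraph G)" using assms gpath_verts by blast
  interpret gv: group "vgrp G v" using group_vgrp v by blast
  have ip: "gpath G v (inv_path G p) (base G)" using path_inverseD(1)[OF assms] .
  have "peq G v v [Vg v \<one>\<^bsub>vgrp G v\<^esub>] []"
    using peq_step[OF _ _ elem_one[of G "[]" v "[]"]] v by simp
  from peq_ctx[OF this assms ip]
  have "peq G (base G) (base G) (p @ [Vg v \<one>\<^bsub>vgrp G v\<^esub>] @ inv_path G p) []"
    using peq_trans path_inverseD(2)[OF assms] by fastforce
  then show ?thesis unfolding vconj_def cls_one
    by (intro cls_eq) (use vconj_loop assms base_vert in auto)
qed

lemma vertex_groups_conj:
  assumes "group (pi1 G)" "S \<in> vertex_groups G v" "h \<in> carrier (pi1 G)"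
  shows "(\<lambda>s. h \<otimes>\<^bsub>pi1 G\<^esub> s \<otimes>\<^bsub>pi1 G\<^esub> inv\<^bsub>pi1 G\<^esub> h) ` S \<in> vertex_groups G v"
proof -
  obtain p where p: "gpath G (base G) p v" "S = vconj p v ` carrier (vgrp G v)"
    using assms(2) unfolding vertex_groups_vconj by blast
  obtain q where q: "loop q" "h = cls G q" using carrier_cls assms(3) by blast
  have qp: "gpath G (base G) (q @ p) v" using gpath_appendI q p by blast
  have "h \<otimes>\<^bsub>pi1 G\<^esub> vconj p v g \<otimes>\<^bsub>pi1 G\<^esub> inv\<^bsub>pi1 G\<^esub> h = vconj (q @ p) v g" if "g \<in> carrier (vgrp G v)" for g
  proof -
    have l: "loop (p @ [Vg v g] @ inv_path G p)" using vconj_loop p that by blast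
    have "loop (q @ p @ [Vg v g] @ inv_path G p)" using gpath_appendI[OF q(1) l] .
    then show ?thesis
      unfolding vconj_def q(2) cls_inv[OF assms(1) q(1)] cls_mult[OF q(1) l]
      using cls_mult[OF _ loop_inv[OF q(1)]] by (simp add: inv_path_append)
  qed
  then have "(\<lambda>s. h \<otimes>\<^bsub>pi1 G\<^esub> s \<otimes>\<^bsub>pi1 G\<^esub> inv\<^bsub>pi1 G\<^esub> h) ` S = vconj (q @ p) v ` carrier (vgrp G v)"
    unfolding p(2) image_image by (intro image_cong) auto
  then show ?thesis unfolding vertex_groups_vconj using qp by blast
qed

lemma path_to_vertex:
  assumes "v \<in> verts (ugraph G)"
  shows "\<exists>p. gpath G (base G) p v"
proof -
  let ?M = "with_proj (mk_symmetric (ugraph G))"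
  have "base G \<rightarrow>\<^sup>*\<^bsub>?M\<^esub> v"
    using gog assms base_vert unfolding graph_of_groups_def connected_def strongly_connected_def
    by (simp add: mk_symmetric_def)
  then have "(base G, v) \<in> (arcs_ends ?M)\<^sup>*"
    unfolding reachable_def by (rule rtrancl_on_rtranclI)
  then show ?thesis
  proof (induction rule: rtrancl_induct)
    case base
    then show ?case using base_vert by (intro exI[of _ "[]"]) simp
  next
    case (step x y)
    then obtain p where p: "gpath G (base G) p x" by blast
    have "(x, y) \<in> parcs (mk_symmetric (ugraph G))" using step(2) by simp
    then obtain e where e: "e \<in> arcs (ugraph G)"
      "(x, y) = (tail (ugraph G) e, head (ugraph G) e) \<or> (x, y) = (head (ugraph G) e, tail (ugraph G) e)"
      by (auto simp: mk_symmetric_def)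
    then have "gpath G x [Ed e True] y \<or> gpath G x [Ed e False] y" by auto
    then show ?case using gpath_appendI[OF p] by blast
  qed
qed

section \<open>Generation by vertex groups and edge loops\<close>

definition edge_loop :: "('v \<Rightarrow> ('v, 'e, 'g) letter list) \<Rightarrow> 'e \<Rightarrow> ('v, 'e, 'g) loop_class" where
  "edge_loop pv e = cls G (pv (tail (ugraph G) e) @ [Ed e True] @ inv_path G (pv (head (ugraph G) e)))"

lemma edge_loop_loop:
  assumes "\<And>v. v \<in> verts (ugraph G) \<Longrightarrow> gpath G (base G) (pv v) v" "e \<in> arcs (ugraph G)"
  shows "loop (pv (tail (ugraph G) e) @ [Ed e True] @ inv_path G (pv (head (ugraph G) e)))"
  by (intro gpath_appendI[of "base G" _ "tail (ugraph G) e"] gpath_appendI[of _ "[Ed e True]" "head (ugraph G) e"])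
    (use assms path_inverseD(1) in auto)

lemma edge_loop_carrier:
  assumes "\<And>v. v \<in> verts (ugraph G) \<Longrightarrow> gpath G (base G) (pv v) v" "e \<in> arcs (ugraph G)"
  shows "edge_loop pv e \<in> carrier (pi1 G)"
  unfolding edge_loop_def using edge_loop_loop[OF assms] cls_carrier by blast

text \<open>Closing up each letter of a path by the paths \<open>pv\<close> writes a loop as a
  product of the listed generators. The \<open>pv\<close> are arbitrary and not taken from a
  spanning tree: later they are chosen so that the transported vertex groups fix vertices of a given
  tree.\<close>

lemma pi1_induct:
  assumes grp: "group (pi1 G)" and pv: "\<And>v. v \<in> verts (ugraph G) \<Longrightarrow> gpath G (base G) (pv v) v"
    and one: "P \<one>\<^bsub>pi1 G\<^esub>"
    and mult: "\<And>g h. g \<in> carrier (pi1 G) \<Longrightarrow> h \<in> carrier (pi1 G) \<Longrightarrow> P g \<Longrightarrow> P h \<Longrightarrow> P (g \<otimes>\<^bsub>pi1 G\<^esub> h)"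
    and inv: "\<And>g. g \<in> carrier (pi1 G) \<Longrightarrow> P g \<Longrightarrow> P (inv\<^bsub>pi1 G\<^esub> g)"
    and vg: "\<And>v g. v \<in> verts (ugraph G) \<Longrightarrow> g \<in> carrier (vgrp G v) \<Longrightarrow> P (vconj (pv v) v g)"
    and el: "\<And>e. e \<in> arcs (ugraph G) \<Longrightarrow> P (edge_loop pv e)"
    and c: "c \<in> carrier (pi1 G)"
  shows "P c"
proof -
  have conj_loop: "loop (pv u @ w @ inv_path G (pv v))" if "gpath G u w v" for u w v
    using gpath_appendI[OF pv gpath_appendI[OF that path_inverseD(1)[OF pv]]] gpath_verts[OF that] by blast
  have letter: "P (cls G (pv u @ [l] @ inv_path G (pv v)))" if l: "gpath G u [l] v" for u l v
  proof (cases l)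
    case (Vg x g)
    then show ?thesis using l vg[of u g] gpath_verts[OF l] by (auto simp: vconj_def)
  next
    case (Ed e b)
    have e: "e \<in> arcs (ugraph G)" using l Ed by simp
    show ?thesis
    proof (cases b)
      case True
      then show ?thesis using l Ed el[OF e] by (auto simp: edge_loop_def)
    next
      case False
      then have uv: "u = head (ugraph G) e" "v = tail (ugraph G) e" using l Ed by auto
      have V: "u \<in> verts (ugraph G)" "v \<in> verts (ugraph G)" using gpath_verts[OF l] by auto
      have "inv_path G (pv v @ [Ed e True] @ inv_path G (pv u)) = pv u @ [l] @ inv_path G (pv v)"
        using path_inverseD(4)[OF pv[OF V(1)]] Ed False
        by (simp add: inv_path_append) (simp add: inv_path_def)
      then have "cls G (pv u @ [l] @ inv_path G (pv v)) = inv\<^bsub>pi1 G\<^esub> (edge_loop pv e)"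
        unfolding edge_loop_def using cls_inv[OF grp edge_loop_loop[OF pv e]] uv by simp
      then show ?thesis using inv[OF edge_loop_carrier[OF pv e] el[OF e]] by simp
    qed
  qed
  have path: "P (cls G (pv u @ w @ inv_path G (pv v)))" if "gpath G u w v" for u w v
    using that
  proof (induction w arbitrary: u)
    case Nil
    then have "gpath G (base G) (pv u) u" "u = v" using pv by auto
    then have "cls G (pv u @ [] @ inv_path G (pv v)) = \<one>\<^bsub>pi1 G\<^esub>"
      unfolding cls_one using path_inverseD(2) conj_loop[OF Nil] base_vert by (intro cls_eq) auto
    then show ?case using one by simp
  next
    case (Cons l w)
    then obtain x where l: "gpath G u [l] x" and w: "gpath G x w v"
      using gpath_append[of u "[l]" w v] by auto
    have x: "x \<in> verts (ugraph G)" using gpath_verts l by blast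
    have uv: "u \<in> verts (ugraph G)" "v \<in> verts (ugraph G)" using gpath_verts Cons.prems by blast+
    let ?a = "pv u @ [l] @ inv_path G (pv x)" and ?b = "pv x @ w @ inv_path G (pv v)"
    have ul: "gpath G (base G) (pv u @ [l]) x" using gpath_appendI[OF pv[OF uv(1)] l] .
    have wv: "gpath G x (w @ inv_path G (pv v)) (base G)"
      using gpath_appendI[OF w path_inverseD(1)[OF pv[OF uv(2)]]] .
    have "cls G ?a \<otimes>\<^bsub>pi1 G\<^esub> cls G ?b = cls G (?a @ ?b)"
      by (rule cls_mult[OF conj_loop[OF l] conj_loop[OF w]])
    also have "\<dots> = cls G (pv u @ (l # w) @ inv_path G (pv v))"
    proof (rule cls_eq)
      show "loop (?a @ ?b)" using gpath_appendI conj_loop l w by blast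
      show "loop (pv u @ (l # w) @ inv_path G (pv v))" by (rule conj_loop[OF Cons.prems])
      show "peq G (base G) (base G) (?a @ ?b) (pv u @ (l # w) @ inv_path G (pv v))"
        using peq_ctx[OF path_inverseD(3)[OF pv[OF x]] ul wv] by simp
    qed
    finally have eq: "cls G ?a \<otimes>\<^bsub>pi1 G\<^esub> cls G ?b = cls G (pv u @ (l # w) @ inv_path G (pv v))" .
    have "P (cls G ?a \<otimes>\<^bsub>pi1 G\<^esub> cls G ?b)"
      by (rule mult[OF cls_carrier[OF conj_loop[OF l]] cls_carrier[OF conj_loop[OF w]] letter[OF l] Cons.IH[OF w]])
    then show ?case unfolding eq .
  qed
  obtain w where w: "loop w" "c = cls G w" using carrier_cls c by blast
  \<comment> \<open>The path chosen for the base vertex may be a nontrivial loop, so the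
    decomposition is applied to the conjugate of \<open>w\<close> that cancels it.\<close>
  let ?p = "pv (base G)"
  have p: "loop ?p" "loop (inv_path G ?p)" using pv[OF base_vert] loop_inv by auto
  have l: "loop (inv_path G ?p @ w @ ?p)" using p w gpath_appendI by blast
  have nil: "loop []" using base_vert by simp
  have r: "peq G (base G) (base G) (?p @ inv_path G ?p) []" by (rule path_inverseD(2)[OF p(1)])
  have wpp: "loop (w @ ?p @ inv_path G ?p)" using p w gpath_appendI by blast
  have "peq G (base G) (base G) (?p @ (inv_path G ?p @ w @ ?p) @ inv_path G ?p) (w @ ?p @ inv_path G ?p)"
    using peq_ctx[OF r nil wpp] by simp
  moreover have "peq G (base G) (base G) (w @ ?p @ inv_path G ?p) w"
    using peq_ctx[OF r w(1) nil] by simp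
  ultimately have "cls G (?p @ (inv_path G ?p @ w @ ?p) @ inv_path G ?p) = c"
    unfolding w(2) using peq_trans w(1) conj_loop[OF l] by (intro cls_eq) auto
  then show ?thesis using path[OF l] by simp
qed

end

section \<open>Bounding the number of edges of a reduced tree\<close>

text \<open>Labels for the orbits of oriented edges. When edge stabilisers are trivial, the two
  directions of an edge lie in different orbits and carry different labels.\<close>

definition arc_index :: "('h, 'b) monoid_scheme \<Rightarrow> ('h, 'x) gtree \<Rightarrow> nat \<Rightarrow> ('x \<times> 'x \<Rightarrow> nat) \<Rightarrow> bool" where
  "arc_index H T n idx \<longleftrightarrow> (\<forall>e \<in> tarcs T. idx e < n) \<and>
     (\<forall>e \<in> tarcs T. \<forall>f \<in> tarcs T. idx e = idx f \<longleftrightarrow>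
        (\<exists>g \<in> carrier H. f = (act T g (fst e), act T g (snd e))))"

lemma odd_card_symdiff:
  assumes "finite A" "finite B"
  shows "odd (card (A - B \<union> (B - A))) \<longleftrightarrow> odd (card A) \<noteq> odd (card B)"
proof -
  have "card A = card (A - B) + card (A \<inter> B)" "card B = card (B - A) + card (A \<inter> B)"
    using card_Int_Diff[OF assms(1), of B] card_Int_Diff[OF assms(2), of A] by (simp_all add: Int_commute)
  moreover have "card (A - B \<union> (B - A)) = card (A - B) + card (B - A)"
    using assms by (intro card_Un_disjoint) auto
  ultimately show ?thesis by auto
qed

context htree
begin

definition garc :: "'h \<Rightarrow> 'x \<times> 'x \<Rightarrow> 'x \<times> 'x" where
  "garc g e = (act T g (fst e), act T g (snd e))"

definition aorb :: "'x \<times> 'x \<Rightarrow> ('x \<times> 'x) set" where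
  "aorb e = (\<lambda>g. garc g e) ` carrier H"

abbreviation "AO \<equiv> aorb ` E"
abbreviation "vorb \<equiv> orbit H (act T)"
abbreviation "VO \<equiv> orbits H V (act T)"

lemma garc_E: "g \<in> carrier H \<Longrightarrow> e \<in> E \<Longrightarrow> garc g e \<in> E"
  using act_E by (cases e) (simp add: garc_def)

lemma garc_mult: "g \<in> carrier H \<Longrightarrow> h \<in> carrier H \<Longrightarrow> e \<in> E \<Longrightarrow> garc (g \<otimes>\<^bsub>H\<^esub> h) e = garc g (garc h e)"
  using act_mult wf by (cases e) (auto simp: garc_def)

lemma garc_one: "e \<in> E \<Longrightarrow> garc \<one>\<^bsub>H\<^esub> e = e"
  using act_one wf by (cases e) (auto simp: garc_def)

lemma garc_inv: "g \<in> carrier H \<Longrightarrow> e \<in> E \<Longrightarrow> garc (inv\<^bsub>H\<^esub> g) (garc g e) = e"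
  "g \<in> carrier H \<Longrightarrow> e \<in> E \<Longrightarrow> garc g (garc (inv\<^bsub>H\<^esub> g) e) = e"
  using act_inv wf by (cases e, auto simp: garc_def)+

lemma aorb_self: "e \<in> E \<Longrightarrow> e \<in> aorb e"
  unfolding aorb_def by (rule image_eqI[of _ _ "\<one>\<^bsub>H\<^esub>"]) (simp_all add: garc_one)

lemma aorb_garc:
  assumes "g \<in> carrier H" "e \<in> E"
  shows "aorb (garc g e) = aorb e"
proof -
  have "aorb (garc g e) \<subseteq> aorb e" if "g \<in> carrier H" "e \<in> E" for g e
    unfolding aorb_def using that garc_mult[symmetric] by auto
  from this[OF assms] this[OF inv_closed[OF assms(1)] garc_E[OF assms]] show ?thesis
    using garc_inv(1)[OF assms] by auto
qed

lemma aorb_eq_iff: "e \<in> E \<Longrightarrow> f \<in> E \<Longrightarrow> aorb e = aorb f \<longleftrightarrow> (\<exists>g \<in> carrier H. f = garc g e)"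
proof
  assume "e \<in> E" "f \<in> E" "aorb e = aorb f"
  then have "f \<in> aorb e" using aorb_self by blast
  then show "\<exists>g \<in> carrier H. f = garc g e" unfolding aorb_def by blast
qed (auto simp: aorb_garc)

lemma aorb_swap: "aorb (prod.swap e) = prod.swap ` aorb e"
  by (auto simp: aorb_def garc_def image_image)

lemma vorb_act: "g \<in> carrier H \<Longrightarrow> y \<in> V \<Longrightarrow> vorb (act T g y) = vorb y"
proof -
  have sub: "vorb (act T g y) \<subseteq> vorb y" if "g \<in> carrier H" "y \<in> V" for g y
  proof
    fix z assume "z \<in> vorb (act T g y)"
    then obtain h where h: "h \<in> carrier H" "z = act T h (act T g y)" by (auto simp: orbit_def)
    then have "z = act T (h \<otimes>\<^bsub>H\<^esub> g) y" using act_mult that by simp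
    then show "z \<in> vorb y" using h(1) that(1) by (auto simp: orbit_def)
  qed
  assume gy: "g \<in> carrier H" "y \<in> V"
  have "vorb y \<subseteq> vorb (act T g y)"
    using sub[OF inv_closed[OF gy(1)] act_V[OF gy]] unfolding act_inv(1)[OF gy] .
  then show ?thesis using sub[OF gy] by (rule subset_antisym[rotated])
qed

lemma vorb_self: "y \<in> V \<Longrightarrow> y \<in> vorb y"
  by (rule ga.orbit_refl)

lemma VO_eq: "o' \<in> VO \<Longrightarrow> y \<in> o' \<Longrightarrow> o' = vorb y \<and> y \<in> V"
proof -
  assume "o' \<in> VO" and y: "y \<in> o'"
  then obtain z where z: "z \<in> V" "o' = vorb z" unfolding orbits_def by blast
  then obtain g where "g \<in> carrier H" "y = act T g z" using y by (auto simp: orbit_def)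
  then show ?thesis using z vorb_act act_V by simp
qed

lemma vorb_VO: "y \<in> V \<Longrightarrow> vorb y \<in> VO"
  unfolding orbits_def by blast

lemma path_arcs_rtrancl:
  assumes "u \<in> V" "v \<in> V"
  shows "(u, v) \<in> (path_arcs E u v)\<^sup>*"
proof -
  interpret P: pair_bidirected_digraph "tgraph T" using simplicial by (rule simplicial_treeD_pair)
  obtain p where p: "P.apath u p v" using apath_exists_raw[OF stree_axioms assms] by blast
  then have s: "set p = path_arcs E u v" using apath_arcs_raw[OF stree_axioms] by blast
  have "(u, v) \<in> (set p)\<^sup>*" if "pcas u p v" for p u
    using that
  proof (induction p arbitrary: u)
    case (Cons e p)
    have "(snd e, v) \<in> (set (e # p))\<^sup>*"
      using Cons.IH[of "snd e"] Cons.prems rtrancl_mono[of "set p" "set (e # p)"] by auto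
    moreover have "(u, snd e) \<in> set (e # p)" using Cons.prems by (cases e) auto
    ultimately show ?case by (rule converse_rtrancl_into_rtrancl[rotated])
  qed simp
  moreover have "pcas u p v" using p by (simp add: P.apath_def P.awalk_def)
  ultimately have "(u, v) \<in> (set p)\<^sup>*" by blast
  then show ?thesis unfolding s .
qed

section \<open>Mod 2 cochains on the quotient graph\<close>

definition cset :: "('x \<times> 'x) set set \<Rightarrow> 'x \<Rightarrow> 'x \<Rightarrow> ('x \<times> 'x) set" where
  "cset c u v = {e \<in> E. aorb e \<in> c \<and> side E e u \<noteq> side E e v}"

text \<open>\<open>par c u v\<close> is the integral of the mod 2 cochain \<open>c\<close> on the quotient graph along the path from \<open>u\<close> to \<open>v\<close>.\<close>

definition par :: "('x \<times> 'x) set set \<Rightarrow> 'x \<Rightarrow> 'x \<Rightarrow> bool" where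
  "par c u v \<longleftrightarrow> odd (card (cset c u v))"

lemma finite_cset: "u \<in> V \<Longrightarrow> v \<in> V \<Longrightarrow> finite (cset c u v)"
proof (rule finite_subset)
  show "cset c u v \<subseteq> path_arcs E u v \<union> path_arcs E v u"
  proof
    fix e assume "e \<in> cset c u v"
    then show "e \<in> path_arcs E u v \<union> path_arcs E v u"
      using side_cases[of E e u] side_cases[of E e v] by (auto simp: cset_def path_arcs_def)
  qed
qed (use finite_paths in auto)

text \<open>Sides take two values, so the arcs separating \<open>u\<close> from \<open>w\<close> are
  those that separate precisely one of the pairs \<open>u\<close>, \<open>v\<close> and
  \<open>v\<close>, \<open>w\<close>.\<close>

lemma par_add:
  assumes "u \<in> V" "v \<in> V" "w \<in> V"
  shows "par c u w \<longleftrightarrow> par c u v \<noteq> par c v w"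
proof -
  have "cset c u w = cset c u v - cset c v w \<union> (cset c v w - cset c u v)"
  proof (rule Set.set_eqI)
    fix e
    show "e \<in> cset c u w \<longleftrightarrow> e \<in> cset c u v - cset c v w \<union> (cset c v w - cset c u v)"
      using side_cases[of E e u] side_cases[of E e v] side_cases[of E e w] by (auto simp: cset_def)
  qed
  then show ?thesis unfolding par_def using odd_card_symdiff finite_cset assms by metis
qed

lemma par_self: "\<not> par c u u"
  by (simp add: par_def cset_def)

lemma par_sym: "par c u v \<longleftrightarrow> par c v u"
  by (simp add: par_def cset_def eq_commute)

lemma par_act:
  assumes g: "g \<in> carrier H" and V: "u \<in> V" "v \<in> V"
  shows "par c (act T g u) (act T g v) \<longleftrightarrow> par c u v"
proof -
  have into: "garc g e \<in> cset c (act T g u) (act T g v)"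
    if "g \<in> carrier H" "u \<in> V" "v \<in> V" "e \<in> cset c u v" for g u v e
    using that garc_E[of g e] aorb_garc[of g e] side_act[of g "fst e" "snd e"]
    by (auto simp: cset_def garc_def)
  have "bij_betw (garc g) (cset c u v) (cset c (act T g u) (act T g v))"
  proof (rule bij_betw_byWitness[of _ "garc (inv\<^bsub>H\<^esub> g)"])
    show "garc g ` cset c u v \<subseteq> cset c (act T g u) (act T g v)" using into[OF g V] by blast
    show "garc (inv\<^bsub>H\<^esub> g) ` cset c (act T g u) (act T g v) \<subseteq> cset c u v"
      using into[OF inv_closed[OF g] act_V[OF g V(1)] act_V[OF g V(2)]] act_inv(1)[OF g] V by auto
  qed (use garc_inv[OF g] in \<open>auto simp: cset_def\<close>)
  then show ?thesis by (simp add: par_def bij_betw_same_card)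
qed

lemma par_symdiff:
  assumes "u \<in> V" "v \<in> V"
  shows "par (c - c' \<union> (c' - c)) u v \<longleftrightarrow> par c u v \<noteq> par c' u v"
proof -
  have "cset (c - c' \<union> (c' - c)) u v = cset c u v - cset c' u v \<union> (cset c' u v - cset c u v)"
    by (auto simp: cset_def)
  then show ?thesis unfolding par_def using odd_card_symdiff finite_cset assms by metis
qed

text \<open>If both directions of the edge were in \<open>c\<close>, their contributions would
  cancel mod 2.\<close>

lemma par_edge:
  assumes ab: "(a, b) \<in> E" and c: "\<not> (aorb (a, b) \<in> c \<and> aorb (b, a) \<in> c)"
  shows "par c a b \<longleftrightarrow> aorb (a, b) \<in> c \<or> aorb (b, a) \<in> c"
proof -
  have sides: "side E (a, b) a \<noteq> side E (a, b) b" "side E (b, a) a \<noteq> side E (b, a) b"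
    using side_fst[OF ab] side_snd[OF ab] side_fst[OF sym[OF ab]] side_snd[OF sym[OF ab]] by auto
  have "e = (a, b) \<or> e = (b, a)" if "side E e a \<noteq> side E e b" for e using side_eq[OF ab, of e] that by blast
  then have "cset c a b = (if aorb (a, b) \<in> c then {(a, b)} else {}) \<union> (if aorb (b, a) \<in> c then {(b, a)} else {})"
    using sides ab sym[OF ab] by (auto simp: cset_def)
  then show ?thesis using c by (auto simp: par_def)
qed

end

text \<open>Here \<open>H\<close> is generated by finitely many sets \<open>S i\<close>, each fixing
  a vertex \<open>x i\<close>, and finitely many elements \<open>t j\<close>; the induction
  principle \<open>gen\<close> expresses generation. For a graph of groups these come from its
  vertices and its edges.\<close>

locale gen_tree = htree H T for H :: "('h, 'b) monoid_scheme" and T :: "('h, 'x) gtree" +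
  fixes I :: "'i set" and x :: "'i \<Rightarrow> 'x" and S :: "'i \<Rightarrow> 'h set" and J :: "'j set" and t :: "'j \<Rightarrow> 'h"
  assumes tes: "trivial_edge_stabilisers H T" and mini: "minimal_tree H T"
    and fin: "finite I" "finite J"
    and xV: "i \<in> I \<Longrightarrow> x i \<in> tverts T" and S_carrier: "i \<in> I \<Longrightarrow> S i \<subseteq> carrier H"
    and S_fix: "i \<in> I \<Longrightarrow> s \<in> S i \<Longrightarrow> act T s (x i) = x i"
    and t_carrier: "j \<in> J \<Longrightarrow> t j \<in> carrier H"
    and gen: "\<And>P h. P \<one>\<^bsub>H\<^esub> \<Longrightarrow>
      (\<And>g h. g \<in> carrier H \<Longrightarrow> h \<in> carrier H \<Longrightarrow> P g \<Longrightarrow> P h \<Longrightarrow> P (g \<otimes>\<^bsub>H\<^esub> h)) \<Longrightarrow>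
      (\<And>g. g \<in> carrier H \<Longrightarrow> P g \<Longrightarrow> P (inv\<^bsub>H\<^esub> g)) \<Longrightarrow>
      (\<And>i s. i \<in> I \<Longrightarrow> s \<in> S i \<Longrightarrow> P s) \<Longrightarrow> (\<And>j. j \<in> J \<Longrightarrow> P (t j)) \<Longrightarrow> h \<in> carrier H \<Longrightarrow> P h"
begin

definition "x0 = (SOME y. y \<in> V)"

lemma x0: "x0 \<in> V"
  unfolding x0_def using nonempty some_in_eq by blast

text \<open>Enough arcs to connect \<open>x0\<close> with its image under every generator: for
  \<open>t j\<close> directly, for an element of \<open>S i\<close> by going to the fixed vertex
  \<open>x i\<close> and returning along the translated path.\<close>

definition "K = (\<Union>i \<in> I. path_arcs E x0 (x i)) \<union> (\<Union>j \<in> J. path_arcs E x0 (act T (t j) x0))"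

definition "R = {garc g e | g e. g \<in> carrier H \<and> (e \<in> K \<or> prod.swap e \<in> K)}"

lemma finite_K: "finite K"
  unfolding K_def using fin finite_paths x0 xV t_carrier act_V by auto

lemma K_E: "K \<subseteq> E"
  by (auto simp: K_def path_arcs_def)

lemma K_swap_E: "e \<in> K \<or> prod.swap e \<in> K \<Longrightarrow> e \<in> E"
  using K_E sym by (cases e) auto

lemma R_E: "R \<subseteq> E"
  unfolding R_def using garc_E K_swap_E by blast

lemma R_sym: "(u, v) \<in> R \<Longrightarrow> (v, u) \<in> R"
proof -
  assume "(u, v) \<in> R"
  then obtain g e where "g \<in> carrier H" "e \<in> K \<or> prod.swap e \<in> K" "(u, v) = garc g e" unfolding R_def by blast
  then have "(v, u) = garc g (prod.swap e)" "prod.swap e \<in> K \<or> prod.swap (prod.swap e) \<in> K"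
    by (auto simp: garc_def)
  then show ?thesis unfolding R_def using \<open>g \<in> carrier H\<close> by blast
qed

lemma R_act: "g \<in> carrier H \<Longrightarrow> (u, v) \<in> R \<Longrightarrow> (act T g u, act T g v) \<in> R"
proof -
  assume g: "g \<in> carrier H" and "(u, v) \<in> R"
  then obtain h e where h: "h \<in> carrier H" "e \<in> K \<or> prod.swap e \<in> K" "(u, v) = garc h e" unfolding R_def by blast
  have "(act T g u, act T g v) = garc g (garc h e)" using h(3)[symmetric] by (simp add: garc_def)
  also have "\<dots> = garc (g \<otimes>\<^bsub>H\<^esub> h) e" using garc_mult[OF g h(1) K_swap_E[OF h(2)]] by simp
  finally show ?thesis unfolding R_def using h g by blast
qed

lemma R_star_act: "g \<in> carrier H \<Longrightarrow> (u, v) \<in> R\<^sup>* \<Longrightarrow> (act T g u, act T g v) \<in> R\<^sup>*"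
  by (erule rtrancl_induct) (auto intro: rtrancl_into_rtrancl R_act)

lemma R_star_sym: "(u, v) \<in> R\<^sup>* \<Longrightarrow> (v, u) \<in> R\<^sup>*"
  using R_sym by (meson sym_rtrancl symD symI)

lemma K_R: "K \<subseteq> R"
proof
  fix e assume "e \<in> K"
  then have "e = garc \<one>\<^bsub>H\<^esub> e" using garc_one[of e] K_E by auto
  then show "e \<in> R" unfolding R_def using \<open>e \<in> K\<close> by blast
qed

lemma R_path: "path_arcs E x0 y \<subseteq> K \<Longrightarrow> y \<in> V \<Longrightarrow> (x0, y) \<in> R\<^sup>*"
  using path_arcs_rtrancl[OF x0] K_R rtrancl_mono[of "path_arcs E x0 y" R] by blast

lemma R_orbit: "h \<in> carrier H \<Longrightarrow> (x0, act T h x0) \<in> R\<^sup>*"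
proof (rule gen[of "\<lambda>h. (x0, act T h x0) \<in> R\<^sup>*"])
  show "(x0, act T \<one>\<^bsub>H\<^esub> x0) \<in> R\<^sup>*" using act_one x0 by simp
  show "(x0, act T (g \<otimes>\<^bsub>H\<^esub> h) x0) \<in> R\<^sup>*" if "g \<in> carrier H" "h \<in> carrier H"
    "(x0, act T g x0) \<in> R\<^sup>*" "(x0, act T h x0) \<in> R\<^sup>*" for g h
    using that R_star_act[of g x0 "act T h x0"] act_mult x0 by (auto intro: rtrancl_trans)
  show "(x0, act T (inv\<^bsub>H\<^esub> g) x0) \<in> R\<^sup>*" if "g \<in> carrier H" "(x0, act T g x0) \<in> R\<^sup>*" for g
    using R_star_act[OF inv_closed[OF that(1)] that(2)] act_inv(1)[OF that(1) x0] R_star_sym by auto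
  show "(x0, act T s x0) \<in> R\<^sup>*" if "i \<in> I" "s \<in> S i" for i s
  proof -
    have 1: "(x0, x i) \<in> R\<^sup>*" by (rule R_path) (use that xV in \<open>auto simp: K_def\<close>)
    have "s \<in> carrier H" using that S_carrier by blast
    then have "(act T s x0, act T s (x i)) \<in> R\<^sup>*" using R_star_act 1 by blast
    then show ?thesis using 1 R_star_sym S_fix[OF that] by (metis rtrancl_trans)
  qed
  show "(x0, act T (t j) x0) \<in> R\<^sup>*" if "j \<in> J" for j
    by (rule R_path) (use that t_carrier act_V x0 in \<open>auto simp: K_def\<close>)
qed

text \<open>What the translates of \<open>K\<close> connect to \<open>x0\<close> is an invariant
  subtree, so by minimality it is everything. Hence the finite set \<open>K\<close> meets every
  orbit of edges.\<close>

lemma E_R: "E = R"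
proof -
  define A where "A = \<lparr>pverts = {y \<in> V. (x0, y) \<in> R\<^sup>*}, parcs = {(u, v) \<in> R. (x0, u) \<in> R\<^sup>*}\<rparr>"
  have Av: "pverts A = {y \<in> V. (x0, y) \<in> R\<^sup>*}" and Aa: "(u, v) \<in> parcs A \<longleftrightarrow> (u, v) \<in> R \<and> (x0, u) \<in> R\<^sup>*" for u v
    by (auto simp: A_def)
  have wfA: "a \<in> pverts A \<and> b \<in> pverts A" if "(a, b) \<in> parcs A" for a b
    using that R_E wf unfolding Av Aa by (auto intro: rtrancl_into_rtrancl)
  have symA: "(b, a) \<in> parcs A" if "(a, b) \<in> parcs A" for a b
    using that R_sym unfolding Aa by (auto intro: rtrancl_into_rtrancl)
  have from0: "(x0, y) \<in> (parcs A)\<^sup>*" if "(x0, y) \<in> R\<^sup>*" for y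
    using that by induction (auto intro: rtrancl_into_rtrancl simp: Aa)
  have symst: "(v, u) \<in> (parcs A)\<^sup>*" if "(u, v) \<in> (parcs A)\<^sup>*" for u v
    using that symA by (meson sym_rtrancl symD symI)
  have "stree (pverts A) (parcs A)"
  proof (rule stree_sub[OF stree_axioms])
    show "pverts A \<subseteq> V" "pverts A \<noteq> {}" using x0 by (auto simp: Av)
    show "parcs A \<subseteq> E" using R_E by (auto simp: A_def)
    show "(u, v) \<in> (parcs A)\<^sup>*" if "u \<in> pverts A" "v \<in> pverts A" for u v
      using from0[of u] from0[of v] symst that unfolding Av by (auto intro: rtrancl_trans)
  qed (use wfA symA in blast)+
  then have "simplicial_tree A" by (rule stree_simplicial_tree)
  moreover have "invariant_subgraph H T A"
    unfolding invariant_subgraph_def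
  proof (intro conjI ballI)
    have "wf_digraph (with_proj A)"
      by (simp add: wf_digraph_wp_iff pair_wf_digraph_def) (use wfA in auto)
    moreover have "wf_digraph (with_proj (tgraph T))"
      by (simp add: wf_digraph_wp_iff pair_wf_digraph_def) (use wf in auto)
    moreover have "parcs A \<subseteq> E" using R_E by (auto simp: A_def)
    ultimately show "subgraph (with_proj A) (with_proj (tgraph T))" unfolding subgraph_def by (auto simp: Av)
    show "symmetric (with_proj A)" using symA by (auto simp: symmetric_def intro: symI)
    have star: "(x0, act T g y) \<in> R\<^sup>*" if "g \<in> carrier H" "(x0, y) \<in> R\<^sup>*" for g y
      using R_orbit[OF that(1)] R_star_act[OF that] by (rule rtrancl_trans)
    show "act T g y \<in> pverts A" if "g \<in> carrier H" "y \<in> pverts A" for g y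
      using that star act_V by (simp add: Av)
    show "case e of (u, v) \<Rightarrow> (act T g u, act T g v) \<in> parcs A" if "g \<in> carrier H" "e \<in> parcs A" for g e
      using that star R_act by (cases e) (simp add: Aa)
  qed
  ultimately have "A = tgraph T" using mini by (simp add: minimal_tree_def)
  then have "E = parcs A" by simp
  then show ?thesis using R_E by (auto simp: A_def)
qed

lemma finite_quotient_T: "finite_quotient H T"
  unfolding finite_quotient_def
proof (intro exI[of _ "K \<union> prod.swap ` K"] conjI ballI)
  show "finite (K \<union> prod.swap ` K)" using finite_K by simp
  show "K \<union> prod.swap ` K \<subseteq> E" using K_E K_swap_E by auto
  fix e assume "e \<in> E"
  then obtain g f where g: "g \<in> carrier H" "f \<in> K \<or> prod.swap f \<in> K" "e = garc g f"
    unfolding E_R R_def by blast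
  then have "f \<in> K \<union> prod.swap ` K" by (metis UnI1 UnI2 image_eqI swap_swap)
  moreover have "case f of (u, v) \<Rightarrow> e = (act T g u, act T g v)"
    using g(3) by (simp add: garc_def case_prod_unfold)
  ultimately show "\<exists>g \<in> carrier H. \<exists>(u, v) \<in> K \<union> prod.swap ` K. e = (act T g u, act T g v)"
    by (intro bexI[OF _ g(1)]) (rule bexI)
qed

lemma finite_AO: "finite AO"
proof (rule finite_subset)
  show "AO \<subseteq> aorb ` (K \<union> prod.swap ` K)"
  proof
    fix o' assume "o' \<in> AO"
    then obtain e where "e \<in> E" "o' = aorb e" by blast
    then obtain g f where g: "g \<in> carrier H" "f \<in> K \<or> prod.swap f \<in> K" "e = garc g f"
      unfolding E_R R_def by blast
    then have "f \<in> K \<union> prod.swap ` K" by (metis UnI1 UnI2 image_eqI swap_swap)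
    moreover have "o' = aorb f" using \<open>o' = aorb e\<close> g aorb_garc K_swap_E by simp
    ultimately show "o' \<in> aorb ` (K \<union> prod.swap ` K)" by blast
  qed
qed (use finite_K in simp)

lemma finite_VO: "finite VO"
proof (rule finite_subset)
  show "VO \<subseteq> insert (vorb x0) ((\<lambda>e. vorb (snd e)) ` (K \<union> prod.swap ` K))"
  proof
    fix o' assume "o' \<in> VO"
    then obtain y where y: "y \<in> V" "o' = vorb y" unfolding orbits_def by blast
    have "(x0, y) \<in> E\<^sup>*" using conn x0 y by blast
    then show "o' \<in> insert (vorb x0) ((\<lambda>e. vorb (snd e)) ` (K \<union> prod.swap ` K))"
    proof (cases rule: rtranclE)
      case base
      then show ?thesis using y by simp
    next
      case (step z)
      obtain g f where g: "g \<in> carrier H" "f \<in> K \<or> prod.swap f \<in> K" "(z, y) = garc g f"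
        using step(2) unfolding E_R R_def by blast
      then have f: "f \<in> K \<union> prod.swap ` K" by (metis UnI1 UnI2 image_eqI swap_swap)
      have "vorb y = vorb (snd f)"
        using g vorb_act[OF g(1) snd_V[OF K_swap_E[OF g(2)]]] by (simp add: garc_def)
      then show ?thesis using f y by blast
    qed
  qed
qed (use finite_K in simp)

lemma no_inversion: "(a, b) \<in> E \<Longrightarrow> aorb (a, b) \<noteq> aorb (b, a)"
proof
  assume ab: "(a, b) \<in> E" and "aorb (a, b) = aorb (b, a)"
  then have "\<exists>g \<in> carrier H. (b, a) = garc g (a, b)" using aorb_eq_iff[OF ab sym[OF ab]] by simp
  then obtain g where g: "g \<in> carrier H" "(b, a) = garc g (a, b)" by (rule bexE)
  have "act T g a = b" "act T g b = a" using g(2)[symmetric] by (simp_all add: garc_def)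
  then have "{act T g a, act T g b} = {a, b}" by (simp add: insert_commute)
  then have "g = \<one>\<^bsub>H\<^esub>" using tes ab g(1) unfolding trivial_edge_stabilisers_def by blast
  then show False using g garc_one[OF ab] irrefl[OF ab] by simp
qed

lemma orientation:
  obtains W where "W \<subseteq> AO" "card AO = 2 * card W"
    "\<And>a b. (a, b) \<in> E \<Longrightarrow> aorb (a, b) \<in> W \<longleftrightarrow> aorb (b, a) \<notin> W"
proof -
  obtain f :: "('x \<times> 'x) set \<Rightarrow> nat" where f: "inj_on f AO"
    using finite_imp_inj_to_nat_seg[OF finite_AO] by blast
  \<comment> \<open>An injective numbering of the orbits selects one of the two directions of each
    edge.\<close>
  define W where "W = {o' \<in> AO. f o' < f (prod.swap ` o')}"
  have sw: "prod.swap ` aorb (a, b) = aorb (b, a)" for a b using aorb_swap[of "(a, b)"] by simp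
  have W: "aorb (a, b) \<in> W \<longleftrightarrow> aorb (b, a) \<notin> W" if ab: "(a, b) \<in> E" for a b
  proof -
    have "f (aorb (a, b)) \<noteq> f (aorb (b, a))"
      using f no_inversion[OF ab] ab sym[OF ab] by (auto dest!: inj_onD)
    moreover have "aorb (a, b) \<in> AO" "aorb (b, a) \<in> AO" using ab sym by auto
    ultimately show ?thesis unfolding W_def using sw[of a b] sw[of b a] by auto
  qed
  have sub: "W \<subseteq> AO" by (auto simp: W_def)
  have "bij_betw ((`) prod.swap) W (AO - W)"
  proof (rule bij_betw_byWitness[of _ "(`) prod.swap"])
    show "(`) prod.swap ` W \<subseteq> AO - W"
    proof
      fix o' assume "o' \<in> (`) prod.swap ` W"
      then obtain w where w: "w \<in> W" "o' = prod.swap ` w" by blast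
      then obtain a b where ab: "(a, b) \<in> E" "w = aorb (a, b)" using sub by auto
      then have "o' = aorb (b, a)" using w sw by simp
      then show "o' \<in> AO - W" using W[OF ab(1)] w ab sym by auto
    qed
    show "(`) prod.swap ` (AO - W) \<subseteq> W"
    proof
      fix o' assume "o' \<in> (`) prod.swap ` (AO - W)"
      then obtain w where w: "w \<in> AO - W" "o' = prod.swap ` w" by blast
      then obtain a b where ab: "(a, b) \<in> E" "w = aorb (a, b)" by auto
      then have "o' = aorb (b, a)" using w sw by simp
      then show "o' \<in> W" using W[OF ab(1)] w ab by auto
    qed
  qed (auto simp: image_image)
  then have "card W = card (AO - W)" by (rule bij_betw_same_card)
  moreover have "card AO = card W + card (AO - W)"
    using sub finite_AO by (metis card_Diff_subset card_mono finite_subset le_add_diff_inverse)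
  ultimately show thesis using that[OF sub _ W] by simp
qed

text \<open>By additivity and invariance, the integral from \<open>x0\<close> to \<open>h x0\<close>
  is a homomorphism in \<open>h\<close> to the integers mod 2. An element fixing a vertex is in its
  kernel, since the way to that vertex and the translated way back cancel.\<close>

lemma par_invariant:
  assumes d: "\<And>j. j \<in> J \<Longrightarrow> \<not> par d x0 (act T (t j) x0)" and h: "h \<in> carrier H"
  shows "\<not> par d x0 (act T h x0)"
proof (rule gen[of "\<lambda>h. \<not> par d x0 (act T h x0)", OF _ _ _ _ _ h])
  show "\<not> par d x0 (act T \<one>\<^bsub>H\<^esub> x0)" using act_one x0 par_self by simp
  show "\<not> par d x0 (act T (g \<otimes>\<^bsub>H\<^esub> h) x0)" if "g \<in> carrier H" "h \<in> carrier H"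
    "\<not> par d x0 (act T g x0)" "\<not> par d x0 (act T h x0)" for g h
  proof -
    have "par d (act T g x0) (act T g (act T h x0)) \<longleftrightarrow> par d x0 (act T h x0)"
      using par_act that x0 act_V by simp
    then show ?thesis
      using par_add[of x0 "act T g x0" "act T g (act T h x0)" d] that act_mult act_V x0 by simp
  qed
  show "\<not> par d x0 (act T (inv\<^bsub>H\<^esub> g) x0)" if "g \<in> carrier H" "\<not> par d x0 (act T g x0)" for g
    using par_act[OF inv_closed[OF that(1)] x0 act_V[OF that(1) x0], of d] that act_inv(1)[OF that(1) x0]
      par_sym[of d x0] by simp
  show "\<not> par d x0 (act T s x0)" if i: "i \<in> I" "s \<in> S i" for i s
  proof -
    have s: "s \<in> carrier H" using i S_carrier by blast
    have "par d (x i) (act T s x0) \<longleftrightarrow> par d (x i) x0"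
      using par_act[OF s xV[OF i(1)] x0, of d] S_fix[OF i] by simp
    then show ?thesis
      using par_add[OF x0 xV[OF i(1)] act_V[OF s x0], of d] par_sym[of d x0 "x i"] by simp
  qed
qed (use d in blast)

text \<open>
  The integrals along the loops \<open>t j\<close> determine a cochain up to a coboundary, that is, up to a
  function on the vertex orbits; hence \<open>2 ^ card W \<le> 2 ^ (card J + card VO)\<close>.
\<close>

lemma cochain_count:
  assumes W: "W \<subseteq> AO" "\<And>a b. (a, b) \<in> E \<Longrightarrow> aorb (a, b) \<in> W \<longleftrightarrow> aorb (b, a) \<notin> W"
  shows "card W \<le> card J + card VO"
proof -
  have finW: "finite W" using W(1) finite_AO finite_subset by blast
  \<comment> \<open>\<open>\<Psi>\<close> records the integrals along the loops.
    \<open>\<Phi>\<close> records the vertex orbits on which the potential based at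
    \<open>x0\<close> is odd; this determines the potential once it is constant on orbits, which
    \<open>inv\<close> below proves for differences within a fibre of \<open>\<Psi>\<close>.\<close>
  define \<Psi> where "\<Psi> c = {j \<in> J. par c x0 (act T (t j) x0)}" for c
  define \<Phi> where "\<Phi> d = {o' \<in> VO. \<exists>y \<in> o'. par d x0 y}" for d
  have fiber: "card {c \<in> Pow W. \<Psi> c = z} \<le> 2 ^ card VO" for z
  proof (cases "{c \<in> Pow W. \<Psi> c = z} = {}")
    case False
    then obtain c0 where c0: "c0 \<subseteq> W" "\<Psi> c0 = z" by blast
    define D where "D c = c - c0 \<union> (c0 - c)" for c
    have "inj_on (\<lambda>c. \<Phi> (D c)) {c \<in> Pow W. \<Psi> c = z}"
    proof (rule inj_onI)
      fix c c' assume c: "c \<in> {c \<in> Pow W. \<Psi> c = z}" "c' \<in> {c \<in> Pow W. \<Psi> c = z}" and eq: "\<Phi> (D c) = \<Phi> (D c')"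
      have inv: "par (D c) x0 (act T h y) \<longleftrightarrow> par (D c) x0 y"
        if c: "c \<in> {c \<in> Pow W. \<Psi> c = z}" and h: "h \<in> carrier H" and y: "y \<in> V" for c h y
      proof -
        have "\<not> par (D c) x0 (act T (t j) x0)" if j: "j \<in> J" for j
        proof -
          have "j \<in> \<Psi> c \<longleftrightarrow> j \<in> \<Psi> c0" using c c0 by simp
          then show ?thesis
            unfolding D_def par_symdiff[OF x0 act_V[OF t_carrier[OF j] x0]] using j by (simp add: \<Psi>_def)
        qed
        then have "\<not> par (D c) x0 (act T h x0)" using par_invariant h by blast
        then show ?thesis
          using par_add[OF x0 act_V[OF h x0] act_V[OF h y], of "D c"] par_act[OF h x0 y, of "D c"] by simp
      qed
      have rec: "vorb y \<in> \<Phi> (D c) \<longleftrightarrow> par (D c) x0 y"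
        if "c \<in> {c \<in> Pow W. \<Psi> c = z}" and y: "y \<in> V" for c y
      proof -
        have "(\<exists>y' \<in> vorb y. par (D c) x0 y') \<longleftrightarrow> par (D c) x0 y"
          using inv[OF that(1) _ y] vorb_self[OF y] by (auto simp: orbit_def)
        then show ?thesis using vorb_VO[OF y] by (simp add: \<Phi>_def)
      qed
      have same: "par (D c) x0 y \<longleftrightarrow> par (D c') x0 y" if "y \<in> V" for y
        using rec[OF c(1) that] rec[OF c(2) that] eq by simp
      \<comment> \<open>Exactly one direction of the edge is in \<open>W\<close>, so the integral
        over the edge reads off whether its orbit belongs to the difference.\<close>
      have edge: "o' \<in> D c \<longleftrightarrow> par (D c) a b"
        if "c \<subseteq> W" "o' \<in> W" "(a, b) \<in> E" "o' = aorb (a, b)" for c o' a b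
      proof -
        have "aorb (b, a) \<notin> D c" using W(2)[OF that(3)] that c0 by (auto simp: D_def)
        then show ?thesis using par_edge[OF that(3), of "D c"] that by simp
      qed
      have "o' \<in> D c \<longleftrightarrow> o' \<in> D c'" if o': "o' \<in> W" for o'
      proof -
        obtain a b where ab: "(a, b) \<in> E" "o' = aorb (a, b)" using o' W(1) by auto
        have V: "a \<in> V" "b \<in> V" using wf ab by auto
        have "par (D c) a b \<longleftrightarrow> par (D c') a b"
          using par_add[OF x0 V, of "D c"] par_add[OF x0 V, of "D c'"] same[OF V(1)] same[OF V(2)] by blast
        then show ?thesis using edge[OF _ o' ab] c by blast
      qed
      then have "D c = D c'" using c c0 unfolding D_def by blast
      then show "c = c'" unfolding D_def by blast
    qed
    moreover have "(\<lambda>c. \<Phi> (D c)) ` {c \<in> Pow W. \<Psi> c = z} \<subseteq> Pow VO" by (auto simp: \<Phi>_def)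
    ultimately have "card {c \<in> Pow W. \<Psi> c = z} \<le> card (Pow VO)"
      using finite_VO by (intro card_inj_on_le) auto
    then show ?thesis using finite_VO by (simp add: card_Pow)
  next
    case True
    then show ?thesis unfolding True by simp
  qed
  have "Pow W = (\<Union>z \<in> Pow J. {c \<in> Pow W. \<Psi> c = z})" by (auto simp: \<Psi>_def)
  then have "2 ^ card W = card (\<Union>z \<in> Pow J. {c \<in> Pow W. \<Psi> c = z})"
    using card_Pow[OF finW] by metis
  also have "\<dots> \<le> (\<Sum>z \<in> Pow J. card {c \<in> Pow W. \<Psi> c = z})" using fin by (intro card_UN_le) auto
  also have "\<dots> \<le> (\<Sum>z \<in> Pow J. 2 ^ card VO)" by (intro sum_mono fiber)
  also have "\<dots> = 2 ^ (card J + card VO)" using fin by (simp add: card_Pow power_add)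
  finally have "(2::nat) ^ card W \<le> 2 ^ (card J + card VO)" .
  then show ?thesis by simp
qed

lemma AO_VO: "card AO \<le> 2 * (card J + card VO)"
  using orientation cochain_count by (metis mult_le_mono2)

section \<open>Valence of free vertices\<close>

definition "star y = {e \<in> E. fst e = y}"

text \<open>An element carrying one arc at \<open>y\<close> to another fixes \<open>y\<close>, hence
  is trivial.\<close>

lemma star_inj:
  assumes "stabilizer H (act T) y = {\<one>\<^bsub>H\<^esub>}" "e \<in> star y" "f \<in> star y" "aorb e = aorb f"
  shows "e = f"
proof -
  obtain g where g: "g \<in> carrier H" "f = garc g e" using assms aorb_eq_iff by (auto simp: star_def)
  then have "act T g y = y" using assms by (auto simp: star_def garc_def)
  then have "g = \<one>\<^bsub>H\<^esub>" using assms(1) g(1) by (auto simp: stabilizer_def)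
  then show ?thesis using g garc_one assms by (auto simp: star_def)
qed

lemma finite_star: "stabilizer H (act T) y = {\<one>\<^bsub>H\<^esub>} \<Longrightarrow> finite (star y)"
proof (rule finite_imageD)
  show "finite (aorb ` star y)" by (rule finite_subset[OF _ finite_AO]) (auto simp: star_def)
  show "stabilizer H (act T) y = {\<one>\<^bsub>H\<^esub>} \<Longrightarrow> inj_on aorb (star y)" using star_inj by (intro inj_onI)
qed

text \<open>A leaf orbit could be pruned, against minimality.\<close>

lemma star_not_single:
  assumes y: "y \<in> V" shows "star y \<noteq> {e}"
proof
  assume s: "star y = {e}"
  then have e: "e \<in> E" "fst e = y" by (auto simp: star_def)
  define z where "z = snd e"
  have yz: "(y, z) \<in> E" using e by (cases e) (simp add: z_def)
  have uniq: "w = act T g z" if g: "g \<in> carrier H" and "(act T g y, w) \<in> E" for g w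
  proof -
    have w: "w \<in> V" using that wf by blast
    have "(y, act T (inv\<^bsub>H\<^esub> g) w) \<in> E"
      using act_E[OF inv_closed[OF g] that(2)] act_inv(1)[OF g y] by simp
    then have "(y, act T (inv\<^bsub>H\<^esub> g) w) \<in> star y" by (simp add: star_def)
    then have "act T (inv\<^bsub>H\<^esub> g) w = z" using s by (auto simp: z_def)
    then show ?thesis using act_inv(2)[OF g w] by simp
  qed
  let ?O = "vorb y"
  have O: "u \<in> ?O \<longleftrightarrow> (\<exists>g \<in> carrier H. u = act T g y)" for u by (auto simp: orbit_def)
  \<comment> \<open>Otherwise the neighbour would be a leaf too, and the element carrying
    \<open>y\<close> to it would invert the edge.\<close>
  have zO: "z \<notin> ?O"
  proof
    assume "z \<in> ?O"
    then obtain g where g: "g \<in> carrier H" "z = act T g y" using O by blast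
    then have "y = act T g z" using uniq[OF g(1)] sym[OF yz] by simp
    then have "{act T g y, act T g z} = {y, z}" using g by auto
    then have "g = \<one>\<^bsub>H\<^esub>" using tes yz g(1) unfolding trivial_edge_stabilisers_def by blast
    then show False using g act_one[OF y] irrefl[OF yz] by simp
  qed
  have O_act: "act T h u \<in> ?O \<longleftrightarrow> u \<in> ?O" if h: "h \<in> carrier H" and u: "u \<in> V" for h u
    using VO_eq[OF vorb_VO[OF y], of u] VO_eq[OF vorb_VO[OF y], of "act T h u"] vorb_act[OF h u]
      vorb_self[OF u] vorb_self[OF act_V[OF h u]] by metis
  have nb: "v \<notin> ?O" if "u \<in> ?O" "(u, v) \<in> E" for u v
  proof -
    have "\<exists>g \<in> carrier H. u = act T g y" using that O by simp
    then obtain g where g: "g \<in> carrier H" "u = act T g y" by (rule bexE)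
    have "v = act T g z" using uniq[OF g(1), of v] that(2) g(2) by simp
    then show ?thesis using O_act[OF g(1)] zO wf yz by simp
  qed
  have nb1: "v = v'" if "u \<in> ?O" "(u, v) \<in> E" "(u, v') \<in> E" for u v v'
    using that uniq O by metis
  define A where "A = \<lparr>pverts = V - ?O, parcs = {(u, v) \<in> E. u \<notin> ?O \<and> v \<notin> ?O}\<rparr>"
  have Av: "pverts A = V - ?O" and Aa: "(u, v) \<in> parcs A \<longleftrightarrow> (u, v) \<in> E \<and> u \<notin> ?O \<and> v \<notin> ?O" for u v
    by (auto simp: A_def)
  \<comment> \<open>\<open>r\<close> retracts each vertex of the orbit to its only neighbour. It
    turns walks in the tree into walks in the pruned graph, which is therefore connected.\<close>
  define r where "r u = (if u \<in> ?O then SOME v. (u, v) \<in> E else u)" for u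
  have r: "r u = v" if "u \<in> ?O" "(u, v) \<in> E" for u v
  proof -
    have "(SOME v. (u, v) \<in> E) = v" by (rule some_equality[of "\<lambda>v. (u, v) \<in> E", OF that(2)]) (rule nb1[OF that(1) _ that(2)])
    then show ?thesis using that(1) by (simp add: r_def)
  qed
  have step: "(r u, r v) \<in> (parcs A)\<^sup>*" if uv: "(u, v) \<in> E" for u v
  proof -
    consider "u \<in> ?O" | "v \<in> ?O" | "u \<notin> ?O" "v \<notin> ?O" by blast
    then show ?thesis
    proof cases
      case 1
      then show ?thesis using r[OF 1 uv] nb[OF 1 uv] by (simp add: r_def)
    next
      case 2
      then show ?thesis using r[OF 2 sym[OF uv]] nb[OF 2 sym[OF uv]] by (simp add: r_def)
    next
      case 3
      then show ?thesis using uv by (auto simp: r_def Aa)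
    qed
  qed
  have walk: "(r u, r v) \<in> (parcs A)\<^sup>*" if "(u, v) \<in> E\<^sup>*" for u v
    using that by induction (use step in \<open>auto intro: rtrancl_trans\<close>)
  have "stree (pverts A) (parcs A)"
  proof (rule stree_sub[OF stree_axioms])
    show "pverts A \<subseteq> V" "pverts A \<noteq> {}" using zO wf[OF yz] by (auto simp: Av)
    show "parcs A \<subseteq> E" by (auto simp: A_def)
    show "a \<in> pverts A \<and> b \<in> pverts A" if "(a, b) \<in> parcs A" for a b using that wf by (auto simp: Av Aa)
    show "(b, a) \<in> parcs A" if "(a, b) \<in> parcs A" for a b using that sym by (auto simp: Aa)
    show "(u, v) \<in> (parcs A)\<^sup>*" if "u \<in> pverts A" "v \<in> pverts A" for u v
      using walk[OF conn[of u v]] that by (simp add: Av r_def)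
  qed
  then have "simplicial_tree A" by (rule stree_simplicial_tree)
  moreover have "invariant_subgraph H T A"
    unfolding invariant_subgraph_def
  proof (intro conjI ballI)
    have "wf_digraph (with_proj A)"
      by (simp add: wf_digraph_wp_iff pair_wf_digraph_def) (use wf in \<open>auto simp: Av A_def\<close>)
    moreover have "wf_digraph (with_proj (tgraph T))"
      by (simp add: wf_digraph_wp_iff pair_wf_digraph_def) (use wf in auto)
    moreover have "parcs A \<subseteq> E" by (auto simp: A_def)
    ultimately show "subgraph (with_proj A) (with_proj (tgraph T))" unfolding subgraph_def by (auto simp: Av)
    show "symmetric (with_proj A)" using sym by (auto simp: symmetric_def A_def intro: symI)
    show "act T g y \<in> pverts A" if "g \<in> carrier H" "y \<in> pverts A" for g y
      using that O_act act_V by (simp add: Av)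
    show "case e of (u, v) \<Rightarrow> (act T g u, act T g v) \<in> parcs A" if "g \<in> carrier H" "e \<in> parcs A" for g e
      using that O_act[OF that(1)] act_E[OF that(1)] wf by (cases e) (auto simp: Aa)
  qed
  ultimately have "A = tgraph T" using mini by (simp add: minimal_tree_def)
  then have "V = V - ?O" using Av by simp
  then show False using vorb_self[OF y] y by blast
qed

text \<open>A vertex without edges is the whole tree, hence fixed by all of
  \<open>H\<close>.\<close>

lemma star_nonempty:
  assumes y: "y \<in> V" "stabilizer H (act T) y = {\<one>\<^bsub>H\<^esub>}" and nontriv: "carrier H \<noteq> {\<one>\<^bsub>H\<^esub>}"
  shows "star y \<noteq> {}"
proof
  assume s: "star y = {}"
  have no: "(y, v) \<notin> E" for v using s by (auto simp: star_def)
  have only: "w = y" if w: "w \<in> V" for w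
    using conn[OF y(1) w] no by (metis converse_rtranclE)
  have "act T g y = y" if "g \<in> carrier H" for g by (rule only[OF act_V[OF that y(1)]])
  then have "stabilizer H (act T) y = carrier H" by (auto simp: stabilizer_def)
  then show False using y(2) nontriv by simp
qed

lemma star_card:
  assumes "y \<in> V" "free_vertex H T y" "\<not> redundant_vertex H T y" "carrier H \<noteq> {\<one>\<^bsub>H\<^esub>}"
  shows "3 \<le> card (star y)"
proof -
  have st: "stabilizer H (act T) y = {\<one>\<^bsub>H\<^esub>}" using assms(2) by (simp add: free_vertex_def)
  have "card (star y) \<noteq> 2"
    using assms(2,3) by (simp add: redundant_vertex_def out_degree_def out_arcs_def star_def)
  moreover have "card (star y) \<noteq> 0" using star_nonempty[OF assms(1) st assms(4)] finite_star[OF st] by simp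
  moreover have "card (star y) \<noteq> 1" using star_not_single[OF assms(1)] by (metis card_1_singletonE)
  ultimately show ?thesis by linarith
qed

text \<open>The stars of representatives of the free orbits inject, with disjoint images, into the
  orbits of arcs, and each has at least three elements.\<close>

lemma free_orbits:
  assumes red: "\<And>y. y \<in> V \<Longrightarrow> \<not> redundant_vertex H T y" and nontriv: "carrier H \<noteq> {\<one>\<^bsub>H\<^esub>}"
  shows "3 * card {o' \<in> VO. \<exists>y \<in> o'. free_vertex H T y} \<le> card AO"
proof -
  let ?F = "{o' \<in> VO. \<exists>y \<in> o'. free_vertex H T y}"
  define p where "p o' = (SOME y. y \<in> o' \<and> free_vertex H T y)" for o'
  have p: "p o' \<in> o'" "free_vertex H T (p o')" if "o' \<in> ?F" for o'
  proof -
    have "\<exists>y. y \<in> o' \<and> free_vertex H T y" using that by blast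
    from someI_ex[OF this] show "p o' \<in> o'" "free_vertex H T (p o')" by (simp_all add: p_def)
  qed
  have pV: "p o' \<in> V" "o' = vorb (p o')" if "o' \<in> ?F" for o' using VO_eq[of o' "p o'"] p[OF that] that by auto
  have st: "stabilizer H (act T) (p o') = {\<one>\<^bsub>H\<^esub>}" if "o' \<in> ?F" for o'
    using p(2)[OF that] by (simp add: free_vertex_def)
  have same: "o1 = o2 \<and> e = f"
    if "o1 \<in> ?F" "o2 \<in> ?F" "e \<in> star (p o1)" "f \<in> star (p o2)" "aorb e = aorb f" for o1 o2 e f
  proof -
    have "\<exists>g \<in> carrier H. f = garc g e" using that aorb_eq_iff[of e f] by (simp add: star_def)
    then obtain g where g: "g \<in> carrier H" "f = garc g e" by (rule bexE)
    then have "p o2 = act T g (p o1)" using that by (auto simp: star_def garc_def)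
    then have "vorb (p o2) = vorb (p o1)" using vorb_act[OF g(1) pV(1)[OF that(1)]] by simp
    then have "o1 = o2" using pV(2)[OF that(1)] pV(2)[OF that(2)] by argo
    then show ?thesis using star_inj[OF st[OF that(1)]] that by blast
  qed
  have "3 * card ?F = (\<Sum>o' \<in> ?F. 3)" by simp
  also have "\<dots> \<le> (\<Sum>o' \<in> ?F. card (star (p o')))"
    by (intro sum_mono star_card pV p red nontriv)
  also have "\<dots> = card (\<Union>o' \<in> ?F. star (p o'))"
  proof (rule card_UN_disjoint[symmetric])
    show "finite ?F" using finite_VO by simp
    show "\<forall>o' \<in> ?F. finite (star (p o'))" using finite_star[OF st] by blast
    show "\<forall>o1 \<in> ?F. \<forall>o2 \<in> ?F. o1 \<noteq> o2 \<longrightarrow> star (p o1) \<inter> star (p o2) = {}"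
    proof (intro ballI impI)
      fix o1 o2 assume o: "o1 \<in> ?F" "o2 \<in> ?F" "o1 \<noteq> o2"
      have "\<not> (e \<in> star (p o1) \<and> e \<in> star (p o2))" for e using same[OF o(1,2), of e e] o(3) by blast
      then show "star (p o1) \<inter> star (p o2) = {}" by blast
    qed
  qed
  also have "\<dots> \<le> card AO"
  proof (rule card_inj_on_le[of aorb])
    show "inj_on aorb (\<Union>o' \<in> ?F. star (p o'))" using same by (intro inj_onI) blast
    show "aorb ` (\<Union>o' \<in> ?F. star (p o')) \<subseteq> AO" by (auto simp: star_def)
  qed (rule finite_AO)
  finally show ?thesis .
qed

lemma arc_index_exists:
  assumes "card AO \<le> n"
  shows "\<exists>idx. arc_index H T n idx"
proof -
  obtain f m where fm: "f ` AO = {i::nat. i < m}" "inj_on f AO"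
    using finite_imp_inj_to_nat_seg[OF finite_AO] by blast
  have "card AO = m" using card_image[OF fm(2)] fm(1) by simp
  then have f: "inj_on f AO" "f ` AO = {i. i < card AO}" using fm by simp_all
  have "arc_index H T n (\<lambda>e. f (aorb e))"
    unfolding arc_index_def
  proof (intro conjI ballI)
    fix e assume e: "e \<in> E"
    then have "f (aorb e) \<in> {i. i < card AO}" using f(2) by blast
    then show "f (aorb e) < n" using assms by simp
    fix e' assume e': "e' \<in> E"
    have "f (aorb e) = f (aorb e') \<longleftrightarrow> aorb e = aorb e'" using f(1) e e' by (auto dest: inj_onD)
    then show "f (aorb e) = f (aorb e') \<longleftrightarrow> (\<exists>g \<in> carrier H. e' = (act T g (fst e), act T g (snd e)))"
      using aorb_eq_iff[OF e e'] by (simp add: garc_def)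
  qed
  then show ?thesis by blast
qed

end

text \<open>Meant for \<open>N\<close> orbits of arcs, \<open>f\<close> free and \<open>n\<close>
  non-free orbits of vertices, and a graph of groups with \<open>k\<close> vertices and
  \<open>b\<close> edges. Tripling the last inequality produces \<open>6 * f\<close>, which is at
  most \<open>2 * N\<close> and can be absorbed on the left.\<close>

lemma orbit_arith:
  fixes N n k v f b :: nat
  assumes "n \<le> k" "v = f + n" "3 * f \<le> N" "N \<le> 2 * (b + v)"
  shows "N \<le> 6 * (k + b) + 2"
proof -
  have "3 * N \<le> 6 * b + 6 * f + 6 * n" "6 * f \<le> 2 * N" "6 * n \<le> 6 * k" using assms by simp_all
  then have "3 * N \<le> 6 * b + 2 * N + 6 * k" by linarith
  then show ?thesis by simp
qed

text \<open>The factor 6 comes from \<open>orbit_arith\<close>. The summand 2 covers the action on a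
  line with a single orbit of vertices, where \<open>AO_VO\<close> gives twice the number of edges
  of the graph plus 2.\<close>

definition arc_bound :: "('v, 'e, 'g) gog \<Rightarrow> nat" where
  "arc_bound G = 6 * (card (verts (ugraph G)) + card (arcs (ugraph G))) + 2"

text \<open>\<open>AO_VO\<close> bounds the arc orbits by the vertex orbits. Of these, the free ones
  number at most a third of the arc orbits, and the non-free ones inject into the vertices of the
  graph of groups.\<close>

lemma outer_tree_bound:
  fixes G :: "('v, 'e, 'g) gog"
  assumes "graph_of_groups G" and nontriv: "carrier (pi1 G) \<noteq> {\<one>\<^bsub>pi1 G\<^esub>}" and T: "T \<in> outer_trees G"
  shows "finite_quotient (pi1 G) T" "\<exists>idx. arc_index (pi1 G) T (arc_bound G) idx"
proof -
  interpret gog G by unfold_locales fact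
  let ?H = "pi1 G" and ?VG = "verts (ugraph G)"
  have mt: "metric_tree ?H T" "trivial_edge_stabilisers ?H T" "minimal_tree ?H T"
    and uniq: "\<And>v. v \<in> nontrivial_vertices G \<Longrightarrow> \<exists>!o'. o' \<in> orbits ?H (tverts T) (act T) \<and>
      (\<forall>y \<in> o'. stabilizer ?H (act T) y \<in> vertex_groups G v)"
    and stabs: "\<And>y. y \<in> tverts T \<Longrightarrow> free_vertex ?H T y \<or>
      (\<exists>v \<in> nontrivial_vertices G. stabilizer ?H (act T) y \<in> vertex_groups G v)"
    and red: "no_redundant_vertices ?H T"
    using T by (auto simp: outer_trees_def)
  interpret h: htree ?H T by unfold_locales fact
  \<comment> \<open>For a nontrivial vertex group the path is taken such that the transported group
    is a vertex stabiliser; a trivial one fixes any vertex.\<close>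
  have "\<exists>p y. gpath G (base G) p v \<and> y \<in> tverts T \<and> (\<forall>g \<in> carrier (vgrp G v). act T (vconj p v g) y = y)"
    if v: "v \<in> ?VG" for v
  proof (cases "v \<in> nontrivial_vertices G")
    case True
    then obtain o' where o': "o' \<in> orbits ?H (tverts T) (act T)"
      "\<forall>y \<in> o'. stabilizer ?H (act T) y \<in> vertex_groups G v" using uniq by blast
    obtain y where y: "y \<in> tverts T" "o' = h.vorb y" using o'(1) unfolding orbits_def by blast
    then have "stabilizer ?H (act T) y \<in> vertex_groups G v" using o'(2) h.vorb_self by blast
    then obtain p where p: "gpath G (base G) p v" "stabilizer ?H (act T) y = vconj p v ` carrier (vgrp G v)"
      unfolding vertex_groups_vconj by blast
    have "act T (vconj p v g) y = y" if "g \<in> carrier (vgrp G v)" for g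
    proof -
      have "vconj p v g \<in> stabilizer ?H (act T) y" using p that by blast
      then show ?thesis by (simp add: stabilizer_def)
    qed
    then show ?thesis using p y by blast
  next
    case False
    then have triv: "carrier (vgrp G v) = {\<one>\<^bsub>vgrp G v\<^esub>}" using v by (simp add: nontrivial_vertices_def)
    obtain p where p: "gpath G (base G) p v" using path_to_vertex[OF v] by blast
    obtain y where y: "y \<in> tverts T" using h.nonempty by blast
    have "act T (vconj p v g) y = y" if "g \<in> carrier (vgrp G v)" for g
      using that triv vconj_one[OF p] h.act_one[OF y] by simp
    then show ?thesis using p y by blast
  qed
  then obtain pv y where pv: "\<And>v. v \<in> ?VG \<Longrightarrow> gpath G (base G) (pv v) v"
    and y: "\<And>v. v \<in> ?VG \<Longrightarrow> y v \<in> tverts T"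
    "\<And>v g. v \<in> ?VG \<Longrightarrow> g \<in> carrier (vgrp G v) \<Longrightarrow> act T (vconj (pv v) v g) (y v) = y v"
    by metis
  interpret gen_tree ?H T ?VG y "\<lambda>v. vconj (pv v) v ` carrier (vgrp G v)" "arcs (ugraph G)" "edge_loop pv"
  proof
    fix P :: "('v, 'e, 'g) loop_class \<Rightarrow> bool" and c
    assume P: "P \<one>\<^bsub>?H\<^esub>"
      "\<And>g h. g \<in> carrier ?H \<Longrightarrow> h \<in> carrier ?H \<Longrightarrow> P g \<Longrightarrow> P h \<Longrightarrow> P (g \<otimes>\<^bsub>?H\<^esub> h)"
      "\<And>g. g \<in> carrier ?H \<Longrightarrow> P g \<Longrightarrow> P (inv\<^bsub>?H\<^esub> g)"
      "\<And>v s. v \<in> ?VG \<Longrightarrow> s \<in> vconj (pv v) v ` carrier (vgrp G v) \<Longrightarrow> P s"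
      "\<And>e. e \<in> arcs (ugraph G) \<Longrightarrow> P (edge_loop pv e)" "c \<in> carrier ?H"
    show "P c" by (rule pi1_induct[OF h.group_H pv P(1-3) _ P(5,6)]) (use P(4) in auto)
  qed (use mt pv y vconj_carrier edge_loop_carrier[OF pv] in auto)
  show "finite_quotient ?H T" by (rule finite_quotient_T)
  \<comment> \<open>Stabilisers along an orbit are conjugate, and \<open>vertex_groups G v\<close>
    is closed under conjugation; so one vertex of an orbit decides for the whole orbit.\<close>
  have conj_stab: "stabilizer ?H (act T) (act T h u) \<in> vertex_groups G v"
    if "stabilizer ?H (act T) u \<in> vertex_groups G v" "h \<in> carrier ?H" "u \<in> tverts T" for h u v
  proof -
    have "stabilizer ?H (act T) (act T h u)
        = (\<lambda>s. h \<otimes>\<^bsub>?H\<^esub> s \<otimes>\<^bsub>?H\<^esub> inv\<^bsub>?H\<^esub> h) ` stabilizer ?H (act T) u"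
    proof (intro equalityI subsetI)
      fix g assume "g \<in> stabilizer ?H (act T) (act T h u)"
      then have g: "g \<in> carrier ?H" "act T g (act T h u) = act T h u" by (auto simp: stabilizer_def)
      let ?s = "inv\<^bsub>?H\<^esub> h \<otimes>\<^bsub>?H\<^esub> g \<otimes>\<^bsub>?H\<^esub> h"
      have "act T ?s u = u" using g that(2,3) h.act_mult h.act_V h.act_inv(1) h.m_assoc by simp
      then have "?s \<in> stabilizer ?H (act T) u" using g that by (simp add: stabilizer_def)
      moreover have "g = h \<otimes>\<^bsub>?H\<^esub> ?s \<otimes>\<^bsub>?H\<^esub> inv\<^bsub>?H\<^esub> h"
      proof -
        have "h \<otimes>\<^bsub>?H\<^esub> ?s = g \<otimes>\<^bsub>?H\<^esub> h" using g that by (simp add: h.m_assoc[symmetric])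
        then show ?thesis using g that by (simp add: h.m_assoc)
      qed
      ultimately show "g \<in> (\<lambda>s. h \<otimes>\<^bsub>?H\<^esub> s \<otimes>\<^bsub>?H\<^esub> inv\<^bsub>?H\<^esub> h) ` stabilizer ?H (act T) u" by blast
    next
      fix g assume "g \<in> (\<lambda>s. h \<otimes>\<^bsub>?H\<^esub> s \<otimes>\<^bsub>?H\<^esub> inv\<^bsub>?H\<^esub> h) ` stabilizer ?H (act T) u"
      then obtain s where "s \<in> carrier ?H" "act T s u = u" "g = h \<otimes>\<^bsub>?H\<^esub> s \<otimes>\<^bsub>?H\<^esub> inv\<^bsub>?H\<^esub> h"
        by (auto simp: stabilizer_def)
      then show "g \<in> stabilizer ?H (act T) (act T h u)"
        using that(2,3) h.act_mult h.act_V h.act_inv(1) by (simp add: stabilizer_def)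
    qed
    then show ?thesis using vertex_groups_conj[OF h.group_H that(1,2)] by simp
  qed
  have "card h.AO \<le> arc_bound G"
    using red unfolding no_redundant_vertices_def
  proof
    assume "\<forall>y \<in> tverts T. \<not> redundant_vertex ?H T y"
    then have 3: "3 * card {o' \<in> h.VO. \<exists>y \<in> o'. free_vertex ?H T y} \<le> card h.AO"
      using free_orbits nontriv by blast
    let ?F = "{o' \<in> h.VO. \<exists>y \<in> o'. free_vertex ?H T y}"
    define w where "w o' = (SOME v. v \<in> nontrivial_vertices G \<and> (\<forall>y \<in> o'. stabilizer ?H (act T) y \<in> vertex_groups G v))" for o'
    have w: "w o' \<in> nontrivial_vertices G \<and> (\<forall>y \<in> o'. stabilizer ?H (act T) y \<in> vertex_groups G (w o'))"
      if o': "o' \<in> h.VO - ?F" for o'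
    proof -
      obtain u where u: "u \<in> tverts T" "o' = h.vorb u" using o' unfolding orbits_def by blast
      then have "\<not> free_vertex ?H T u" using o' h.vorb_self by blast
      then obtain v where v: "v \<in> nontrivial_vertices G" "stabilizer ?H (act T) u \<in> vertex_groups G v"
        using stabs u by blast
      then have "\<forall>y \<in> o'. stabilizer ?H (act T) y \<in> vertex_groups G v"
        using conj_stab[OF v(2) _ u(1)] unfolding u(2) orbit_def by blast
      then have "\<exists>v. v \<in> nontrivial_vertices G \<and> (\<forall>y \<in> o'. stabilizer ?H (act T) y \<in> vertex_groups G v)"
        using v by blast
      from someI_ex[OF this] show ?thesis unfolding w_def .
    qed
    \<comment> \<open>Two non-free orbits belonging to the same vertex would contradict the
      uniqueness demanded in \<open>outer_trees\<close>.\<close>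
    have nonfree: "card (h.VO - ?F) \<le> card ?VG"
    proof (rule card_inj_on_le[of w])
      show "inj_on w (h.VO - ?F)"
      proof (rule inj_onI)
        fix o1 o2 assume o: "o1 \<in> h.VO - ?F" "o2 \<in> h.VO - ?F" "w o1 = w o2"
        let ?Q = "\<lambda>o'. o' \<in> h.VO \<and> (\<forall>y \<in> o'. stabilizer ?H (act T) y \<in> vertex_groups G (w o1))"
        have 1: "?Q o1" using o(1) w[OF o(1)] by simp
        have 2: "?Q o2" using o(2) w[OF o(2)] unfolding o(3) by simp
        have ex: "\<exists>!o'. ?Q o'" by (rule uniq) (use w[OF o(1)] in simp)
        show "o1 = o2" using the1_equality[OF ex 1] the1_equality[OF ex 2] by simp
      qed
      have "w o' \<in> ?VG" if "o' \<in> h.VO - ?F" for o'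
        using w[OF that] by (simp add: nontrivial_vertices_def)
      then show "w ` (h.VO - ?F) \<subseteq> ?VG" by (rule image_subsetI)
    qed simp
    have split: "card h.VO = card ?F + card (h.VO - ?F)"
    proof -
      have "h.VO \<inter> ?F = ?F" by blast
      then show ?thesis using card_Int_Diff[OF finite_VO, of ?F] by simp
    qed
    show ?thesis
      unfolding arc_bound_def by (rule orbit_arith[OF nonfree split 3 AO_VO])
  next
    assume "orbits ?H (tverts T) (act T) = {tverts T} \<and> (\<forall>y \<in> tverts T. redundant_vertex ?H T y)"
    then have "card h.VO = 1" by simp
    then show ?thesis using AO_VO unfolding arc_bound_def by simp
  qed
  then show "\<exists>idx. arc_index ?H T (arc_bound G) idx" by (rule arc_index_exists)
qed

section \<open>Dickson's lemma\<close>

text \<open>One coordinate at a time: pass to a monotone subsequence. A nonincreasing sequence of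
  natural numbers is constant from its minimum on, so in any case some tail is
  nondecreasing.\<close>

lemma dickson_subsequence:
  fixes f :: "nat \<Rightarrow> 'k \<Rightarrow> nat"
  assumes "finite K"
  shows "\<exists>r :: nat \<Rightarrow> nat. strict_mono r \<and> (\<forall>k \<in> K. \<forall>m n. m \<le> n \<longrightarrow> f (r m) k \<le> f (r n) k)"
  using assms
proof induction
  case empty
  then show ?case by (intro exI[of _ id]) (simp add: strict_mono_def)
next
  case (insert k K)
  then obtain r :: "nat \<Rightarrow> nat" where r: "strict_mono r" "\<forall>k \<in> K. \<forall>m n. m \<le> n \<longrightarrow> f (r m) k \<le> f (r n) k"
    by (elim exE conjE) (rule that)
  obtain g :: "nat \<Rightarrow> nat" where g: "strict_mono g" "monoseq (\<lambda>n. f (r (g n)) k)"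
    using seq_monosub[of "\<lambda>n. f (r n) k"] by (elim exE conjE) (rule that)
  have "\<exists>N. \<forall>m n. N \<le> m \<and> m \<le> n \<longrightarrow> f (r (g m)) k \<le> f (r (g n)) k"
  proof (cases "\<forall>m n. m \<le> n \<longrightarrow> f (r (g m)) k \<le> f (r (g n)) k")
    case False
    then have dec: "\<forall>m n. m \<le> n \<longrightarrow> f (r (g n)) k \<le> f (r (g m)) k"
      using g(2) by (auto simp: monoseq_def)
    define v where "v = (LEAST x. \<exists>n. f (r (g n)) k = x)"
    have "\<exists>n. f (r (g n)) k = v" unfolding v_def by (rule LeastI[of _ "f (r (g 0)) k"]) blast
    then obtain N where N: "f (r (g N)) k = v" by blast
    have "v \<le> f (r (g n)) k" for n unfolding v_def by (rule Least_le) blast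
    moreover have "f (r (g n)) k \<le> v" if "N \<le> n" for n using dec that unfolding N[symmetric] by blast
    ultimately have "f (r (g n)) k = v" if "N \<le> n" for n using that by (intro le_antisym)
    then show ?thesis by (intro exI[of _ N]) auto
  qed blast
  then obtain N where N: "\<And>m n. N \<le> m \<Longrightarrow> m \<le> n \<Longrightarrow> f (r (g m)) k \<le> f (r (g n)) k" by blast
  have "strict_mono (\<lambda>n. r (g (N + n)))"
    using r(1) g(1) by (auto simp: strict_mono_def)
  moreover have "g (N + m) \<le> g (N + n)" if "m \<le> n" for m n
    using g(1) that by (simp add: strict_mono_less_eq)
  ultimately show ?case
    using r(2) N by (intro exI[of _ "\<lambda>n. r (g (N + n))"]) auto
qed

text \<open>The pigeonhole principle for the finitely many types is applied inside a subsequence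
  along which all counts are already monotone.\<close>

lemma dickson_pair:
  fixes f :: "nat \<Rightarrow> 'k \<Rightarrow> nat" and \<tau> :: "nat \<Rightarrow> 't"
  assumes "finite Z" "\<And>n. \<tau> n \<in> Z" "finite K"
  obtains n m where "n < m" "\<tau> n = \<tau> m" "\<And>k. k \<in> K \<Longrightarrow> f n k \<le> f m k"
proof -
  obtain r :: "nat \<Rightarrow> nat" where r0: "strict_mono r" "\<forall>k \<in> K. \<forall>m n. m \<le> n \<longrightarrow> f (r m) k \<le> f (r n) k"
    using dickson_subsequence[OF assms(3), of f] by (elim exE conjE) (rule that)
  have r: "strict_mono r" "\<And>k m n. k \<in> K \<Longrightarrow> m \<le> n \<Longrightarrow> f (r m) k \<le> f (r n) k" using r0 by auto
  have "finite (range (\<lambda>n. \<tau> (r n)))" by (rule finite_subset[OF _ assms(1)]) (use assms(2) in blast)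
  then have "\<not> inj (\<lambda>n. \<tau> (r n))" using range_inj_infinite[of "\<lambda>n. \<tau> (r n)"] by blast
  then obtain a b where ab: "a \<noteq> b" "\<tau> (r a) = \<tau> (r b)" by (auto simp: inj_def)
  show thesis
  proof (cases "a < b")
    case True
    then show ?thesis using that[of "r a" "r b"] ab r by (simp add: strict_mono_less)
  next
    case False
    then show ?thesis using that[of "r b" "r a"] ab r by (simp add: strict_mono_less)
  qed
qed

section \<open>Combinatorial types of maps\<close>

text \<open>Of the two directions of an edge the one with the smaller index is used. This
  orientation is invariant under the group because indices are; it exists because the two indices
  differ.\<close>

definition interior :: "('h, 'x) gtree \<Rightarrow> ('x \<times> 'x \<Rightarrow> nat) \<Rightarrow> ('x \<Rightarrow> real) \<Rightarrow> 'x \<times> 'x \<times> real \<Rightarrow> bool" where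
  "interior T idx p = (\<lambda>(a, b, t). (a, b) \<in> tarcs T \<and> idx (a, b) < idx (b, a) \<and> 0 < t \<and> t < 1 \<and> p = pt a b t)"

text \<open>
  \<open>slide T idx p s\<close> moves a point inside an edge to parameter \<open>s\<close> on that edge, with respect to an
  invariant orientation of the edges; vertices stay fixed.
\<close>

definition slide :: "('h, 'x) gtree \<Rightarrow> ('x \<times> 'x \<Rightarrow> nat) \<Rightarrow> ('x \<Rightarrow> real) \<Rightarrow> real \<Rightarrow> 'x \<Rightarrow> real" where
  "slide T idx p s = (if \<exists>z. interior T idx p z
     then (case SOME z. interior T idx p z of (a, b, t) \<Rightarrow> pt a b s) else p)"

text \<open>The value 0 at vertices is arbitrary, as \<open>slide\<close> ignores the parameter
  there.\<close>

definition param :: "('h, 'x) gtree \<Rightarrow> ('x \<times> 'x \<Rightarrow> nat) \<Rightarrow> ('x \<Rightarrow> real) \<Rightarrow> real" where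
  "param T idx p = (if \<exists>z. interior T idx p z then snd (snd (SOME z. interior T idx p z)) else 0)"

text \<open>
  The coordinate of \<open>slide T idx p s\<close> with respect to an edge \<open>e\<close>, as a function of \<open>s\<close>, is one of
  \<open>0\<close>, \<open>1\<close>, \<open>s\<close>, \<open>1 - s\<close>; the codes number these four cases.
\<close>

definition codeval :: "nat \<Rightarrow> real \<Rightarrow> real" where
  "codeval \<kappa> s = (if \<kappa> = 0 then 0 else if \<kappa> = 1 then 1 else if \<kappa> = 2 then s else 1 - s)"

definition code :: "('h, 'x) gtree \<Rightarrow> ('x \<times> 'x \<Rightarrow> nat) \<Rightarrow> 'x \<times> 'x \<Rightarrow> ('x \<Rightarrow> real) \<Rightarrow> nat" where
  "code T idx e p = (SOME \<kappa>. \<kappa> < 4 \<and>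
     (\<forall>s. 0 \<le> s \<and> s \<le> 1 \<longrightarrow> coord (tarcs T) e (slide T idx p s) = codeval \<kappa> s))"

text \<open>The arcs whose coordinate can differ between the two points for some positions inside
  their edges. Equal codes contribute only from 2 on: then both points are inside the same edge, at
  independent positions.\<close>

definition dset :: "('h, 'x) gtree \<Rightarrow> ('x \<times> 'x \<Rightarrow> nat) \<Rightarrow> ('x \<Rightarrow> real) \<Rightarrow> ('x \<Rightarrow> real) \<Rightarrow> ('x \<times> 'x) set" where
  "dset T idx p q = {e \<in> tarcs T. code T idx e p \<noteq> code T idx e q \<or> 2 \<le> code T idx e p}"

text \<open>The crossing numbers: how many arcs of an orbit are met between \<open>p\<close> and
  \<open>q\<close>, sorted by how they meet the two ends.\<close>

definition cnt :: "('h, 'x) gtree \<Rightarrow> ('x \<times> 'x \<Rightarrow> nat) \<Rightarrow> ('x \<Rightarrow> real) \<Rightarrow> ('x \<Rightarrow> real) \<Rightarrow> nat \<times> nat \<times> nat \<Rightarrow> nat" where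
  "cnt T idx p q k = card {e \<in> dset T idx p q. (idx e, code T idx e p, code T idx e q) = k}"

text \<open>Names a vertex orbit by the smallest index of an arc starting in it, so that names obey
  the bound for arcs. Meaningful only for vertices at which some arc starts.\<close>

definition vdx :: "('h, 'b) monoid_scheme \<Rightarrow> ('h, 'x) gtree \<Rightarrow> ('x \<times> 'x \<Rightarrow> nat) \<Rightarrow> 'x \<Rightarrow> nat" where
  "vdx H T idx v = (LEAST j. \<exists>e \<in> tarcs T. fst e \<in> orbit H (act T) v \<and> idx e = j)"

definition rarc :: "('h, 'x) gtree \<Rightarrow> ('x \<times> 'x \<Rightarrow> nat) \<Rightarrow> nat \<Rightarrow> 'x \<times> 'x" where
  "rarc T idx j = (SOME e. e \<in> tarcs T \<and> idx e = j)"

section \<open>Distances as combinations of crossing numbers\<close>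

locale marked_tree = htree H T for H :: "('h, 'b) monoid_scheme" and T :: "('h, 'x) gtree" +
  fixes B :: nat and idx :: "'x \<times> 'x \<Rightarrow> nat"
  assumes tes: "trivial_edge_stabilisers H T" and ai: "arc_index H T B idx"
begin

lemma idx_less: "e \<in> E \<Longrightarrow> idx e < B"
  using ai by (simp add: arc_index_def)

lemma idx_eq: "e \<in> E \<Longrightarrow> f \<in> E \<Longrightarrow> idx e = idx f \<longleftrightarrow> (\<exists>g \<in> carrier H. f = garc g e)"
  using ai by (simp add: arc_index_def garc_def)

lemma idx_garc: "e \<in> E \<Longrightarrow> g \<in> carrier H \<Longrightarrow> idx (garc g e) = idx e"
  using idx_eq[of e "garc g e"] garc_E by auto

lemma idx_act: "(a, b) \<in> E \<Longrightarrow> g \<in> carrier H \<Longrightarrow> idx (act T g a, act T g b) = idx (a, b)"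
  using idx_garc[of "(a, b)" g] by (simp add: garc_def)

lemma idx_swap:
  assumes ab: "(a, b) \<in> E"
  shows "idx (a, b) \<noteq> idx (b, a)"
proof
  assume "idx (a, b) = idx (b, a)"
  then have "\<exists>g \<in> carrier H. (b, a) = garc g (a, b)" using idx_eq[OF ab sym[OF ab]] by simp
  then obtain g where g: "g \<in> carrier H" "(b, a) = garc g (a, b)" by (rule bexE)
  have "act T g a = b" "act T g b = a" using g(2)[symmetric] by (simp_all add: garc_def)
  then have "{act T g a, act T g b} = {a, b}" by (simp add: insert_commute)
  then have "g = \<one>\<^bsub>H\<^esub>" using tes ab g(1) unfolding trivial_edge_stabilisers_def by blast
  then show False using g garc_one[OF ab] irrefl[OF ab] by simp
qed

abbreviation "intr \<equiv> interior T idx"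
abbreviation "sl \<equiv> slide T idx"
abbreviation "tp \<equiv> param T idx"

lemma interior_unique:
  assumes "intr p (a, b, t)" "intr p (c, d, s)"
  shows "c = a \<and> d = b \<and> s = t"
proof -
  have 1: "pt a b t = pt c d s" "0 < t" "t < 1" "0 < s" "s < 1" "(a, b) \<in> E" "(c, d) \<in> E"
    "idx (a, b) < idx (b, a)" "idx (c, d) < idx (d, c)"
    using assms by (auto simp: interior_def)
  then have "a \<noteq> b" "c \<noteq> d" using irrefl by blast+
  then show ?thesis using pt_eqD[OF 1(1)] 1 by auto
qed

lemma interior_some:
  assumes "intr p (a, b, t)"
  shows "(SOME z. intr p z) = (a, b, t)"
proof (rule some_equality[of "intr p", OF assms])
  fix z assume "intr p z"
  then show "z = (a, b, t)" using interior_unique[OF assms] by (cases z) auto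
qed

lemma interior_slide: "intr p (a, b, t) \<Longrightarrow> sl p s = pt a b s"
  and interior_param: "intr p (a, b, t) \<Longrightarrow> tp p = t"
  using interior_some by (auto simp: slide_def param_def)

lemma point_cases:
  assumes "p \<in> points T"
  obtains (inner) a b t where "intr p (a, b, t)"
  | (vertex) u where "u \<in> V" "p = vpt u" "\<And>z. \<not> intr p z"
proof (cases "\<exists>z. intr p z")
  case True
  then obtain z where "intr p z" by blast
  then show ?thesis using inner by (cases z) auto
next
  case False
  obtain a b t where r: "rep (tgraph T) a b t" "p = pt a b t" using assms by (rule realisationE)
  have V: "a \<in> V" "b \<in> V" using rep_V[OF r(1)] by auto
  have "t = 0 \<or> t = 1 \<or> a = b"
  proof (rule ccontr)
    assume n: "\<not> ?thesis"
    then have ab: "(a, b) \<in> E" "0 < t" "t < 1" using r by (auto simp: rep_def)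
    have "intr p (a, b, t) \<or> intr p (b, a, 1 - t)"
      using ab idx_swap[OF ab(1)] sym[OF ab(1)] r(2) pt_swap[of b a t] by (auto simp: interior_def)
    then show False using False by blast
  qed
  then have "p = vpt a \<or> p = vpt b" using r(2) by auto
  then show ?thesis using vertex V False by blast
qed

lemma slide_vertex: "(\<And>z. \<not> intr p z) \<Longrightarrow> sl p s = p" and param_vertex: "(\<And>z. \<not> intr p z) \<Longrightarrow> tp p = 0"
  by (simp_all add: slide_def param_def)

lemma param_range: "0 \<le> tp p \<and> tp p \<le> 1"
proof (cases "\<exists>z. intr p z")
  case True
  then obtain z where "intr p z" by blast
  then show ?thesis using interior_param[of p "fst z" "fst (snd z)" "snd (snd z)"] by (cases z) (auto simp: interior_def)
qed (simp add: param_def)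

lemma slide_param: "p \<in> points T \<Longrightarrow> sl p (tp p) = p"
  by (erule point_cases) (auto simp: interior_slide interior_param interior_def slide_vertex)

lemma slide_in: "p \<in> points T \<Longrightarrow> 0 \<le> s \<Longrightarrow> s \<le> 1 \<Longrightarrow> sl p s \<in> points T"
proof (erule point_cases)
  fix a b t assume "intr p (a, b, t)" "0 \<le> s" "s \<le> 1"
  then show "sl p s \<in> points T"
    using rep_in[of "tgraph T" a b s] interior_slide by (simp add: interior_def rep_def)
next
  fix u assume "u \<in> V" "p = vpt u" "\<And>z. \<not> intr p z"
  then show "sl p s \<in> points T" using slide_vertex[of p s] vpt_in[of u] by simp
qed

lemma interior_pact:
  assumes g: "g \<in> carrier H" and i: "intr p (a, b, t)"
  shows "intr (pact T g p) (act T g a, act T g b, t)"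
proof -
  have i': "(a, b) \<in> E" "idx (a, b) < idx (b, a)" "0 < t" "t < 1" "p = pt a b t" using i by (auto simp: interior_def)
  have "rep (tgraph T) a b t" using i' by (simp add: rep_def)
  then show ?thesis
    using i' pact_pt[OF g] act_E[OF g i'(1)] idx_act[OF i'(1) g] idx_act[OF sym[OF i'(1)] g]
    by (simp add: interior_def)
qed

lemma pact_inv: "g \<in> carrier H \<Longrightarrow> p \<in> points T \<Longrightarrow> pact T (inv\<^bsub>H\<^esub> g) (pact T g p) = p"
proof (erule realisationE)
  fix a b t assume g: "g \<in> carrier H" and r: "rep (tgraph T) a b t" "p = pt a b t"
  then show ?thesis
    using pact_pt[OF g r(1)] pact_pt[OF inv_closed[OF g] rep_act[OF g r(1)]] act_inv(1)[OF g] rep_V[OF r(1)]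
    by simp
qed

lemma slide_pact:
  assumes g: "g \<in> carrier H" and p: "p \<in> points T" and s: "0 \<le> s" "s \<le> 1"
  shows "sl (pact T g p) s = pact T g (sl p s)" "tp (pact T g p) = tp p"
proof -
  have "sl (pact T g p) s = pact T g (sl p s) \<and> tp (pact T g p) = tp p"
    using p
  proof (cases rule: point_cases)
    case (inner a b t)
    note i = interior_pact[OF g inner]
    have "rep (tgraph T) a b s" using inner s by (simp add: interior_def rep_def)
    then show ?thesis
      using interior_slide[OF i, of s] interior_slide[OF inner, of s] interior_param[OF i] interior_param[OF inner]
        pact_pt[OF g] by simp
  next
    case (vertex u)
    have "\<not> intr (pact T g p) z" for z
    proof
      assume i: "intr (pact T g p) z"
      obtain a b t where z: "z = (a, b, t)" by (cases z)
      have "intr (pact T (inv\<^bsub>H\<^esub> g) (pact T g p)) (act T (inv\<^bsub>H\<^esub> g) a, act T (inv\<^bsub>H\<^esub> g) b, t)"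
        by (rule interior_pact[OF inv_closed[OF g]]) (use i z in simp)
      then show False using pact_inv[OF g p] vertex(3) by simp
    qed
    then show ?thesis using slide_vertex param_vertex vertex(3) by simp
  qed
  then show "sl (pact T g p) s = pact T g (sl p s)" "tp (pact T g p) = tp p" by auto
qed

lemma code:
  assumes p: "p \<in> points T" and e: "e \<in> E"
  shows "code T idx e p < 4"
    and "0 \<le> s \<Longrightarrow> s \<le> 1 \<Longrightarrow> coord E e (sl p s) = codeval (code T idx e p) s"
proof -
  have "\<exists>\<kappa>. \<kappa> < 4 \<and> (\<forall>s. 0 \<le> s \<and> s \<le> 1 \<longrightarrow> coord E e (sl p s) = codeval \<kappa> s)"
    using p
  proof (cases rule: point_cases)
    case (inner a b t)
    have ab: "(a, b) \<in> E" using inner by (simp add: interior_def)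
    consider "e = (a, b)" | "e = (b, a)" | "e \<noteq> (a, b)" "e \<noteq> (b, a)" by blast
    then show ?thesis
    proof cases
      case 1
      then show ?thesis
        using coord_on[OF ab] interior_slide[OF inner] by (intro exI[of _ 2]) (simp add: codeval_def)
    next
      case 2
      then show ?thesis
        using coord_on_swap[OF ab] interior_slide[OF inner] by (intro exI[of _ 3]) (simp add: codeval_def)
    next
      case 3
      have "coord E e (pt a b s) = side E e a" if "0 \<le> s" "s \<le> 1" for s
        by (rule coord_off[OF _ 3]) (use ab that in \<open>simp add: rep_def\<close>)
      then show ?thesis
        using side_cases[of E e a] interior_slide[OF inner]
        by (intro exI[of _ "if side E e a = 0 then 0 else 1"]) (auto simp: codeval_def)
    qed
  next
    case (vertex u)
    then show ?thesis
      using side_cases[of E e u] slide_vertex[OF vertex(3)]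
      by (intro exI[of _ "if side E e u = 0 then 0 else 1"]) (auto simp: codeval_def)
  qed
  from someI_ex[OF this] show "code T idx e p < 4"
    and "0 \<le> s \<Longrightarrow> s \<le> 1 \<Longrightarrow> coord E e (sl p s) = codeval (code T idx e p) s"
    by (auto simp: code_def)
qed

lemma finite_dset:
  assumes p: "p \<in> points T" and q: "q \<in> points T"
  shows "finite (dset T idx p q)"
proof (rule finite_subset)
  \<comment> \<open>At 1/3 the four codes have the four different values 0, 1, 1/3 and 2/3, so the
    first set sees all differing codes; comparing 1/3 with 1/2 detects the codes from 2 on.\<close>
  show "dset T idx p q \<subseteq> crossing (sl p (1/3)) (sl q (1/3)) \<union> crossing (sl p (1/3)) (sl p (1/2))"
  proof
    fix e assume "e \<in> dset T idx p q"
    then have e: "e \<in> E" "code T idx e p \<noteq> code T idx e q \<or> 2 \<le> code T idx e p" by (auto simp: dset_def)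
    have c: "coord E e (sl p (1/3)) = codeval (code T idx e p) (1/3)"
      "coord E e (sl p (1/2)) = codeval (code T idx e p) (1/2)"
      "coord E e (sl q (1/3)) = codeval (code T idx e q) (1/3)"
      using code(2)[OF p e(1)] code(2)[OF q e(1)] by simp_all
    show "e \<in> crossing (sl p (1/3)) (sl q (1/3)) \<union> crossing (sl p (1/3)) (sl p (1/2))"
      using e code(1)[OF p e(1)] code(1)[OF q e(1)]
      by (auto simp: crossing_def c codeval_def split: if_splits)
  qed
  show "finite (crossing (sl p (1/3)) (sl q (1/3)) \<union> crossing (sl p (1/3)) (sl p (1/2)))"
    using finite_crossing slide_in p q by simp
qed

lemma sum_by_key:
  fixes h :: "'k \<Rightarrow> real"
  assumes "finite D" "finite K" "\<And>e. e \<in> D \<Longrightarrow> key e \<in> K"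
  shows "(\<Sum>e \<in> D. h (key e)) = (\<Sum>k \<in> K. real (card {e \<in> D. key e = k}) * h k)"
proof -
  have "(\<Sum>k \<in> K. \<Sum>e \<in> {e \<in> D. key e = k}. h (key e)) = (\<Sum>e \<in> D. h (key e))"
    by (rule sum.group) (use assms in auto)
  moreover have "(\<Sum>e \<in> {e \<in> D. key e = k}. h (key e)) = real (card {e \<in> D. key e = k}) * h k" for k
    by simp
  ultimately show ?thesis by simp
qed

text \<open>The crossing numbers enter linearly, and their coefficients depend only on the orbit
  lengths \<open>x\<close> and the positions \<open>s\<close>, \<open>s'\<close>; they are
  nonnegative if \<open>x\<close> is. As \<open>x\<close> is a function of indices, it can be
  borrowed from another tree.\<close>

lemma dist_formula:
  assumes l: "inv_len H T l" and lx: "\<And>e. e \<in> E \<Longrightarrow> l e = x (idx e)"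
    and pq: "p \<in> points T" "q \<in> points T" and s: "0 \<le> s" "s \<le> 1" and s': "0 \<le> s'" "s' \<le> 1"
  shows "tdist (relen l T) (sl p s) (sl q s') =
    (\<Sum>k \<in> {..<B} \<times> {..<4} \<times> {..<4}. real (cnt T idx p q k) *
      (x (fst k) * \<bar>codeval (snd (snd k)) s' - codeval (fst (snd k)) s\<bar>)) / 2"
proof -
  interpret R: metric_gtree "relen l T" by (rule metric_tree_gtree[OF metric_tree_relen[OF mt l]])
  let ?D = "dset T idx p q" and ?key = "\<lambda>e. (idx e, code T idx e p, code T idx e q)"
  let ?h = "\<lambda>k. x (fst k) * \<bar>codeval (snd (snd k)) s' - codeval (fst (snd k)) s\<bar>"
  have D: "?D \<subseteq> E" by (auto simp: dset_def)
  have c: "coord E e (sl p s) = codeval (code T idx e p) s" "coord E e (sl q s') = codeval (code T idx e q) s'"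
    if "e \<in> E" for e using code(2)[OF pq(1) that s] code(2)[OF pq(2) that s'] by auto
  have cr: "R.crossing (sl p s) (sl q s') \<subseteq> ?D"
  proof
    fix e assume "e \<in> R.crossing (sl p s) (sl q s')"
    then have e: "e \<in> E" "coord E e (sl p s) \<noteq> coord E e (sl q s')" by (auto simp: R.crossing_def)
    have "e \<in> ?D" if "code T idx e p = code T idx e q"
    proof (rule ccontr)
      assume "e \<notin> ?D"
      then have "code T idx e p < 2" using e(1) by (auto simp: dset_def)
      then show False using e c[OF e(1)] that by (auto simp: codeval_def split: if_splits)
    qed
    then show "e \<in> ?D" using e(1) by (auto simp: dset_def)
  qed
  have "tdist (relen l T) (sl p s) (sl q s') = R.dd (sl p s) (sl q s')"
    by (rule R.tdist_dd) (use slide_in pq s s' in simp_all)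
  also have "\<dots> = (\<Sum>e \<in> ?D. l e * \<bar>coord E e (sl q s') - coord E e (sl p s)\<bar>) / 2"
    using R.dd_superset[OF finite_dset[OF pq] cr] D by simp
  also have "(\<Sum>e \<in> ?D. l e * \<bar>coord E e (sl q s') - coord E e (sl p s)\<bar>) = (\<Sum>e \<in> ?D. ?h (?key e))"
    by (rule sum.cong[OF refl]) (use D c lx in auto)
  also have "\<dots> = (\<Sum>k \<in> {..<B} \<times> {..<4} \<times> {..<4}. real (card {e \<in> ?D. ?key e = k}) * ?h k)"
    by (rule sum_by_key[OF finite_dset[OF pq]]) (use D idx_less code(1) pq in auto)
  finally show ?thesis by (simp add: cnt_def)
qed

lemma vdx_act: "v \<in> V \<Longrightarrow> g \<in> carrier H \<Longrightarrow> vdx H T idx (act T g v) = vdx H T idx v"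
  using vorb_act by (simp add: vdx_def)

lemma vdx_arc:
  assumes "e \<in> E"
  shows "\<exists>f \<in> E. fst f \<in> vorb (fst e) \<and> idx f = vdx H T idx (fst e)" "vdx H T idx (fst e) < B"
proof -
  have ex: "\<exists>f \<in> E. fst f \<in> vorb (fst e) \<and> idx f = idx e" using assms vorb_self fst_V by blast
  show 1: "\<exists>f \<in> E. fst f \<in> vorb (fst e) \<and> idx f = vdx H T idx (fst e)"
    unfolding vdx_def by (rule LeastI[of "\<lambda>j. \<exists>f \<in> E. fst f \<in> vorb (fst e) \<and> idx f = j", OF ex])
  then show "vdx H T idx (fst e) < B" using idx_less by metis
qed

text \<open>The arcs realising the two minima have equal indices, hence lie in one orbit, and so do
  their starting points.\<close>

lemma vdx_eq:
  assumes e: "e \<in> E" and f: "f \<in> E" and eq: "vdx H T idx (fst e) = vdx H T idx (fst f)"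
  shows "\<exists>g \<in> carrier H. fst f = act T g (fst e)"
proof -
  obtain e' where e': "e' \<in> E" "fst e' \<in> vorb (fst e)" "idx e' = vdx H T idx (fst e)" using vdx_arc(1)[OF e] by blast
  obtain f' where f': "f' \<in> E" "fst f' \<in> vorb (fst f)" "idx f' = vdx H T idx (fst f)" using vdx_arc(1)[OF f] by blast
  obtain h where h: "h \<in> carrier H" "f' = garc h e'" using idx_eq[OF e'(1) f'(1)] e' f' eq by auto
  have V: "fst e \<in> V" "fst f \<in> V" "fst e' \<in> V" "fst f' \<in> V" using fst_V e f e' f' by auto
  have "vorb (fst e') = vorb (fst e)" using VO_eq[OF vorb_VO[OF V(1)] e'(2)] by simp
  moreover have "vorb (fst f') = vorb (fst f)" using VO_eq[OF vorb_VO[OF V(2)] f'(2)] by simp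
  moreover have "vorb (fst f') = vorb (fst e')" using vorb_act[OF h(1) V(3)] h(2) by (simp add: garc_def)
  ultimately have "fst f \<in> vorb (fst e)" using vorb_self[OF V(2)] by simp
  then show ?thesis by (auto simp: orbit_def)
qed

lemma rarc: "e \<in> E \<Longrightarrow> rarc T idx (idx e) \<in> E \<and> idx (rarc T idx (idx e)) = idx e"
  unfolding rarc_def by (rule someI[of "\<lambda>f. f \<in> E \<and> idx f = idx e" e]) simp

lemma rarc_garc: "e \<in> E \<Longrightarrow> \<exists>g \<in> carrier H. e = garc g (rarc T idx (idx e))"
  using idx_eq[of "rarc T idx (idx e)" e] rarc by simp

lemma len_rarc: "e \<in> E \<Longrightarrow> len T (rarc T idx (idx e)) = len T e"
proof -
  assume e: "e \<in> E"
  obtain g where g: "g \<in> carrier H" "e = garc g (rarc T idx (idx e))" using rarc_garc[OF e] by (rule bexE)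
  have "(fst (rarc T idx (idx e)), snd (rarc T idx (idx e))) \<in> E" using rarc[OF e] by simp
  from act_len[OF g(1) this] have "len T (garc g (rarc T idx (idx e))) = len T (rarc T idx (idx e))"
    by (simp add: garc_def)
  then show ?thesis using g(2) by simp
qed

end

text \<open>One map, detached from the graphs of groups it comes from: trees with numbered edge
  orbits, the images \<open>F0\<close> of the vertices, which may lie inside edges, and a bound
  \<open>C\<close> for the stretching of each edge.\<close>

locale map_data =
  fixes H :: "nat \<Rightarrow> ('h, 'b) monoid_scheme" and N :: nat and \<sigma> :: "nat \<Rightarrow> nat"
    and \<alpha> :: "nat \<Rightarrow> 'h \<Rightarrow> 'h" and B :: nat and Y :: "nat \<Rightarrow> ('h, 'x) gtree"
    and idx :: "nat \<Rightarrow> 'x \<times> 'x \<Rightarrow> nat" and F0 :: "nat \<Rightarrow> 'x \<Rightarrow> 'x \<Rightarrow> real" and C :: real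
  assumes \<sigma>: "i < N \<Longrightarrow> \<sigma> i < N" and \<alpha>: "i < N \<Longrightarrow> \<alpha> i \<in> iso (H i) (H (\<sigma> i))"
    and marked: "i < N \<Longrightarrow> marked_tree (H i) (Y i) B (idx i)"
    and F0_in: "i < N \<Longrightarrow> v \<in> tverts (Y i) \<Longrightarrow> F0 i v \<in> points (Y (\<sigma> i))"
    and F0_act: "i < N \<Longrightarrow> v \<in> tverts (Y i) \<Longrightarrow> g \<in> carrier (H i) \<Longrightarrow>
      F0 i (act (Y i) g v) = pact (Y (\<sigma> i)) (\<alpha> i g) (F0 i v)"
    and F0_lip: "i < N \<Longrightarrow> e \<in> tarcs (Y i) \<Longrightarrow>
      tdist (Y (\<sigma> i)) (F0 i (fst e)) (F0 i (snd e)) \<le> C * len (Y i) e"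
begin

text \<open>The incidence data: which indices occur, which are opposite to each other, and to which
  vertex orbits their ends belong. It takes finitely many values, and equality of it allows lengths
  and positions to be copied from one tree to another.\<close>

definition arc_types :: "(nat \<times> nat \<times> nat \<times> nat \<times> nat) set" where
  "arc_types = {(i, idx i e, idx i (prod.swap e), vdx (H i) (Y i) (idx i) (fst e), vdx (H i) (Y i) (idx i) (snd e))
     | i e. i < N \<and> e \<in> tarcs (Y i)}"

definition perm_type :: "(nat \<times> nat) set" where
  "perm_type = {(i, \<sigma> i) | i. i < N}"

text \<open>One representative arc per index is enough, as the images of its translates have the
  same distance by equivariance.\<close>

definition counts :: "nat \<times> nat \<times> nat \<times> nat \<times> nat \<Rightarrow> nat" where
  "counts = (\<lambda>(i, j, k). cnt (Y (\<sigma> i)) (idx (\<sigma> i))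
     (F0 i (fst (rarc (Y i) (idx i) j))) (F0 i (snd (rarc (Y i) (idx i) j))) k)"

lemma \<alpha>_carrier: "i < N \<Longrightarrow> g \<in> carrier (H i) \<Longrightarrow> \<alpha> i g \<in> carrier (H (\<sigma> i))"
  using \<alpha> by (auto simp: iso_def hom_def)

lemma arc_types_finite: "arc_types \<in> Pow ({..<N} \<times> {..<B} \<times> {..<B} \<times> {..<B} \<times> {..<B})"
proof -
  have "t \<in> {..<N} \<times> {..<B} \<times> {..<B} \<times> {..<B} \<times> {..<B}" if t: "t \<in> arc_types" for t
  proof -
    obtain i e where e: "i < N" "e \<in> tarcs (Y i)" "t = (i, idx i e, idx i (prod.swap e),
        vdx (H i) (Y i) (idx i) (fst e), vdx (H i) (Y i) (idx i) (snd e))"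
      using t unfolding arc_types_def by blast
    interpret marked_tree "H i" "Y i" B "idx i" using marked e(1) .
    have sw: "prod.swap e \<in> tarcs (Y i)" using sym e(2) by (cases e) simp
    show ?thesis using e idx_less[OF e(2)] idx_less[OF sw] vdx_arc(2)[OF e(2)] vdx_arc(2)[OF sw] by simp
  qed
  then show ?thesis by blast
qed

lemma perm_type_finite: "perm_type \<in> Pow ({..<N} \<times> {..<N})"
  using \<sigma> by (auto simp: perm_type_def)

end

section \<open>Comparing two maps of the same combinatorial type\<close>

lemma relen_self [simp]: "relen (len T) T = T"
  by (simp add: relen_def)

text \<open>
  A map of the same combinatorial type as a given one, but with smaller crossing numbers, is made no
  worse by copying the lengths and vertex positions of the given one.
\<close>

lemma map_data_compare:
  fixes Y Y' :: "nat \<Rightarrow> ('h, 'x) gtree"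
  assumes D: "map_data H N \<sigma> \<alpha> B Y idx F0 C" and D': "map_data H N \<sigma>' \<alpha>' B Y' idx' F0' C'"
    and types: "map_data.arc_types H N Y idx = map_data.arc_types H N Y' idx'"
      "map_data.perm_type N \<sigma> = map_data.perm_type N \<sigma>'"
    and counts: "\<And>k. k \<in> {..<N} \<times> {..<B} \<times> {..<B} \<times> {..<4} \<times> {..<4} \<Longrightarrow>
      map_data.counts \<sigma> Y idx F0 k \<le> map_data.counts \<sigma>' Y' idx' F0' k"
  obtains l f where "\<And>i. i < N \<Longrightarrow> inv_len (H i) (Y i) (l i)"
    "\<And>i v. i < N \<Longrightarrow> v \<in> tverts (Y i) \<Longrightarrow> f i v \<in> points (Y (\<sigma> i))"
    "\<And>i v g. i < N \<Longrightarrow> v \<in> tverts (Y i) \<Longrightarrow> g \<in> carrier (H i) \<Longrightarrow>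
      f i (act (Y i) g v) = pact (Y (\<sigma> i)) (\<alpha> i g) (f i v)"
    "\<And>i e. i < N \<Longrightarrow> e \<in> tarcs (Y i) \<Longrightarrow>
      tdist (relen (l (\<sigma> i)) (Y (\<sigma> i))) (f i (fst e)) (f i (snd e)) \<le> C' * l i e"
proof -
  interpret D: map_data H N \<sigma> \<alpha> B Y idx F0 C by (rule D)
  interpret D': map_data H N \<sigma>' \<alpha>' B Y' idx' F0' C' by (rule D')
  let ?vd = "\<lambda>i. vdx (H i) (Y i) (idx i)" and ?vd' = "\<lambda>i. vdx (H i) (Y' i) (idx' i)"
  have sig: "\<sigma>' i = \<sigma> i" if "i < N" for i
  proof -
    have "(i, \<sigma> i) \<in> D.perm_type" using that by (auto simp: D.perm_type_def)
    then show ?thesis unfolding types(2) D'.perm_type_def by auto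
  qed
  have tup: "\<exists>e' \<in> tarcs (Y' i). idx' i e' = idx i e \<and> idx' i (prod.swap e') = idx i (prod.swap e) \<and>
      ?vd' i (fst e') = ?vd i (fst e) \<and> ?vd' i (snd e') = ?vd i (snd e)"
    if "i < N" "e \<in> tarcs (Y i)" for i e
  proof -
    have "(i, idx i e, idx i (prod.swap e), ?vd i (fst e), ?vd i (snd e)) \<in> D.arc_types"
      using that unfolding D.arc_types_def by blast
    then show ?thesis unfolding types(1) D'.arc_types_def by force
  qed
  \<comment> \<open>The lengths of the second tree as a function of the index. The default 0 at
    indices that do not occur keeps the coefficients in \<open>dist_formula\<close>
    nonnegative.\<close>
  define x where "x i j = (if \<exists>e \<in> tarcs (Y' i). idx' i e = j then len (Y' i) (rarc (Y' i) (idx' i) j) else 0)" for i j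
  have x_len: "x i (idx' i e) = len (Y' i) e" if "i < N" "e \<in> tarcs (Y' i)" for i e
    using marked_tree.len_rarc[OF D'.marked[OF that(1)] that(2)] that by (auto simp: x_def)
  have x_nonneg: "0 \<le> x i j" if i: "i < N" for i j
  proof (cases "\<exists>e \<in> tarcs (Y' i). idx' i e = j")
    case True
    interpret M': marked_tree "H i" "Y' i" B "idx' i" by (rule D'.marked[OF i])
    obtain e where e: "e \<in> tarcs (Y' i)" "idx' i e = j" using True by blast
    then show ?thesis using x_len[OF i e(1)] M'.len_nonneg[OF e(1)] by simp
  qed (simp add: x_def)
  define l where "l i e = x i (idx i e)" for i e
  have l: "inv_len (H i) (Y i) (l i)" if i: "i < N" for i
    unfolding inv_len_def
  proof (clarify, intro conjI ballI)
    interpret M: marked_tree "H i" "Y i" B "idx i" by (rule D.marked[OF i])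
    interpret M': marked_tree "H i" "Y' i" B "idx' i" by (rule D'.marked[OF i])
    fix u v assume uv: "(u, v) \<in> tarcs (Y i)"
    obtain e' where e': "e' \<in> tarcs (Y' i)" "idx' i e' = idx i (u, v)" "idx' i (prod.swap e') = idx i (v, u)"
      using tup[OF i uv] by auto
    have sw: "prod.swap e' \<in> tarcs (Y' i)" using M'.sym e'(1) by (cases e') simp
    have 1: "l i (u, v) = len (Y' i) e'" "l i (v, u) = len (Y' i) (prod.swap e')"
      using x_len[OF i e'(1)] x_len[OF i sw] e' by (simp_all add: l_def)
    show "0 < l i (u, v)" using 1 M'.len_pos[OF e'(1)] by simp
    show "l i (v, u) = l i (u, v)" using 1 M'.len_sym e'(1) by (cases e') simp
    show "l i (act (Y i) g u, act (Y i) g v) = l i (u, v)" if "g \<in> carrier (H i)" for g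
      using M.idx_act[OF uv that] by (simp add: l_def)
  qed
  \<comment> \<open>The position, inside its edge, of the image of the vertex orbit named
    \<open>w\<close> under the second map.\<close>
  define tm where "tm i w = param (Y' (\<sigma> i)) (idx' (\<sigma> i)) (F0' i (fst (SOME e. e \<in> tarcs (Y' i) \<and> ?vd' i (fst e) = w)))" for i w
  have tm_range: "0 \<le> tm i w \<and> tm i w \<le> 1" if "i < N" for i w
    unfolding tm_def by (rule marked_tree.param_range[OF D'.marked[OF D.\<sigma>[OF that]]])
  \<comment> \<open>Positions are invariant under the group, so the chosen representative of the
    orbit does not matter.\<close>
  have tm_val: "tm i (?vd' i (fst e)) = param (Y' (\<sigma> i)) (idx' (\<sigma> i)) (F0' i (fst e))"
    if i: "i < N" and e: "e \<in> tarcs (Y' i)" for i e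
  proof -
    interpret M': marked_tree "H i" "Y' i" B "idx' i" by (rule D'.marked[OF i])
    interpret S': marked_tree "H (\<sigma> i)" "Y' (\<sigma> i)" B "idx' (\<sigma> i)" by (rule D'.marked[OF D.\<sigma>[OF i]])
    define f where "f = (SOME f. f \<in> tarcs (Y' i) \<and> ?vd' i (fst f) = ?vd' i (fst e))"
    have f: "f \<in> tarcs (Y' i)" "?vd' i (fst f) = ?vd' i (fst e)"
      using someI[of "\<lambda>f. f \<in> tarcs (Y' i) \<and> ?vd' i (fst f) = ?vd' i (fst e)" e] e unfolding f_def by auto
    obtain g where g: "g \<in> carrier (H i)" "fst e = act (Y' i) g (fst f)"
      using M'.vdx_eq[OF f(1) e f(2)] by (rule bexE)
    have fV: "fst f \<in> tverts (Y' i)" using M'.fst_V f by simp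
    have "F0' i (fst e) = pact (Y' (\<sigma> i)) (\<alpha>' i g) (F0' i (fst f))"
      using D'.F0_act[OF i fV g(1)] g(2) sig[OF i] by simp
    moreover have "\<alpha>' i g \<in> carrier (H (\<sigma> i))" using D'.\<alpha>_carrier[OF i g(1)] sig[OF i] by simp
    moreover have "F0' i (fst f) \<in> points (Y' (\<sigma> i))" using D'.F0_in[OF i fV] sig[OF i] by simp
    ultimately have "param (Y' (\<sigma> i)) (idx' (\<sigma> i)) (F0' i (fst e)) = param (Y' (\<sigma> i)) (idx' (\<sigma> i)) (F0' i (fst f))"
      using S'.slide_pact(2)[of "\<alpha>' i g" "F0' i (fst f)" 0] by simp
    then show ?thesis unfolding tm_def f_def by simp
  qed
  \<comment> \<open>Images under the first map stay in their edges but take over the positions from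
    the second map.\<close>
  define f where "f i v = slide (Y (\<sigma> i)) (idx (\<sigma> i)) (F0 i v) (tm i (?vd i v))" for i v
  have f_in: "f i v \<in> points (Y (\<sigma> i))" if "i < N" "v \<in> tverts (Y i)" for i v
    unfolding f_def
    by (rule marked_tree.slide_in[OF D.marked[OF D.\<sigma>[OF that(1)]] D.F0_in[OF that]])
      (use tm_range[OF that(1)] in auto)
  have f_act: "f i (act (Y i) g v) = pact (Y (\<sigma> i)) (\<alpha> i g) (f i v)"
    if i: "i < N" and v: "v \<in> tverts (Y i)" and g: "g \<in> carrier (H i)" for i v g
  proof -
    interpret M: marked_tree "H i" "Y i" B "idx i" by (rule D.marked[OF i])
    interpret S: marked_tree "H (\<sigma> i)" "Y (\<sigma> i)" B "idx (\<sigma> i)" by (rule D.marked[OF D.\<sigma>[OF i]])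
    show ?thesis
      unfolding f_def M.vdx_act[OF v g] D.F0_act[OF i v g]
      by (rule S.slide_pact(1)[OF D.\<alpha>_carrier[OF i g] D.F0_in[OF i v]]) (use tm_range[OF i] in auto)
  qed
  have bound: "tdist (relen (l (\<sigma> i)) (Y (\<sigma> i))) (f i (fst e)) (f i (snd e)) \<le> C' * l i e"
    if i: "i < N" and e: "e \<in> tarcs (Y i)" for i e
  proof -
    interpret M: marked_tree "H i" "Y i" B "idx i" by (rule D.marked[OF i])
    interpret M': marked_tree "H i" "Y' i" B "idx' i" by (rule D'.marked[OF i])
    interpret S: marked_tree "H (\<sigma> i)" "Y (\<sigma> i)" B "idx (\<sigma> i)" by (rule D.marked[OF D.\<sigma>[OF i]])
    interpret S': marked_tree "H (\<sigma> i)" "Y' (\<sigma> i)" B "idx' (\<sigma> i)" by (rule D'.marked[OF D.\<sigma>[OF i]])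
    interpret R: htree "H (\<sigma> i)" "relen (l (\<sigma> i)) (Y (\<sigma> i))"
      by unfold_locales (rule metric_tree_relen[OF S.mt l[OF D.\<sigma>[OF i]]])
    define j where "j = idx i e"
    define r where "r = rarc (Y i) (idx i) j"
    define r' where "r' = rarc (Y' i) (idx' i) j"
    have r: "r \<in> tarcs (Y i)" "idx i r = j" using M.rarc[OF e] by (auto simp: r_def j_def)
    obtain g where g: "g \<in> carrier (H i)" "e = M.garc g r" using M.rarc_garc[OF e] unfolding r_def j_def by (rule bexE)
    have V: "fst r \<in> tverts (Y i)" "snd r \<in> tverts (Y i)" using M.fst_V M.snd_V r by auto
    \<comment> \<open>By equivariance it is enough to estimate the image of the representative arc
      \<open>r\<close>, the one recorded in \<open>counts\<close>.\<close>
    have eq: "tdist (relen (l (\<sigma> i)) (Y (\<sigma> i))) (f i (fst e)) (f i (snd e)) =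
        tdist (relen (l (\<sigma> i)) (Y (\<sigma> i))) (f i (fst r)) (f i (snd r))"
      using R.tdist_pact[OF D.\<alpha>_carrier[OF i g(1)], of "f i (fst r)" "f i (snd r)"]
        f_act[OF i V(1) g(1)] f_act[OF i V(2) g(1)] f_in[OF i V(1)] f_in[OF i V(2)] g(2) by (simp add: M.garc_def)
    obtain e' where e': "e' \<in> tarcs (Y' i)" "idx' i e' = j"
      "?vd' i (fst e') = ?vd i (fst r)" "?vd' i (snd e') = ?vd i (snd r)"
      using tup[OF i r(1)] r(2) by auto
    have r': "r' \<in> tarcs (Y' i)" "idx' i r' = j" using M'.rarc[OF e'(1)] e'(2) by (auto simp: r'_def)
    obtain h where h: "h \<in> carrier (H i)" "e' = M'.garc h r'"
      using M'.rarc_garc[OF e'(1)] unfolding r'_def e'(2) by (rule bexE)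
    have V': "fst r' \<in> tverts (Y' i)" "snd r' \<in> tverts (Y' i)" using M'.fst_V M'.snd_V r' by auto
    have vd: "?vd i (fst r) = ?vd' i (fst r')" "?vd i (snd r) = ?vd' i (snd r')"
      using e'(3,4) h M'.vdx_act[OF V'(1) h(1)] M'.vdx_act[OF V'(2) h(1)] by (simp_all add: M'.garc_def)
    have sw: "prod.swap r' \<in> tarcs (Y' i)" using M'.sym r'(1) by (cases r') simp
    let ?P = "F0' i (fst r')" and ?Q = "F0' i (snd r')"
    let ?s = "param (Y' (\<sigma> i)) (idx' (\<sigma> i)) ?P" and ?s' = "param (Y' (\<sigma> i)) (idx' (\<sigma> i)) ?Q"
    have PQ: "?P \<in> points (Y' (\<sigma> i))" "?Q \<in> points (Y' (\<sigma> i))"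
      using D'.F0_in[OF i V'(1)] D'.F0_in[OF i V'(2)] sig[OF i] by simp_all
    have tms: "tm i (?vd i (fst r)) = ?s" "tm i (?vd i (snd r)) = ?s'"
      using tm_val[OF i r'(1)] tm_val[OF i sw] vd by simp_all
    let ?K = "{..<B} \<times> {..<4::nat} \<times> {..<4::nat}"
    let ?h = "\<lambda>k. x (\<sigma> i) (fst k) * \<bar>codeval (snd (snd k)) ?s' - codeval (fst (snd k)) ?s\<bar>"
    have "tdist (relen (l (\<sigma> i)) (Y (\<sigma> i))) (f i (fst r)) (f i (snd r)) =
        (\<Sum>k \<in> ?K. real (cnt (Y (\<sigma> i)) (idx (\<sigma> i)) (F0 i (fst r)) (F0 i (snd r)) k) * ?h k) / 2"
      unfolding f_def tms
      by (rule S.dist_formula[OF l[OF D.\<sigma>[OF i]] _ D.F0_in[OF i V(1)] D.F0_in[OF i V(2)]])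
        (use S'.param_range in \<open>simp_all add: l_def\<close>)
    \<comment> \<open>Lengths and positions are the same on both sides, hence so are the nonnegative
      factors; only the crossing numbers differ.\<close>
    also have "\<dots> \<le> (\<Sum>k \<in> ?K. real (cnt (Y' (\<sigma> i)) (idx' (\<sigma> i)) ?P ?Q k) * ?h k) / 2"
    proof (intro divide_right_mono sum_mono mult_right_mono)
      fix k assume k: "k \<in> ?K"
      have "j < B" using M.idx_less[OF e] by (simp add: j_def)
      then have "D.counts (i, j, k) \<le> D'.counts (i, j, k)" using counts[of "(i, j, k)"] k i by simp
      then show "real (cnt (Y (\<sigma> i)) (idx (\<sigma> i)) (F0 i (fst r)) (F0 i (snd r)) k) \<le>
          real (cnt (Y' (\<sigma> i)) (idx' (\<sigma> i)) ?P ?Q k)"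
        using sig[OF i] by (simp add: D.counts_def D'.counts_def r_def r'_def)
      show "0 \<le> ?h k" using x_nonneg[OF D.\<sigma>[OF i]] by simp
    qed simp
    also have "\<dots> = tdist (relen (len (Y' (\<sigma> i))) (Y' (\<sigma> i)))
        (slide (Y' (\<sigma> i)) (idx' (\<sigma> i)) ?P ?s) (slide (Y' (\<sigma> i)) (idx' (\<sigma> i)) ?Q ?s')"
      by (rule S'.dist_formula[OF inv_len_self[OF S'.mt] _ PQ, symmetric])
        (use S'.param_range x_len[OF D.\<sigma>[OF i]] in simp_all)
    also have "\<dots> = tdist (Y' (\<sigma> i)) ?P ?Q" using S'.slide_param PQ by simp
    also have "\<dots> \<le> C' * len (Y' i) r'" using D'.F0_lip[OF i r'(1)] sig[OF i] by simp
    also have "len (Y' i) r' = l i e" using x_len[OF i r'(1)] r'(2) by (simp add: l_def j_def)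
    finally show ?thesis unfolding eq .
  qed
  show thesis using that[OF l f_in f_act bound] by blast
qed

section \<open>Outer automorphisms\<close>

lemma inner_iso:
  assumes "group G" "h \<in> carrier G"
  shows "(\<lambda>x \<in> carrier G. h \<otimes>\<^bsub>G\<^esub> x \<otimes>\<^bsub>G\<^esub> inv\<^bsub>G\<^esub> h) \<in> iso G G"
proof -
  interpret group G by fact
  let ?c = "\<lambda>x \<in> carrier G. h \<otimes>\<^bsub>G\<^esub> x \<otimes>\<^bsub>G\<^esub> inv\<^bsub>G\<^esub> h"
  let ?d = "\<lambda>x. inv\<^bsub>G\<^esub> h \<otimes>\<^bsub>G\<^esub> x \<otimes>\<^bsub>G\<^esub> h"
  have cancel: "a \<otimes>\<^bsub>G\<^esub> (inv\<^bsub>G\<^esub> a \<otimes>\<^bsub>G\<^esub> x) = x" "inv\<^bsub>G\<^esub> a \<otimes>\<^bsub>G\<^esub> (a \<otimes>\<^bsub>G\<^esub> x) = x"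
    if "a \<in> carrier G" "x \<in> carrier G" for a x
    using that by (simp_all add: m_assoc[symmetric])
  have "?c \<in> hom G G"
    using assms(2) by (auto simp: hom_def m_assoc cancel)
  moreover have "bij_betw ?c (carrier G) (carrier G)"
    by (rule bij_betw_byWitness[of _ ?d]) (use assms(2) in \<open>auto simp: m_assoc cancel\<close>)
  ultimately show ?thesis by (simp add: iso_def)
qed

lemma iso_compose:
  assumes "group G" "h \<in> iso G K" "k \<in> iso K L"
  shows "compose (carrier G) k h \<in> iso G L"
proof -
  interpret group G by fact
  have kh: "k \<circ> h \<in> iso G L" using assms(2,3) by (rule iso_set_trans)
  have eq: "compose (carrier G) k h x = (k \<circ> h) x" if "x \<in> carrier G" for x
    using that by (simp add: compose_def)
  have "bij_betw (compose (carrier G) k h) (carrier G) (carrier L) = bij_betw (k \<circ> h) (carrier G) (carrier L)"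
    by (rule bij_betw_cong) (rule eq)
  then show ?thesis using kh eq by (auto simp: iso_def hom_def Pi_iff)
qed

definition good_aut :: "('v, 'e, 'g) union_gog \<Rightarrow> ('v, 'e, 'g) uaut \<Rightarrow> bool" where
  "good_aut \<Gamma> \<phi> \<longleftrightarrow> (\<forall>i < length \<Gamma>. fst \<phi> i < length \<Gamma> \<and> snd \<phi> i \<in> iso (HH \<Gamma> i) (HH \<Gamma> (fst \<phi> i)))"

text \<open>A member of a coset is an automorphism followed by an inner one, and the inner one fixes
  every index and acts on each group by an isomorphism.\<close>

lemma OutG_good_aut:
  assumes c: "c \<in> carrier (OutG \<Gamma>)" "\<phi> \<in> c" and grp: "\<And>i. i < length \<Gamma> \<Longrightarrow> group (HH \<Gamma> i)"
  shows "good_aut \<Gamma> \<phi>"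
proof -
  have "c \<in> (\<Union>a \<in> carrier (AutG \<Gamma>). {InnG \<Gamma> #>\<^bsub>AutG \<Gamma>\<^esub> a})"
    using c(1) by (simp add: OutG_def FactGroup_def RCOSETS_def)
  then obtain a where a: "a \<in> carrier (AutG \<Gamma>)" "c = InnG \<Gamma> #>\<^bsub>AutG \<Gamma>\<^esub> a" by blast
  then obtain b where b: "b \<in> InnG \<Gamma>" "\<phi> = b \<otimes>\<^bsub>AutG \<Gamma>\<^esub> a" using c(2) by (auto simp: r_coset_def)
  obtain \<tau> \<psi> where \<tau>: "a = (\<tau>, \<psi>)" "(\<tau>, \<psi>) \<in> aut_carrier \<Gamma>" using a(1) by (cases a) (auto simp: AutG_def)
  obtain h where h: "\<And>i. i < length \<Gamma> \<Longrightarrow> h i \<in> carrier (HH \<Gamma> i)"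
    "b = (id, \<lambda>i \<in> {..<length \<Gamma>}. \<lambda>x \<in> carrier (HH \<Gamma> i). h i \<otimes>\<^bsub>HH \<Gamma> i\<^esub> x \<otimes>\<^bsub>HH \<Gamma> i\<^esub> inv\<^bsub>HH \<Gamma> i\<^esub> (h i))"
    using b(1) unfolding InnG_def by blast
  show ?thesis
    unfolding good_aut_def
  proof (intro allI impI)
    fix i assume i: "i < length \<Gamma>"
    have t: "\<tau> i < length \<Gamma>" "\<psi> i \<in> iso (HH \<Gamma> i) (HH \<Gamma> (\<tau> i))"
      using \<tau>(2) i permutes_in_image[of \<tau> "{..<length \<Gamma>}" i] by (auto simp: aut_carrier_def)
    have "fst \<phi> i = \<tau> i"
      using b(2) h(2) \<tau>(1) by (simp add: AutG_def)
    moreover have "snd \<phi> i = compose (carrier (HH \<Gamma> i))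
        (\<lambda>x \<in> carrier (HH \<Gamma> (\<tau> i)). h (\<tau> i) \<otimes>\<^bsub>HH \<Gamma> (\<tau> i)\<^esub> x \<otimes>\<^bsub>HH \<Gamma> (\<tau> i)\<^esub> inv\<^bsub>HH \<Gamma> (\<tau> i)\<^esub> (h (\<tau> i))) (\<psi> i)"
      using b(2) h(2) \<tau>(1) i t(1) by (simp add: AutG_def)
    ultimately show "fst \<phi> i < length \<Gamma> \<and> snd \<phi> i \<in> iso (HH \<Gamma> i) (HH \<Gamma> (fst \<phi> i))"
      using iso_compose[OF grp[OF i] t(2) inner_iso[OF grp[OF t(1)] h(1)[OF t(1)]]] t(1) by simp
  qed
qed

section \<open>Points of finite displacement\<close>

lemma relen_invariance [simp]:
  "trivial_edge_stabilisers H (relen l T) = trivial_edge_stabilisers H T"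
  "minimal_tree H (relen l T) = minimal_tree H T"
  "invariant_subgraph H (relen l T) A = invariant_subgraph H T A"
  "elliptic (relen l T) S = elliptic T S"
  "free_vertex H (relen l T) v = free_vertex H T v"
  "no_redundant_vertices H (relen l T) = no_redundant_vertices H T"
  by (simp_all add: trivial_edge_stabilisers_def minimal_tree_def invariant_subgraph_def elliptic_def
      free_vertex_def no_redundant_vertices_def redundant_vertex_def)

lemma outer_trees_relen:
  assumes "T \<in> outer_trees G" "inv_len (pi1 G) T l"
  shows "relen l T \<in> outer_trees G"
  using assms metric_tree_relen[of "pi1 G" T l] by (simp add: outer_trees_def)

lemma finite_quotient_twist:
  assumes "finite_quotient H' T" "\<alpha> \<in> iso H H'"
  shows "finite_quotient H (twist \<alpha> T)"
proof -
  obtain F where F: "finite F" "F \<subseteq> tarcs T"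
    "\<And>e. e \<in> tarcs T \<Longrightarrow> \<exists>g \<in> carrier H'. \<exists>(u, v) \<in> F. e = (act T g u, act T g v)"
    using assms(1) unfolding finite_quotient_def by blast
  have c: "carrier H' = \<alpha> ` carrier H" using assms(2) by (auto simp: iso_def bij_betw_def)
  have "\<exists>g \<in> carrier H. \<exists>(u, v) \<in> F. e = (act T (\<alpha> g) u, act T (\<alpha> g) v)" if e: "e \<in> tarcs T" for e
  proof -
    obtain g' where g': "g' \<in> carrier H'" "\<exists>(u, v) \<in> F. e = (act T g' u, act T g' v)"
      using F(3)[OF e] by (rule bexE)
    obtain g where g: "g \<in> carrier H" "g' = \<alpha> g" using g'(1) unfolding c by (rule imageE)
    show ?thesis using g'(2) unfolding g(2) by (rule bexI[OF _ g(1)])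
  qed
  then show ?thesis unfolding finite_quotient_def using F(1,2) by (intro exI[of _ F]) simp
qed

lemma inv_len_twist:
  assumes "inv_len H' T l" "\<alpha> \<in> hom H H'"
  shows "inv_len H (twist \<alpha> T) l"
proof -
  have "\<alpha> g \<in> carrier H'" if "g \<in> carrier H" for g using assms(2) that by (auto simp: hom_def)
  then show ?thesis using inv_lenD[OF assms(1)] unfolding inv_len_def by auto
qed

text \<open>The condition that separates the two cases in \<open>displacement\<close>, named because
  it has to be re-established after every change of lengths.\<close>

definition adm :: "('v, 'e, 'g) union_gog \<Rightarrow> ('v, 'e, 'g) uaut \<Rightarrow> ('v, 'e, 'g) hforest \<Rightarrow> bool" where
  "adm \<Gamma> \<phi> X \<longleftrightarrow>
     (\<exists>X\<^sub>0 \<in> outer_space \<Gamma>. \<forall>i < length \<Gamma>. equiv_isometric (HH \<Gamma> i) (X i) (X\<^sub>0 i)) \<or>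
     (\<exists>X\<^sub>0 \<in> outer_space \<Gamma>. \<exists>A.
        proper_subgraph \<Gamma> X\<^sub>0 A \<and> carries_hyperbolic \<Gamma> X\<^sub>0 A \<and> aut_invariant \<Gamma> \<phi> X\<^sub>0 A \<and>
        (\<forall>i < length \<Gamma>. equiv_isometric (HH \<Gamma> i) (X i) (collapse (X\<^sub>0 i) (A i))))"

lemma displacement_adm:
  "displacement \<Gamma> \<phi> X = (if adm \<Gamma> \<phi> X then stretch \<Gamma> X (aut_act \<Gamma> \<phi> X) else \<infinity>)"
  by (simp add: displacement_def adm_def)

lemma outer_treeD: "T \<in> outer_trees G \<Longrightarrow> metric_tree (pi1 G) T"
  "T \<in> outer_trees G \<Longrightarrow> trivial_edge_stabilisers (pi1 G) T" "T \<in> outer_trees G \<Longrightarrow> minimal_tree (pi1 G) T"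
  by (simp_all add: outer_trees_def)

lemma outer_spaceD: "X \<in> outer_space \<Gamma> \<Longrightarrow> i < length \<Gamma> \<Longrightarrow> X i \<in> outer_trees (\<Gamma> ! i)"
  by (auto simp: outer_space_def)

lemma valid_unionD:
  assumes "valid_union \<Gamma>" "i < length \<Gamma>"
  shows "graph_of_groups (\<Gamma> ! i)" "carrier (HH \<Gamma> i) \<noteq> {\<one>\<^bsub>HH \<Gamma> i\<^esub>}"
  using assms by (auto simp: valid_union_def)

text \<open>Twisting the target turns a map representing \<open>\<phi>\<close> into an equivariant
  one. The reparametrised map of \<open>straight_map_relen\<close> sends each edge into its old
  image, so it still maps \<open>A\<close> into itself.\<close>

lemma aut_invariant_relen:
  assumes val: "valid_union \<Gamma>" and \<phi>: "good_aut \<Gamma> \<phi>" and X: "X \<in> outer_space \<Gamma>"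
    and A: "\<And>i. i < length \<Gamma> \<Longrightarrow> invariant_subgraph (HH \<Gamma> i) (X i) (A i)"
    and inv: "aut_invariant \<Gamma> \<phi> X A"
    and l: "\<And>i. i < length \<Gamma> \<Longrightarrow> inv_len (HH \<Gamma> i) (X i) (l i)"
    and X': "\<And>i. i < length \<Gamma> \<Longrightarrow> X' i = relen (l i) (X i)"
  shows "aut_invariant \<Gamma> \<phi> X' A"
proof -
  obtain f where f: "straight_rep \<Gamma> \<phi> X f"
    "\<forall>i < length \<Gamma>. f i ` realisation (A i) \<subseteq> realisation (A (fst \<phi> i))"
    using inv unfolding aut_invariant_def by (elim exE conjE) (rule that)
  have "\<exists>F. equivariant_map (HH \<Gamma> i) (X i) (twist (snd \<phi> i) (X (fst \<phi> i))) F \<and>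
      straight_map (X' i) (X' (fst \<phi> i)) F \<and> F ` realisation (A i) \<subseteq> realisation (A (fst \<phi> i))"
    if i: "i < length \<Gamma>" for i
  proof -
    let ?j = "fst \<phi> i" and ?\<alpha> = "snd \<phi> i"
    have j: "?j < length \<Gamma>" and iso: "?\<alpha> \<in> iso (HH \<Gamma> i) (HH \<Gamma> ?j)" using \<phi> i by (auto simp: good_aut_def)
    have hom: "?\<alpha> \<in> hom (HH \<Gamma> i) (HH \<Gamma> ?j)" using iso by (simp add: iso_def)
    note T = outer_treeD(1)[OF outer_spaceD[OF X i]] and T' = outer_treeD(1)[OF outer_spaceD[OF X j]]
    interpret T: htree "HH \<Gamma> i" "X i" by unfold_locales (rule T)
    have tw: "metric_tree (HH \<Gamma> i) (twist ?\<alpha> (X ?j))" by (rule metric_tree_twist[OF T' hom T.group_H])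
    have fin: "finite_quotient (HH \<Gamma> i) (twist ?\<alpha> (X ?j))"
      by (rule finite_quotient_twist[OF outer_tree_bound(1)[OF valid_unionD[OF val j] outer_spaceD[OF X j]] iso])
    have st: "straight_map (X i) (X ?j) (f i)" using f(1) i by (simp add: straight_rep_def)
    have "equivariant_map (HH \<Gamma> i) (X i) (twist ?\<alpha> (X ?j)) (f i)"
      using f(1) i unfolding straight_rep_def straight_map_def equivariant_map_def by simp
    moreover have "straight_map (X i) (twist ?\<alpha> (X ?j)) (f i)"
      using st by (simp add: straight_map_def)
    ultimately obtain F where F: "equivariant_map (HH \<Gamma> i) (X i) (twist ?\<alpha> (X ?j)) F"
      "straight_map (relen (l i) (X i)) (relen (l ?j) (twist ?\<alpha> (X ?j))) F"
      "\<And>v. v \<in> tverts (X i) \<Longrightarrow> F (vpt v) = f i (vpt v)"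
      "\<And>e. e \<in> tarcs (X i) \<Longrightarrow> F ` seg e \<subseteq> f i ` seg e"
      using straight_map_relen[OF T tw l[OF i] inv_len_twist[OF l[OF j] hom] fin] by metis
    have "relen (l ?j) (twist ?\<alpha> (X ?j)) = twist ?\<alpha> (X' ?j)"
      using X'[OF j] by (simp add: relen_def twist_def)
    then have "straight_map (X' i) (X' ?j) F" using F(2) X'[OF i] by (simp add: straight_map_def)
    moreover have "F ` realisation (A i) \<subseteq> realisation (A ?j)"
    proof -
      have sub: "pverts (A i) \<subseteq> tverts (X i)" "parcs (A i) \<subseteq> tarcs (X i)"
        using A[OF i] unfolding invariant_subgraph_def subgraph_def by auto
      have "F ` realisation (A i) \<subseteq> f i ` realisation (A i)"
        unfolding realisation_def image_Un image_UN
      proof (intro Un_mono UN_mono order_refl)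
        show "F ` vpt ` pverts (A i) \<subseteq> f i ` vpt ` pverts (A i)"
          unfolding image_image using sub(1) F(3) by (intro equalityD1 image_cong) auto
        show "F ` seg e \<subseteq> f i ` seg e" if "e \<in> parcs (A i)" for e by (rule F(4)[OF subsetD[OF sub(2) that]])
      qed
      then show ?thesis using f(2) i by (meson order_trans)
    qed
    ultimately show ?thesis using F(1) by (intro exI[of _ F]) simp
  qed
  then obtain F where F: "\<And>i. i < length \<Gamma> \<Longrightarrow> equivariant_map (HH \<Gamma> i) (X i) (twist (snd \<phi> i) (X (fst \<phi> i))) (F i)"
    "\<And>i. i < length \<Gamma> \<Longrightarrow> straight_map (X' i) (X' (fst \<phi> i)) (F i)"
    "\<And>i. i < length \<Gamma> \<Longrightarrow> F i ` realisation (A i) \<subseteq> realisation (A (fst \<phi> i))"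
    by metis
  have "straight_rep \<Gamma> \<phi> X' F"
    unfolding straight_rep_def
  proof (intro allI impI conjI ballI)
    fix i h p assume i: "i < length \<Gamma>" and h: "h \<in> carrier (HH \<Gamma> i)" and p: "p \<in> points (X' i)"
    have "fst \<phi> i < length \<Gamma>" using \<phi> i by (simp add: good_aut_def)
    then show "F i (pact (X' i) h p) = pact (X' (fst \<phi> i)) (snd \<phi> i h) (F i p)"
      using F(1)[OF i] h p X' i unfolding equivariant_map_def by simp
  qed (use F in auto)
  then show ?thesis unfolding aut_invariant_def using F(3) by blast
qed

section \<open>Admissible points as collapses of trees in outer space\<close>

abbreviation "no_graph \<equiv> \<lparr>pverts = {}, parcs = {}\<rparr>"

lemma invariant_no_graph:
  assumes "metric_tree H T" shows "invariant_subgraph H T no_graph"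
proof -
  interpret htree H T by unfold_locales fact
  have "wf_digraph (with_proj (tgraph T))"
    by (simp add: wf_digraph_wp_iff pair_wf_digraph_def) (use wf in auto)
  moreover have "wf_digraph (with_proj no_graph)" by (simp add: wf_digraph_wp_iff pair_wf_digraph_def)
  ultimately show ?thesis
    unfolding invariant_subgraph_def subgraph_def by (auto simp: symmetric_def intro: symI)
qed

definition cquot :: "('h, 'x) gtree \<Rightarrow> 'x pair_pre_digraph \<Rightarrow> ('h, 'x) gtree" where
  "cquot T A = quot (choose_rep A) T (parcs A)"

lemma cquot_quotient:
  assumes "metric_tree H T" "invariant_subgraph H T A"
  shows "quotient_tree H T (parcs A) (choose_rep A) (cquot T A)"
  unfolding cquot_def by (rule collapsing.quotient_tree_quot[OF collapsing_comp_of(2)[OF assms]])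

lemma collapse_quotient:
  assumes "metric_tree H T" "invariant_subgraph H T A"
  shows "quotient_tree H T (parcs A) (comp_of A) (collapse T A)"
  by (rule quotient_tree_collapse[OF collapsing_comp_of(1)[OF assms]])

lemma cquot_relen:
  assumes T: "metric_tree H T" and A: "invariant_subgraph H T A" and l: "inv_len H (cquot T A) l"
  obtains l0 where "inv_len H T l0" "quotient_tree H (relen l0 T) (parcs A) (choose_rep A) (relen l (cquot T A))"
  using quotient_tree_relen[OF cquot_quotient[OF T A] l] by blast

text \<open>Points of outer space and points at infinity get the common form of a collapse, with
  \<open>A\<close> empty for the former. The last clause says that this form is admissible for all
  lengths: they are lifted to \<open>X0\<close>, where properness, hyperbolic elements and
  invariance of \<open>A\<close> persist.\<close>

lemma presentation:
  assumes val: "valid_union \<Gamma>" and \<phi>: "good_aut \<Gamma> \<phi>" and X: "X \<in> bordification \<Gamma>" and adm: "adm \<Gamma> \<phi> X"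
  obtains X0 A where "X0 \<in> outer_space \<Gamma>"
    "\<And>i. i < length \<Gamma> \<Longrightarrow> invariant_subgraph (HH \<Gamma> i) (X0 i) (A i)"
    "\<And>i. i < length \<Gamma> \<Longrightarrow> equiv_isometric (HH \<Gamma> i) (X i) (cquot (X0 i) (A i))"
    "\<And>l Z. (\<And>i. i < length \<Gamma> \<Longrightarrow> inv_len (HH \<Gamma> i) (cquot (X0 i) (A i)) (l i)) \<Longrightarrow>
      (\<And>i. i < length \<Gamma> \<Longrightarrow> Z i = relen (l i) (cquot (X0 i) (A i))) \<Longrightarrow> adm \<Gamma> \<phi> Z"
proof -
  consider X0 where "X0 \<in> outer_space \<Gamma>" "\<forall>i < length \<Gamma>. equiv_isometric (HH \<Gamma> i) (X i) (X0 i)"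
    | X0 A where "X0 \<in> outer_space \<Gamma>" "proper_subgraph \<Gamma> X0 A" "carries_hyperbolic \<Gamma> X0 A"
      "aut_invariant \<Gamma> \<phi> X0 A" "\<forall>i < length \<Gamma>. equiv_isometric (HH \<Gamma> i) (X i) (collapse (X0 i) (A i))"
    using adm unfolding adm_def by (elim disjE bexE exE conjE) blast+
  then show thesis
  proof cases
    case (1 X0)
    note mt = outer_treeD(1)[OF outer_spaceD[OF 1(1)]]
    \<comment> \<open>Collapsing the empty subgraph changes the tree only by an isometry.\<close>
    show ?thesis
    proof (rule that[of X0 "\<lambda>i. no_graph"])
      fix i assume i: "i < length \<Gamma>"
      show A: "invariant_subgraph (HH \<Gamma> i) (X0 i) no_graph" by (rule invariant_no_graph[OF mt[OF i]])
      have "quotient_tree (HH \<Gamma> i) (X0 i) {} (choose_rep no_graph) (cquot (X0 i) no_graph)"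
        using cquot_quotient[OF mt[OF i] A] by simp
      then show "equiv_isometric (HH \<Gamma> i) (X i) (cquot (X0 i) no_graph)"
        using 1(2) i quotient_trees_isometric[OF quotient_tree_id[OF mt[OF i]]] equiv_isometric_trans by blast
    next
      fix l Z
      assume l: "\<And>i. i < length \<Gamma> \<Longrightarrow> inv_len (HH \<Gamma> i) (cquot (X0 i) no_graph) (l i)"
        and Z: "\<And>i. i < length \<Gamma> \<Longrightarrow> Z i = relen (l i) (cquot (X0 i) no_graph)"
      have "\<exists>l0. inv_len (HH \<Gamma> i) (X0 i) l0 \<and> equiv_isometric (HH \<Gamma> i) (Z i) (relen l0 (X0 i))"
        if i: "i < length \<Gamma>" for i
      proof -
        obtain l0 where l0: "inv_len (HH \<Gamma> i) (X0 i) l0"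
          "quotient_tree (HH \<Gamma> i) (relen l0 (X0 i)) (parcs no_graph) (choose_rep no_graph) (relen (l i) (cquot (X0 i) no_graph))"
          using cquot_relen[OF mt[OF i] invariant_no_graph[OF mt[OF i]] l[OF i]] by metis
        have "quotient_tree (HH \<Gamma> i) (relen l0 (X0 i)) (parcs no_graph) id (relen l0 (X0 i))"
          using quotient_tree_id[OF metric_tree_relen[OF mt[OF i] l0(1)]] by simp
        then have "equiv_isometric (HH \<Gamma> i) (Z i) (relen l0 (X0 i))"
          using quotient_trees_isometric[OF l0(2)] Z[OF i] by simp
        then show ?thesis using l0(1) by (intro exI[of _ l0] conjI)
      qed
      then obtain l0 where l0: "\<And>i. i < length \<Gamma> \<Longrightarrow> inv_len (HH \<Gamma> i) (X0 i) (l0 i)"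
        "\<And>i. i < length \<Gamma> \<Longrightarrow> equiv_isometric (HH \<Gamma> i) (Z i) (relen (l0 i) (X0 i))" by metis
      define X1 where "X1 = (\<lambda>i \<in> {..<length \<Gamma>}. relen (l0 i) (X0 i))"
      have "X1 \<in> outer_space \<Gamma>"
        unfolding outer_space_def X1_def using outer_trees_relen[OF outer_spaceD[OF 1(1)] l0(1)] by auto
      moreover have "\<forall>i < length \<Gamma>. equiv_isometric (HH \<Gamma> i) (Z i) (X1 i)" using l0(2) by (simp add: X1_def)
      ultimately show "adm \<Gamma> \<phi> Z" unfolding adm_def by (intro disjI1 bexI[of _ X1])
    qed (rule 1(1))
  next
    case (2 X0 A)
    note mt = outer_treeD(1)[OF outer_spaceD[OF 2(1)]]
    have A: "invariant_subgraph (HH \<Gamma> i) (X0 i) (A i)" if "i < length \<Gamma>" for i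
      using 2(2) that by (simp add: proper_subgraph_def)
    show ?thesis
    proof (rule that[of X0 A])
      fix i assume i: "i < length \<Gamma>"
      show "invariant_subgraph (HH \<Gamma> i) (X0 i) (A i)" by (rule A[OF i])
      show "equiv_isometric (HH \<Gamma> i) (X i) (cquot (X0 i) (A i))"
        using 2(5) i quotient_trees_isometric[OF collapse_quotient[OF mt[OF i] A[OF i]] cquot_quotient[OF mt[OF i] A[OF i]]]
          equiv_isometric_trans by blast
    next
      fix l Z
      assume l: "\<And>i. i < length \<Gamma> \<Longrightarrow> inv_len (HH \<Gamma> i) (cquot (X0 i) (A i)) (l i)"
        and Z: "\<And>i. i < length \<Gamma> \<Longrightarrow> Z i = relen (l i) (cquot (X0 i) (A i))"
      have "\<exists>l0. inv_len (HH \<Gamma> i) (X0 i) l0 \<and> equiv_isometric (HH \<Gamma> i) (Z i) (collapse (relen l0 (X0 i)) (A i))"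
        if i: "i < length \<Gamma>" for i
      proof -
        obtain l0 where l0: "inv_len (HH \<Gamma> i) (X0 i) l0"
          "quotient_tree (HH \<Gamma> i) (relen l0 (X0 i)) (parcs (A i)) (choose_rep (A i)) (relen (l i) (cquot (X0 i) (A i)))"
          using cquot_relen[OF mt[OF i] A[OF i] l[OF i]] by metis
        have "quotient_tree (HH \<Gamma> i) (relen l0 (X0 i)) (parcs (A i)) (comp_of (A i)) (collapse (relen l0 (X0 i)) (A i))"
          using collapse_quotient[OF metric_tree_relen[OF mt[OF i] l0(1)]] A[OF i] by simp
        then have "equiv_isometric (HH \<Gamma> i) (Z i) (collapse (relen l0 (X0 i)) (A i))"
          using quotient_trees_isometric[OF l0(2)] Z[OF i] by simp
        then show ?thesis using l0(1) by (intro exI[of _ l0] conjI)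
      qed
      then obtain l0 where l0: "\<And>i. i < length \<Gamma> \<Longrightarrow> inv_len (HH \<Gamma> i) (X0 i) (l0 i)"
        "\<And>i. i < length \<Gamma> \<Longrightarrow> equiv_isometric (HH \<Gamma> i) (Z i) (collapse (relen (l0 i) (X0 i)) (A i))" by metis
      define X1 where "X1 = (\<lambda>i \<in> {..<length \<Gamma>}. relen (l0 i) (X0 i))"
      have X1: "X1 i = relen (l0 i) (X0 i)" if "i < length \<Gamma>" for i using that by (simp add: X1_def)
      have "X1 \<in> outer_space \<Gamma>"
        unfolding outer_space_def X1_def using outer_trees_relen[OF outer_spaceD[OF 2(1)] l0(1)] by auto
      moreover have "proper_subgraph \<Gamma> X1 A" using 2(2) X1 by (auto simp: proper_subgraph_def)
      moreover have "carries_hyperbolic \<Gamma> X1 A"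
      proof -
        obtain i v g where c: "i < length \<Gamma>" "v \<in> pverts (A i)" "g \<in> carrier (HH \<Gamma> i)"
          "act (X0 i) g ` comp_of (A i) v = comp_of (A i) v" "\<not> elliptic (X0 i) {g}"
          using 2(3) unfolding carries_hyperbolic_def by blast
        show ?thesis
          unfolding carries_hyperbolic_def
          by (rule exI[of _ i], intro conjI c(1) bexI[OF _ c(2)] bexI[OF _ c(3)]) (use c X1 in simp_all)
      qed
      moreover have "aut_invariant \<Gamma> \<phi> X1 A"
        by (rule aut_invariant_relen[OF val \<phi> 2(1) A 2(4) l0(1) X1])
      moreover have "\<forall>i < length \<Gamma>. equiv_isometric (HH \<Gamma> i) (Z i) (collapse (X1 i) (A i))"
        using l0(2) X1 by simp
      ultimately show "adm \<Gamma> \<phi> Z" unfolding adm_def by (intro disjI2 bexI[of _ X1] exI[of _ A] conjI)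
    qed (rule 2(1))
  qed
qed

section \<open>Finiteness of the quotient of a collapsed tree\<close>

lemma arc_index_mono: "arc_index H T n idx \<Longrightarrow> n \<le> m \<Longrightarrow> arc_index H T m idx"
  by (auto simp: arc_index_def intro: less_le_trans)

text \<open>Since lifts are unique, the orbits of edges of the collapse are orbits of edges outside
  \<open>A\<close>, so the bound for \<open>T\<close> is inherited.\<close>

lemma (in quotient_tree) arc_index_Y:
  assumes "arc_index H T n idx"
  shows "\<exists>idx'. arc_index H Y n idx'"
proof -
  define lift where "lift e = (SOME f. f \<in> E - A \<and> e = (q (fst f), q (snd f)))" for e
  have lift: "lift e \<in> E - A \<and> e = (q (fst (lift e)), q (snd (lift e)))" if "e \<in> tarcs Y" for e
  proof -
    have "\<exists>f. f \<in> E - A \<and> e = (q (fst f), q (snd f))" using that unfolding Y_E by force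
    from someI_ex[OF this] show ?thesis unfolding lift_def .
  qed
  have idx: "idx e = idx f \<longleftrightarrow> (\<exists>g \<in> carrier H. f = (act T g (fst e), act T g (snd e)))"
    "idx e < n" if "e \<in> E" "f \<in> E" for e f
    using assms that by (auto simp: arc_index_def)
  have "arc_index H Y n (\<lambda>e. idx (lift e))"
    unfolding arc_index_def
  proof (intro conjI ballI)
    fix e assume e: "e \<in> tarcs Y"
    note le = lift[OF e]
    show "idx (lift e) < n" using le idx(2) by blast
    fix f assume f: "f \<in> tarcs Y"
    note lf = lift[OF f]
    have V: "fst (lift e) \<in> V" "snd (lift e) \<in> V" using le fst_V snd_V by auto
    have "idx (lift e) = idx (lift f) \<longleftrightarrow>
        (\<exists>g \<in> carrier H. lift f = (act T g (fst (lift e)), act T g (snd (lift e))))"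
      using idx(1) le lf by blast
    also have "\<dots> \<longleftrightarrow> (\<exists>g \<in> carrier H. f = (act Y g (fst e), act Y g (snd e)))"
    proof (rule bex_cong[OF refl])
      fix g assume g: "g \<in> carrier H"
      let ?a = "act T g (fst (lift e))" and ?b = "act T g (snd (lift e))"
      have ab: "(?a, ?b) \<in> E" using act_E[OF g, of "fst (lift e)" "snd (lift e)"] le by simp
      have "fst e = q (fst (lift e))" "snd e = q (snd (lift e))" using le by (metis fst_conv snd_conv)+
      then have im: "(act Y g (fst e), act Y g (snd e)) = (q ?a, q ?b)" using Y_act[OF g] V by simp
      have lf': "(fst (lift f), snd (lift f)) \<in> E - A" "f = (q (fst (lift f)), q (snd (lift f)))" using lf by simp_all
      show "lift f = (?a, ?b) \<longleftrightarrow> f = (act Y g (fst e), act Y g (snd e))"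
      proof
        assume "lift f = (?a, ?b)"
        then show "f = (act Y g (fst e), act Y g (snd e))" using lf'(2) im by simp
      next
        assume "f = (act Y g (fst e), act Y g (snd e))"
        then have "q ?a = q (fst (lift f))" "q ?b = q (snd (lift f))" using lf'(2) im by (metis prod.inject)+
        from q_arc_inj[OF lf'(1) ab this] show "lift f = (?a, ?b)" by (simp add: prod_eq_iff)
      qed
    qed
    finally show "idx (lift e) = idx (lift f) \<longleftrightarrow> (\<exists>g \<in> carrier H. f = (act Y g (fst e), act Y g (snd e)))" .
  qed
  then show ?thesis by blast
qed

lemma (in marked_tree) finite_quotient_marked: "finite_quotient H T"
  unfolding finite_quotient_def
proof (intro exI[of _ "rarc T idx ` (idx ` E)"] conjI ballI)
  have "idx ` E \<subseteq> {..<B}" using idx_less by blast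
  then show "finite (rarc T idx ` (idx ` E))" using finite_subset by blast
  show "rarc T idx ` (idx ` E) \<subseteq> E" using rarc by blast
  fix e assume e: "e \<in> E"
  obtain g where g: "g \<in> carrier H" "e = garc g (rarc T idx (idx e))" using rarc_garc[OF e] by (rule bexE)
  have "case rarc T idx (idx e) of (u, v) \<Rightarrow> e = (act T g u, act T g v)"
    using g(2) by (simp add: garc_def case_prod_unfold)
  moreover have "rarc T idx (idx e) \<in> rarc T idx ` (idx ` E)" using e by blast
  ultimately show "\<exists>g \<in> carrier H. \<exists>(u, v) \<in> rarc T idx ` (idx ` E). e = (act T g u, act T g v)"
    by (intro bexI[OF _ g(1)]) (rule bexI)
qed

section \<open>The spectrum\<close>

lemma bordificationD: "X \<in> bordification \<Gamma> \<Longrightarrow> i < length \<Gamma> \<Longrightarrow> X i \<in> bord_trees (\<Gamma> ! i)"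
  by (auto simp: bordification_def)

lemma bord_treeD: "T \<in> bord_trees G \<Longrightarrow> metric_tree (pi1 G) T"
  by (simp add: bord_trees_def)

text \<open>Ellipticity of the vertex groups is carried over from \<open>X\<close> along the
  isometry; trivial edge stabilisers and minimality come from \<open>T\<close> through the
  collapse.\<close>

lemma bord_trees_relen_cquot:
  assumes "graph_of_groups G" and X: "X \<in> bord_trees G" and T: "T \<in> outer_trees G"
    and A: "invariant_subgraph (pi1 G) T A" and iso: "equiv_isometric (pi1 G) X (cquot T A)"
    and l: "inv_len (pi1 G) (cquot T A) l"
  shows "relen l (cquot T A) \<in> bord_trees G"
proof -
  interpret gog G by unfold_locales fact
  interpret quotient_tree "pi1 G" T "parcs A" "choose_rep A" "cquot T A"
    by (rule cquot_quotient[OF outer_treeD(1)[OF T] A])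
  have tes: "trivial_edge_stabilisers (pi1 G) (cquot T A)"
    by (rule trivial_edge_stabilisers_Y[OF outer_treeD(2)[OF T]])
  have "elliptic (cquot T A) S" if "v \<in> verts (ugraph G)" "S \<in> vertex_groups G v" for v S
    by (rule elliptic_isometric[OF bord_treeD[OF X] metric_tree_Y iso tes vertex_groups_carrier[OF that(2)]])
      (use X that in \<open>auto simp: bord_trees_def\<close>)
  then show ?thesis
    using metric_tree_relen[OF metric_tree_Y l] tes minimal_tree_Y[OF outer_treeD(3)[OF T]]
    by (simp add: bord_trees_def)
qed

lemma equiv_homeomorphic_trans:
  assumes "equiv_homeomorphic H T T'" "equiv_homeomorphic H T' T''"
  shows "equiv_homeomorphic H T T''"
proof -
  obtain f where f: "equivariant_map H T T' f"
    "homeomorphic_map (Metric_space.mtopology (points T) (tdist T)) (Metric_space.mtopology (points T') (tdist T')) f"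
    using assms(1) unfolding equiv_homeomorphic_def by (elim exE conjE) (rule that)
  obtain g where g: "equivariant_map H T' T'' g"
    "homeomorphic_map (Metric_space.mtopology (points T') (tdist T')) (Metric_space.mtopology (points T'') (tdist T'')) g"
    using assms(2) unfolding equiv_homeomorphic_def by (elim exE conjE) (rule that)
  show ?thesis
    unfolding equiv_homeomorphic_def
    by (intro exI[of _ "g \<circ> f"] conjI equivariant_map_comp[OF f(1) g(1)] homeomorphic_map_compose[OF f(2) g(2)])
qed

lemma simplexD:
  assumes "\<Delta> \<in> simplices \<Gamma>" "X \<in> \<Delta>"
  shows "X \<in> bordification \<Gamma>"
    and "Z \<in> bordification \<Gamma> \<Longrightarrow> (\<And>i. i < length \<Gamma> \<Longrightarrow> equiv_homeomorphic (HH \<Gamma> i) (X i) (Z i)) \<Longrightarrow> Z \<in> \<Delta>"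
proof -
  let ?R = "{(X, Y). X \<in> bordification \<Gamma> \<and> Y \<in> bordification \<Gamma> \<and>
              (\<forall>i < length \<Gamma>. equiv_homeomorphic (HH \<Gamma> i) (X i) (Y i))}"
  obtain W where W: "\<Delta> = ?R `` {W}" using assms(1) unfolding simplices_def by (rule quotientE)
  then show X: "X \<in> bordification \<Gamma>" using assms(2) by auto
  show "Z \<in> \<Delta>" if "Z \<in> bordification \<Gamma>" "\<And>i. i < length \<Gamma> \<Longrightarrow> equiv_homeomorphic (HH \<Gamma> i) (X i) (Z i)"
    using that assms(2) equiv_homeomorphic_trans unfolding W by blast
qed

section \<open>Displacement bounds and Lipschitz maps\<close>

lemma stretch_lessD:
  assumes less: "stretch \<Gamma> X (aut_act \<Gamma> \<phi> X) < ennreal r"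
    and mt: "\<And>i. i < length \<Gamma> \<Longrightarrow> metric_gtree (X i)" and \<phi>: "good_aut \<Gamma> \<phi>"
  obtains f C where "0 \<le> C" "C < r"
    "\<And>i. i < length \<Gamma> \<Longrightarrow> equivariant_map (HH \<Gamma> i) (X i) (twist (snd \<phi> i) (X (fst \<phi> i))) (f i)"
    "\<And>i p q. i < length \<Gamma> \<Longrightarrow> p \<in> points (X i) \<Longrightarrow> q \<in> points (X i) \<Longrightarrow>
      tdist (X (fst \<phi> i)) (f i p) (f i q) \<le> C * tdist (X i) p q"
proof -
  have act: "aut_act \<Gamma> \<phi> X i = twist (snd \<phi> i) (X (fst \<phi> i))" if "i < length \<Gamma>" for i
    using that by (simp add: aut_act_def)
  \<comment> \<open>Needed because 0 takes part in the maximum that defines \<open>C\<close>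
    below.\<close>
  have rpos: "0 < r"
  proof (rule ccontr)
    assume "\<not> 0 < r"
    then have "ennreal r = 0" by (simp add: ennreal_neg)
    then show False using less by simp
  qed
  obtain s f where sf: "s < ennreal r" "s = (SUP i \<in> {..<length \<Gamma>}. Lip (X i) (aut_act \<Gamma> \<phi> X i) (f i))"
    "\<And>i. i < length \<Gamma> \<Longrightarrow> equivariant_map (HH \<Gamma> i) (X i) (aut_act \<Gamma> \<phi> X i) (f i)"
    using less unfolding stretch_def Inf_less_iff by blast
  have "\<exists>C \<ge> 0. C < r \<and> (\<forall>p \<in> points (X i). \<forall>q \<in> points (X i). tdist (X (fst \<phi> i)) (f i p) (f i q) \<le> C * tdist (X i) p q)"
    if i: "i < length \<Gamma>" for i
  proof -
    have "Lip (X i) (aut_act \<Gamma> \<phi> X i) (f i) \<le> s" unfolding sf(2) using i by (intro SUP_upper) simp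
    then have "Lip (X i) (aut_act \<Gamma> \<phi> X i) (f i) < ennreal r" using sf(1) by (rule le_less_trans)
    then obtain c where "c \<in> {ennreal C | C. 0 \<le> C \<and> (\<forall>p \<in> points (X i). \<forall>q \<in> points (X i).
        tdist (aut_act \<Gamma> \<phi> X i) (f i p) (f i q) \<le> C * tdist (X i) p q)}" "c < ennreal r"
      unfolding Lip_def Inf_less_iff by (elim bexE) (rule that)
    then obtain C where C: "0 \<le> C" "ennreal C < ennreal r" "\<forall>p \<in> points (X i). \<forall>q \<in> points (X i).
        tdist (aut_act \<Gamma> \<phi> X i) (f i p) (f i q) \<le> C * tdist (X i) p q"
      unfolding mem_Collect_eq by (elim exE conjE) (rule that, simp_all)
    then have "C < r" using ennreal_less_iff by blast
    then show ?thesis using C act[OF i] by (intro exI[of _ C]) simp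
  qed
  then obtain Ci where Ci: "\<And>i. i < length \<Gamma> \<Longrightarrow> 0 \<le> Ci i \<and> Ci i < r \<and>
      (\<forall>p \<in> points (X i). \<forall>q \<in> points (X i). tdist (X (fst \<phi> i)) (f i p) (f i q) \<le> Ci i * tdist (X i) p q)" by metis
  \<comment> \<open>The element 0 covers an empty union and makes \<open>C\<close>
    nonnegative.\<close>
  define C where "C = Max (insert 0 (Ci ` {..<length \<Gamma>}))"
  have ge: "Ci i \<le> C" if "i < length \<Gamma>" for i unfolding C_def using that by (intro Max_ge) auto
  show thesis
  proof (rule that[of C f])
    show "0 \<le> C" unfolding C_def by (intro Max_ge) auto
    show "C < r" unfolding C_def using Ci rpos by (subst Max_less_iff) auto
    show "equivariant_map (HH \<Gamma> i) (X i) (twist (snd \<phi> i) (X (fst \<phi> i))) (f i)" if "i < length \<Gamma>" for i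
      using sf(3)[OF that] act[OF that] by simp
    fix i p q assume i: "i < length \<Gamma>" and pq: "p \<in> points (X i)" "q \<in> points (X i)"
    have "0 \<le> tdist (X i) p q" by (rule Metric_space.nonneg[OF metric_gtree.Metric_space_points[OF mt[OF i]]])
    then have "Ci i * tdist (X i) p q \<le> C * tdist (X i) p q" using ge[OF i] by (rule mult_right_mono[rotated])
    moreover have "tdist (X (fst \<phi> i)) (f i p) (f i q) \<le> Ci i * tdist (X i) p q" using Ci[OF i] pq by simp
    ultimately show "tdist (X (fst \<phi> i)) (f i p) (f i q) \<le> C * tdist (X i) p q" by linarith
  qed
qed

lemma stretch_leI:
  assumes C: "0 \<le> C"
    and f: "\<And>i. i < length \<Gamma> \<Longrightarrow> equivariant_map (HH \<Gamma> i) (X i) (twist (snd \<phi> i) (X (fst \<phi> i))) (f i)"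
    and lip: "\<And>i p q. i < length \<Gamma> \<Longrightarrow> p \<in> points (X i) \<Longrightarrow> q \<in> points (X i) \<Longrightarrow>
      tdist (X (fst \<phi> i)) (f i p) (f i q) \<le> C * tdist (X i) p q"
  shows "stretch \<Gamma> X (aut_act \<Gamma> \<phi> X) \<le> ennreal C"
proof -
  have act: "aut_act \<Gamma> \<phi> X i = twist (snd \<phi> i) (X (fst \<phi> i))" if "i < length \<Gamma>" for i
    using that by (simp add: aut_act_def)
  have L: "Lip (X i) (aut_act \<Gamma> \<phi> X i) (f i) \<le> ennreal C" if i: "i < length \<Gamma>" for i
    unfolding Lip_def act[OF i] by (rule Inf_lower) (use C lip[OF i] in auto)
  have "stretch \<Gamma> X (aut_act \<Gamma> \<phi> X) \<le> (SUP i \<in> {..<length \<Gamma>}. Lip (X i) (aut_act \<Gamma> \<phi> X i) (f i))"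
    unfolding stretch_def
  proof (rule Inf_lower, rule CollectI, intro exI[of _ f] conjI refl allI impI)
    fix i assume i: "i < length \<Gamma>"
    show "equivariant_map (HH \<Gamma> i) (X i) (aut_act \<Gamma> \<phi> X i) (f i)" using f[OF i] act[OF i] by simp
    have "ennreal C < \<infinity>" by simp
    then show "Lip (X i) (aut_act \<Gamma> \<phi> X i) (f i) < \<infinity>" using L[OF i] by (rule le_less_trans[rotated])
  qed
  also have "\<dots> \<le> ennreal C" using L by (intro SUP_least) simp
  finally show ?thesis .
qed

lemma equivariant_map_twist:
  assumes "equivariant_map H' T T' j" "\<alpha> \<in> hom H H'"
  shows "equivariant_map H (twist \<alpha> T) (twist \<alpha> T') j"
proof -
  have "\<alpha> g \<in> carrier H'" if "g \<in> carrier H" for g using assms(2) that by (auto simp: hom_def)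
  then show ?thesis using assms(1) by (simp add: equivariant_map_def)
qed

text \<open>Conjugation by isometries moves a Lipschitz map from a point of the simplex, whose
  vertices of valence two are uncontrolled, to the isometric collapse, whose edge orbits are
  counted.\<close>

lemma transfer_map:
  assumes X: "metric_tree H X" and iso: "equiv_isometric H X Y" and iso': "equiv_isometric H' X' Y'"
    and \<alpha>: "\<alpha> \<in> hom H H'" and f: "equivariant_map H X (twist \<alpha> X') f"
    and lip: "\<And>p q. p \<in> points X \<Longrightarrow> q \<in> points X \<Longrightarrow> tdist X' (f p) (f q) \<le> C * tdist X p q"
  obtains F where "equivariant_map H Y (twist \<alpha> Y') F"
    "\<And>p q. p \<in> points Y \<Longrightarrow> q \<in> points Y \<Longrightarrow> tdist Y' (F p) (F q) \<le> C * tdist Y p q"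
proof -
  obtain g where g: "equivariant_map H Y X g"
    "\<forall>p \<in> points Y. \<forall>q \<in> points Y. tdist X (g p) (g q) = tdist Y p q"
    using equiv_isometric_sym[OF iso X] unfolding equiv_isometric_def by (elim exE conjE) (rule that)
  obtain j where j: "equivariant_map H' X' Y' j"
    "\<forall>p \<in> points X'. \<forall>q \<in> points X'. tdist Y' (j p) (j q) = tdist X' p q"
    using iso' unfolding equiv_isometric_def by (elim exE conjE) (rule that)
  show thesis
  proof (rule that[of "j \<circ> (f \<circ> g)"])
    show "equivariant_map H Y (twist \<alpha> Y') (j \<circ> (f \<circ> g))"
      by (rule equivariant_map_comp[OF equivariant_map_comp[OF g(1) f] equivariant_map_twist[OF j(1) \<alpha>]])
    fix p q assume pq: "p \<in> points Y" "q \<in> points Y"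
    have gp: "g p \<in> points X" "g q \<in> points X" using g(1) pq by (auto simp: equivariant_map_def)
    have fp: "f (g p) \<in> points X'" "f (g q) \<in> points X'" using f gp by (auto simp: equivariant_map_def)
    have "tdist Y' ((j \<circ> (f \<circ> g)) p) ((j \<circ> (f \<circ> g)) q) = tdist X' (f (g p)) (f (g q))" using j(2) fp by simp
    also have "\<dots> \<le> C * tdist X (g p) (g q)" by (rule lip[OF gp])
    also have "tdist X (g p) (g q) = tdist Y p q" using g(2) pq by simp
    finally show "tdist Y' ((j \<circ> (f \<circ> g)) p) ((j \<circ> (f \<circ> g)) q) \<le> C * tdist Y p q" .
  qed
qed

text \<open>One bound for all components; a sum avoids the maximum of a possibly empty set.\<close>

definition total_bound :: "('v, 'e, 'g) union_gog \<Rightarrow> nat" where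
  "total_bound \<Gamma> = (\<Sum>i < length \<Gamma>. arc_bound (\<Gamma> ! i))"

text \<open>The last clause hides the presentation as a collapse. Any lengths and equivariant vertex
  images on \<open>Y\<close> that stretch edges by at most \<open>C'\<close> give a point
  \<open>Z\<close> of \<open>\<Delta>\<close>: it is the same collapse with new lengths, hence
  homeomorphic to \<open>X\<close> and still admissible, and the extended map bounds its
  displacement.\<close>

lemma map_data_exists:
  fixes \<Gamma> :: "('v, 'e, 'g) union_gog"
  assumes val: "valid_union \<Gamma>" and \<phi>: "good_aut \<Gamma> \<phi>" and \<Delta>: "\<Delta> \<in> simplices \<Gamma>" "X \<in> \<Delta>"
    and less: "displacement \<Gamma> \<phi> X < ennreal r"
  shows "\<exists>(Y :: ('v, 'e, 'g) hforest) idx F0 C.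
    map_data (HH \<Gamma>) (length \<Gamma>) (fst \<phi>) (snd \<phi>) (total_bound \<Gamma>) Y idx F0 C \<and> 0 \<le> C \<and> C < r \<and>
    (\<forall>l f C'. 0 \<le> C' \<longrightarrow> (\<forall>i < length \<Gamma>. inv_len (HH \<Gamma> i) (Y i) (l i) \<and>
      (\<forall>v \<in> tverts (Y i). f i v \<in> points (Y (fst \<phi> i)) \<and> (\<forall>g \<in> carrier (HH \<Gamma> i).
        f i (act (Y i) g v) = pact (Y (fst \<phi> i)) (snd \<phi> i g) (f i v))) \<and>
      (\<forall>e \<in> tarcs (Y i). tdist (relen (l (fst \<phi> i)) (Y (fst \<phi> i))) (f i (fst e)) (f i (snd e)) \<le> C' * l i e)) \<longrightarrow>
      simplex_displacement \<Gamma> \<phi> \<Delta> \<le> ennreal C')"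
proof -
  let ?N = "length \<Gamma>" and ?\<sigma> = "fst \<phi>" and ?\<alpha> = "snd \<phi>"
  have X: "X \<in> bordification \<Gamma>" by (rule simplexD(1)[OF \<Delta>])
  note mtX = bord_treeD[OF bordificationD[OF X]]
  have \<sigma>: "?\<sigma> i < ?N" and iso\<alpha>: "?\<alpha> i \<in> iso (HH \<Gamma> i) (HH \<Gamma> (?\<sigma> i))" and hom\<alpha>: "?\<alpha> i \<in> hom (HH \<Gamma> i) (HH \<Gamma> (?\<sigma> i))"
    if "i < ?N" for i using \<phi> that by (auto simp: good_aut_def iso_def)
  have adm: "adm \<Gamma> \<phi> X" and less': "stretch \<Gamma> X (aut_act \<Gamma> \<phi> X) < ennreal r"
    using less unfolding displacement_adm by (auto split: if_splits)
  obtain X0 A where X0: "X0 \<in> outer_space \<Gamma>"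
    and A: "\<And>i. i < ?N \<Longrightarrow> invariant_subgraph (HH \<Gamma> i) (X0 i) (A i)"
    and iso: "\<And>i. i < ?N \<Longrightarrow> equiv_isometric (HH \<Gamma> i) (X i) (cquot (X0 i) (A i))"
    and adm': "\<And>l Z. (\<And>i. i < ?N \<Longrightarrow> inv_len (HH \<Gamma> i) (cquot (X0 i) (A i)) (l i)) \<Longrightarrow>
      (\<And>i. i < ?N \<Longrightarrow> Z i = relen (l i) (cquot (X0 i) (A i))) \<Longrightarrow> adm \<Gamma> \<phi> Z"
  proof (rule presentation[OF val \<phi> X adm], goal_cases)
    case (1 X0 A)
    show ?case
    proof (rule that[of X0 A])
      fix l Z
      assume l: "\<And>i. i < ?N \<Longrightarrow> inv_len (HH \<Gamma> i) (cquot (X0 i) (A i)) (l i)"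
        and Z: "\<And>i. i < ?N \<Longrightarrow> Z i = relen (l i) (cquot (X0 i) (A i))"
      show "adm \<Gamma> \<phi> Z" by (rule 1(5), rule l, assumption, rule Z, assumption)
    qed (rule 1(2-4), assumption?)+
  qed
  define Y where "Y i = cquot (X0 i) (A i)" for i
  note outer = outer_spaceD[OF X0]
  have quot: "quotient_tree (HH \<Gamma> i) (X0 i) (parcs (A i)) (choose_rep (A i)) (Y i)" if "i < ?N" for i
    unfolding Y_def by (rule cquot_quotient[OF outer_treeD(1)[OF outer[OF that]] A[OF that]])
  note mtY = quotient_tree.metric_tree_Y[OF quot]
  have tesY: "trivial_edge_stabilisers (HH \<Gamma> i) (Y i)" if "i < ?N" for i
    by (rule quotient_tree.trivial_edge_stabilisers_Y[OF quot[OF that] outer_treeD(2)[OF outer[OF that]]])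
  have "\<exists>idx. arc_index (HH \<Gamma> i) (Y i) (total_bound \<Gamma>) idx" if i: "i < ?N" for i
  proof -
    obtain idx where "arc_index (HH \<Gamma> i) (X0 i) (arc_bound (\<Gamma> ! i)) idx"
      using outer_tree_bound(2)[OF valid_unionD[OF val i] outer[OF i]] by blast
    moreover have "arc_bound (\<Gamma> ! i) \<le> total_bound \<Gamma>"
      unfolding total_bound_def by (rule member_le_sum) (use i in auto)
    ultimately show ?thesis using quotient_tree.arc_index_Y[OF quot[OF i]] arc_index_mono by blast
  qed
  then obtain idx where idx: "\<And>i. i < ?N \<Longrightarrow> arc_index (HH \<Gamma> i) (Y i) (total_bound \<Gamma>) (idx i)" by metis
  have marked: "marked_tree (HH \<Gamma> i) (Y i) (total_bound \<Gamma>) (idx i)" if "i < ?N" for i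
    using mtY[OF that] tesY[OF that] idx[OF that] by (simp add: marked_tree_def htree_def marked_tree_axioms_def)
  obtain f C where C: "0 \<le> C" "C < r"
    and f: "\<And>i. i < ?N \<Longrightarrow> equivariant_map (HH \<Gamma> i) (X i) (twist (?\<alpha> i) (X (?\<sigma> i))) (f i)"
    "\<And>i p q. i < ?N \<Longrightarrow> p \<in> points (X i) \<Longrightarrow> q \<in> points (X i) \<Longrightarrow>
      tdist (X (?\<sigma> i)) (f i p) (f i q) \<le> C * tdist (X i) p q"
    by (rule stretch_lessD[OF less' _ \<phi>]) (rule metric_tree_gtree[OF mtX], assumption, rule that)
  have "\<exists>F. equivariant_map (HH \<Gamma> i) (Y i) (twist (?\<alpha> i) (Y (?\<sigma> i))) F \<and>
      (\<forall>p \<in> points (Y i). \<forall>q \<in> points (Y i). tdist (Y (?\<sigma> i)) (F p) (F q) \<le> C * tdist (Y i) p q)"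
    if i: "i < ?N" for i
  proof -
    obtain F where "equivariant_map (HH \<Gamma> i) (Y i) (twist (?\<alpha> i) (Y (?\<sigma> i))) F"
      "\<And>p q. p \<in> points (Y i) \<Longrightarrow> q \<in> points (Y i) \<Longrightarrow> tdist (Y (?\<sigma> i)) (F p) (F q) \<le> C * tdist (Y i) p q"
      by (rule transfer_map[OF mtX[OF i] iso[OF i, folded Y_def] iso[OF \<sigma>[OF i], folded Y_def] hom\<alpha>[OF i] f(1)[OF i] f(2)[OF i]])
        (assumption, assumption, rule that)
    then show ?thesis by (intro exI[of _ F]) simp
  qed
  then obtain F where F: "\<And>i. i < ?N \<Longrightarrow> equivariant_map (HH \<Gamma> i) (Y i) (twist (?\<alpha> i) (Y (?\<sigma> i))) (F i)"
    "\<And>i. i < ?N \<Longrightarrow> \<forall>p \<in> points (Y i). \<forall>q \<in> points (Y i). tdist (Y (?\<sigma> i)) (F i p) (F i q) \<le> C * tdist (Y i) p q"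
    by metis
  define F0 where "F0 i v = F i (vpt v)" for i v
  have md: "map_data (HH \<Gamma>) ?N ?\<sigma> ?\<alpha> (total_bound \<Gamma>) Y idx F0 C"
  proof
    fix i v assume i: "i < ?N" and v: "v \<in> tverts (Y i)"
    interpret M: marked_tree "HH \<Gamma> i" "Y i" "total_bound \<Gamma>" "idx i" by (rule marked[OF i])
    show "F0 i v \<in> points (Y (?\<sigma> i))"
      using F(1)[OF i] vpt_in[OF v] by (auto simp: equivariant_map_def F0_def)
    fix g assume g: "g \<in> carrier (HH \<Gamma> i)"
    have "F i (pact (Y i) g (vpt v)) = pact (Y (?\<sigma> i)) (?\<alpha> i g) (F i (vpt v))"
      using F(1)[OF i] vpt_in[OF v] g unfolding equivariant_map_def by simp
    then show "F0 i (act (Y i) g v) = pact (Y (?\<sigma> i)) (?\<alpha> i g) (F0 i v)"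
      using M.pact_vpt[OF g v] by (simp add: F0_def)
  next
    fix i e assume i: "i < ?N" and e: "e \<in> tarcs (Y i)"
    interpret M: marked_tree "HH \<Gamma> i" "Y i" "total_bound \<Gamma>" "idx i" by (rule marked[OF i])
    have P: "vpt (fst e) \<in> points (Y i)" "vpt (snd e) \<in> points (Y i)"
      using vpt_in[OF M.fst_V[OF e]] vpt_in[OF M.snd_V[OF e]] by simp_all
    have "(fst e, snd e) \<in> tarcs (Y i)" using e by simp
    from M.dd_edge[OF this, of 0 1] have "tdist (Y i) (vpt (fst e)) (vpt (snd e)) = len (Y i) e"
      using M.tdist_dd[OF P] by simp
    then show "tdist (Y (?\<sigma> i)) (F0 i (fst e)) (F0 i (snd e)) \<le> C * len (Y i) e"
      using F(2)[OF i] P unfolding F0_def by metis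
  qed (use \<sigma> iso\<alpha> mtY tesY idx in auto)
  have real: "simplex_displacement \<Gamma> \<phi> \<Delta> \<le> ennreal C'"
    if C': "0 \<le> C'" and l: "\<And>i. i < ?N \<Longrightarrow> inv_len (HH \<Gamma> i) (Y i) (l i)"
      and h_in: "\<And>i v. i < ?N \<Longrightarrow> v \<in> tverts (Y i) \<Longrightarrow> h i v \<in> points (Y (?\<sigma> i))"
      and h_act: "\<And>i v g. i < ?N \<Longrightarrow> v \<in> tverts (Y i) \<Longrightarrow> g \<in> carrier (HH \<Gamma> i) \<Longrightarrow>
        h i (act (Y i) g v) = pact (Y (?\<sigma> i)) (?\<alpha> i g) (h i v)"
      and h_lip: "\<And>i e. i < ?N \<Longrightarrow> e \<in> tarcs (Y i) \<Longrightarrow>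
        tdist (relen (l (?\<sigma> i)) (Y (?\<sigma> i))) (h i (fst e)) (h i (snd e)) \<le> C' * l i e"
    for l :: "nat \<Rightarrow> (('v, 'e, 'g) loop_class \<times> nat) \<times> (('v, 'e, 'g) loop_class \<times> nat) \<Rightarrow> real"
      and h :: "nat \<Rightarrow> ('v, 'e, 'g) loop_class \<times> nat \<Rightarrow> ('v, 'e, 'g) loop_class \<times> nat \<Rightarrow> real" and C'
  proof -
    define Z where "Z = (\<lambda>i \<in> {..<?N}. relen (l i) (Y i))"
    have Z: "Z i = relen (l i) (Y i)" if "i < ?N" for i using that by (simp add: Z_def)
    have mtZ: "metric_tree (HH \<Gamma> i) (Z i)" if "i < ?N" for i
      using metric_tree_relen[OF mtY[OF that] l[OF that]] Z[OF that] by simp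
    have zb: "relen (l i) (Y i) \<in> bord_trees (\<Gamma> ! i)" if "i < ?N" for i
      unfolding Y_def
      by (rule bord_trees_relen_cquot[OF valid_unionD(1)[OF val that] bordificationD[OF X that] outer[OF that] A[OF that]
            iso[OF that] l[OF that, unfolded Y_def]])
    have bordZ: "Z \<in> bordification \<Gamma>"
      unfolding bordification_def Z_def using zb by auto
    have homeo: "equiv_homeomorphic (HH \<Gamma> i) (X i) (Z i)" if i: "i < ?N" for i
    proof (rule equiv_homeomorphic_trans)
      show "equiv_homeomorphic (HH \<Gamma> i) (X i) (Y i)"
        unfolding Y_def by (rule equiv_isometric_homeomorphic[OF mtX[OF i] mtY[OF i, unfolded Y_def] iso[OF i]])
      show "equiv_homeomorphic (HH \<Gamma> i) (Y i) (Z i)"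
        unfolding Z[OF i] by (rule equiv_homeomorphic_relen[OF mtY[OF i] l[OF i] marked_tree.finite_quotient_marked[OF marked[OF i]]])
    qed
    have "Z \<in> \<Delta>" by (rule simplexD(2)[OF \<Delta> bordZ homeo])
    then have "simplex_displacement \<Gamma> \<phi> \<Delta> \<le> displacement \<Gamma> \<phi> Z"
      unfolding simplex_displacement_def by (rule INF_lower)
    also have "adm \<Gamma> \<phi> Z" by (rule adm'[where l = l and Z = Z]) (use l Z in \<open>auto simp: Y_def\<close>)
    then have "displacement \<Gamma> \<phi> Z = stretch \<Gamma> Z (aut_act \<Gamma> \<phi> Z)" by (simp add: displacement_adm)
    also have "\<dots> \<le> ennreal C'"
    proof -
      have "\<exists>K. equivariant_map (HH \<Gamma> i) (Z i) (twist (?\<alpha> i) (Z (?\<sigma> i))) K \<and>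
          (\<forall>p \<in> points (Z i). \<forall>q \<in> points (Z i). tdist (Z (?\<sigma> i)) (K p) (K q) \<le> C' * tdist (Z i) p q)"
        if i: "i < ?N" for i
      proof -
        note j = \<sigma>[OF i]
        interpret S: htree "HH \<Gamma> i" "Z i" by unfold_locales (rule mtZ[OF i])
        interpret R: metric_gtree "Z (?\<sigma> i)" by (rule metric_tree_gtree[OF mtZ[OF j]])
        have tw: "metric_tree (HH \<Gamma> i) (twist (?\<alpha> i) (Z (?\<sigma> i)))"
          by (rule metric_tree_twist[OF mtZ[OF j] hom\<alpha>[OF i] S.group_H])
        interpret W: metric_gtree "twist (?\<alpha> i) (Z (?\<sigma> i))" by (rule metric_tree_gtree[OF tw])
        have tv: "tverts (Z i) = tverts (Y i)" "tarcs (Z i) = tarcs (Y i)" using Z[OF i] by simp_all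
        have hW: "h i v \<in> points (twist (?\<alpha> i) (Z (?\<sigma> i)))" if "v \<in> tverts (Z i)" for v
          using h_in[OF i] that Z[OF i] Z[OF j] by simp
        \<comment> \<open>Extension at constant speed, so that the bound for the ends of an edge
          holds along the edge.\<close>
        obtain K where K: "equivariant_map (HH \<Gamma> i) (Z i) (twist (?\<alpha> i) (Z (?\<sigma> i))) K"
          "\<And>v. v \<in> tverts (Z i) \<Longrightarrow> K (vpt v) = h i v"
          "\<And>a b t. (a, b) \<in> tarcs (Z i) \<Longrightarrow> 0 \<le> t \<Longrightarrow> t \<le> 1 \<Longrightarrow> K (pt a b t) = W.geo (h i a) (h i b) t"
        proof (rule straight_extension[OF mtZ[OF i] tw, of "h i"])
          show "h i v \<in> points (twist (?\<alpha> i) (Z (?\<sigma> i)))" if "v \<in> tverts (Z i)" for v by (rule hW[OF that])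
          show "h i (act (Z i) g v) = pact (twist (?\<alpha> i) (Z (?\<sigma> i))) g (h i v)"
            if "g \<in> carrier (HH \<Gamma> i)" "v \<in> tverts (Z i)" for g v
            using h_act[OF i, of v g] that Z[OF i] Z[OF j] by simp
        qed (rule that)
        have K_in: "K p \<in> points (Z (?\<sigma> i))" if "p \<in> points (Z i)" for p
          using K(1) that by (auto simp: equivariant_map_def)
        have "tdist (Z (?\<sigma> i)) (K p) (K q) \<le> C' * tdist (Z i) p q" if "p \<in> points (Z i)" "q \<in> points (Z i)" for p q
        proof (rule S.lipschitz_of_edges[OF R.Metric_space_points K_in C' _ that])
          fix a b t s assume ab: "(a, b) \<in> tarcs (Z i)" and t: "0 \<le> t" "t \<le> (1::real)" and s: "0 \<le> s" "s \<le> (1::real)"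
          have V: "a \<in> tverts (Z i)" "b \<in> tverts (Z i)" using S.wf ab by auto
          note P = hW[OF V(1)] hW[OF V(2)]
          have "tdist (twist (?\<alpha> i) (Z (?\<sigma> i))) (K (pt a b t)) (K (pt a b s)) = \<bar>t - s\<bar> * W.dd (h i a) (h i b)"
            unfolding K(3)[OF ab t] K(3)[OF ab s]
            using W.tdist_dd[OF W.geo(1)[OF P t] W.geo(1)[OF P s]] W.geo_dist[OF P t s] by simp
          also have "W.dd (h i a) (h i b) = tdist (Z (?\<sigma> i)) (h i a) (h i b)" using W.tdist_dd[OF P] by simp
          also have "\<bar>t - s\<bar> * tdist (Z (?\<sigma> i)) (h i a) (h i b) \<le> \<bar>t - s\<bar> * (C' * l i (a, b))"
            using h_lip[OF i, of "(a, b)"] ab tv Z[OF j] by (intro mult_left_mono) simp_all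
          finally show "tdist (Z (?\<sigma> i)) (K (pt a b t)) (K (pt a b s)) \<le> C' * (len (Z i) (a, b) * \<bar>s - t\<bar>)"
            using Z[OF i] by (simp add: mult.commute mult.left_commute abs_minus_commute)
        qed
        then show ?thesis using K(1) by (intro exI[of _ K]) simp
      qed
      then obtain K where K: "\<And>i. i < ?N \<Longrightarrow> equivariant_map (HH \<Gamma> i) (Z i) (twist (?\<alpha> i) (Z (?\<sigma> i))) (K i)"
        "\<And>i. i < ?N \<Longrightarrow> \<forall>p \<in> points (Z i). \<forall>q \<in> points (Z i). tdist (Z (?\<sigma> i)) (K i p) (K i q) \<le> C' * tdist (Z i) p q"
        by metis
      show ?thesis by (rule stretch_leI[OF C' K(1)]) (use K(2) in simp_all)
    qed
    finally show ?thesis .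
  qed
  show ?thesis
  proof (intro exI[of _ Y] exI[of _ idx] exI[of _ F0] exI[of _ C] conjI md C allI impI, goal_cases)
    case (1 l f C')
    show ?case by (rule real[of C' l f]) (use 1 in simp_all)
  qed
qed

section \<open>Excluding strictly decreasing sequences\<close>

lemma well_orderedI:
  assumes "\<And>s :: nat \<Rightarrow> real. (\<And>n. s n \<in> S) \<Longrightarrow> (\<And>n. s (Suc n) < s n) \<Longrightarrow> False"
  shows "well_ordered S"
proof -
  let ?r = "{(x, y). x \<in> S \<and> y \<in> S \<and> x \<le> y}"
  have "wf (?r - Id)"
    unfolding wf_iff_no_infinite_down_chain
  proof
    assume "\<exists>s. \<forall>i. (s (Suc i), s i) \<in> ?r - Id"
    then obtain s where s: "\<And>i. (s (Suc i), s i) \<in> ?r - Id" by blast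
    have "s n \<in> S" "s (Suc n) < s n" for n using s[of n] by auto
    then show False by (rule assms)
  qed
  moreover have "linear_order_on S ?r"
    by (auto simp: linear_order_on_def partial_order_on_def preorder_on_def refl_on_def trans_def antisym_def total_on_def)
  ultimately show ?thesis by (simp add: well_ordered_def well_order_on_def)
qed

lemma no_descending_spectrum:
  fixes \<Gamma> :: "('v, 'e, 'g) union_gog" and s :: "nat \<Rightarrow> real"
  assumes val: "valid_union \<Gamma>" and s: "\<And>n. s n \<in> global_spec \<Gamma>" and dec: "\<And>n. s (Suc n) < s n"
  shows False
proof -
  have "\<exists>\<phi> \<Delta>. (\<exists>c \<in> carrier (OutG \<Gamma>). \<phi> \<in> c) \<and> \<Delta> \<in> simplices \<Gamma> \<and> simplex_displacement \<Gamma> \<phi> \<Delta> = ennreal (s n)" for n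
  proof -
    obtain c \<phi> \<Delta> where "s n = enn2real (simplex_displacement \<Gamma> \<phi> \<Delta>)" "c \<in> carrier (OutG \<Gamma>)" "\<phi> \<in> c"
      "\<Delta> \<in> simplices \<Gamma>" "simplex_displacement \<Gamma> \<phi> \<Delta> < \<infinity>" using s[of n] unfolding global_spec_def by blast
    then show ?thesis by (intro exI[of _ \<phi>] exI[of _ \<Delta>]) auto
  qed
  then obtain \<phi> \<Delta> where d: "\<And>n. \<exists>c \<in> carrier (OutG \<Gamma>). \<phi> n \<in> c" "\<And>n. \<Delta> n \<in> simplices \<Gamma>"
    "\<And>n. simplex_displacement \<Gamma> (\<phi> n) (\<Delta> n) = ennreal (s n)" by metis
  have anti: "s n \<le> s m" if "m \<le> n" for m n
    using lift_Suc_antimono_le[of s, OF less_imp_le[OF dec] that] .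
  have nonneg: "0 \<le> s n" for n
  proof -
    obtain c \<phi> \<Delta> where "s n = enn2real (simplex_displacement \<Gamma> \<phi> \<Delta>)" using s[of n] unfolding global_spec_def by blast
    then show ?thesis by simp
  qed
  \<comment> \<open>The data with index \<open>n\<close> belong to the simplex of
    \<open>s (Suc n)\<close>: the strict inequality \<open>s (Suc n) < s n\<close> is what provides
    a point and a map stretching by less than \<open>s n\<close>.\<close>
  let ?P = "\<lambda>n (D :: ('v, 'e, 'g) hforest \<times> _). case D of (Y, idx, F0, C) \<Rightarrow>
    map_data (HH \<Gamma>) (length \<Gamma>) (fst (\<phi> (Suc n))) (snd (\<phi> (Suc n))) (total_bound \<Gamma>) Y idx F0 C \<and> 0 \<le> C \<and> C < s n \<and>
    (\<forall>l f C'. 0 \<le> C' \<longrightarrow> (\<forall>i < length \<Gamma>. inv_len (HH \<Gamma> i) (Y i) (l i) \<and>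
      (\<forall>v \<in> tverts (Y i). f i v \<in> points (Y (fst (\<phi> (Suc n)) i)) \<and> (\<forall>g \<in> carrier (HH \<Gamma> i).
        f i (act (Y i) g v) = pact (Y (fst (\<phi> (Suc n)) i)) (snd (\<phi> (Suc n)) i g) (f i v))) \<and>
      (\<forall>e \<in> tarcs (Y i). tdist (relen (l (fst (\<phi> (Suc n)) i)) (Y (fst (\<phi> (Suc n)) i))) (f i (fst e)) (f i (snd e)) \<le> C' * l i e)) \<longrightarrow>
      ennreal (s (Suc n)) \<le> ennreal C')"
  have ex: "\<exists>D :: ('v, 'e, 'g) hforest \<times> _. ?P n D" for n
  proof -
    have "(INF X \<in> \<Delta> (Suc n). displacement \<Gamma> (\<phi> (Suc n)) X) < ennreal (s n)"
      using d(3)[of "Suc n"] dec[of n] nonneg[of "Suc n"] by (simp add: simplex_displacement_def ennreal_less_iff)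
    then obtain X where X: "X \<in> \<Delta> (Suc n)" "displacement \<Gamma> (\<phi> (Suc n)) X < ennreal (s n)"
      unfolding INF_less_iff by (rule bexE)
    have "X \<in> bordification \<Gamma>" by (rule simplexD(1)[OF d(2) X(1)])
    then have "group (HH \<Gamma> i)" if "i < length \<Gamma>" for i
      using bord_treeD[OF bordificationD[OF _ that]] htree.group_H[unfolded htree_def] by blast
    then have "good_aut \<Gamma> (\<phi> (Suc n))" using OutG_good_aut d(1)[of "Suc n"] by blast
    from map_data_exists[OF val this d(2) X] show ?thesis unfolding d(3) by simp
  qed
  define D where "D n = (SOME D. ?P n D)" for n
  have D: "?P n (D n)" for n unfolding D_def by (rule someI_ex[OF ex])
  define Y where "Y n = fst (D n)" for n
  define idx where "idx n = fst (snd (D n))" for n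
  define F0 where "F0 n = fst (snd (snd (D n)))" for n
  define C where "C n = snd (snd (snd (D n)))" for n
  have Deq: "D n = (Y n, idx n, F0 n, C n)" for n by (simp add: Y_def idx_def F0_def C_def)
  have md: "map_data (HH \<Gamma>) (length \<Gamma>) (fst (\<phi> (Suc n))) (snd (\<phi> (Suc n))) (total_bound \<Gamma>) (Y n) (idx n) (F0 n) (C n)"
    and C: "0 \<le> C n" "C n < s n" for n using D[of n] unfolding Deq by simp_all
  have min: "ennreal (s (Suc n)) \<le> ennreal C'"
    if "0 \<le> C'" "\<forall>i < length \<Gamma>. inv_len (HH \<Gamma> i) (Y n i) (l i) \<and>
      (\<forall>v \<in> tverts (Y n i). f i v \<in> points (Y n (fst (\<phi> (Suc n)) i)) \<and> (\<forall>g \<in> carrier (HH \<Gamma> i).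
        f i (act (Y n i) g v) = pact (Y n (fst (\<phi> (Suc n)) i)) (snd (\<phi> (Suc n)) i g) (f i v))) \<and>
      (\<forall>e \<in> tarcs (Y n i). tdist (relen (l (fst (\<phi> (Suc n)) i)) (Y n (fst (\<phi> (Suc n)) i))) (f i (fst e)) (f i (snd e)) \<le> C' * l i e)"
    for n C' l f using D[of n] that unfolding Deq prod.case by blast
  let ?N = "length \<Gamma>" and ?B = "total_bound \<Gamma>"
  let ?T = "Pow ({..<?N} \<times> {..<?B} \<times> {..<?B} \<times> {..<?B} \<times> {..<?B}) \<times> Pow ({..<?N} \<times> {..<?N})"
  let ?\<tau> = "\<lambda>n. (map_data.arc_types (HH \<Gamma>) ?N (Y n) (idx n), map_data.perm_type ?N (fst (\<phi> (Suc n))))"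
  have fin: "finite ?T" by simp
  have tau: "?\<tau> n \<in> ?T" for n
    using map_data.arc_types_finite[OF md[of n]] map_data.perm_type_finite[OF md[of n]] by simp
  obtain n m where nm: "n < m" "?\<tau> n = ?\<tau> m"
    "\<And>k. k \<in> {..<?N} \<times> {..<?B} \<times> {..<?B} \<times> {..<4} \<times> {..<4} \<Longrightarrow>
      map_data.counts (fst (\<phi> (Suc n))) (Y n) (idx n) (F0 n) k \<le> map_data.counts (fst (\<phi> (Suc m))) (Y m) (idx m) (F0 m) k"
    by (rule dickson_pair[of ?T ?\<tau> "{..<?N} \<times> {..<?B} \<times> {..<?B} \<times> {..<4} \<times> {..<4}"
          "\<lambda>n. map_data.counts (fst (\<phi> (Suc n))) (Y n) (idx n) (F0 n)", OF fin tau])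
      (simp, rule that)
  have types: "map_data.arc_types (HH \<Gamma>) ?N (Y n) (idx n) = map_data.arc_types (HH \<Gamma>) ?N (Y m) (idx m)"
    "map_data.perm_type ?N (fst (\<phi> (Suc n))) = map_data.perm_type ?N (fst (\<phi> (Suc m)))" using nm(2) by simp_all
  obtain l f where lf: "\<And>i. i < ?N \<Longrightarrow> inv_len (HH \<Gamma> i) (Y n i) (l i)"
    "\<And>i v. i < ?N \<Longrightarrow> v \<in> tverts (Y n i) \<Longrightarrow> f i v \<in> points (Y n (fst (\<phi> (Suc n)) i))"
    "\<And>i v g. i < ?N \<Longrightarrow> v \<in> tverts (Y n i) \<Longrightarrow> g \<in> carrier (HH \<Gamma> i) \<Longrightarrow>
      f i (act (Y n i) g v) = pact (Y n (fst (\<phi> (Suc n)) i)) (snd (\<phi> (Suc n)) i g) (f i v)"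
    "\<And>i e. i < ?N \<Longrightarrow> e \<in> tarcs (Y n i) \<Longrightarrow>
      tdist (relen (l (fst (\<phi> (Suc n)) i)) (Y n (fst (\<phi> (Suc n)) i))) (f i (fst e)) (f i (snd e)) \<le> C m * l i e"
    by (rule map_data_compare[OF md[of n] md[of m] types nm(3)]) (simp, rule that)
  have "ennreal (s (Suc n)) \<le> ennreal (C m)"
    by (rule min[OF C(1), of n l f]) (use lf in simp)
  then have "s (Suc n) \<le> C m" using C(1) nonneg by (simp add: ennreal_le_iff)
  also have "\<dots> < s m" by (rule C(2))
  \<comment> \<open>\<open>n < m\<close> means \<open>Suc n \<le> m\<close>, and the sequence
    decreases; this is where the shift by one in the choice of the data closes the circle.\<close>
  also have "\<dots> \<le> s (Suc n)" using nm(1) by (intro anti) simp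
  finally show False by simp
qed

theorem theorem7p2:
  fixes \<Gamma> :: "('v, 'e, 'g) union_gog"
  assumes "valid_union \<Gamma>"
  shows "well_ordered (global_spec \<Gamma>) \<and>
         (\<forall>c \<in> carrier (OutG \<Gamma>). \<forall>\<phi> \<in> c. well_ordered (spec \<Gamma> \<phi>))"
proof (intro conjI ballI)
  show "well_ordered (global_spec \<Gamma>)"
    using no_descending_spectrum[OF assms] by (rule well_orderedI)
  fix c \<phi> assume c: "c \<in> carrier (OutG \<Gamma>)" "\<phi> \<in> c"
  then have "spec \<Gamma> \<phi> \<subseteq> global_spec \<Gamma>" unfolding spec_def global_spec_def by blast
  then show "well_ordered (spec \<Gamma> \<phi>)"
    using no_descending_spectrum[OF assms] by (intro well_orderedI) blast
qed

end
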